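(* Let $\mathcal{C}$ be a coring over an associative ring $A$. Then the additive category $\mathcal{C}\text{-}\mathrm{Comod}$ of left $\mathcal{C}$-comodules is locally $\aleph_1$-presentable. The $\aleph_1$-presentable objects of $\mathcal{C}\text{-}\mathrm{Comod}$ are precisely all the $A$-countably presentable $\mathcal{C}$-comodules. So any $\mathcal{C}$-comodule is an $\aleph_1$-directed colimit of $A$-countably presentable $\mathcal{C}$-comodules.
   Context: Rings are associative and unital. A coring $\mathcal{C}$ over a ring $A$ is an $A$-$A$-bimodule with $A$-$A$-bimodule maps $\mu\colon\mathcal{C}\to\mathcal{C}\otimes_A\mathcal{C}$ and $\epsilon\colon\mathcal{C}\to A$ such that $(\mu\otimes\mathrm{id})\mu=(\mathrm{id}\otimes\mu)\mu$ and $(\epsilon\otimes\mathrm{id})\mu=\mathrm{id}_{\mathcal{C}}=(\mathrm{id}\otimes\epsilon)\mu$. A left $\mathcal{C}$-comodule is a left $A$-module $\mathcal{M}$ with a left $A$-module map $\nu\colon\mathcal{M}\to\mathcal{C}\otimes_A\mathcal{M}$ such that $(\mu\otimes\mathrm{id})\nu=(\mathrm{id}\otimes\nu)\nu$ and $(\epsilon\otimes\mathrm{id})\nu=\mathrm{id}_{\mathcal{M}}$; morphisms are left $A$-module maps commuting with the coactions $\nu$. $\mathcal{C}\text{-}\mathrm{Comod}$ is the additive category of left $\mathcal{C}$-comodules ("$\mathcal{C}$-comodule" means left $\mathcal{C}$-comodule). A $\mathcal{C}$-comodule is $A$-countably presentable if its underlying left $A$-module is countably presentable, i.e. the cokernel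 of a morphism of free $A$-modules with at most countable sets of generators. A poset is $\aleph_1$-directed if every countable subset has an upper bound; an $\aleph_1$-directed colimit is a colimit of a diagram indexed by an $\aleph_1$-directed poset. In a category with $\aleph_1$-directed colimits, an object $S$ is $\aleph_1$-presentable if $\mathrm{Hom}(S,-)$ preserves $\aleph_1$-directed colimits. A category is $\aleph_1$-accessible if it has $\aleph_1$-directed colimits and there is a set of $\aleph_1$-presentable objects such that every object is an $\aleph_1$-directed colimit of objects from this set. An $\aleph_1$-accessible category is locally $\aleph_1$-presentable if all (small) colimits exist in it. *)

theory Defs
  imports "HOL-Algebra.Free_Abelian_Groups" "HOL-Algebra.AbelCoset" "HOL-Algebra.Module"
    "HOL-Algebra.Generated_Groups"
begin

unbundle cardinal_syntax

section \<open>Modules and bimodules over a noncommutative ring\<close>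

text \<open>
  The locale \<open>module\<close> of HOL-Algebra is restricted to commutative rings; we only reuse its
  record type. The multiplicative fields that this record inherits from \<open>ring\<close> carry no meaning
  for modules and are never referred to.
\<close>

locale left_module = R?: ring A + M?: abelian_group M
  for A :: "('a, 'r) ring_scheme" (structure) and M :: "('a, 'm, 'x) module_scheme" (structure) +
  assumes smult_closed:
      "\<lbrakk>a \<in> carrier A; x \<in> carrier M\<rbrakk> \<Longrightarrow> a \<odot>\<^bsub>M\<^esub> x \<in> carrier M"
    and smult_l_distr:
      "\<lbrakk>a \<in> carrier A; b \<in> carrier A; x \<in> carrier M\<rbrakk> \<Longrightarrow>
        (a \<oplus>\<^bsub>A\<^esub> b) \<odot>\<^bsub>M\<^esub> x = a \<odot>\<^bsub>M\<^esub> x \<oplus>\<^bsub>M\<^esub> b \<odot>\<^bsub>M\<^esub> x"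
    and smult_r_distr:
      "\<lbrakk>a \<in> carrier A; x \<in> carrier M; y \<in> carrier M\<rbrakk> \<Longrightarrow>
        a \<odot>\<^bsub>M\<^esub> (x \<oplus>\<^bsub>M\<^esub> y) = a \<odot>\<^bsub>M\<^esub> x \<oplus>\<^bsub>M\<^esub> a \<odot>\<^bsub>M\<^esub> y"
    and smult_assoc:
      "\<lbrakk>a \<in> carrier A; b \<in> carrier A; x \<in> carrier M\<rbrakk> \<Longrightarrow>
        (a \<otimes>\<^bsub>A\<^esub> b) \<odot>\<^bsub>M\<^esub> x = a \<odot>\<^bsub>M\<^esub> (b \<odot>\<^bsub>M\<^esub> x)"
    and smult_one:
      "x \<in> carrier M \<Longrightarrow> \<one>\<^bsub>A\<^esub> \<odot>\<^bsub>M\<^esub> x = x"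

record ('a, 'b) bimodule = "('a, 'b) module" +
  rsmult :: "'b \<Rightarrow> 'a \<Rightarrow> 'b"  (infixl \<open>\<odot>\<^sub>r\<index>\<close> 70)

locale bimodule = left_module A M
  for A :: "('a, 'r) ring_scheme" (structure) and M :: "('a, 'm, 'x) bimodule_scheme" (structure) +
  assumes rsmult_closed:
      "\<lbrakk>x \<in> carrier M; a \<in> carrier A\<rbrakk> \<Longrightarrow> x \<odot>\<^sub>r\<^bsub>M\<^esub> a \<in> carrier M"
    and rsmult_r_distr:
      "\<lbrakk>x \<in> carrier M; a \<in> carrier A; b \<in> carrier A\<rbrakk> \<Longrightarrow>
        x \<odot>\<^sub>r\<^bsub>M\<^esub> (a \<oplus>\<^bsub>A\<^esub> b) = x \<odot>\<^sub>r\<^bsub>M\<^esub> a \<oplus>\<^bsub>M\<^esub> x \<odot>\<^sub>r\<^bsub>M\<^esub> b"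
    and rsmult_l_distr:
      "\<lbrakk>x \<in> carrier M; y \<in> carrier M; a \<in> carrier A\<rbrakk> \<Longrightarrow>
        (x \<oplus>\<^bsub>M\<^esub> y) \<odot>\<^sub>r\<^bsub>M\<^esub> a = x \<odot>\<^sub>r\<^bsub>M\<^esub> a \<oplus>\<^bsub>M\<^esub> y \<odot>\<^sub>r\<^bsub>M\<^esub> a"
    and rsmult_assoc:
      "\<lbrakk>x \<in> carrier M; a \<in> carrier A; b \<in> carrier A\<rbrakk> \<Longrightarrow>
        x \<odot>\<^sub>r\<^bsub>M\<^esub> (a \<otimes>\<^bsub>A\<^esub> b) = (x \<odot>\<^sub>r\<^bsub>M\<^esub> a) \<odot>\<^sub>r\<^bsub>M\<^esub> b"
    and rsmult_one:
      "x \<in> carrier M \<Longrightarrow> x \<odot>\<^sub>r\<^bsub>M\<^esub> \<one>\<^bsub>A\<^esub> = x"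
    and smult_rsmult:
      "\<lbrakk>a \<in> carrier A; x \<in> carrier M; b \<in> carrier A\<rbrakk> \<Longrightarrow>
        (a \<odot>\<^bsub>M\<^esub> x) \<odot>\<^sub>r\<^bsub>M\<^esub> b = a \<odot>\<^bsub>M\<^esub> (x \<odot>\<^sub>r\<^bsub>M\<^esub> b)"

definition left_hom ::
  "('a, 'r) ring_scheme \<Rightarrow> ('a, 'm, 'x) module_scheme \<Rightarrow> ('a, 'n, 'y) module_scheme \<Rightarrow> ('m \<Rightarrow> 'n) set"
  where
  "left_hom A M N =
    {f \<in> carrier M \<rightarrow> carrier N.
      (\<forall>x\<in>carrier M. \<forall>y\<in>carrier M. f (x \<oplus>\<^bsub>M\<^esub> y) = f x \<oplus>\<^bsub>N\<^esub> f y) \<and>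
      (\<forall>a\<in>carrier A. \<forall>x\<in>carrier M. f (a \<odot>\<^bsub>M\<^esub> x) = a \<odot>\<^bsub>N\<^esub> f x)}"

definition bimodule_hom ::
  "('a, 'r) ring_scheme \<Rightarrow> ('a, 'm, 'x) bimodule_scheme \<Rightarrow> ('a, 'n, 'y) bimodule_scheme \<Rightarrow> ('m \<Rightarrow> 'n) set"
  where
  "bimodule_hom A M N =
    {f \<in> left_hom A M N. \<forall>x\<in>carrier M. \<forall>a\<in>carrier A. f (x \<odot>\<^sub>r\<^bsub>M\<^esub> a) = f x \<odot>\<^sub>r\<^bsub>N\<^esub> a}"

definition regular_bimodule :: "('a, 'r) ring_scheme \<Rightarrow> ('a, 'a) bimodule" where
  "regular_bimodule A =
    \<lparr>carrier = carrier A, mult = undefined, one = undefined, zero = \<zero>\<^bsub>A\<^esub>, add = add A,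
     smult = mult A, rsmult = mult A\<rparr>"


section \<open>Countably presentable modules\<close>

definition free_left_module :: "('a, 'r) ring_scheme \<Rightarrow> 'x set \<Rightarrow> ('a, 'x \<Rightarrow> 'a) module" where
  "free_left_module A X =
    \<lparr>carrier = {f. (\<forall>x\<in>X. f x \<in> carrier A) \<and> (\<forall>x\<in>-X. f x = \<zero>\<^bsub>A\<^esub>) \<and>
                   finite {x. f x \<noteq> \<zero>\<^bsub>A\<^esub>}},
     mult = undefined, one = undefined, zero = (\<lambda>x. \<zero>\<^bsub>A\<^esub>),
     add = (\<lambda>f g x. f x \<oplus>\<^bsub>A\<^esub> g x), smult = (\<lambda>a f x. a \<otimes>\<^bsub>A\<^esub> f x)\<rparr>"

definition quotient_module ::
  "('a, 'm, 'x) module_scheme \<Rightarrow> 'm set \<Rightarrow> ('a, 'm set) module" where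
  "quotient_module M N =
    \<lparr>carrier = a_rcosets\<^bsub>M\<^esub> N, mult = undefined, one = undefined, zero = N, add = set_add M,
     smult = (\<lambda>a K. \<Union>x\<in>K. N +>\<^bsub>M\<^esub> (a \<odot>\<^bsub>M\<^esub> x))\<rparr>"

definition cokernel_module ::
  "('a, 'm, 'x) module_scheme \<Rightarrow> ('a, 'n, 'y) module_scheme \<Rightarrow> ('m \<Rightarrow> 'n) \<Rightarrow> ('a, 'n set) module" where
  "cokernel_module M N f = quotient_module N (f ` carrier M)"

definition left_module_isomorphic ::
  "('a, 'r) ring_scheme \<Rightarrow> ('a, 'm, 'x) module_scheme \<Rightarrow> ('a, 'n, 'y) module_scheme \<Rightarrow> bool" where
  "left_module_isomorphic A M N \<longleftrightarrow> (\<exists>h \<in> left_hom A M N. bij_betw h (carrier M) (carrier N))"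

text \<open>Subsets of the naturals serve as the at most countable sets of generators.\<close>

definition countably_presentable ::
  "('a, 'r) ring_scheme \<Rightarrow> ('a, 'm, 'x) module_scheme \<Rightarrow> bool" where
  "countably_presentable A M \<longleftrightarrow>
    (\<exists>(X :: nat set) (Y :: nat set). \<exists>f \<in> left_hom A (free_left_module A X) (free_left_module A Y).
      left_module_isomorphic A
        (cokernel_module (free_left_module A X) (free_left_module A Y) f) M)"


section \<open>Tensor products\<close>

text \<open>
  \<open>C \<otimes>\<^sub>A M\<close> is the free abelian group on \<open>C \<times> M\<close> modulo the usual relations; its elements are
  cosets. \<open>C\<close> may be any record with a right action, \<open>M\<close> any record with a left action.
\<close>

type_synonym ('c, 'm) tensor = "('c \<times> 'm \<Rightarrow>\<^sub>0 int) set"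

definition tensor_relations ::
  "('a, 'r) ring_scheme \<Rightarrow> ('a, 'c, 'x) bimodule_scheme \<Rightarrow> ('a, 'm, 'y) module_scheme \<Rightarrow>
    ('c \<times> 'm \<Rightarrow>\<^sub>0 int) set" where
  "tensor_relations A C M = generate (free_Abelian_group (carrier C \<times> carrier M))
    ({frag_of (c \<oplus>\<^bsub>C\<^esub> d, m) - frag_of (c, m) - frag_of (d, m) | c d m.
        c \<in> carrier C \<and> d \<in> carrier C \<and> m \<in> carrier M} \<union>
     {frag_of (c, m \<oplus>\<^bsub>M\<^esub> n) - frag_of (c, m) - frag_of (c, n) | c m n.
        c \<in> carrier C \<and> m \<in> carrier M \<and> n \<in> carrier M} \<union>
     {frag_of (c \<odot>\<^sub>r\<^bsub>C\<^esub> a, m) - frag_of (c, a \<odot>\<^bsub>M\<^esub> m) | c a m.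
        c \<in> carrier C \<and> a \<in> carrier A \<and> m \<in> carrier M})"

definition pure_tensor ::
  "('a, 'r) ring_scheme \<Rightarrow> ('a, 'c, 'x) bimodule_scheme \<Rightarrow> ('a, 'm, 'y) module_scheme \<Rightarrow>
    'c \<Rightarrow> 'm \<Rightarrow> ('c, 'm) tensor" where
  "pure_tensor A C M c m =
    tensor_relations A C M #>\<^bsub>free_Abelian_group (carrier C \<times> carrier M)\<^esub> frag_of (c, m)"

definition tensor_group ::
  "('a, 'r) ring_scheme \<Rightarrow> ('a, 'c, 'x) bimodule_scheme \<Rightarrow> ('a, 'm, 'y) module_scheme \<Rightarrow>
    ('c, 'm) tensor ring" where
  "tensor_group A C M =
    (let T = free_Abelian_group (carrier C \<times> carrier M) Mod tensor_relations A C M in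
     \<lparr>carrier = carrier T, mult = undefined, one = undefined, zero = one T, add = mult T\<rparr>)"

text \<open>
  The additive map from a tensor product to \<open>G\<close> induced by a balanced biadditive map \<open>\<beta>\<close>: apply
  the linear extension of \<open>\<beta>\<close> to any representative of the coset.
\<close>

definition tensor_lift ::
  "('g, 'x) ring_scheme \<Rightarrow> ('c \<Rightarrow> 'm \<Rightarrow> 'g) \<Rightarrow> ('c, 'm) tensor \<Rightarrow> 'g" where
  "tensor_lift G \<beta> T =
    the_elem ((\<lambda>t. \<Oplus>\<^bsub>G\<^esub>k\<in>Poly_Mapping.keys t. [Poly_Mapping.lookup t k] \<cdot>\<^bsub>G\<^esub> \<beta> (fst k) (snd k)) ` T)"

text \<open>The map \<open>f \<otimes> g\<close> with values in \<open>C \<otimes>\<^sub>A M\<close>.\<close>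

definition tensor_map ::
  "('a, 'r) ring_scheme \<Rightarrow> ('a, 'c, 'x) bimodule_scheme \<Rightarrow> ('a, 'm, 'y) module_scheme \<Rightarrow>
    ('d \<Rightarrow> 'c) \<Rightarrow> ('n \<Rightarrow> 'm) \<Rightarrow> ('d, 'n) tensor \<Rightarrow> ('c, 'm) tensor" where
  "tensor_map A C M f g =
    tensor_lift (tensor_group A C M) (\<lambda>d n. pure_tensor A C M (f d) (g n))"

definition tensor_module ::
  "('a, 'r) ring_scheme \<Rightarrow> ('a, 'c, 'x) bimodule_scheme \<Rightarrow> ('a, 'm, 'y) module_scheme \<Rightarrow>
    ('a, ('c, 'm) tensor) module" where
  "tensor_module A C M = ring.extend (tensor_group A C M)
    (module.fields (\<lambda>a. tensor_map A C M (\<lambda>c. a \<odot>\<^bsub>C\<^esub> c) id))"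

definition tensor_bimodule ::
  "('a, 'r) ring_scheme \<Rightarrow> ('a, 'c, 'x) bimodule_scheme \<Rightarrow> ('a, 'd, 'y) bimodule_scheme \<Rightarrow>
    ('a, ('c, 'd) tensor) bimodule" where
  "tensor_bimodule A C D = module.extend (tensor_module A C D)
    (bimodule.fields (\<lambda>t a. tensor_map A C D id (\<lambda>d. d \<odot>\<^sub>r\<^bsub>D\<^esub> a) t))"

text \<open>
  The canonical isomorphisms \<open>(C \<otimes>\<^sub>A D) \<otimes>\<^sub>A M \<cong> C \<otimes>\<^sub>A (D \<otimes>\<^sub>A M)\<close>, \<open>A \<otimes>\<^sub>A M \<cong> M\<close> and
  \<open>C \<otimes>\<^sub>A A \<cong> C\<close>, which are left implicit on paper.
\<close>

definition tensor_assoc ::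
  "('a, 'r) ring_scheme \<Rightarrow> ('a, 'c, 'x) bimodule_scheme \<Rightarrow> ('a, 'd, 'y) bimodule_scheme \<Rightarrow>
    ('a, 'm, 'z) module_scheme \<Rightarrow> (('c, 'd) tensor, 'm) tensor \<Rightarrow> ('c, ('d, 'm) tensor) tensor" where
  "tensor_assoc A C D M =
    (let DM = tensor_module A D M; T = tensor_module A C DM in
     tensor_lift T (\<lambda>t m. tensor_lift T (\<lambda>c d. pure_tensor A C DM c (pure_tensor A D M d m)) t))"

definition tensor_lunit :: "('a, 'm, 'z) module_scheme \<Rightarrow> ('a, 'm) tensor \<Rightarrow> 'm" where
  "tensor_lunit M = tensor_lift M (\<lambda>a m. a \<odot>\<^bsub>M\<^esub> m)"

definition tensor_runit :: "('a, 'c, 'z) bimodule_scheme \<Rightarrow> ('c, 'a) tensor \<Rightarrow> 'c" where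
  "tensor_runit C = tensor_lift C (\<lambda>c a. c \<odot>\<^sub>r\<^bsub>C\<^esub> a)"


section \<open>Corings and comodules\<close>

record ('a, 'c) coring = "('a, 'c) bimodule" +
  comult :: "'c \<Rightarrow> ('c, 'c) tensor"
  counit :: "'c \<Rightarrow> 'a"

locale coring = bimodule A C
  for A :: "('a, 'r) ring_scheme" (structure) and C :: "('a, 'c, 'x) coring_scheme" (structure) +
  assumes comult_hom: "comult C \<in> bimodule_hom A C (tensor_bimodule A C C)"
    and counit_hom: "counit C \<in> bimodule_hom A C (regular_bimodule A)"
    and coassoc: "c \<in> carrier C \<Longrightarrow>
      tensor_assoc A C C C (tensor_map A (tensor_bimodule A C C) C (comult C) id (comult C c)) =
      tensor_map A C (tensor_module A C C) id (comult C) (comult C c)"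
    and counit_left: "c \<in> carrier C \<Longrightarrow>
      tensor_lunit C (tensor_map A (regular_bimodule A) C (counit C) id (comult C c)) = c"
    and counit_right: "c \<in> carrier C \<Longrightarrow>
      tensor_runit C (tensor_map A C (regular_bimodule A) id (counit C) (comult C c)) = c"

record ('a, 'c, 'm) comodule = "('a, 'm) module" +
  coact :: "'m \<Rightarrow> ('c, 'm) tensor"

locale comodule = C: coring A C + M: left_module A M
  for A :: "('a, 'r) ring_scheme" (structure) and C :: "('a, 'c, 'x) coring_scheme" (structure)
    and M :: "('a, 'c, 'm, 'y) comodule_scheme" (structure) +
  assumes coact_hom: "coact M \<in> left_hom A M (tensor_module A C M)"
    and coact_coassoc: "m \<in> carrier M \<Longrightarrow>
      tensor_assoc A C C M (tensor_map A (tensor_bimodule A C C) M (comult C) id (coact M m)) =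
      tensor_map A C (tensor_module A C M) id (coact M) (coact M m)"
    and coact_counit: "m \<in> carrier M \<Longrightarrow>
      tensor_lunit M (tensor_map A (regular_bimodule A) M (counit C) id (coact M m)) = m"

text \<open>Morphisms are extensional functions, so that equality of morphisms is equality in HOL.\<close>

definition comodule_hom ::
  "('a, 'r) ring_scheme \<Rightarrow> ('a, 'c, 'x) coring_scheme \<Rightarrow> ('a, 'c, 'm, 'y) comodule_scheme \<Rightarrow>
    ('a, 'c, 'n, 'z) comodule_scheme \<Rightarrow> ('m \<Rightarrow> 'n) set" where
  "comodule_hom A C M N =
    {f \<in> left_hom A M N. f \<in> extensional (carrier M) \<and>
      (\<forall>m\<in>carrier M. coact N (f m) = tensor_map A C N id f (coact M m))}"


section \<open>Categories, functors, colimits\<close>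

text \<open>Hom-sets need not be disjoint; composition is therefore indexed by three objects.\<close>

record ('o, 'm) category =
  Obj :: "'o set"
  Hom :: "'o \<Rightarrow> 'o \<Rightarrow> 'm set"
  Cmp :: "'o \<Rightarrow> 'o \<Rightarrow> 'o \<Rightarrow> 'm \<Rightarrow> 'm \<Rightarrow> 'm"  \<comment> \<open>\<open>Cmp K X Y Z g f\<close> is \<open>g \<circ> f : X \<rightarrow> Y \<rightarrow> Z\<close>\<close>
  Idt :: "'o \<Rightarrow> 'm"

locale category =
  fixes K :: "('o, 'm, 'z) category_scheme"
  assumes Idt_in_Hom: "X \<in> Obj K \<Longrightarrow> Idt K X \<in> Hom K X X"
    and Cmp_in_Hom:
      "\<lbrakk>X \<in> Obj K; Y \<in> Obj K; Z \<in> Obj K; f \<in> Hom K X Y; g \<in> Hom K Y Z\<rbrakk> \<Longrightarrow>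
        Cmp K X Y Z g f \<in> Hom K X Z"
    and Cmp_Idt_right:
      "\<lbrakk>X \<in> Obj K; Y \<in> Obj K; f \<in> Hom K X Y\<rbrakk> \<Longrightarrow> Cmp K X X Y f (Idt K X) = f"
    and Cmp_Idt_left:
      "\<lbrakk>X \<in> Obj K; Y \<in> Obj K; f \<in> Hom K X Y\<rbrakk> \<Longrightarrow> Cmp K X Y Y (Idt K Y) f = f"
    and Cmp_assoc:
      "\<lbrakk>W \<in> Obj K; X \<in> Obj K; Y \<in> Obj K; Z \<in> Obj K;
        f \<in> Hom K W X; g \<in> Hom K X Y; h \<in> Hom K Y Z\<rbrakk> \<Longrightarrow>
        Cmp K W Y Z h (Cmp K W X Y g f) = Cmp K W X Z (Cmp K X Y Z h g) f"

record ('i, 'n, 'o, 'm) functor_data =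
  fobj :: "'i \<Rightarrow> 'o"
  fmap :: "'i \<Rightarrow> 'i \<Rightarrow> 'n \<Rightarrow> 'm"

definition is_functor ::
  "('i, 'n) category \<Rightarrow> ('o, 'm) category \<Rightarrow> ('i, 'n, 'o, 'm) functor_data \<Rightarrow> bool" where
  "is_functor J K F \<longleftrightarrow>
    (\<forall>i\<in>Obj J. fobj F i \<in> Obj K) \<and>
    (\<forall>i\<in>Obj J. \<forall>j\<in>Obj J. \<forall>u\<in>Hom J i j. fmap F i j u \<in> Hom K (fobj F i) (fobj F j)) \<and>
    (\<forall>i\<in>Obj J. fmap F i i (Idt J i) = Idt K (fobj F i)) \<and>
    (\<forall>i\<in>Obj J. \<forall>j\<in>Obj J. \<forall>k\<in>Obj J. \<forall>u\<in>Hom J i j. \<forall>v\<in>Hom J j k.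
      fmap F i k (Cmp J i j k v u) =
      Cmp K (fobj F i) (fobj F j) (fobj F k) (fmap F j k v) (fmap F i j u))"

definition comp_functor ::
  "('o, 'm, 'p, 'q) functor_data \<Rightarrow> ('i, 'n, 'o, 'm) functor_data \<Rightarrow> ('i, 'n, 'p, 'q) functor_data" where
  "comp_functor G F =
    \<lparr>fobj = fobj G \<circ> fobj F, fmap = (\<lambda>i j u. fmap G (fobj F i) (fobj F j) (fmap F i j u))\<rparr>"

definition is_cocone ::
  "('i, 'n) category \<Rightarrow> ('o, 'm) category \<Rightarrow> ('i, 'n, 'o, 'm) functor_data \<Rightarrow> 'o \<Rightarrow> ('i \<Rightarrow> 'm) \<Rightarrow> bool"
  where
  "is_cocone J K F X \<xi> \<longleftrightarrow>
    X \<in> Obj K \<and>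
    (\<forall>i\<in>Obj J. \<xi> i \<in> Hom K (fobj F i) X) \<and>
    (\<forall>i\<in>Obj J. \<forall>j\<in>Obj J. \<forall>u\<in>Hom J i j.
      Cmp K (fobj F i) (fobj F j) X (\<xi> j) (fmap F i j u) = \<xi> i)"

definition is_colimit ::
  "('i, 'n) category \<Rightarrow> ('o, 'm) category \<Rightarrow> ('i, 'n, 'o, 'm) functor_data \<Rightarrow> 'o \<Rightarrow> ('i \<Rightarrow> 'm) \<Rightarrow> bool"
  where
  "is_colimit J K F X \<xi> \<longleftrightarrow>
    is_cocone J K F X \<xi> \<and>
    (\<forall>Y \<eta>. is_cocone J K F Y \<eta> \<longrightarrow>
      (\<exists>!h. h \<in> Hom K X Y \<and> (\<forall>i\<in>Obj J. Cmp K (fobj F i) X Y h (\<xi> i) = \<eta> i)))"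

text \<open>
  The category of the subsets of a type. Colimit cocones in the category of all sets are already
  detected by maps into sets with at most two elements, so passing to the subsets of one type does
  not change which cocones of hom-sets are colimit cocones.
\<close>

definition set_category :: "('x set, 'x \<Rightarrow> 'x) category" where
  "set_category =
    \<lparr>Obj = UNIV, Hom = (\<lambda>X Y. X \<rightarrow>\<^sub>E Y), Cmp = (\<lambda>X Y Z g f. compose X g f), Idt = (\<lambda>X. \<lambda>x\<in>X. x)\<rparr>"

definition hom_functor :: "('o, 'm) category \<Rightarrow> 'o \<Rightarrow> ('o, 'm, 'm set, 'm \<Rightarrow> 'm) functor_data" where
  "hom_functor K S =
    \<lparr>fobj = Hom K S, fmap = (\<lambda>X Y f. \<lambda>g\<in>Hom K S X. Cmp K S X Y f g)\<rparr>"

definition poset_category :: "'i set \<Rightarrow> 'i rel \<Rightarrow> ('i, unit) category" where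
  "poset_category I r =
    \<lparr>Obj = I, Hom = (\<lambda>i j. if (i, j) \<in> r then {()} else {}), Cmp = (\<lambda>_ _ _ _ _. ()), Idt = (\<lambda>_. ())\<rparr>"

definition aleph1_directed :: "'i set \<Rightarrow> 'i rel \<Rightarrow> bool" where
  "aleph1_directed I r \<longleftrightarrow>
    partial_order_on I r \<and> (\<forall>X. X \<subseteq> I \<and> countable X \<longrightarrow> (\<exists>u\<in>I. \<forall>x\<in>X. (x, u) \<in> r))"


section \<open>Smallness\<close>

text \<open>
  ``Set'' (as opposed to class) is read as ``set of cardinality less than \<open>\<kappa>\<close>'' for a cardinal \<open>\<kappa>\<close>
  with the closure properties below. If \<open>\<kappa>\<close> is an uncountable strongly inaccessible cardinal, this
  is smallness with respect to a Grothendieck universe. The weaker conditions imposed here also hold,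
  for example, for the successor of any cardinal of the form \<open>\<mu>\<^sup>\<omega>\<close> with \<open>\<mu> \<ge> 2\<close>; such \<open>\<kappa>\<close> exist
  in HOL above any given type (lemma \<open>universe_cardinal_exists\<close>). As \<open>\<kappa>\<close> is a relation on \<open>'u\<close>, every set of cardinality
  less than \<open>\<kappa>\<close> has a copy inside \<open>'u\<close>; small structures and small index categories
  are therefore taken on subsets of \<open>'u\<close>.
\<close>

definition universe_cardinal :: "'u rel \<Rightarrow> bool" where
  "universe_cardinal \<kappa> \<longleftrightarrow>
    Cinfinite \<kappa> \<and> regularCard \<kappa> \<and> (\<forall>X :: 'u set. |X| <o \<kappa> \<longrightarrow> |X| ^c natLeq <o \<kappa>)"

lemma universe_cardinal_exists:
  fixes K defines "K \<equiv> |UNIV :: (nat \<Rightarrow> 'v) set|"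
  assumes inf: "infinite (UNIV :: 'v set)"
  shows "universe_cardinal (cardSuc K)" and "|UNIV :: 'v set| <o cardSuc K"
proof -
  have i0: "infinite (UNIV :: (nat \<Rightarrow> 'v) set)" using inf finite_fun_UNIVD2 by blast
  have ci: "Cinfinite K" unfolding K_def cinfinite_def using i0 by (simp add: Field_card_of)
  have c2: "Cinfinite (cardSuc K)" using ci Cinfinite_cardSuc by blast
  have reg: "regularCard (cardSuc K)" using ci infinite_cardSuc_regularCard unfolding cinfinite_def by blast
  have e: "K ^c natLeq =o K"
  proof -
    have "|UNIV :: (nat \<Rightarrow> 'v) set| =o |UNIV :: 'v set| ^c natLeq"
      by (simp add: cexp_def Field_natLeq Field_card_of card_of_Func_UNIV ordIso_symmetric Func_def)
    hence "K ^c natLeq =o ( |UNIV :: 'v set| ^c natLeq) ^c natLeq"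
      unfolding K_def using cexp_cong1 natLeq_Card_order by blast
    also have "( |UNIV :: 'v set| ^c natLeq) ^c natLeq =o |UNIV :: 'v set| ^c (natLeq *c natLeq)"
      using cexp_cprod natLeq_Card_order card_of_Card_order by blast
    also have "|UNIV :: 'v set| ^c (natLeq *c natLeq) =o |UNIV :: 'v set| ^c natLeq"
      by (rule cexp_cong2[OF cprod_infinite[OF natLeq_Cinfinite] card_of_Card_order])
        (rule Card_order_cprod)
    also have "|UNIV :: 'v set| ^c natLeq =o K" unfolding K_def
      by (simp add: cexp_def Field_natLeq Field_card_of Func_def)
    finally show ?thesis .
  qed
  have "|X| ^c natLeq <o cardSuc K" if "|X| <o cardSuc K" for X :: "(nat \<Rightarrow> 'v) set set"
  proof -
    have "|X| \<le>o K"
      by (rule iffD1[OF cardSuc_ordLeq_ordLess[OF conjunct2[OF ci] card_of_Card_order] that])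
    hence "|X| ^c natLeq \<le>o K ^c natLeq" by (simp add: cexp_mono1 natLeq_Card_order)
    hence "|X| ^c natLeq \<le>o K" by (rule ordLeq_ordIso_trans[OF _ e])
    thus ?thesis by (rule ordLeq_ordLess_trans[OF _ cardSuc_greater[OF conjunct2[OF ci]]])
  qed
  thus "universe_cardinal (cardSuc K)" unfolding universe_cardinal_def using c2 reg by blast
  have "|UNIV :: 'v set| \<le>o K" unfolding K_def
    by (intro card_of_ordLeqI[of "\<lambda>x _. x"]) (auto simp: inj_on_def fun_eq_iff)
  thus "|UNIV :: 'v set| <o cardSuc K"
    by (rule ordLeq_ordLess_trans[OF _ cardSuc_greater[OF conjunct2[OF ci]]])
qed

abbreviation small :: "'u rel \<Rightarrow> 'x set \<Rightarrow> bool" where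
  "small \<kappa> X \<equiv> |X| <o \<kappa>"

definition small_category :: "'u rel \<Rightarrow> ('i, 'n) category \<Rightarrow> bool" where
  "small_category \<kappa> J \<longleftrightarrow>
    category J \<and> small \<kappa> (Obj J) \<and> (\<forall>i\<in>Obj J. \<forall>j\<in>Obj J. small \<kappa> (Hom J i j))"


section \<open>Accessible and locally presentable categories\<close>

text \<open>All index categories and index posets below have their elements in \<open>'u\<close>.\<close>

definition aleph1_directed_diagram ::
  "'u rel \<Rightarrow> 'u set \<Rightarrow> 'u rel \<Rightarrow> ('o, 'm) category \<Rightarrow> ('u, unit, 'o, 'm) functor_data \<Rightarrow> bool" where
  "aleph1_directed_diagram \<kappa> I r K D \<longleftrightarrow>
    small \<kappa> I \<and> aleph1_directed I r \<and> is_functor (poset_category I r) K D"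

definition has_aleph1_directed_colimits :: "'u rel \<Rightarrow> ('o, 'm) category \<Rightarrow> bool" where
  "has_aleph1_directed_colimits \<kappa> K \<longleftrightarrow>
    (\<forall>I r D. aleph1_directed_diagram \<kappa> I r K D \<longrightarrow> (\<exists>X \<xi>. is_colimit (poset_category I r) K D X \<xi>))"

definition aleph1_presentable :: "'u rel \<Rightarrow> ('o, 'm) category \<Rightarrow> 'o \<Rightarrow> bool" where
  "aleph1_presentable \<kappa> K S \<longleftrightarrow>
    S \<in> Obj K \<and>
    (\<forall>I r D X \<xi>. aleph1_directed_diagram \<kappa> I r K D \<and> is_colimit (poset_category I r) K D X \<xi> \<longrightarrow>
      is_colimit (poset_category I r) set_category (comp_functor (hom_functor K S) D)
        (fobj (hom_functor K S) X) (\<lambda>i. fmap (hom_functor K S) (fobj D i) X (\<xi> i)))"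

definition aleph1_directed_colimit_of ::
  "'u rel \<Rightarrow> ('o, 'm) category \<Rightarrow> 'o set \<Rightarrow> 'o \<Rightarrow> bool" where
  "aleph1_directed_colimit_of \<kappa> K G X \<longleftrightarrow>
    (\<exists>I r D \<xi>. aleph1_directed_diagram \<kappa> I r K D \<and> (\<forall>i\<in>I. fobj D i \<in> G) \<and>
      is_colimit (poset_category I r) K D X \<xi>)"

definition aleph1_accessible :: "'u rel \<Rightarrow> ('o, 'm) category \<Rightarrow> bool" where
  "aleph1_accessible \<kappa> K \<longleftrightarrow>
    category K \<and> has_aleph1_directed_colimits \<kappa> K \<and>
    (\<exists>G. small \<kappa> G \<and> (\<forall>S\<in>G. aleph1_presentable \<kappa> K S) \<and>
      (\<forall>X\<in>Obj K. aleph1_directed_colimit_of \<kappa> K G X))"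

definition has_small_colimits :: "'u rel \<Rightarrow> ('o, 'm) category \<Rightarrow> bool" where
  "has_small_colimits \<kappa> K \<longleftrightarrow>
    (\<forall>(J :: ('u, 'u) category) D. small_category \<kappa> J \<and> is_functor J K D \<longrightarrow>
      (\<exists>X \<xi>. is_colimit J K D X \<xi>))"

definition locally_aleph1_presentable :: "'u rel \<Rightarrow> ('o, 'm) category \<Rightarrow> bool" where
  "locally_aleph1_presentable \<kappa> K \<longleftrightarrow> aleph1_accessible \<kappa> K \<and> has_small_colimits \<kappa> K"


section \<open>The category of comodules\<close>

definition Comod ::
  "'u rel \<Rightarrow> ('a, 'r) ring_scheme \<Rightarrow> ('a, 'c, 'x) coring_scheme \<Rightarrow>
    (('a, 'c, 'u) comodule, 'u \<Rightarrow> 'u) category" where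
  "Comod \<kappa> A C =
    \<lparr>Obj = {M. comodule A C M \<and> small \<kappa> (carrier M)},
     Hom = comodule_hom A C,
     Cmp = (\<lambda>L M N g f. compose (carrier L) g f),
     Idt = (\<lambda>M. \<lambda>x\<in>carrier M. x)\<rparr>"

end

theory Submission
  imports Defs "HOL-Library.Countable_Set_Type"
begin

text \<open>
  A comodule is a coalgebra over the functor \<open>C \<otimes>\<^sub>A -\<close> on \<open>A\<close>-modules, which preserves directed colimits;
  the colimit of a diagram of comodules is its colimit in the category of modules with the induced coaction.
  A countably presentable comodule is \<open>\<aleph>\<^sub>1\<close>-presentable because a morphism out of it is determined by countably
  many elements subject to countably many equations, and each of these equations is witnessed at some stage of
  the diagram.

  Conversely, present a comodule \<open>M\<close> by all its elements and all the relations between them. Lifting the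
  coaction of one generator, or verifying that it respects one relation or satisfies one of the comodule
  axioms, only involves countably many further generators and relations. The countable sets \<open>Z\<close> of generators
  and relations that are closed under these choices form an \<open>\<aleph>\<^sub>1\<close>-directed poset, each of them defines a
  countably presentable comodule, and \<open>M\<close> is the colimit. An \<open>\<aleph>\<^sub>1\<close>-presentable \<open>M\<close> is therefore a retract of
  one of these comodules.
\<close>

section \<open>Linear maps, linear combinations and presentations\<close>

text \<open>The coring need not be flat over A: for a submodule N of M the map from C tensor N to C
  tensor M can have a kernel, so submodules of M are no substitute for subcomodules. This is why M
  is approximated by presented modules, with relations on the same footing as generators: an
  equation that holds in C tensor M holds for an approximation only after further relations have
  been imposed. Each correction creates new conditions, and closing up under corrections takes
  countably many steps. A countable set of data stays countable under this, whereas a finite set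
  need not stay finite; this is where aleph_1 comes from.

  Tensor products are compared at the level of formal sums, since there a relation over a directed
  colimit can be lifted to a relation at a stage.

  Smallness rests on a property of \<open>\<kappa>\<close>: a small set has only a small number of
  countable subsets. It bounds the index poset of the approximations as well as the data that
  determine a countably presentable comodule up to isomorphism. Objects have their elements in
  \<open>'u\<close>, so the modules that become objects are realised by representatives in that
  type.\<close>

definition add_hom :: "('m, 'x) ring_scheme \<Rightarrow> ('n, 'y) ring_scheme \<Rightarrow> ('m \<Rightarrow> 'n) set" where
  "add_hom G H =
    {f \<in> carrier G \<rightarrow> carrier H.
      \<forall>x\<in>carrier G. \<forall>y\<in>carrier G. f (x \<oplus>\<^bsub>G\<^esub> y) = f x \<oplus>\<^bsub>H\<^esub> f y}"

lemma add_homI: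
  assumes "\<And>x. x \<in> carrier G \<Longrightarrow> f x \<in> carrier H"
    and "\<And>x y. \<lbrakk>x \<in> carrier G; y \<in> carrier G\<rbrakk> \<Longrightarrow> f (x \<oplus>\<^bsub>G\<^esub> y) = f x \<oplus>\<^bsub>H\<^esub> f y"
  shows "f \<in> add_hom G H"
  using assms by (auto simp: add_hom_def)

lemma add_homD:
  assumes "f \<in> add_hom G H"
  shows "x \<in> carrier G \<Longrightarrow> f x \<in> carrier H"
    and "\<lbrakk>x \<in> carrier G; y \<in> carrier G\<rbrakk> \<Longrightarrow> f (x \<oplus>\<^bsub>G\<^esub> y) = f x \<oplus>\<^bsub>H\<^esub> f y"
  using assms by (auto simp: add_hom_def)

lemma add_hom_zero:
  assumes "abelian_group G" "abelian_group H" "f \<in> add_hom G H"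
  shows "f \<zero>\<^bsub>G\<^esub> = \<zero>\<^bsub>H\<^esub>"
proof -
  interpret G: abelian_group G by fact
  interpret H: abelian_group H by fact
  have "f \<zero>\<^bsub>G\<^esub> = f \<zero>\<^bsub>G\<^esub> \<oplus>\<^bsub>H\<^esub> f \<zero>\<^bsub>G\<^esub>"
    using add_homD(2)[OF assms(3), of "\<zero>\<^bsub>G\<^esub>" "\<zero>\<^bsub>G\<^esub>"] by simp
  moreover have "f \<zero>\<^bsub>G\<^esub> \<in> carrier H" using add_homD(1)[OF assms(3)] by simp
  ultimately show ?thesis by (metis H.add.l_cancel_one)
qed

lemma add_hom_minus:
  assumes "abelian_group G" "abelian_group H" "f \<in> add_hom G H" "x \<in> carrier G"
  shows "f (\<ominus>\<^bsub>G\<^esub> x) = \<ominus>\<^bsub>H\<^esub> f x"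
proof -
  interpret G: abelian_group G by fact
  interpret H: abelian_group H by fact
  have "f (\<ominus>\<^bsub>G\<^esub> x) \<oplus>\<^bsub>H\<^esub> f x = \<zero>\<^bsub>H\<^esub>"
    using add_homD(2)[OF assms(3), of "\<ominus>\<^bsub>G\<^esub> x" x] add_hom_zero[OF assms(1-3)] assms(4)
    by (simp add: G.l_neg)
  thus ?thesis using add_homD(1)[OF assms(3)] assms(4) H.minus_equality by force
qed

lemma add_hom_diff:
  assumes "abelian_group G" "abelian_group H" "f \<in> add_hom G H" "x \<in> carrier G" "y \<in> carrier G"
  shows "f (x \<ominus>\<^bsub>G\<^esub> y) = f x \<ominus>\<^bsub>H\<^esub> f y"
proof -
  interpret G: abelian_group G by fact
  show ?thesis
    using assms add_hom_minus[OF assms(1-3)] add_homD(2)[OF assms(3)] by (simp add: a_minus_def)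
qed

lemma (in abelian_group) diff_zero_iff:
  assumes "x \<in> carrier G" "y \<in> carrier G"
  shows "x \<ominus> y = \<zero> \<longleftrightarrow> x = y"
proof
  assume "x \<ominus> y = \<zero>"
  hence "\<ominus> (\<ominus> y) = x" using assms by (intro minus_equality) (auto simp: a_minus_def)
  thus "x = y" using assms by simp
qed (use assms in \<open>simp add: a_minus_def r_neg\<close>)

lemma left_homI:
  assumes "\<And>x. x \<in> carrier M \<Longrightarrow> f x \<in> carrier N"
    and "\<And>x y. \<lbrakk>x \<in> carrier M; y \<in> carrier M\<rbrakk> \<Longrightarrow> f (x \<oplus>\<^bsub>M\<^esub> y) = f x \<oplus>\<^bsub>N\<^esub> f y"
    and "\<And>a x. \<lbrakk>a \<in> carrier A; x \<in> carrier M\<rbrakk> \<Longrightarrow> f (a \<odot>\<^bsub>M\<^esub> x) = a \<odot>\<^bsub>N\<^esub> f x"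
  shows "f \<in> left_hom A M N"
  using assms by (auto simp: left_hom_def)

lemma left_homD:
  assumes "f \<in> left_hom A M N"
  shows "x \<in> carrier M \<Longrightarrow> f x \<in> carrier N"
    and "\<lbrakk>x \<in> carrier M; y \<in> carrier M\<rbrakk> \<Longrightarrow> f (x \<oplus>\<^bsub>M\<^esub> y) = f x \<oplus>\<^bsub>N\<^esub> f y"
    and "\<lbrakk>a \<in> carrier A; x \<in> carrier M\<rbrakk> \<Longrightarrow> f (a \<odot>\<^bsub>M\<^esub> x) = a \<odot>\<^bsub>N\<^esub> f x"
    and "f \<in> add_hom M N"
  using assms by (auto simp: left_hom_def add_hom_def)

lemma left_moduleD:
  assumes "left_module A M"
  shows "ring A" "abelian_group M"
  using assms by (auto simp: left_module_def)

lemma left_hom_zero: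
  assumes "left_module A M" "left_module A N" "f \<in> left_hom A M N"
  shows "f \<zero>\<^bsub>M\<^esub> = \<zero>\<^bsub>N\<^esub>"
  by (rule add_hom_zero[OF assms(1,2)[THEN left_moduleD(2)] left_homD(4)[OF assms(3)]])

lemma left_hom_diff:
  assumes "left_module A M" "left_module A N" "f \<in> left_hom A M N"
    and "x \<in> carrier M" "y \<in> carrier M"
  shows "f (x \<ominus>\<^bsub>M\<^esub> y) = f x \<ominus>\<^bsub>N\<^esub> f y"
  by (rule add_hom_diff[OF assms(1,2)[THEN left_moduleD(2)] left_homD(4)[OF assms(3)] assms(4,5)])

lemma left_hom_comp:
  assumes "f \<in> left_hom A L M" "g \<in> left_hom A M N"
  shows "(\<lambda>x. g (f x)) \<in> left_hom A L N"
  using assms by (auto simp: left_hom_def Pi_iff)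

text \<open>Linearity only concerns values on the carrier. This is needed because
  \<open>comodule_hom\<close> consists of extensional functions, so linear maps keep being replaced
  by their restrictions.\<close>

lemma left_hom_cong:
  assumes "left_module A M" "f \<in> left_hom A M N" "\<And>x. x \<in> carrier M \<Longrightarrow> f x = g x"
  shows "g \<in> left_hom A M N"
proof -
  interpret left_module A M by fact
  show ?thesis
    by (intro left_homI) (simp_all add: left_homD[OF assms(2)] assms(3)[symmetric] smult_closed)
qed

lemma left_hom_id: "id \<in> left_hom A M M" "(\<lambda>x. x) \<in> left_hom A M M"
  by (auto intro: left_homI)

lemma (in left_module) smult_zero [simp]: "a \<in> carrier A \<Longrightarrow> a \<odot>\<^bsub>M\<^esub> \<zero>\<^bsub>M\<^esub> = \<zero>\<^bsub>M\<^esub>"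
  using smult_r_distr[of a "\<zero>\<^bsub>M\<^esub>" "\<zero>\<^bsub>M\<^esub>"] by (simp add: smult_closed)

lemma (in left_module) zero_smult [simp]: "x \<in> carrier M \<Longrightarrow> \<zero>\<^bsub>A\<^esub> \<odot>\<^bsub>M\<^esub> x = \<zero>\<^bsub>M\<^esub>"
  using smult_l_distr[of "\<zero>\<^bsub>A\<^esub>" "\<zero>\<^bsub>A\<^esub>" x] by (simp add: smult_closed)

lemma (in left_module) minus_smult:
  "x \<in> carrier M \<Longrightarrow> (\<ominus>\<^bsub>A\<^esub> \<one>\<^bsub>A\<^esub>) \<odot>\<^bsub>M\<^esub> x = \<ominus>\<^bsub>M\<^esub> x"
  using smult_l_distr[of "\<ominus>\<^bsub>A\<^esub> \<one>\<^bsub>A\<^esub>" "\<one>\<^bsub>A\<^esub>" x]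
  by (metis M.minus_equality R.add.inv_closed R.l_neg R.one_closed smult_closed smult_one zero_smult)

text \<open>Each module axiom for N is an equation between sums and multiples of images under
  \<open>q\<close>, hence the image of the same equation in M. Both kinds of quotients below,
  \<open>quotient_on_type\<close> and \<open>quotient_module_hom\<close>, are recognised as modules
  in this way.\<close>

lemma left_module_surj:
  assumes "left_module A M" "q ` carrier M = carrier N" "\<zero>\<^bsub>N\<^esub> = q \<zero>\<^bsub>M\<^esub>"
    and add: "\<And>x y. \<lbrakk>x \<in> carrier M; y \<in> carrier M\<rbrakk> \<Longrightarrow> q (x \<oplus>\<^bsub>M\<^esub> y) = q x \<oplus>\<^bsub>N\<^esub> q y"
    and smult: "\<And>a x. \<lbrakk>a \<in> carrier A; x \<in> carrier M\<rbrakk> \<Longrightarrow> q (a \<odot>\<^bsub>M\<^esub> x) = a \<odot>\<^bsub>N\<^esub> q x"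
  shows "left_module A N" "q \<in> left_hom A M N"
proof -
  interpret M: left_module A M by fact
  have car: "\<exists>v. v \<in> carrier M \<and> x = q v" if "x \<in> carrier N" for x
    using that unfolding assms(2)[symmetric] by blast
  have "abelian_group N"
  proof (rule abelian_groupI)
    fix x y assume "x \<in> carrier N" "y \<in> carrier N"
    then obtain v w where "v \<in> carrier M" "w \<in> carrier M" "x = q v" "y = q w" using car by meson
    thus "x \<oplus>\<^bsub>N\<^esub> y \<in> carrier N" "x \<oplus>\<^bsub>N\<^esub> y = y \<oplus>\<^bsub>N\<^esub> x"
      by (auto simp: add[symmetric] M.M.a_comm assms(2)[symmetric])
  next
    show "\<zero>\<^bsub>N\<^esub> \<in> carrier N" by (simp add: assms(3) assms(2)[symmetric])
  next
    fix x y z assume "x \<in> carrier N" "y \<in> carrier N" "z \<in> carrier N"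
    then obtain u v w where "u \<in> carrier M" "v \<in> carrier M" "w \<in> carrier M" "x = q u" "y = q v" "z = q w"
      using car by meson
    thus "x \<oplus>\<^bsub>N\<^esub> y \<oplus>\<^bsub>N\<^esub> z = x \<oplus>\<^bsub>N\<^esub> (y \<oplus>\<^bsub>N\<^esub> z)"
      by (simp add: add[symmetric] M.M.a_assoc)
  next
    fix x assume "x \<in> carrier N"
    then obtain v where v: "v \<in> carrier M" "x = q v" using car by blast
    thus "\<zero>\<^bsub>N\<^esub> \<oplus>\<^bsub>N\<^esub> x = x"
      by (simp add: assms(3) add[symmetric])
    show "\<exists>y\<in>carrier N. y \<oplus>\<^bsub>N\<^esub> x = \<zero>\<^bsub>N\<^esub>"
      using v add[of "\<ominus>\<^bsub>M\<^esub> v" v] assms(3) by (auto simp: M.M.l_neg assms(2)[symmetric])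
  qed
  moreover have "left_module_axioms A N"
    by (unfold_locales; drule car; (drule car)?)
      (auto simp: add[symmetric] smult[symmetric] M.smult_closed assms(2)[symmetric]
        M.smult_l_distr M.smult_r_distr M.smult_assoc M.smult_one)
  ultimately show "left_module A N" by (simp add: left_module_def M.R.ring_axioms)
  show "q \<in> left_hom A M N" using assms(2) add smult by (intro left_homI) auto
qed

section \<open>Free modules and linear combinations\<close>

definition lincomb ::
  "('a, 'r) ring_scheme \<Rightarrow> ('a, 'm, 'z) module_scheme \<Rightarrow> ('x \<Rightarrow> 'm) \<Rightarrow> ('x \<Rightarrow> 'a) \<Rightarrow> 'm" where
  "lincomb A M g v = (\<Oplus>\<^bsub>M\<^esub>x\<in>{x. v x \<noteq> \<zero>\<^bsub>A\<^esub>}. v x \<odot>\<^bsub>M\<^esub> g x)"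

definition unit_vec :: "('a, 'r) ring_scheme \<Rightarrow> 'x \<Rightarrow> 'x \<Rightarrow> 'a" where
  "unit_vec A x = (\<lambda>y. if y = x then \<one>\<^bsub>A\<^esub> else \<zero>\<^bsub>A\<^esub>)"

lemma free_simps:
  "\<zero>\<^bsub>free_left_module A X\<^esub> = (\<lambda>x. \<zero>\<^bsub>A\<^esub>)"
  "v \<oplus>\<^bsub>free_left_module A X\<^esub> w = (\<lambda>x. v x \<oplus>\<^bsub>A\<^esub> w x)"
  "a \<odot>\<^bsub>free_left_module A X\<^esub> v = (\<lambda>x. a \<otimes>\<^bsub>A\<^esub> v x)"
  by (simp_all add: free_left_module_def)

lemma free_carrier:
  "v \<in> carrier (free_left_module A X) \<longleftrightarrow>
    (\<forall>x\<in>X. v x \<in> carrier A) \<and> (\<forall>x\<in>-X. v x = \<zero>\<^bsub>A\<^esub>) \<and> finite {x. v x \<noteq> \<zero>\<^bsub>A\<^esub>}"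
  by (simp add: free_left_module_def)

lemma free_val:
  assumes "ring A" "v \<in> carrier (free_left_module A X)"
  shows "v x \<in> carrier A"
proof -
  interpret ring A by fact
  show ?thesis using assms(2) by (cases "x \<in> X") (auto simp: free_carrier)
qed

lemma free_supp_sub: "v \<in> carrier (free_left_module A X) \<Longrightarrow> {x. v x \<noteq> \<zero>\<^bsub>A\<^esub>} \<subseteq> X"
  by (auto simp: free_carrier)

lemma free_mono: "\<lbrakk>X \<subseteq> X'; ring A\<rbrakk> \<Longrightarrow> carrier (free_left_module A X) \<subseteq> carrier (free_left_module A X')"
  using free_val by (fastforce simp: free_carrier)

lemma free_left_module:
  assumes "ring A"
  shows "left_module A (free_left_module A X)" (is "left_module A ?F")
proof -
  interpret ring A by fact
  note val = free_val[OF assms]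
  have addc: "x \<oplus>\<^bsub>?F\<^esub> y \<in> carrier ?F" if "x \<in> carrier ?F" "y \<in> carrier ?F" for x y
  proof -
    have "{z. (x \<oplus>\<^bsub>?F\<^esub> y) z \<noteq> \<zero>\<^bsub>A\<^esub>} \<subseteq> {z. x z \<noteq> \<zero>\<^bsub>A\<^esub>} \<union> {z. y z \<noteq> \<zero>\<^bsub>A\<^esub>}"
      by (auto simp: free_simps)
    hence "finite {z. (x \<oplus>\<^bsub>?F\<^esub> y) z \<noteq> \<zero>\<^bsub>A\<^esub>}"
      by (rule finite_subset) (use that in \<open>simp add: free_carrier\<close>)
    thus ?thesis using that by (auto simp: free_carrier free_simps)
  qed
  have smc: "a \<odot>\<^bsub>?F\<^esub> x \<in> carrier ?F" if "a \<in> carrier A" "x \<in> carrier ?F" for a x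
  proof -
    have "{z. (a \<odot>\<^bsub>?F\<^esub> x) z \<noteq> \<zero>\<^bsub>A\<^esub>} \<subseteq> {z. x z \<noteq> \<zero>\<^bsub>A\<^esub>}"
      using that by (auto simp: free_simps)
    hence "finite {z. (a \<odot>\<^bsub>?F\<^esub> x) z \<noteq> \<zero>\<^bsub>A\<^esub>}"
      by (rule finite_subset) (use that in \<open>simp add: free_carrier\<close>)
    thus ?thesis using that by (auto simp: free_carrier free_simps)
  qed
  have "abelian_group ?F"
  proof (rule abelian_groupI)
    show "\<zero>\<^bsub>?F\<^esub> \<in> carrier ?F" by (simp add: free_carrier free_simps)
    fix x assume x: "x \<in> carrier ?F"
    have "(\<ominus>\<^bsub>A\<^esub> \<one>\<^bsub>A\<^esub>) \<odot>\<^bsub>?F\<^esub> x \<oplus>\<^bsub>?F\<^esub> x = \<zero>\<^bsub>?F\<^esub>"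
      using val[OF x] by (simp add: free_simps l_minus l_neg)
    thus "\<exists>y\<in>carrier ?F. y \<oplus>\<^bsub>?F\<^esub> x = \<zero>\<^bsub>?F\<^esub>" using smc[OF _ x] by blast
  qed (use addc in \<open>auto simp: free_simps a_ac val intro!: ext\<close>)
  moreover have "left_module_axioms A ?F"
    by (unfold_locales) (use smc in \<open>auto simp: free_simps l_distr r_distr m_assoc val intro!: ext\<close>)
  ultimately show ?thesis by (simp add: left_module_def assms)
qed

lemma unit_vec_closed:
  assumes "ring A" "x \<in> X"
  shows "unit_vec A x \<in> carrier (free_left_module A X)"
proof -
  interpret ring A by fact
  have "{y. unit_vec A x y \<noteq> \<zero>\<^bsub>A\<^esub>} \<subseteq> {x}" by (auto simp: unit_vec_def)
  hence "finite {y. unit_vec A x y \<noteq> \<zero>\<^bsub>A\<^esub>}" by (rule finite_subset) simp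
  thus ?thesis using assms(2) by (auto simp: free_carrier unit_vec_def)
qed

text \<open>Entries outside the support contribute zero. Since \<open>lincomb\<close> sums over the
  support of its own vector, sums for different vectors can only be added after being rewritten over
  a common finite index set.\<close>

lemma lincomb_superset:
  assumes "left_module A M" "g \<in> X \<rightarrow> carrier M" "v \<in> carrier (free_left_module A X)"
    and "finite S" "{x. v x \<noteq> \<zero>\<^bsub>A\<^esub>} \<subseteq> S" "S \<subseteq> X"
  shows "lincomb A M g v = (\<Oplus>\<^bsub>M\<^esub>x\<in>S. v x \<odot>\<^bsub>M\<^esub> g x)"
proof -
  interpret left_module A M by fact
  note val = free_val[OF R.ring_axioms assms(3)]
  show ?thesis unfolding lincomb_def
    by (rule M.add.finprod_mono_neutral_cong_left)
      (use assms in \<open>auto simp: val intro!: smult_closed zero_smult val\<close>)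
qed

lemma lincomb_closed:
  assumes "left_module A M" "g \<in> X \<rightarrow> carrier M" "v \<in> carrier (free_left_module A X)"
  shows "lincomb A M g v \<in> carrier M"
proof -
  interpret left_module A M by fact
  note val = free_val[OF R.ring_axioms assms(3)]
  show ?thesis unfolding lincomb_def
    using assms(2) free_supp_sub[OF assms(3)]
    by (intro M.finsum_closed) (auto intro!: smult_closed val)
qed

lemma finsum_smult:
  assumes "left_module A M" "a \<in> carrier A" "f \<in> S \<rightarrow> carrier M" "finite S"
  shows "a \<odot>\<^bsub>M\<^esub> (\<Oplus>\<^bsub>M\<^esub>x\<in>S. f x) = (\<Oplus>\<^bsub>M\<^esub>x\<in>S. a \<odot>\<^bsub>M\<^esub> f x)"
proof -
  interpret left_module A M by fact
  show ?thesis using assms(4,3)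
    by (induction S rule: finite_induct)
       (auto simp: assms(2) smult_r_distr smult_closed Pi_iff)
qed

lemma lincomb_hom:
  assumes "left_module A M" "g \<in> X \<rightarrow> carrier M"
  shows "lincomb A M g \<in> left_hom A (free_left_module A X) M" (is "_ \<in> left_hom A ?F M")
proof -
  interpret left_module A M by fact
  interpret F: left_module A ?F by (rule free_left_module[OF R.ring_axioms])
  note val = free_val[OF R.ring_axioms]
  show ?thesis
  proof (rule left_homI)
    fix v w assume v: "v \<in> carrier ?F" and w: "w \<in> carrier ?F"
    let ?S = "{x. v x \<noteq> \<zero>\<^bsub>A\<^esub>} \<union> {x. w x \<noteq> \<zero>\<^bsub>A\<^esub>}"
    have S: "finite ?S" "?S \<subseteq> X" using v w by (auto simp: free_carrier)
    have "lincomb A M g (v \<oplus>\<^bsub>?F\<^esub> w) = (\<Oplus>\<^bsub>M\<^esub>x\<in>?S. (v \<oplus>\<^bsub>?F\<^esub> w) x \<odot>\<^bsub>M\<^esub> g x)"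
      by (rule lincomb_superset[OF assms F.M.add.m_closed[OF v w] S(1) _ S(2)])
        (auto simp: free_simps)
    also have "\<dots> = (\<Oplus>\<^bsub>M\<^esub>x\<in>?S. v x \<odot>\<^bsub>M\<^esub> g x \<oplus>\<^bsub>M\<^esub> w x \<odot>\<^bsub>M\<^esub> g x)"
      using assms(2) S val[OF v] val[OF w]
      by (intro M.finsum_cong') (auto simp: free_simps smult_l_distr smult_closed Pi_iff subset_iff)
    also have "\<dots> = (\<Oplus>\<^bsub>M\<^esub>x\<in>?S. v x \<odot>\<^bsub>M\<^esub> g x) \<oplus>\<^bsub>M\<^esub> (\<Oplus>\<^bsub>M\<^esub>x\<in>?S. w x \<odot>\<^bsub>M\<^esub> g x)"
      using assms(2) S val[OF v] val[OF w]
      by (intro M.finsum_addf) (auto simp: smult_closed Pi_iff subset_iff)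
    also have "(\<Oplus>\<^bsub>M\<^esub>x\<in>?S. v x \<odot>\<^bsub>M\<^esub> g x) = lincomb A M g v"
      by (rule lincomb_superset[OF assms v S(1) _ S(2), symmetric]) auto
    also have "(\<Oplus>\<^bsub>M\<^esub>x\<in>?S. w x \<odot>\<^bsub>M\<^esub> g x) = lincomb A M g w"
      by (rule lincomb_superset[OF assms w S(1) _ S(2), symmetric]) auto
    finally show "lincomb A M g (v \<oplus>\<^bsub>?F\<^esub> w) = lincomb A M g v \<oplus>\<^bsub>M\<^esub> lincomb A M g w" .
  next
    fix a v assume a: "a \<in> carrier A" and v: "v \<in> carrier ?F"
    let ?S = "{x. v x \<noteq> \<zero>\<^bsub>A\<^esub>}"
    have S: "finite ?S" "?S \<subseteq> X" using v by (auto simp: free_carrier)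
    have "lincomb A M g (a \<odot>\<^bsub>?F\<^esub> v) = (\<Oplus>\<^bsub>M\<^esub>x\<in>?S. (a \<odot>\<^bsub>?F\<^esub> v) x \<odot>\<^bsub>M\<^esub> g x)"
      by (rule lincomb_superset[OF assms F.smult_closed[OF a v] S(1) _ S(2)])
         (use a in \<open>auto simp: free_simps\<close>)
    also have "\<dots> = (\<Oplus>\<^bsub>M\<^esub>x\<in>?S. a \<odot>\<^bsub>M\<^esub> (v x \<odot>\<^bsub>M\<^esub> g x))"
      using assms(2) S val[OF v] a
      by (intro M.finsum_cong') (auto simp: free_simps smult_assoc smult_closed Pi_iff subset_iff)
    also have "\<dots> = a \<odot>\<^bsub>M\<^esub> lincomb A M g v"
      using assms(2) S val[OF v] a unfolding lincomb_def
      by (intro finsum_smult[OF assms(1), symmetric]) (auto simp: smult_closed Pi_iff subset_iff)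
    finally show "lincomb A M g (a \<odot>\<^bsub>?F\<^esub> v) = a \<odot>\<^bsub>M\<^esub> lincomb A M g v" .
  qed (rule lincomb_closed[OF assms])
qed

lemma lincomb_unit_vec:
  assumes "left_module A M" "g x \<in> carrier M"
  shows "lincomb A M g (unit_vec A x) = g x"
proof -
  interpret left_module A M by fact
  have "lincomb A M g (unit_vec A x) = (\<Oplus>\<^bsub>M\<^esub>y\<in>{x}. unit_vec A x y \<odot>\<^bsub>M\<^esub> g y)"
  proof (rule lincomb_superset[OF assms(1), of g "{x}"])
    show "unit_vec A x \<in> carrier (free_left_module A {x})"
      by (rule unit_vec_closed[OF R.ring_axioms]) simp
  qed (use assms(2) in \<open>auto simp: unit_vec_def\<close>)
  also have "\<dots> = g x" using assms(2) by (simp add: unit_vec_def smult_one smult_closed)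
  finally show ?thesis .
qed

lemma lincomb_cong:
  assumes "left_module A M" "g \<in> X \<rightarrow> carrier M" "v \<in> carrier (free_left_module A X)"
    "\<And>x. x \<in> X \<Longrightarrow> g x = h x"
  shows "lincomb A M g v = lincomb A M h v"
proof -
  interpret left_module A M by fact
  show ?thesis unfolding lincomb_def
    using assms(2,4) free_supp_sub[OF assms(3)] free_val[OF R.ring_axioms assms(3)]
    by (intro M.finsum_cong') (auto simp: Pi_iff subset_iff intro!: smult_closed)
qed

text \<open>A vector has finite support, so it is reached from zero by adding one multiple of a
  basis vector at a time. Linear maps out of free modules are compared in this way.\<close>

lemma free_induct [consumes 2, case_names zero step]:
  assumes "ring A" "v \<in> carrier (free_left_module A X)"
    and zero: "P \<zero>\<^bsub>free_left_module A X\<^esub>"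
    and step: "\<And>a x v. \<lbrakk>a \<in> carrier A; x \<in> X; v \<in> carrier (free_left_module A X); P v\<rbrakk> \<Longrightarrow>
      P (a \<odot>\<^bsub>free_left_module A X\<^esub> unit_vec A x \<oplus>\<^bsub>free_left_module A X\<^esub> v)"
  shows "P v"
proof -
  interpret ring A by fact
  have "finite {x. v x \<noteq> \<zero>\<^bsub>A\<^esub>}" using assms(2) by (simp add: free_carrier)
  \<comment> \<open>The induction runs over a finite superset of the support and not over the
    support itself, so that a coordinate of \<open>S\<close> at which the vector vanishes can simply
    be dropped.\<close>
  then obtain S where S: "finite S" "{x. v x \<noteq> \<zero>\<^bsub>A\<^esub>} \<subseteq> S" by blast
  thus ?thesis using assms(2)
  proof (induction S arbitrary: v rule: finite_induct)
    case empty
    hence "v = \<zero>\<^bsub>free_left_module A X\<^esub>" by (auto simp: free_simps)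
    thus ?case using zero by simp
  next
    case (insert x S)
    note val = free_val[OF assms(1) insert.prems(2)]
    show ?case
    proof (cases "v x = \<zero>\<^bsub>A\<^esub>")
      case True
      hence "{x. v x \<noteq> \<zero>\<^bsub>A\<^esub>} \<subseteq> S" using insert.prems by auto
      thus ?thesis using insert.IH insert.prems by blast
    next
      case False
      hence x: "x \<in> X" using insert.prems(2) by (auto simp: free_carrier)
      let ?w = "v(x := \<zero>\<^bsub>A\<^esub>)"
      have sub: "{y. ?w y \<noteq> \<zero>\<^bsub>A\<^esub>} \<subseteq> {y. v y \<noteq> \<zero>\<^bsub>A\<^esub>}" by auto
      have w: "?w \<in> carrier (free_left_module A X)"
        using insert.prems(2) finite_subset[OF sub] by (auto simp: free_carrier)
      have "P ?w" by (rule insert.IH[OF _ w]) (use insert.prems(1) in auto)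
      moreover have "v x \<odot>\<^bsub>free_left_module A X\<^esub> unit_vec A x \<oplus>\<^bsub>free_left_module A X\<^esub> ?w = v"
        using val by (auto simp: free_simps unit_vec_def)
      ultimately show ?thesis using step[OF val[of x] x w] by simp
    qed
  qed
qed

lemma hom_lincomb:
  assumes "left_module A M" "left_module A N" "g \<in> X \<rightarrow> carrier M" "f \<in> left_hom A M N"
    and "v \<in> carrier (free_left_module A X)"
  shows "f (lincomb A M g v) = lincomb A N (\<lambda>x. f (g x)) v"
proof -
  interpret M: left_module A M by fact
  interpret N: left_module A N by fact
  interpret F: left_module A "free_left_module A X" by (rule free_left_module[OF M.R.ring_axioms])
  have fg: "(\<lambda>x. f (g x)) \<in> X \<rightarrow> carrier N" using assms(3) left_homD(1)[OF assms(4)] by auto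
  note h1 = lincomb_hom[OF assms(1,3)] note h2 = lincomb_hom[OF assms(2) fg]
  note u = unit_vec_closed[OF M.R.ring_axioms]
  from M.R.ring_axioms assms(5) show ?thesis
  proof (induction rule: free_induct)
    case zero
    thus ?case
      using left_hom_zero[OF F.left_module_axioms M.left_module_axioms h1]
        left_hom_zero[OF F.left_module_axioms N.left_module_axioms h2]
        left_hom_zero[OF assms(1,2,4)] by simp
  next
    case (step a x v)
    have g: "g x \<in> carrier M" using step assms(3) by auto
    have "lincomb A M g (unit_vec A x) = g x" "lincomb A N (\<lambda>x. f (g x)) (unit_vec A x) = f (g x)"
      using g assms by (auto intro!: lincomb_unit_vec simp: left_homD)
    with step show ?case
      using u[OF step(2)] g
      by (simp add: left_homD[OF h1] left_homD[OF h2] F.smult_closed left_homD[OF assms(4)] M.smult_closed)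
  qed
qed

text \<open>The unit vectors are a basis. Together with \<open>hom_lincomb\<close> this shows that
  every linear map out of a free module is the linear combination of its values on the unit
  vectors.\<close>

lemma lincomb_free_self:
  assumes "ring A" "v \<in> carrier (free_left_module A X)"
  shows "lincomb A (free_left_module A X) (unit_vec A) v = v"
proof -
  interpret F: left_module A "free_left_module A X" by (rule free_left_module[OF assms(1)])
  have u: "unit_vec A \<in> X \<rightarrow> carrier (free_left_module A X)" by (simp add: unit_vec_closed[OF assms(1)])
  note h = lincomb_hom[OF F.left_module_axioms u]
  from assms show ?thesis
  proof (induction rule: free_induct)
    case zero
    then show ?case using left_hom_zero[OF F.left_module_axioms F.left_module_axioms h] by simp
  next
    case (step a x v)
    have "lincomb A (free_left_module A X) (unit_vec A) (unit_vec A x) = unit_vec A x"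
      using u step(2) by (intro lincomb_unit_vec[OF F.left_module_axioms]) auto
    moreover have "unit_vec A x \<in> carrier (free_left_module A X)" by (rule unit_vec_closed[OF assms(1) step(2)])
    ultimately show ?case using step
      by (simp add: left_homD[OF h] F.smult_closed)
  qed
qed

section \<open>Spans and presentations by generators and relations\<close>

inductive_set mspan ::
  "('a, 'r) ring_scheme \<Rightarrow> ('a, 'm, 'z) module_scheme \<Rightarrow> 'm set \<Rightarrow> 'm set"
  for A :: "('a, 'r) ring_scheme" and M :: "('a, 'm, 'z) module_scheme" and Y :: "'m set"
  where
    zero: "\<zero>\<^bsub>M\<^esub> \<in> mspan A M Y"
  | step: "\<lbrakk>y \<in> Y; a \<in> carrier A; v \<in> mspan A M Y\<rbrakk> \<Longrightarrow> a \<odot>\<^bsub>M\<^esub> y \<oplus>\<^bsub>M\<^esub> v \<in> mspan A M Y"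

context left_module
begin

lemma mspan_closed: "\<lbrakk>v \<in> mspan A M Y; Y \<subseteq> carrier M\<rbrakk> \<Longrightarrow> v \<in> carrier M"
  by (induction rule: mspan.induct) (auto intro!: smult_closed)

lemma mspan_add:
  assumes "v \<in> mspan A M Y" "w \<in> mspan A M Y" "Y \<subseteq> carrier M"
  shows "v \<oplus>\<^bsub>M\<^esub> w \<in> mspan A M Y"
  using assms(1)
proof (induction rule: mspan.induct)
  case zero
  then show ?case using assms mspan_closed by simp
next
  case (step y a v)
  have "a \<odot>\<^bsub>M\<^esub> y \<oplus>\<^bsub>M\<^esub> v \<oplus>\<^bsub>M\<^esub> w = a \<odot>\<^bsub>M\<^esub> y \<oplus>\<^bsub>M\<^esub> (v \<oplus>\<^bsub>M\<^esub> w)"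
    using step assms mspan_closed by (intro M.a_assoc) (auto intro!: smult_closed)
  then show ?case using step mspan.step by metis
qed

lemma mspan_smult:
  assumes "v \<in> mspan A M Y" "b \<in> carrier A" "Y \<subseteq> carrier M"
  shows "b \<odot>\<^bsub>M\<^esub> v \<in> mspan A M Y"
  using assms(1)
proof (induction rule: mspan.induct)
  case zero
  then show ?case using assms by (simp add: mspan.zero)
next
  case (step y a v)
  have "b \<odot>\<^bsub>M\<^esub> (a \<odot>\<^bsub>M\<^esub> y \<oplus>\<^bsub>M\<^esub> v) = (b \<otimes>\<^bsub>A\<^esub> a) \<odot>\<^bsub>M\<^esub> y \<oplus>\<^bsub>M\<^esub> b \<odot>\<^bsub>M\<^esub> v"
    using step assms mspan_closed by (subst smult_r_distr) (auto simp: smult_assoc smult_closed)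
  then show ?case using step assms mspan.step by (metis R.m_closed)
qed

lemma mspan_minus:
  assumes "v \<in> mspan A M Y" "Y \<subseteq> carrier M"
  shows "\<ominus>\<^bsub>M\<^esub> v \<in> mspan A M Y"
  using mspan_smult[OF assms(1) _ assms(2), of "\<ominus>\<^bsub>A\<^esub> \<one>\<^bsub>A\<^esub>"] minus_smult mspan_closed[OF assms] by simp

lemma mspan_base:
  assumes "y \<in> Y" "Y \<subseteq> carrier M"
  shows "y \<in> mspan A M Y"
  using mspan.step[OF assms(1) R.one_closed mspan.zero, of M] assms smult_one[of y] by auto

end

lemma mspan_mono: "v \<in> mspan A M Y \<Longrightarrow> Y \<subseteq> mspan A M Y' \<Longrightarrow> left_module A M \<Longrightarrow> Y' \<subseteq> carrier M \<Longrightarrow>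
   v \<in> mspan A M Y'"
  by (induction rule: mspan.induct)
     (auto intro!: mspan.zero left_module.mspan_add left_module.mspan_smult)

lemma mspan_kernel:
  assumes "left_module A M" "left_module A N" "f \<in> left_hom A M N" "Y \<subseteq> carrier M"
    and "\<And>y. y \<in> Y \<Longrightarrow> f y = \<zero>\<^bsub>N\<^esub>" "v \<in> mspan A M Y"
  shows "f v = \<zero>\<^bsub>N\<^esub>"
proof -
  interpret M: left_module A M by fact
  interpret N: left_module A N by fact
  show ?thesis using assms(6)
  proof (induction rule: mspan.induct)
    case zero
    then show ?case using left_hom_zero[OF assms(1-3)] .
  next
    case (step y a v)
    then have "y \<in> carrier M" "v \<in> carrier M" using assms(4) M.mspan_closed by auto
    then show ?case using step assms(5) by (simp add: left_homD[OF assms(3)] M.smult_closed)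
  qed
qed

text \<open>Here \<open>g\<close> is the family of generators and the vectors in \<open>Y\<close>
  are the relations. That the kernel of the evaluation map is spanned by \<open>Y\<close> says that
  M is a cokernel of free modules, but no quotient appears in the type of M, so the same notion
  applies to cosets and to modules on \<open>'u\<close>.\<close>

definition presents ::
  "('a, 'r) ring_scheme \<Rightarrow> ('a, 'm, 'z) module_scheme \<Rightarrow> 'x set \<Rightarrow> ('x \<Rightarrow> 'm) \<Rightarrow> ('x \<Rightarrow> 'a) set \<Rightarrow> bool" where
  "presents A M X g Y \<longleftrightarrow>
    left_module A M \<and> g \<in> X \<rightarrow> carrier M \<and> Y \<subseteq> carrier (free_left_module A X) \<and>
    (\<forall>v\<in>carrier (free_left_module A X).
      lincomb A M g v = \<zero>\<^bsub>M\<^esub> \<longleftrightarrow> v \<in> mspan A (free_left_module A X) Y) \<and>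
    lincomb A M g ` carrier (free_left_module A X) = carrier M"

lemma presentsD:
  assumes "presents A M X g Y"
  shows "left_module A M" "x \<in> X \<Longrightarrow> g x \<in> carrier M" "g \<in> X \<rightarrow> carrier M"
    "Y \<subseteq> carrier (free_left_module A X)" "y \<in> Y \<Longrightarrow> lincomb A M g y = \<zero>\<^bsub>M\<^esub>"
    "v \<in> carrier (free_left_module A X) \<Longrightarrow>
      lincomb A M g v = \<zero>\<^bsub>M\<^esub> \<longleftrightarrow> v \<in> mspan A (free_left_module A X) Y"
    "m \<in> carrier M \<Longrightarrow> \<exists>v\<in>carrier (free_left_module A X). m = lincomb A M g v"
  using assms left_module.mspan_base[OF free_left_module] left_moduleD(1)
  unfolding presents_def by (blast+)

lemma presents_ext:
  assumes "presents A M X g Y" "left_module A N" "f \<in> left_hom A M N" "f' \<in> left_hom A M N"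
    and "\<And>x. x \<in> X \<Longrightarrow> f (g x) = f' (g x)" "m \<in> carrier M"
  shows "f m = f' m"
proof -
  obtain v where v: "v \<in> carrier (free_left_module A X)" "m = lincomb A M g v"
    using presentsD(7)[OF assms(1,6)] by blast
  have "f m = lincomb A N (\<lambda>x. f (g x)) v" "f' m = lincomb A N (\<lambda>x. f' (g x)) v"
    using v assms hom_lincomb[OF presentsD(1)[OF assms(1)] assms(2) presentsD(3)[OF assms(1)]] by auto
  moreover have "(\<lambda>x. f (g x)) \<in> X \<rightarrow> carrier N"
    using presentsD(2)[OF assms(1)] left_homD(1)[OF assms(3)] by auto
  ultimately show ?thesis using lincomb_cong[OF assms(2) _ v(1) assms(5)] by simp
qed

text \<open>This is the universal property of a presentation. Two vectors that represent the same
  element of M differ by a vector in the span of \<open>Y\<close>, which the linear extension of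
  \<open>h\<close> kills; so \<open>h\<close> may be evaluated on any chosen representing
  vector.\<close>

lemma presents_lift:
  assumes "presents A M X g Y" "left_module A N" "h \<in> X \<rightarrow> carrier N"
    and "\<And>y. y \<in> Y \<Longrightarrow> lincomb A N h y = \<zero>\<^bsub>N\<^esub>"
  obtains f where "f \<in> left_hom A M N" "\<And>x. x \<in> X \<Longrightarrow> f (g x) = h x"
proof -
  let ?F = "free_left_module A X"
  interpret M: left_module A M using presentsD(1)[OF assms(1)] .
  interpret N: left_module A N by fact
  interpret F: left_module A ?F by (rule free_left_module[OF M.R.ring_axioms])
  note hN = lincomb_hom[OF assms(2,3)]
  note hM = lincomb_hom[OF presentsD(1,3)[OF assms(1)]]
  define p where "p = (\<lambda>m. SOME v. v \<in> carrier ?F \<and> m = lincomb A M g v)"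
  have p: "p m \<in> carrier ?F" "m = lincomb A M g (p m)" if "m \<in> carrier M" for m
    using someI_ex[of "\<lambda>v. v \<in> carrier ?F \<and> m = lincomb A M g v"] presentsD(7)[OF assms(1) that]
    unfolding p_def by blast+
  have key: "lincomb A N h v = lincomb A N h w"
    if "v \<in> carrier ?F" "w \<in> carrier ?F" "lincomb A M g v = lincomb A M g w" for v w
  proof -
    have d: "v \<ominus>\<^bsub>?F\<^esub> w \<in> carrier ?F" using that by simp
    have "lincomb A M g (v \<ominus>\<^bsub>?F\<^esub> w) = \<zero>\<^bsub>M\<^esub>"
      using left_hom_diff[OF F.left_module_axioms M.left_module_axioms hM] that
        left_homD(1)[OF hM] by (simp add: M.M.diff_zero_iff)
    hence "v \<ominus>\<^bsub>?F\<^esub> w \<in> mspan A ?F Y" using presentsD(6)[OF assms(1) d] by simp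
    hence "lincomb A N h (v \<ominus>\<^bsub>?F\<^esub> w) = \<zero>\<^bsub>N\<^esub>"
      using mspan_kernel[OF F.left_module_axioms assms(2) hN presentsD(4)[OF assms(1)]] assms(4) by blast
    thus ?thesis
      using left_hom_diff[OF F.left_module_axioms N.left_module_axioms hN] that
        left_homD(1)[OF hN] by (simp add: N.M.diff_zero_iff)
  qed
  let ?f = "\<lambda>m. lincomb A N h (p m)"
  have f: "?f (lincomb A M g v) = lincomb A N h v" if "v \<in> carrier ?F" for v
    using key[of "p (lincomb A M g v)" v] p[of "lincomb A M g v"] left_homD(1)[OF hM that] that by metis
  have "?f \<in> left_hom A M N"
  proof (rule left_homI)
    fix x y assume "x \<in> carrier M" "y \<in> carrier M"
    then obtain v w where *: "v \<in> carrier ?F" "w \<in> carrier ?F" "x = lincomb A M g v" "y = lincomb A M g w"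
      using presentsD(7)[OF assms(1)] by meson
    hence "x \<oplus>\<^bsub>M\<^esub> y = lincomb A M g (v \<oplus>\<^bsub>?F\<^esub> w)" by (simp add: left_homD[OF hM])
    thus "?f (x \<oplus>\<^bsub>M\<^esub> y) = ?f x \<oplus>\<^bsub>N\<^esub> ?f y" using * by (simp only: f left_homD[OF hN] F.M.add.m_closed)
  next
    fix a x assume "a \<in> carrier A" "x \<in> carrier M"
    then obtain v where *: "v \<in> carrier ?F" "x = lincomb A M g v" "a \<in> carrier A"
      using presentsD(7)[OF assms(1)] by meson
    hence "a \<odot>\<^bsub>M\<^esub> x = lincomb A M g (a \<odot>\<^bsub>?F\<^esub> v)" by (simp add: left_homD[OF hM])
    thus "?f (a \<odot>\<^bsub>M\<^esub> x) = a \<odot>\<^bsub>N\<^esub> ?f x" using * by (simp only: f left_homD[OF hN] F.smult_closed)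
  qed (use p left_homD(1)[OF hN] in auto)
  moreover have "?f (g x) = h x" if "x \<in> X" for x
  proof -
    have "g x = lincomb A M g (unit_vec A x)"
      using lincomb_unit_vec[OF M.left_module_axioms, of g x] presentsD(2)[OF assms(1) that] by metis
    hence "?f (g x) = lincomb A N h (unit_vec A x)"
      using f unit_vec_closed[OF M.R.ring_axioms that] by metis
    thus ?thesis using lincomb_unit_vec[OF N.left_module_axioms, of h x] assms(3) that by auto
  qed
  ultimately show thesis by (rule that)
qed

text \<open>The quotient by the span of \<open>Y\<close> is carried by representatives, transported
  along \<open>\<phi>\<close>, and not by cosets, because objects of \<open>Comod\<close> must have
  elements of type \<open>'u\<close>.\<close>

lemma quotient_on_type:
  fixes \<phi> :: "'m \<Rightarrow> 'u" and M :: "('a, 'm, 'z) module_scheme"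
  assumes "left_module A M" "inj_on \<phi> (carrier M)" "Y \<subseteq> carrier M"
  obtains L :: "('a, 'u) module" and q where "left_module A L" "q \<in> left_hom A M L"
    "q ` carrier M = carrier L" "carrier L \<subseteq> \<phi> ` carrier M"
    "\<And>v. v \<in> carrier M \<Longrightarrow> q v = \<zero>\<^bsub>L\<^esub> \<longleftrightarrow> v \<in> mspan A M Y"
proof -
  interpret M: left_module A M by fact
  have minus_zero: "\<ominus>\<^bsub>M\<^esub> \<zero>\<^bsub>M\<^esub> = \<zero>\<^bsub>M\<^esub>" by (rule M.M.minus_equality) auto
  let ?E = "\<lambda>v w. w \<in> carrier M \<and> v \<ominus>\<^bsub>M\<^esub> w \<in> mspan A M Y"
  \<comment> \<open>The choice depends on \<open>v\<close> only through the predicate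
    \<open>?E v\<close>. Congruent elements have the same predicate, so they receive literally the
    same representative, and \<open>q\<close> is constant on classes.\<close>
  define q where "q = (\<lambda>v. \<phi> (SOME w. ?E v w))"
  have rep: "?E v (SOME w. ?E v w)" if "v \<in> carrier M" for v
    by (rule someI[of _ v]) (use that in \<open>auto simp: M.M.r_neg a_minus_def intro: mspan.zero\<close>)
  have tr: "v \<ominus>\<^bsub>M\<^esub> x \<in> mspan A M Y \<Longrightarrow> x \<ominus>\<^bsub>M\<^esub> w \<in> mspan A M Y \<Longrightarrow> v \<ominus>\<^bsub>M\<^esub> w \<in> mspan A M Y"
    if "v \<in> carrier M" "w \<in> carrier M" "x \<in> carrier M" for v w x
  proof -
    assume a: "v \<ominus>\<^bsub>M\<^esub> x \<in> mspan A M Y" "x \<ominus>\<^bsub>M\<^esub> w \<in> mspan A M Y"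
    have "v \<ominus>\<^bsub>M\<^esub> w = (v \<ominus>\<^bsub>M\<^esub> x) \<oplus>\<^bsub>M\<^esub> (x \<ominus>\<^bsub>M\<^esub> w)"
      using that by (simp add: a_minus_def M.M.a_assoc M.M.r_neg1 M.M.r_neg2)
    thus ?thesis using M.mspan_add[OF a assms(3)] by simp
  qed
  have sy: "w \<ominus>\<^bsub>M\<^esub> v \<in> mspan A M Y" if "v \<in> carrier M" "w \<in> carrier M" "v \<ominus>\<^bsub>M\<^esub> w \<in> mspan A M Y" for v w
  proof -
    have "w \<ominus>\<^bsub>M\<^esub> v = \<ominus>\<^bsub>M\<^esub> (v \<ominus>\<^bsub>M\<^esub> w)"
      using that by (simp add: a_minus_def M.M.minus_add M.M.a_comm)
    thus ?thesis using M.mspan_minus[OF that(3) assms(3)] by simp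
  qed
  have q_eq: "q v = q w \<longleftrightarrow> v \<ominus>\<^bsub>M\<^esub> w \<in> mspan A M Y" if v: "v \<in> carrier M" and w: "w \<in> carrier M" for v w
  proof
    assume "q v = q w"
    hence eq: "(SOME z. ?E v z) = (SOME z. ?E w z)"
      using rep[OF v] rep[OF w] assms(2) unfolding q_def by (simp add: inj_on_eq_iff)
    let ?z = "SOME z. ?E v z"
    have z: "?z \<in> carrier M" "v \<ominus>\<^bsub>M\<^esub> ?z \<in> mspan A M Y" "w \<ominus>\<^bsub>M\<^esub> ?z \<in> mspan A M Y"
      using rep[OF v] rep[OF w] unfolding eq by blast+
    show "v \<ominus>\<^bsub>M\<^esub> w \<in> mspan A M Y" by (rule tr[OF v w z(1,2) sy[OF w z(1,3)]])
  next
    assume a: "v \<ominus>\<^bsub>M\<^esub> w \<in> mspan A M Y"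
    have "?E v = ?E w"
      using tr[OF v _ w a] tr[OF w _ v sy[OF v w a]] by (intro ext) blast
    thus "q v = q w" unfolding q_def by simp
  qed
  \<comment> \<open>A section of \<open>q\<close>; the operations of the quotient are computed on
    the vectors that it selects.\<close>
  define p where "p = inv_into (carrier M) q"
  define L :: "('a, 'u) module" where "L = \<lparr>carrier = q ` carrier M, mult = undefined, one = undefined,
    zero = q \<zero>\<^bsub>M\<^esub>, add = (\<lambda>x y. q (p x \<oplus>\<^bsub>M\<^esub> p y)), smult = (\<lambda>a x. q (a \<odot>\<^bsub>M\<^esub> p x))\<rparr>"
  have p: "p (q v) \<in> carrier M" "v \<ominus>\<^bsub>M\<^esub> p (q v) \<in> mspan A M Y" if "v \<in> carrier M" for v
  proof -
    show c: "p (q v) \<in> carrier M" unfolding p_def using that by (intro inv_into_into) auto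
    have "q (p (q v)) = q v" unfolding p_def using that by (intro f_inv_into_f) auto
    thus "v \<ominus>\<^bsub>M\<^esub> p (q v) \<in> mspan A M Y" using q_eq[OF that c] by simp
  qed
  have L_add: "q (v \<oplus>\<^bsub>M\<^esub> w) = q v \<oplus>\<^bsub>L\<^esub> q w" if vw: "v \<in> carrier M" "w \<in> carrier M" for v w
  proof -
    have "(v \<oplus>\<^bsub>M\<^esub> w) \<ominus>\<^bsub>M\<^esub> (p (q v) \<oplus>\<^bsub>M\<^esub> p (q w)) = (v \<ominus>\<^bsub>M\<^esub> p (q v)) \<oplus>\<^bsub>M\<^esub> (w \<ominus>\<^bsub>M\<^esub> p (q w))"
      using vw p by (simp add: a_minus_def M.M.minus_add M.M.a_ac)
    hence "(v \<oplus>\<^bsub>M\<^esub> w) \<ominus>\<^bsub>M\<^esub> (p (q v) \<oplus>\<^bsub>M\<^esub> p (q w)) \<in> mspan A M Y"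
      using M.mspan_add[OF p(2) p(2) assms(3)] vw by simp
    thus ?thesis unfolding L_def using q_eq vw p by auto
  qed
  have L_smult: "q (a \<odot>\<^bsub>M\<^esub> v) = a \<odot>\<^bsub>L\<^esub> q v" if av: "a \<in> carrier A" "v \<in> carrier M" for a v
  proof -
    have h: "(\<lambda>x. a \<odot>\<^bsub>M\<^esub> x) \<in> add_hom M M"
      using av M.smult_closed M.smult_r_distr by (intro add_homI) auto
    have "a \<odot>\<^bsub>M\<^esub> v \<ominus>\<^bsub>M\<^esub> a \<odot>\<^bsub>M\<^esub> p (q v) = a \<odot>\<^bsub>M\<^esub> (v \<ominus>\<^bsub>M\<^esub> p (q v))"
      using add_hom_diff[OF M.M.abelian_group_axioms M.M.abelian_group_axioms h] av p by simp
    hence "a \<odot>\<^bsub>M\<^esub> v \<ominus>\<^bsub>M\<^esub> a \<odot>\<^bsub>M\<^esub> p (q v) \<in> mspan A M Y"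
      using M.mspan_smult[OF p(2)[OF av(2)] av(1) assms(3)] by simp
    thus ?thesis unfolding L_def using q_eq av p M.smult_closed by auto
  qed
  have L_im: "q ` carrier M = carrier L" "\<zero>\<^bsub>L\<^esub> = q \<zero>\<^bsub>M\<^esub>" by (simp_all add: L_def)
  note L = left_module_surj[OF assms(1) L_im L_add L_smult]
  show thesis
  proof (rule that[OF L])
    show "q ` carrier M = carrier L" by (simp add: L_def)
    show "carrier L \<subseteq> \<phi> ` carrier M" unfolding L_def q_def using rep by auto
    show "q v = \<zero>\<^bsub>L\<^esub> \<longleftrightarrow> v \<in> mspan A M Y" if "v \<in> carrier M" for v
      using q_eq[OF that, of "\<zero>\<^bsub>M\<^esub>"] that by (simp add: L_def a_minus_def minus_zero)
  qed
qed

text \<open>Quotient of the free module by the span of the relations, with the unit vectors as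
  generators. The bound on the carrier is what later makes the module small.\<close>

lemma presents_exists:
  fixes \<phi> :: "('x \<Rightarrow> 'a) \<Rightarrow> 'u"
  assumes "ring A" "inj_on \<phi> (carrier (free_left_module A X))" "Y \<subseteq> carrier (free_left_module A X)"
  obtains L :: "('a, 'u) module" and g where "presents A L X g Y"
    "carrier L \<subseteq> \<phi> ` carrier (free_left_module A X)"
proof -
  let ?F = "free_left_module A X"
  interpret F: left_module A ?F by (rule free_left_module[OF assms(1)])
  obtain L :: "('a, 'u) module" and q where L: "left_module A L" "q \<in> left_hom A ?F L"
    "q ` carrier ?F = carrier L" "carrier L \<subseteq> \<phi> ` carrier ?F"
    "\<And>v. v \<in> carrier ?F \<Longrightarrow> q v = \<zero>\<^bsub>L\<^esub> \<longleftrightarrow> v \<in> mspan A ?F Y"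
    by (rule quotient_on_type[OF F.left_module_axioms assms(2,3)]) (rule that; assumption)
  have u: "unit_vec A \<in> X \<rightarrow> carrier ?F" by (simp add: unit_vec_closed[OF assms(1)])
  have e: "lincomb A L (\<lambda>x. q (unit_vec A x)) v = q v" if "v \<in> carrier ?F" for v
    using hom_lincomb[OF F.left_module_axioms L(1) u L(2) that] lincomb_free_self[OF assms(1) that] by simp
  have "presents A L X (\<lambda>x. q (unit_vec A x)) Y"
    unfolding presents_def using L(1,3,5) u assms(3) e left_homD(1)[OF L(2)] by (auto simp: image_iff)
  thus thesis using L(4) by (rule that)
qed

section \<open>Tensor products over a ring\<close>

text \<open>The class of a formal sum of pairs; \<open>pure_tensor\<close> is the case of a single
  pair. Computing with representatives keeps the individual relations visible, which the passage to
  directed colimits depends on.\<close>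

definition tcoset ::
  "('a, 'r) ring_scheme \<Rightarrow> ('a, 'c, 'x) bimodule_scheme \<Rightarrow> ('a, 'm, 'y) module_scheme \<Rightarrow>
    ('c \<times> 'm \<Rightarrow>\<^sub>0 int) \<Rightarrow> ('c, 'm) tensor" where
  "tcoset A C M t = tensor_relations A C M #>\<^bsub>free_Abelian_group (carrier C \<times> carrier M)\<^esub> t"

definition balanced ::
  "('a, 'r) ring_scheme \<Rightarrow> ('a, 'c, 'x) bimodule_scheme \<Rightarrow> ('a, 'm, 'y) module_scheme \<Rightarrow>
    ('g, 'z) ring_scheme \<Rightarrow> ('c \<Rightarrow> 'm \<Rightarrow> 'g) \<Rightarrow> bool" where
  "balanced A C M G \<beta> \<longleftrightarrow>
    (\<forall>c\<in>carrier C. \<forall>m\<in>carrier M. \<beta> c m \<in> carrier G) \<and>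
    (\<forall>c\<in>carrier C. \<forall>d\<in>carrier C. \<forall>m\<in>carrier M. \<beta> (c \<oplus>\<^bsub>C\<^esub> d) m = \<beta> c m \<oplus>\<^bsub>G\<^esub> \<beta> d m) \<and>
    (\<forall>c\<in>carrier C. \<forall>m\<in>carrier M. \<forall>n\<in>carrier M. \<beta> c (m \<oplus>\<^bsub>M\<^esub> n) = \<beta> c m \<oplus>\<^bsub>G\<^esub> \<beta> c n) \<and>
    (\<forall>c\<in>carrier C. \<forall>a\<in>carrier A. \<forall>m\<in>carrier M. \<beta> (c \<odot>\<^sub>r\<^bsub>C\<^esub> a) m = \<beta> c (a \<odot>\<^bsub>M\<^esub> m))"

lemma balancedI:
  assumes "\<And>c m. \<lbrakk>c \<in> carrier C; m \<in> carrier M\<rbrakk> \<Longrightarrow> \<beta> c m \<in> carrier G"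
    and "\<And>c d m. \<lbrakk>c \<in> carrier C; d \<in> carrier C; m \<in> carrier M\<rbrakk> \<Longrightarrow> \<beta> (c \<oplus>\<^bsub>C\<^esub> d) m = \<beta> c m \<oplus>\<^bsub>G\<^esub> \<beta> d m"
    and "\<And>c m n. \<lbrakk>c \<in> carrier C; m \<in> carrier M; n \<in> carrier M\<rbrakk> \<Longrightarrow> \<beta> c (m \<oplus>\<^bsub>M\<^esub> n) = \<beta> c m \<oplus>\<^bsub>G\<^esub> \<beta> c n"
    and "\<And>c a m. \<lbrakk>c \<in> carrier C; a \<in> carrier A; m \<in> carrier M\<rbrakk> \<Longrightarrow> \<beta> (c \<odot>\<^sub>r\<^bsub>C\<^esub> a) m = \<beta> c (a \<odot>\<^bsub>M\<^esub> m)"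
  shows "balanced A C M G \<beta>"
  using assms by (simp add: balanced_def)

lemma balancedD:
  assumes "balanced A C M G \<beta>"
  shows "\<lbrakk>c \<in> carrier C; m \<in> carrier M\<rbrakk> \<Longrightarrow> \<beta> c m \<in> carrier G"
    and "\<lbrakk>c \<in> carrier C; d \<in> carrier C; m \<in> carrier M\<rbrakk> \<Longrightarrow> \<beta> (c \<oplus>\<^bsub>C\<^esub> d) m = \<beta> c m \<oplus>\<^bsub>G\<^esub> \<beta> d m"
    and "\<lbrakk>c \<in> carrier C; m \<in> carrier M; n \<in> carrier M\<rbrakk> \<Longrightarrow> \<beta> c (m \<oplus>\<^bsub>M\<^esub> n) = \<beta> c m \<oplus>\<^bsub>G\<^esub> \<beta> c n"
    and "\<lbrakk>c \<in> carrier C; a \<in> carrier A; m \<in> carrier M\<rbrakk> \<Longrightarrow> \<beta> (c \<odot>\<^sub>r\<^bsub>C\<^esub> a) m = \<beta> c (a \<odot>\<^bsub>M\<^esub> m)"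
  using assms by (simp_all add: balanced_def)

lemma tensor_module_simps [simp]:
  "carrier (tensor_module A C M) = carrier (tensor_group A C M)"
  "add (tensor_module A C M) = add (tensor_group A C M)"
  "zero (tensor_module A C M) = zero (tensor_group A C M)"
  "smult (tensor_module A C M) = (\<lambda>a. tensor_map A C M (\<lambda>c. a \<odot>\<^bsub>C\<^esub> c) id)"
  by (simp_all add: tensor_module_def ring.defs module.defs)

lemma tensor_bimodule_simps [simp]:
  "carrier (tensor_bimodule A C D) = carrier (tensor_group A C D)"
  "add (tensor_bimodule A C D) = add (tensor_group A C D)"
  "zero (tensor_bimodule A C D) = zero (tensor_group A C D)"
  "smult (tensor_bimodule A C D) = (\<lambda>a. tensor_map A C D (\<lambda>c. a \<odot>\<^bsub>C\<^esub> c) id)"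
  "rsmult (tensor_bimodule A C D) = (\<lambda>t a. tensor_map A C D id (\<lambda>d. d \<odot>\<^sub>r\<^bsub>D\<^esub> a) t)"
  by (simp_all add: tensor_bimodule_def tensor_module_def ring.defs module.defs bimodule.defs)

lemma abelian_group_cong:
  assumes "abelian_group G" "carrier H = carrier G" "add H = add G" "zero H = zero G"
  shows "abelian_group H"
proof -
  interpret G: abelian_group G by fact
  show ?thesis
    by (rule abelian_groupI) (use assms(2-4) G.l_neg in \<open>auto simp: G.a_ac\<close>)
qed

lemma left_module_cong:
  fixes M :: "('a, 'm, 'y) module_scheme" and N :: "('a, 'm, 'z) module_scheme"
  assumes "left_module A M" "carrier N = carrier M" "add N = add M" "zero N = zero M" "smult N = smult M"
  shows "left_module A N"
proof -
  interpret left_module A M by fact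
  have "abelian_group N"
    by (rule abelian_group_cong[OF M.abelian_group_axioms]) (use assms in auto)
  thus ?thesis unfolding left_module_def left_module_axioms_def
    using R.ring_axioms assms
    by (simp add: smult_closed smult_l_distr smult_r_distr smult_assoc smult_one)
qed

lemma add_hom_comp: "\<lbrakk>f \<in> add_hom G H; g \<in> add_hom H K\<rbrakk> \<Longrightarrow> (\<lambda>x. g (f x)) \<in> add_hom G K"
  by (auto simp: add_hom_def Pi_iff)

lemma add_hom_add:
  assumes "abelian_group H" "f \<in> add_hom G H" "g \<in> add_hom G H"
  shows "(\<lambda>x. f x \<oplus>\<^bsub>H\<^esub> g x) \<in> add_hom G H"
proof -
  interpret H: abelian_group H by fact
  show ?thesis
    by (rule add_homI) (simp_all add: add_homD[OF assms(2)] add_homD[OF assms(3)] H.a_ac)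
qed

section \<open>The tensor product of a bimodule with a left module\<close>

locale tensor_pair = C: bimodule A C + M: left_module A M
  for A :: "('a, 'r) ring_scheme"
    and C :: "('a, 'c, 'x) bimodule_scheme"
    and M :: "('a, 'm, 'y) module_scheme"
begin

abbreviation "gens \<equiv> carrier C \<times> carrier M"
abbreviation "rels \<equiv> tensor_relations A C M"

lemma rels_gens_sub:
  "{frag_of (c \<oplus>\<^bsub>C\<^esub> d, m) - frag_of (c, m) - frag_of (d, m) | c d m.
        c \<in> carrier C \<and> d \<in> carrier C \<and> m \<in> carrier M} \<union>
     {frag_of (c, m \<oplus>\<^bsub>M\<^esub> n) - frag_of (c, m) - frag_of (c, n) | c m n.
        c \<in> carrier C \<and> m \<in> carrier M \<and> n \<in> carrier M} \<union>
     {frag_of (c \<odot>\<^sub>r\<^bsub>C\<^esub> a, m) - frag_of (c, a \<odot>\<^bsub>M\<^esub> m) | c a m.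
        c \<in> carrier C \<and> a \<in> carrier A \<and> m \<in> carrier M} \<subseteq> carrier (free_Abelian_group gens)"
  (is "?G1 \<union> ?G2 \<union> ?G3 \<subseteq> _")
proof -
  have d: "Poly_Mapping.keys (x - y) \<subseteq> gens" if "Poly_Mapping.keys x \<subseteq> gens" "Poly_Mapping.keys y \<subseteq> gens"
    for x y :: "'c \<times> 'm \<Rightarrow>\<^sub>0 int"
    using keys_diff[of x y] that by blast
  have d2: "Poly_Mapping.keys (frag_of x - frag_of y) \<subseteq> gens" if "x \<in> gens" "y \<in> gens" for x y
    by (rule d) (use that in auto)
  have d3: "Poly_Mapping.keys (frag_of x - frag_of y - frag_of z) \<subseteq> gens"
    if "x \<in> gens" "y \<in> gens" "z \<in> gens" for x y z
    by (rule d[OF d2]) (use that in auto)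
  show ?thesis
    by (intro Un_least; clarify; unfold carrier_free_Abelian_group_iff; (rule d3 | rule d2))
      (simp_all add: C.rsmult_closed M.smult_closed)
qed

lemma rels_subgroup: "subgroup rels (free_Abelian_group gens)"
  unfolding tensor_relations_def
  by (rule group.generate_is_subgroup[OF group_free_Abelian_group rels_gens_sub])

lemma rels_keys: "t \<in> rels \<Longrightarrow> Poly_Mapping.keys t \<subseteq> gens"
  using subgroup.mem_carrier[OF rels_subgroup] by simp

lemma rels_zero: "0 \<in> rels"
  using subgroup.one_closed[OF rels_subgroup] by simp

lemma rels_add: "\<lbrakk>s \<in> rels; t \<in> rels\<rbrakk> \<Longrightarrow> s + t \<in> rels"
  using subgroup.m_closed[OF rels_subgroup] by simp

lemma rels_minus: "t \<in> rels \<Longrightarrow> - t \<in> rels"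
  using subgroup.m_inv_closed[OF rels_subgroup] rels_keys by force

lemma rels_diff: "\<lbrakk>s \<in> rels; t \<in> rels\<rbrakk> \<Longrightarrow> s - t \<in> rels"
  using rels_add[OF _ rels_minus, of s t] by simp

lemma rels_gen:
  "\<lbrakk>c \<in> carrier C; d \<in> carrier C; m \<in> carrier M\<rbrakk> \<Longrightarrow>
    frag_of (c \<oplus>\<^bsub>C\<^esub> d, m) - frag_of (c, m) - frag_of (d, m) \<in> rels"
  "\<lbrakk>c \<in> carrier C; m \<in> carrier M; n \<in> carrier M\<rbrakk> \<Longrightarrow>
    frag_of (c, m \<oplus>\<^bsub>M\<^esub> n) - frag_of (c, m) - frag_of (c, n) \<in> rels"
  "\<lbrakk>c \<in> carrier C; a \<in> carrier A; m \<in> carrier M\<rbrakk> \<Longrightarrow>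
    frag_of (c \<odot>\<^sub>r\<^bsub>C\<^esub> a, m) - frag_of (c, a \<odot>\<^bsub>M\<^esub> m) \<in> rels"
  unfolding tensor_relations_def by (rule generate.incl, blast)+

text \<open>Induction over a generated subgroup in additive notation, with one case for each of the
  three kinds of defining relations.\<close>

lemma rels_induct [consumes 1, case_names zero minus add add_left add_right balanced]:
  assumes "t \<in> rels" "P 0"
    "\<And>t. \<lbrakk>t \<in> rels; P t\<rbrakk> \<Longrightarrow> P (- t)" "\<And>s t. \<lbrakk>s \<in> rels; t \<in> rels; P s; P t\<rbrakk> \<Longrightarrow> P (s + t)"
    "\<And>c d m. \<lbrakk>c \<in> carrier C; d \<in> carrier C; m \<in> carrier M\<rbrakk> \<Longrightarrow>
      P (frag_of (c \<oplus>\<^bsub>C\<^esub> d, m) - frag_of (c, m) - frag_of (d, m))"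
    "\<And>c m n. \<lbrakk>c \<in> carrier C; m \<in> carrier M; n \<in> carrier M\<rbrakk> \<Longrightarrow>
      P (frag_of (c, m \<oplus>\<^bsub>M\<^esub> n) - frag_of (c, m) - frag_of (c, n))"
    "\<And>c a m. \<lbrakk>c \<in> carrier C; a \<in> carrier A; m \<in> carrier M\<rbrakk> \<Longrightarrow>
      P (frag_of (c \<odot>\<^sub>r\<^bsub>C\<^esub> a, m) - frag_of (c, a \<odot>\<^bsub>M\<^esub> m))"
  shows "P t"
proof -
  have gen: "P h" "h \<in> rels" if "h \<in>
    {frag_of (c \<oplus>\<^bsub>C\<^esub> d, m) - frag_of (c, m) - frag_of (d, m) | c d m.
        c \<in> carrier C \<and> d \<in> carrier C \<and> m \<in> carrier M} \<union>
     {frag_of (c, m \<oplus>\<^bsub>M\<^esub> n) - frag_of (c, m) - frag_of (c, n) | c m n.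
        c \<in> carrier C \<and> m \<in> carrier M \<and> n \<in> carrier M} \<union>
     {frag_of (c \<odot>\<^sub>r\<^bsub>C\<^esub> a, m) - frag_of (c, a \<odot>\<^bsub>M\<^esub> m) | c a m.
        c \<in> carrier C \<and> a \<in> carrier A \<and> m \<in> carrier M}" (is "_ \<in> ?G") for h
    using that assms(5-7) rels_gen by auto
  show ?thesis using assms(1) unfolding tensor_relations_def
  proof (induction rule: generate.induct)
    case one
    then show ?case using assms(2) by simp
  next
    case (incl h)
    then show ?case by (rule gen(1))
  next
    case (inv h)
    then show ?case using gen[OF inv] assms(3) rels_keys by simp
  next
    case (eng h1 h2)
    then show ?case using assms(4) by (simp add: tensor_relations_def)
  qed
qed

lemma tcoset_eq: "tcoset A C M t = (\<lambda>h. h + t) ` rels"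
  by (auto simp: tcoset_def r_coset_def)

lemma tcoset_cong: "tcoset A C M s = tcoset A C M t \<longleftrightarrow> s - t \<in> rels"
proof
  assume a: "tcoset A C M s = tcoset A C M t"
  have "s \<in> tcoset A C M s" unfolding tcoset_eq using rels_zero by force
  then obtain h where "h \<in> rels" "s = h + t" unfolding a unfolding tcoset_eq by blast
  thus "s - t \<in> rels" by simp
next
  assume a: "s - t \<in> rels"
  show "tcoset A C M s = tcoset A C M t"
  proof (intro equalityI subsetI)
    fix x assume "x \<in> tcoset A C M s"
    then obtain h where "h \<in> rels" "x = h + s" unfolding tcoset_eq by blast
    hence "h + (s - t) \<in> rels" "x = (h + (s - t)) + t" using rels_add a by auto
    thus "x \<in> tcoset A C M t" unfolding tcoset_eq by blast
  next
    fix x assume "x \<in> tcoset A C M t"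
    then obtain h where "h \<in> rels" "x = h + t" unfolding tcoset_eq by blast
    hence "h - (s - t) \<in> rels" "x = (h - (s - t)) + s" using rels_diff a by auto
    thus "x \<in> tcoset A C M s" unfolding tcoset_eq by blast
  qed
qed

lemma tensor_carrier: "carrier (tensor_group A C M) = tcoset A C M ` {t. Poly_Mapping.keys t \<subseteq> gens}"
  by (auto simp: tensor_group_def FactGroup_def RCOSETS_def tcoset_def)

lemma tcoset_zero: "\<zero>\<^bsub>tensor_group A C M\<^esub> = tcoset A C M 0"
  by (simp add: tensor_group_def FactGroup_def tcoset_eq)

lemma tcoset_add: "tcoset A C M s \<oplus>\<^bsub>tensor_group A C M\<^esub> tcoset A C M t = tcoset A C M (s + t)"
proof -
  have "(\<Union>h\<in>rels. \<Union>k\<in>rels. {h + s + (k + t)}) = (\<lambda>h. h + (s + t)) ` rels"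
  proof (intro equalityI subsetI)
    fix x assume "x \<in> (\<Union>h\<in>rels. \<Union>k\<in>rels. {h + s + (k + t)})"
    then obtain h k where "h \<in> rels" "k \<in> rels" "x = h + s + (k + t)" by blast
    hence "h + k \<in> rels" "x = (h + k) + (s + t)" using rels_add by (auto simp: algebra_simps)
    thus "x \<in> (\<lambda>h. h + (s + t)) ` rels" by blast
  next
    fix x assume "x \<in> (\<lambda>h. h + (s + t)) ` rels"
    then obtain h where "h \<in> rels" "x = h + s + (0 + t)" by (auto simp: algebra_simps)
    thus "x \<in> (\<Union>h\<in>rels. \<Union>k\<in>rels. {h + s + (k + t)})" using rels_zero by blast
  qed
  thus ?thesis by (simp add: tensor_group_def FactGroup_def set_mult_def tcoset_eq)
qed

lemma tcoset_closed: "Poly_Mapping.keys t \<subseteq> gens \<Longrightarrow> tcoset A C M t \<in> carrier (tensor_group A C M)"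
  by (auto simp: tensor_carrier)

lemma tensorE:
  assumes "x \<in> carrier (tensor_group A C M)"
  obtains t where "Poly_Mapping.keys t \<subseteq> gens" "x = tcoset A C M t"
  using assms unfolding tensor_carrier by auto

lemma tensor_abelian_group: "abelian_group (tensor_group A C M)" (is "abelian_group ?T")
proof (rule abelian_groupI)
  fix x y assume "x \<in> carrier ?T" "y \<in> carrier ?T"
  then obtain s t where *: "Poly_Mapping.keys s \<subseteq> gens" "x = tcoset A C M s"
    "Poly_Mapping.keys t \<subseteq> gens" "y = tcoset A C M t" by (metis tensorE)
  have "Poly_Mapping.keys (s + t) \<subseteq> gens" using * keys_add[of s t] by blast
  thus "x \<oplus>\<^bsub>?T\<^esub> y \<in> carrier ?T" using * by (simp add: tcoset_add tcoset_closed)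
  show "x \<oplus>\<^bsub>?T\<^esub> y = y \<oplus>\<^bsub>?T\<^esub> x" using * by (simp add: tcoset_add add.commute)
next
  show "\<zero>\<^bsub>?T\<^esub> \<in> carrier ?T" by (simp add: tcoset_zero tcoset_closed)
next
  fix x y z assume "x \<in> carrier ?T" "y \<in> carrier ?T" "z \<in> carrier ?T"
  then obtain s t u where "x = tcoset A C M s" "y = tcoset A C M t" "z = tcoset A C M u"
    by (metis tensorE)
  thus "x \<oplus>\<^bsub>?T\<^esub> y \<oplus>\<^bsub>?T\<^esub> z = x \<oplus>\<^bsub>?T\<^esub> (y \<oplus>\<^bsub>?T\<^esub> z)" by (simp add: tcoset_add add.assoc)
next
  fix x assume "x \<in> carrier ?T"
  then obtain s where *: "Poly_Mapping.keys s \<subseteq> gens" "x = tcoset A C M s" by (metis tensorE)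
  thus "\<zero>\<^bsub>?T\<^esub> \<oplus>\<^bsub>?T\<^esub> x = x" by (simp add: tcoset_add tcoset_zero)
  have "tcoset A C M (- s) \<in> carrier ?T" using * by (intro tcoset_closed) simp
  moreover have "tcoset A C M (- s) \<oplus>\<^bsub>?T\<^esub> x = \<zero>\<^bsub>?T\<^esub>" using * by (simp add: tcoset_add tcoset_zero)
  ultimately show "\<exists>y\<in>carrier ?T. y \<oplus>\<^bsub>?T\<^esub> x = \<zero>\<^bsub>?T\<^esub>" by blast
qed

sublocale T: abelian_group "tensor_group A C M"
  by (rule tensor_abelian_group)

lemma tcoset_minus:
  assumes "Poly_Mapping.keys s \<subseteq> gens"
  shows "\<ominus>\<^bsub>tensor_group A C M\<^esub> tcoset A C M s = tcoset A C M (- s)"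
  by (rule T.minus_equality) (use assms in \<open>auto simp: tcoset_add tcoset_zero intro!: tcoset_closed\<close>)

lemma tcoset_diff:
  assumes "Poly_Mapping.keys t \<subseteq> gens"
  shows "tcoset A C M s \<ominus>\<^bsub>tensor_group A C M\<^esub> tcoset A C M t = tcoset A C M (s - t)"
  using assms by (simp add: a_minus_def tcoset_minus tcoset_add)

lemma pure_tcoset: "pure_tensor A C M c m = tcoset A C M (frag_of (c, m))"
  by (simp add: pure_tensor_def tcoset_def)

lemma pure_closed [simp]:
  "\<lbrakk>c \<in> carrier C; m \<in> carrier M\<rbrakk> \<Longrightarrow> pure_tensor A C M c m \<in> carrier (tensor_group A C M)"
  by (simp add: pure_tcoset tcoset_closed)

lemma balanced_pure: "balanced A C M (tensor_group A C M) (pure_tensor A C M)"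
  by (rule balancedI)
    (use rels_gen in \<open>auto simp: pure_tcoset tcoset_add tcoset_cong tcoset_closed algebra_simps\<close>)

lemmas pure_add_left = balancedD(2)[OF balanced_pure]
  and pure_add_right = balancedD(3)[OF balanced_pure]
  and pure_balanced = balancedD(4)[OF balanced_pure]

text \<open>Formal sums are generated from single pairs by differences alone, so one closure case
  covers sums and negatives.\<close>

lemma tensor_induct [consumes 1, case_names zero pure diff]:
  assumes "x \<in> carrier (tensor_group A C M)" "P \<zero>\<^bsub>tensor_group A C M\<^esub>"
    "\<And>c m. \<lbrakk>c \<in> carrier C; m \<in> carrier M\<rbrakk> \<Longrightarrow> P (pure_tensor A C M c m)"
    "\<And>x y. \<lbrakk>x \<in> carrier (tensor_group A C M); y \<in> carrier (tensor_group A C M); P x; P y\<rbrakk>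
      \<Longrightarrow> P (x \<ominus>\<^bsub>tensor_group A C M\<^esub> y)"
  shows "P x"
proof -
  obtain t where t: "Poly_Mapping.keys t \<subseteq> gens" "x = tcoset A C M t" by (rule tensorE[OF assms(1)])
  have "P (tcoset A C M t)"
  proof (rule free_Abelian_group_induct[OF t(1)])
    show "P (tcoset A C M 0)" using assms(2) by (simp add: tcoset_zero)
    show "P (tcoset A C M (x - y))"
      if "Poly_Mapping.keys x \<subseteq> gens" "Poly_Mapping.keys y \<subseteq> gens" "P (tcoset A C M x)" "P (tcoset A C M y)" for x y
      using that assms(4)[of "tcoset A C M x" "tcoset A C M y"] by (simp add: tcoset_diff tcoset_closed)
    show "P (tcoset A C M (frag_of a))" if "a \<in> gens" for a
      using that assms(3)[of "fst a" "snd a"] by (auto simp: pure_tcoset)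
  qed
  thus ?thesis using t by simp
qed

text \<open>Pure tensors generate the tensor product as a group. Nearly every identity between maps
  of tensor products below is proved by checking that both sides are additive and then comparing
  them on pure tensors.\<close>

lemma tensor_hom_ext:
  assumes "abelian_group G" "f \<in> add_hom (tensor_group A C M) G" "g \<in> add_hom (tensor_group A C M) G"
    and "\<And>c m. \<lbrakk>c \<in> carrier C; m \<in> carrier M\<rbrakk> \<Longrightarrow> f (pure_tensor A C M c m) = g (pure_tensor A C M c m)"
    and "x \<in> carrier (tensor_group A C M)"
  shows "f x = g x"
  using assms(5)
proof (induction rule: tensor_induct)
  case zero
  then show ?case
    using add_hom_zero[OF T.abelian_group_axioms assms(1,2)] add_hom_zero[OF T.abelian_group_axioms assms(1,3)]
    by simp
next
  case (diff x y)
  then show ?case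
    using add_hom_diff[OF T.abelian_group_axioms assms(1,2)] add_hom_diff[OF T.abelian_group_axioms assms(1,3)]
    by simp
qed (rule assms(4))

text \<open>The evaluation that \<open>tensor_lift\<close> applies to the members of a coset, named
  separately so that its independence of the representative can be stated.\<close>

definition frag_eval :: "('g, 'w) ring_scheme \<Rightarrow> ('c \<Rightarrow> 'm \<Rightarrow> 'g) \<Rightarrow> ('c \<times> 'm \<Rightarrow>\<^sub>0 int) \<Rightarrow> 'g" where
  "frag_eval G \<beta> t = (\<Oplus>\<^bsub>G\<^esub>k\<in>Poly_Mapping.keys t. [Poly_Mapping.lookup t k] \<cdot>\<^bsub>G\<^esub> \<beta> (fst k) (snd k))"

lemma frag_eval_superset:
  assumes "abelian_group G" "\<And>c m. \<lbrakk>c \<in> carrier C; m \<in> carrier M\<rbrakk> \<Longrightarrow> \<beta> c m \<in> carrier G"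
    and "finite S" "Poly_Mapping.keys t \<subseteq> S" "S \<subseteq> gens"
  shows "frag_eval G \<beta> t = (\<Oplus>\<^bsub>G\<^esub>k\<in>S. [Poly_Mapping.lookup t k] \<cdot>\<^bsub>G\<^esub> \<beta> (fst k) (snd k))"
proof -
  interpret G: abelian_group G by fact
  show ?thesis unfolding frag_eval_def
    by (rule G.add.finprod_mono_neutral_cong_left)
      (use assms in \<open>auto simp: in_keys_iff Pi_iff subset_iff add_pow_def intro!: G.add.int_pow_closed[unfolded add_pow_def]\<close>)
qed

lemma frag_eval_add:
  assumes "abelian_group G" "\<And>c m. \<lbrakk>c \<in> carrier C; m \<in> carrier M\<rbrakk> \<Longrightarrow> \<beta> c m \<in> carrier G"
    and "Poly_Mapping.keys s \<subseteq> gens" "Poly_Mapping.keys t \<subseteq> gens"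
  shows "frag_eval G \<beta> (s + t) = frag_eval G \<beta> s \<oplus>\<^bsub>G\<^esub> frag_eval G \<beta> t"
proof -
  interpret G: abelian_group G by fact
  let ?S = "Poly_Mapping.keys s \<union> Poly_Mapping.keys t"
  have S: "finite ?S" "?S \<subseteq> gens" using assms by auto
  have b: "\<beta> (fst k) (snd k) \<in> carrier G" if "k \<in> ?S" for k using assms(2) S that by auto
  have "frag_eval G \<beta> (s + t) = (\<Oplus>\<^bsub>G\<^esub>k\<in>?S. [Poly_Mapping.lookup (s + t) k] \<cdot>\<^bsub>G\<^esub> \<beta> (fst k) (snd k))"
    by (rule frag_eval_superset[OF assms(1,2) S(1) _ S(2)]) (use keys_add[of s t] in auto)
  also have "\<dots> = (\<Oplus>\<^bsub>G\<^esub>k\<in>?S. [Poly_Mapping.lookup s k] \<cdot>\<^bsub>G\<^esub> \<beta> (fst k) (snd k) \<oplus>\<^bsub>G\<^esub>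
      [Poly_Mapping.lookup t k] \<cdot>\<^bsub>G\<^esub> \<beta> (fst k) (snd k))"
    using b by (intro G.finsum_cong') (auto simp: lookup_add G.add.int_pow_mult)
  also have "\<dots> = (\<Oplus>\<^bsub>G\<^esub>k\<in>?S. [Poly_Mapping.lookup s k] \<cdot>\<^bsub>G\<^esub> \<beta> (fst k) (snd k)) \<oplus>\<^bsub>G\<^esub>
      (\<Oplus>\<^bsub>G\<^esub>k\<in>?S. [Poly_Mapping.lookup t k] \<cdot>\<^bsub>G\<^esub> \<beta> (fst k) (snd k))"
    using b by (intro G.finsum_addf) auto
  also have "(\<Oplus>\<^bsub>G\<^esub>k\<in>?S. [Poly_Mapping.lookup s k] \<cdot>\<^bsub>G\<^esub> \<beta> (fst k) (snd k)) = frag_eval G \<beta> s"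
    by (rule frag_eval_superset[OF assms(1,2) S(1) _ S(2), symmetric]) auto
  also have "(\<Oplus>\<^bsub>G\<^esub>k\<in>?S. [Poly_Mapping.lookup t k] \<cdot>\<^bsub>G\<^esub> \<beta> (fst k) (snd k)) = frag_eval G \<beta> t"
    by (rule frag_eval_superset[OF assms(1,2) S(1) _ S(2), symmetric]) auto
  finally show ?thesis .
qed

lemma frag_eval_closed:
  assumes "abelian_group G" "\<And>c m. \<lbrakk>c \<in> carrier C; m \<in> carrier M\<rbrakk> \<Longrightarrow> \<beta> c m \<in> carrier G"
    and "Poly_Mapping.keys s \<subseteq> gens"
  shows "frag_eval G \<beta> s \<in> carrier G"
proof -
  interpret G: abelian_group G by fact
  show ?thesis unfolding frag_eval_def using assms(2,3)
    by (intro G.finsum_closed) (auto simp: Pi_iff subset_iff intro!: G.add.int_pow_closed)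
qed

lemma frag_eval_zero: "abelian_group G \<Longrightarrow> frag_eval G \<beta> 0 = \<zero>\<^bsub>G\<^esub>"
  by (simp add: frag_eval_def abelian_monoid.finsum_empty abelian_group.axioms(1))

lemma frag_eval_minus:
  assumes "abelian_group G" "\<And>c m. \<lbrakk>c \<in> carrier C; m \<in> carrier M\<rbrakk> \<Longrightarrow> \<beta> c m \<in> carrier G"
    and "Poly_Mapping.keys s \<subseteq> gens"
  shows "frag_eval G \<beta> (- s) = \<ominus>\<^bsub>G\<^esub> frag_eval G \<beta> s"
proof -
  interpret G: abelian_group G by fact
  have "frag_eval G \<beta> (- s) \<oplus>\<^bsub>G\<^esub> frag_eval G \<beta> s = \<zero>\<^bsub>G\<^esub>"
    using frag_eval_add[OF assms(1,2), where s = "- s" and t = s] frag_eval_zero[OF assms(1)] assms(3) by simp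
  thus ?thesis using G.minus_equality frag_eval_closed[OF assms(1,2)] assms(3) by simp
qed

lemma frag_eval_diff:
  assumes "abelian_group G" "\<And>c m. \<lbrakk>c \<in> carrier C; m \<in> carrier M\<rbrakk> \<Longrightarrow> \<beta> c m \<in> carrier G"
    and "Poly_Mapping.keys s \<subseteq> gens" "Poly_Mapping.keys t \<subseteq> gens"
  shows "frag_eval G \<beta> (s - t) = frag_eval G \<beta> s \<ominus>\<^bsub>G\<^esub> frag_eval G \<beta> t"
  using frag_eval_add[OF assms(1,2,3), where t = "- t"] frag_eval_minus[OF assms(1,2,4)] assms(4) by (simp add: a_minus_def)

lemma frag_eval_of:
  assumes "abelian_group G" "\<And>c m. \<lbrakk>c \<in> carrier C; m \<in> carrier M\<rbrakk> \<Longrightarrow> \<beta> c m \<in> carrier G"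
    and "c \<in> carrier C" "m \<in> carrier M"
  shows "frag_eval G \<beta> (frag_of (c, m)) = \<beta> c m"
proof -
  interpret G: abelian_group G by fact
  have "frag_eval G \<beta> (frag_of (c, m)) = (\<Oplus>\<^bsub>G\<^esub>k\<in>{(c, m)}. [Poly_Mapping.lookup (frag_of (c, m)) k] \<cdot>\<^bsub>G\<^esub> \<beta> (fst k) (snd k))"
    by (rule frag_eval_superset[OF assms(1,2)]) (use assms(3,4) in auto)
  thus ?thesis using assms by (simp add: G.add.int_pow_1)
qed

text \<open>Each kind of defining relation evaluates to one of the equations that make up
  \<open>balanced\<close>, brought to one side.\<close>

lemma frag_eval_rels:
  assumes "abelian_group G" "balanced A C M G \<beta>" "t \<in> rels"
  shows "frag_eval G \<beta> t = \<zero>\<^bsub>G\<^esub>"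
proof -
  interpret G: abelian_group G by fact
  note b = balancedD[OF assms(2)]
  have e2: "frag_eval G \<beta> (frag_of x - frag_of y) = \<beta> (fst x) (snd x) \<ominus>\<^bsub>G\<^esub> \<beta> (fst y) (snd y)"
    if "x \<in> gens" "y \<in> gens" for x y
    using that by (subst frag_eval_diff[OF assms(1) b(1)]) (auto simp: frag_eval_of[OF assms(1) b(1)])
  have e3: "frag_eval G \<beta> (frag_of x - frag_of y - frag_of z) =
      \<beta> (fst x) (snd x) \<ominus>\<^bsub>G\<^esub> \<beta> (fst y) (snd y) \<ominus>\<^bsub>G\<^esub> \<beta> (fst z) (snd z)"
    if "x \<in> gens" "y \<in> gens" "z \<in> gens" for x y z
  proof -
    have "Poly_Mapping.keys (frag_of x - frag_of y) \<subseteq> gens"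
      using keys_diff[of "frag_of x" "frag_of y"] that by auto
    thus ?thesis using that
      by (subst frag_eval_diff[OF assms(1) b(1)]) (auto simp: e2 frag_eval_of[OF assms(1) b(1)])
  qed
  have can: "x \<oplus>\<^bsub>G\<^esub> y \<ominus>\<^bsub>G\<^esub> x \<ominus>\<^bsub>G\<^esub> y = \<zero>\<^bsub>G\<^esub>" if "x \<in> carrier G" "y \<in> carrier G" for x y
  proof -
    have "x \<oplus>\<^bsub>G\<^esub> y \<oplus>\<^bsub>G\<^esub> \<ominus>\<^bsub>G\<^esub> x = y \<oplus>\<^bsub>G\<^esub> (x \<oplus>\<^bsub>G\<^esub> \<ominus>\<^bsub>G\<^esub> x)"
      using that by (simp add: G.a_comm[of x y] G.a_assoc)
    hence "x \<oplus>\<^bsub>G\<^esub> y \<oplus>\<^bsub>G\<^esub> \<ominus>\<^bsub>G\<^esub> x = y" using that by (simp add: G.r_neg)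
    thus ?thesis using that by (simp add: a_minus_def G.r_neg)
  qed
  from assms(3) show ?thesis
  proof (induction rule: rels_induct)
    case zero
    then show ?case using frag_eval_zero[OF assms(1)] .
  next
    case (minus t)
    then show ?case using frag_eval_minus[OF assms(1) b(1)] rels_keys G.minus_equality[of "\<zero>\<^bsub>G\<^esub>" "\<zero>\<^bsub>G\<^esub>"] by simp
  next
    case (add s t)
    then show ?case using frag_eval_add[OF assms(1) b(1)] rels_keys by simp
  next
    case (add_left c d m)
    then show ?case by (subst e3) (simp_all add: b can)
  next
    case (add_right c m n)
    then show ?case by (subst e3) (simp_all add: b can)
  next
    case (balanced c a m)
    hence "c \<odot>\<^sub>r\<^bsub>C\<^esub> a \<in> carrier C" "a \<odot>\<^bsub>M\<^esub> m \<in> carrier M" by (simp_all add: C.rsmult_closed M.smult_closed)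
    with balanced show ?case by (subst e2) (simp_all add: b a_minus_def G.r_neg)
  qed
qed

text \<open>By \<open>frag_eval_rels\<close> the evaluation is constant on a coset, so the
  \<open>the_elem\<close> inside \<open>tensor_lift\<close> is taken of a singleton.\<close>

lemma tensor_lift_tcoset:
  assumes "abelian_group G" "balanced A C M G \<beta>" "Poly_Mapping.keys t \<subseteq> gens"
  shows "tensor_lift G \<beta> (tcoset A C M t) = frag_eval G \<beta> t"
proof -
  interpret G: abelian_group G by fact
  note b = balancedD[OF assms(2)]
  have "frag_eval G \<beta> (h + t) = frag_eval G \<beta> t" if "h \<in> rels" for h
    using frag_eval_add[OF assms(1) b(1) rels_keys[OF that] assms(3)] frag_eval_rels[OF assms(1,2) that]
      frag_eval_closed[OF assms(1) b(1) assms(3)] by simp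
  hence "frag_eval G \<beta> ` tcoset A C M t = {frag_eval G \<beta> t}" unfolding tcoset_eq using rels_zero by force
  thus ?thesis by (simp add: tensor_lift_def frag_eval_def[abs_def])
qed

lemma tensor_lift_hom:
  assumes "abelian_group G" "balanced A C M G \<beta>"
  shows "tensor_lift G \<beta> \<in> add_hom (tensor_group A C M) G"
proof (rule add_homI)
  note b = balancedD[OF assms(2)]
  fix x assume "x \<in> carrier (tensor_group A C M)"
  then obtain s where s: "Poly_Mapping.keys s \<subseteq> gens" "x = tcoset A C M s" by (rule tensorE)
  thus "tensor_lift G \<beta> x \<in> carrier G"
    by (simp add: tensor_lift_tcoset[OF assms] frag_eval_closed[OF assms(1) b(1)])
  fix y assume "y \<in> carrier (tensor_group A C M)"
  then obtain t where t: "Poly_Mapping.keys t \<subseteq> gens" "y = tcoset A C M t" by (rule tensorE)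
  have "Poly_Mapping.keys (s + t) \<subseteq> gens" using s t keys_add[of s t] by blast
  thus "tensor_lift G \<beta> (x \<oplus>\<^bsub>tensor_group A C M\<^esub> y) = tensor_lift G \<beta> x \<oplus>\<^bsub>G\<^esub> tensor_lift G \<beta> y"
    using s t by (simp add: tensor_lift_tcoset[OF assms] tcoset_add frag_eval_add[OF assms(1) b(1)])
qed

lemma tensor_lift_pure:
  assumes "abelian_group G" "balanced A C M G \<beta>" "c \<in> carrier C" "m \<in> carrier M"
  shows "tensor_lift G \<beta> (pure_tensor A C M c m) = \<beta> c m"
  using tensor_lift_tcoset[OF assms(1,2), of "frag_of (c, m)"] frag_eval_of[OF assms(1) balancedD(1)[OF assms(2)] assms(3,4)]
    assms(3,4) by (simp add: pure_tcoset)

end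

section \<open>Functoriality of the tensor product\<close>

definition right_hom ::
  "('a, 'r) ring_scheme \<Rightarrow> ('a, 'd, 'x) bimodule_scheme \<Rightarrow> ('a, 'c, 'y) bimodule_scheme \<Rightarrow> ('d \<Rightarrow> 'c) set" where
  "right_hom A D C =
    {f \<in> add_hom D C. \<forall>x\<in>carrier D. \<forall>a\<in>carrier A. f (x \<odot>\<^sub>r\<^bsub>D\<^esub> a) = f x \<odot>\<^sub>r\<^bsub>C\<^esub> a}"

lemma right_homI:
  assumes "f \<in> add_hom D C"
    and "\<And>x a. \<lbrakk>x \<in> carrier D; a \<in> carrier A\<rbrakk> \<Longrightarrow> f (x \<odot>\<^sub>r\<^bsub>D\<^esub> a) = f x \<odot>\<^sub>r\<^bsub>C\<^esub> a"
  shows "f \<in> right_hom A D C"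
  using assms by (simp add: right_hom_def)

lemma right_homD:
  assumes "f \<in> right_hom A D C"
  shows "f \<in> add_hom D C"
    and "x \<in> carrier D \<Longrightarrow> f x \<in> carrier C"
    and "\<lbrakk>x \<in> carrier D; y \<in> carrier D\<rbrakk> \<Longrightarrow> f (x \<oplus>\<^bsub>D\<^esub> y) = f x \<oplus>\<^bsub>C\<^esub> f y"
    and "\<lbrakk>x \<in> carrier D; a \<in> carrier A\<rbrakk> \<Longrightarrow> f (x \<odot>\<^sub>r\<^bsub>D\<^esub> a) = f x \<odot>\<^sub>r\<^bsub>C\<^esub> a"
  using assms by (auto simp: right_hom_def add_hom_def)

lemma right_hom_id: "id \<in> right_hom A C C"
  by (auto simp: right_hom_def add_hom_def)

lemma bimodule_homD:
  assumes "f \<in> bimodule_hom A D C"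
  shows "f \<in> left_hom A D C" "f \<in> right_hom A D C"
  using assms by (auto simp: bimodule_hom_def right_hom_def left_homD)

text \<open>A scalar crosses the tensor sign in three moves: out of \<open>f\<close> by right
  linearity, across by balancedness of pure tensors, into \<open>g\<close> by left
  linearity.\<close>

lemma tensor_map_balanced:
  assumes "tensor_pair A D N" "tensor_pair A C M" "f \<in> right_hom A D C" "g \<in> left_hom A N M"
  shows "balanced A D N (tensor_group A C M) (\<lambda>d n. pure_tensor A C M (f d) (g n))"
proof -
  interpret CM: tensor_pair A C M by fact
  note f = right_homD[OF assms(3)] and g = left_homD[OF assms(4)]
  show ?thesis
    by (rule balancedI)
      (simp_all add: f g CM.pure_add_left CM.pure_add_right CM.pure_balanced)
qed

lemma tensor_map_hom:
  assumes "tensor_pair A D N" "tensor_pair A C M" "f \<in> right_hom A D C" "g \<in> left_hom A N M"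
  shows "tensor_map A C M f g \<in> add_hom (tensor_group A D N) (tensor_group A C M)"
  unfolding tensor_map_def
  by (rule tensor_pair.tensor_lift_hom[OF assms(1) tensor_pair.tensor_abelian_group[OF assms(2)]
        tensor_map_balanced[OF assms]])

lemma tensor_map_pure:
  assumes "tensor_pair A D N" "tensor_pair A C M" "f \<in> right_hom A D C" "g \<in> left_hom A N M"
    and "d \<in> carrier D" "n \<in> carrier N"
  shows "tensor_map A C M f g (pure_tensor A D N d n) = pure_tensor A C M (f d) (g n)"
  unfolding tensor_map_def
  by (rule tensor_pair.tensor_lift_pure[OF assms(1) tensor_pair.tensor_abelian_group[OF assms(2)]
        tensor_map_balanced[OF assms(1-4)] assms(5,6)])

context tensor_pair
begin

lemma smult_right_hom: "a \<in> carrier A \<Longrightarrow> (\<lambda>c. a \<odot>\<^bsub>C\<^esub> c) \<in> right_hom A C C"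
  by (intro right_homI add_homI) (simp_all add: C.smult_closed C.smult_r_distr C.smult_rsmult)

lemma smult_hom:
  "a \<in> carrier A \<Longrightarrow>
    tensor_map A C M (\<lambda>c. a \<odot>\<^bsub>C\<^esub> c) id \<in> add_hom (tensor_group A C M) (tensor_group A C M)"
  by (rule tensor_map_hom[OF tensor_pair_axioms tensor_pair_axioms smult_right_hom left_hom_id(1)])

lemma smult_pure:
  "\<lbrakk>a \<in> carrier A; c \<in> carrier C; m \<in> carrier M\<rbrakk> \<Longrightarrow>
    tensor_map A C M (\<lambda>c. a \<odot>\<^bsub>C\<^esub> c) id (pure_tensor A C M c m) = pure_tensor A C M (a \<odot>\<^bsub>C\<^esub> c) m"
  using tensor_map_pure[OF tensor_pair_axioms tensor_pair_axioms smult_right_hom left_hom_id(1)] by simp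

text \<open>Every axiom is an equality of additive maps of the tensor variable. On pure tensors it
  reduces to the corresponding axiom for the left action on C.\<close>

lemma tensor_left_module: "left_module A (tensor_module A C M)"
proof -
  let ?T = "tensor_group A C M" let ?S = "\<lambda>a. tensor_map A C M (\<lambda>c. a \<odot>\<^bsub>C\<^esub> c) id"
  note ext = tensor_hom_ext[OF tensor_abelian_group]
  note S = add_homD[OF smult_hom]
  have 1: "?S (a \<oplus>\<^bsub>A\<^esub> b) x = ?S a x \<oplus>\<^bsub>?T\<^esub> ?S b x"
    if "a \<in> carrier A" "b \<in> carrier A" "x \<in> carrier ?T" for a b x
    using that
    by (rule_tac ext[where f = "?S (a \<oplus>\<^bsub>A\<^esub> b)" and g = "\<lambda>x. ?S a x \<oplus>\<^bsub>?T\<^esub> ?S b x",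
          OF smult_hom add_hom_add[OF tensor_abelian_group smult_hom smult_hom]])
       (simp_all add: smult_pure C.smult_l_distr pure_add_left C.smult_closed)
  have 2: "?S (a \<otimes>\<^bsub>A\<^esub> b) x = ?S a (?S b x)"
    if "a \<in> carrier A" "b \<in> carrier A" "x \<in> carrier ?T" for a b x
    using that
    by (rule_tac ext[where f = "?S (a \<otimes>\<^bsub>A\<^esub> b)" and g = "\<lambda>x. ?S a (?S b x)",
          OF smult_hom add_hom_comp[OF smult_hom smult_hom]])
       (simp_all add: smult_pure C.smult_assoc C.smult_closed)
  have idh: "(\<lambda>x. x) \<in> add_hom ?T ?T" by (rule add_homI) simp_all
  have 3: "?S \<one>\<^bsub>A\<^esub> x = x" if "x \<in> carrier ?T" for x
    using that
    by (rule_tac ext[where f = "?S \<one>\<^bsub>A\<^esub>" and g = "\<lambda>x. x", OF smult_hom idh])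
      (simp_all add: smult_pure C.smult_one)
  have "abelian_group (tensor_module A C M)"
    by (rule abelian_group_cong[OF tensor_abelian_group]) simp_all
  thus ?thesis unfolding left_module_def left_module_axioms_def
    using C.R.ring_axioms by (simp add: S 1 2 3)
qed

text \<open>For fixed \<open>a\<close> both sides of the homogeneity condition are additive in the
  tensor, so pure tensors decide it.\<close>

lemma tensor_left_homI:
  assumes "left_module A N" "f \<in> add_hom (tensor_group A C M) N"
    and "\<And>a c m. \<lbrakk>a \<in> carrier A; c \<in> carrier C; m \<in> carrier M\<rbrakk> \<Longrightarrow>
      f (pure_tensor A C M (a \<odot>\<^bsub>C\<^esub> c) m) = a \<odot>\<^bsub>N\<^esub> f (pure_tensor A C M c m)"
  shows "f \<in> left_hom A (tensor_module A C M) N"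
proof -
  interpret N: left_module A N by fact
  have sN: "(\<lambda>x. a \<odot>\<^bsub>N\<^esub> x) \<in> add_hom N N" if "a \<in> carrier A" for a
    using that by (intro add_homI) (simp_all add: N.smult_closed N.smult_r_distr)
  have "f (tensor_map A C M (\<lambda>c. a \<odot>\<^bsub>C\<^esub> c) id x) = a \<odot>\<^bsub>N\<^esub> f x"
    if "a \<in> carrier A" "x \<in> carrier (tensor_group A C M)" for a x
    using that
    by (rule_tac tensor_hom_ext[where f = "\<lambda>x. f (tensor_map A C M (\<lambda>c. a \<odot>\<^bsub>C\<^esub> c) id x)"
          and g = "\<lambda>x. a \<odot>\<^bsub>N\<^esub> f x", OF N.M.abelian_group_axioms
          add_hom_comp[OF smult_hom assms(2)] add_hom_comp[OF assms(2) sN]])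
      (simp_all add: smult_pure assms(3))
  thus ?thesis by (intro left_homI) (simp_all add: add_homD[OF assms(2)])
qed

end

lemma tensor_map_left_hom:
  assumes "tensor_pair A D N" "tensor_pair A C M" "f \<in> right_hom A D C" "f \<in> left_hom A D C"
    "g \<in> left_hom A N M"
  shows "tensor_map A C M f g \<in> left_hom A (tensor_module A D N) (tensor_module A C M)"
proof -
  interpret D: tensor_pair A D N by fact
  interpret C: tensor_pair A C M by fact
  note pure = tensor_map_pure[OF assms(1,2,3,5)]
  have "tensor_map A C M f g \<in> add_hom (tensor_group A D N) (tensor_module A C M)"
    using tensor_map_hom[OF assms(1,2,3,5)] by (simp add: add_hom_def)
  thus ?thesis
    by (rule D.tensor_left_homI[OF C.tensor_left_module])
      (simp add: pure D.C.smult_closed left_homD[OF assms(4)] left_homD[OF assms(5)] C.smult_pure)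
qed

text \<open>The right action comes from the second factor and the left action from the first; they
  commute because on pure tensors they change different entries.\<close>

lemma tensor_bimodule:
  assumes "bimodule A C" "bimodule A D"
  shows "bimodule A (tensor_bimodule A C D)"
proof -
  interpret C: bimodule A C by fact
  interpret D: bimodule A D by fact
  interpret CD: tensor_pair A C D by unfold_locales
  let ?T = "tensor_group A C D" let ?S = "\<lambda>a. tensor_map A C D (\<lambda>c. a \<odot>\<^bsub>C\<^esub> c) id"
  let ?R = "\<lambda>a. tensor_map A C D id (\<lambda>d. d \<odot>\<^sub>r\<^bsub>D\<^esub> a)"
  have rl: "(\<lambda>d. d \<odot>\<^sub>r\<^bsub>D\<^esub> a) \<in> left_hom A D D" if "a \<in> carrier A" for a
    using that by (intro left_homI) (simp_all add: D.rsmult_closed D.rsmult_l_distr D.smult_rsmult)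
  note Rh = tensor_map_hom[OF CD.tensor_pair_axioms CD.tensor_pair_axioms right_hom_id rl]
  have Rp: "?R a (pure_tensor A C D c d) = pure_tensor A C D c (d \<odot>\<^sub>r\<^bsub>D\<^esub> a)"
    if "a \<in> carrier A" "c \<in> carrier C" "d \<in> carrier D" for a c d
    using tensor_map_pure[OF CD.tensor_pair_axioms CD.tensor_pair_axioms right_hom_id rl] that by simp
  note ext = CD.tensor_hom_ext[OF CD.tensor_abelian_group]
  note R = add_homD[OF Rh]
  have 1: "?R (a \<oplus>\<^bsub>A\<^esub> b) x = ?R a x \<oplus>\<^bsub>?T\<^esub> ?R b x"
    if "a \<in> carrier A" "b \<in> carrier A" "x \<in> carrier ?T" for a b x
    using that
    by (rule_tac ext[where f = "?R (a \<oplus>\<^bsub>A\<^esub> b)" and g = "\<lambda>x. ?R a x \<oplus>\<^bsub>?T\<^esub> ?R b x",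
          OF Rh add_hom_add[OF CD.tensor_abelian_group Rh Rh]])
       (simp_all add: Rp D.rsmult_r_distr CD.pure_add_right D.rsmult_closed)
  have 2: "?R (a \<otimes>\<^bsub>A\<^esub> b) x = ?R b (?R a x)"
    if "a \<in> carrier A" "b \<in> carrier A" "x \<in> carrier ?T" for a b x
    using that
    by (rule_tac ext[where f = "?R (a \<otimes>\<^bsub>A\<^esub> b)" and g = "\<lambda>x. ?R b (?R a x)",
          OF Rh add_hom_comp[OF Rh Rh]])
       (simp_all add: Rp D.rsmult_assoc D.rsmult_closed)
  have idh: "(\<lambda>x. x) \<in> add_hom ?T ?T" by (rule add_homI) simp_all
  have 3: "?R \<one>\<^bsub>A\<^esub> x = x" if "x \<in> carrier ?T" for x
    using that
    by (rule_tac ext[where f = "?R \<one>\<^bsub>A\<^esub>" and g = "\<lambda>x. x", OF Rh idh])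
      (simp_all add: Rp D.rsmult_one)
  have 4: "?R b (?S a x) = ?S a (?R b x)"
    if "a \<in> carrier A" "b \<in> carrier A" "x \<in> carrier ?T" for a b x
    using that
    by (rule_tac ext[where f = "\<lambda>x. ?R b (?S a x)" and g = "\<lambda>x. ?S a (?R b x)",
          OF add_hom_comp[OF CD.smult_hom Rh] add_hom_comp[OF Rh CD.smult_hom]])
       (simp_all add: Rp CD.smult_pure D.rsmult_closed C.smult_closed)
  have "left_module A (tensor_bimodule A C D)"
    by (rule left_module_cong[OF CD.tensor_left_module]) simp_all
  moreover have "bimodule_axioms A (tensor_bimodule A C D)"
    by unfold_locales (simp_all add: R 1 2 3 4)
  ultimately show ?thesis by (simp add: bimodule_def)
qed

lemma regular_bimodule:
  assumes "ring A"
  shows "bimodule A (regular_bimodule A)"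
proof -
  interpret ring A by fact
  have "abelian_group (regular_bimodule A)"
    by (rule abelian_group_cong[OF is_abelian_group]) (simp_all add: regular_bimodule_def)
  thus ?thesis unfolding bimodule_def left_module_def
    by (auto simp: left_module_axioms_def bimodule_axioms_def regular_bimodule_def assms
        l_distr r_distr m_assoc)
qed

section \<open>The associativity map and the unit map\<close>

locale tensor_triple = C: bimodule A C + D: bimodule A D + M: left_module A M
  for A :: "('a, 'r) ring_scheme"
    and C :: "('a, 'c, 'x) bimodule_scheme"
    and D :: "('a, 'd, 'y) bimodule_scheme"
    and M :: "('a, 'm, 'z) module_scheme"
begin

sublocale CD: tensor_pair A C D by unfold_locales
sublocale DM: tensor_pair A D M by unfold_locales
sublocale DMm: left_module A "tensor_module A D M" by (rule DM.tensor_left_module)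
sublocale C_DM: tensor_pair A C "tensor_module A D M" by unfold_locales
sublocale CDb: bimodule A "tensor_bimodule A C D"
  by (rule tensor_bimodule[OF C.bimodule_axioms D.bimodule_axioms])
sublocale CD_M: tensor_pair A "tensor_bimodule A C D" M by unfold_locales
sublocale C_DMm: left_module A "tensor_module A C (tensor_module A D M)" by (rule C_DM.tensor_left_module)

abbreviation "TT \<equiv> tensor_module A C (tensor_module A D M)"
abbreviation "inner m \<equiv>
  tensor_lift TT (\<lambda>c d. pure_tensor A C (tensor_module A D M) c (pure_tensor A D M d m))"

text \<open>For fixed \<open>m\<close> the pair \<open>(c, d)\<close> goes to c tensor (d tensor m).
  A scalar that moves from c to d is absorbed by the left action on
  \<open>tensor_module A D M\<close>, which acts on the factor D.\<close>

lemma inner_balanced: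
  assumes "m \<in> carrier M"
  shows "balanced A C D TT (\<lambda>c d. pure_tensor A C (tensor_module A D M) c (pure_tensor A D M d m))"
proof -
  note p = C_DM.pure_add_left C_DM.pure_add_right C_DM.pure_balanced
  have "pure_tensor A C (tensor_module A D M) c (pure_tensor A D M (d \<oplus>\<^bsub>D\<^esub> e) m) =
    pure_tensor A C (tensor_module A D M) c (pure_tensor A D M d m) \<oplus>\<^bsub>tensor_group A C (tensor_module A D M)\<^esub>
    pure_tensor A C (tensor_module A D M) c (pure_tensor A D M e m)"
    if "c \<in> carrier C" "d \<in> carrier D" "e \<in> carrier D" for c d e
    using that assms p(2)[of c "pure_tensor A D M d m" "pure_tensor A D M e m"]
    by (simp add: DM.pure_add_left)
  moreover have "pure_tensor A C (tensor_module A D M) (c \<odot>\<^sub>r\<^bsub>C\<^esub> a) (pure_tensor A D M d m) =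
      pure_tensor A C (tensor_module A D M) c (pure_tensor A D M (a \<odot>\<^bsub>D\<^esub> d) m)"
    if "c \<in> carrier C" "d \<in> carrier D" "a \<in> carrier A" for c d a
    using that assms p(3)[of c a "pure_tensor A D M d m"] by (simp add: DM.smult_pure)
  ultimately show ?thesis using assms
    by (intro balancedI) (simp_all add: p(1))
qed

lemma TT_abelian: "abelian_group TT" by (rule C_DMm.M.abelian_group_axioms)

lemma inner_hom: "m \<in> carrier M \<Longrightarrow> inner m \<in> add_hom (tensor_group A C D) TT"
  by (rule CD.tensor_lift_hom[OF TT_abelian inner_balanced])

lemma inner_pure: "\<lbrakk>m \<in> carrier M; c \<in> carrier C; d \<in> carrier D\<rbrakk> \<Longrightarrow>
    inner m (pure_tensor A C D c d) = pure_tensor A C (tensor_module A D M) c (pure_tensor A D M d m)"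
  by (rule CD.tensor_lift_pure[OF TT_abelian inner_balanced])

text \<open>The scalar now acts on the right of the factor D inside \<open>t\<close> and moves to
  \<open>m\<close>. As \<open>t\<close> is an arbitrary tensor and not a pure one, the two sides are
  compared as additive functions of \<open>t\<close>.\<close>

lemma outer_balanced: "balanced A (tensor_bimodule A C D) M TT (\<lambda>t m. inner m t)"
proof (rule balancedI)
  fix t m assume "t \<in> carrier (tensor_bimodule A C D)" "m \<in> carrier M"
  thus "inner m t \<in> carrier TT" using add_homD(1)[OF inner_hom] by simp
next
  fix t u m assume "t \<in> carrier (tensor_bimodule A C D)" "u \<in> carrier (tensor_bimodule A C D)" "m \<in> carrier M"
  thus "inner m (t \<oplus>\<^bsub>tensor_bimodule A C D\<^esub> u) = inner m t \<oplus>\<^bsub>TT\<^esub> inner m u"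
    using add_homD(2)[OF inner_hom] by simp
next
  fix t m n assume *: "t \<in> carrier (tensor_bimodule A C D)" "m \<in> carrier M" "n \<in> carrier M"
  hence "inner (m \<oplus>\<^bsub>M\<^esub> n) \<in> add_hom (tensor_group A C D) TT" by (intro inner_hom) simp
  moreover have "(\<lambda>t. inner m t \<oplus>\<^bsub>TT\<^esub> inner n t) \<in> add_hom (tensor_group A C D) TT"
    using * by (intro add_hom_add[OF TT_abelian] inner_hom)
  moreover have "inner (m \<oplus>\<^bsub>M\<^esub> n) (pure_tensor A C D c d) =
    inner m (pure_tensor A C D c d) \<oplus>\<^bsub>TT\<^esub> inner n (pure_tensor A C D c d)"
    if "c \<in> carrier C" "d \<in> carrier D" for c d
    using that * C_DM.pure_add_right[of c "pure_tensor A D M d m" "pure_tensor A D M d n"]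
    by (simp add: inner_pure DM.pure_add_right)
  ultimately show "inner (m \<oplus>\<^bsub>M\<^esub> n) t = inner m t \<oplus>\<^bsub>TT\<^esub> inner n t"
    using *(1)
    by (rule_tac CD.tensor_hom_ext[OF TT_abelian, where f = "inner (m \<oplus>\<^bsub>M\<^esub> n)"
          and g = "\<lambda>t. inner m t \<oplus>\<^bsub>TT\<^esub> inner n t"]) simp_all
next
  fix t a m assume *: "t \<in> carrier (tensor_bimodule A C D)" "a \<in> carrier A" "m \<in> carrier M"
  have rl: "(\<lambda>d. d \<odot>\<^sub>r\<^bsub>D\<^esub> a) \<in> left_hom A D D"
    using * by (intro left_homI) (simp_all add: D.rsmult_closed D.rsmult_l_distr D.smult_rsmult)
  note Rh = tensor_map_hom[OF CD.tensor_pair_axioms CD.tensor_pair_axioms right_hom_id rl]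
  note Rp = tensor_map_pure[OF CD.tensor_pair_axioms CD.tensor_pair_axioms right_hom_id rl]
  have am: "a \<odot>\<^bsub>M\<^esub> m \<in> carrier M" using * by (simp add: M.smult_closed)
  have "inner m (tensor_map A C D id (\<lambda>d. d \<odot>\<^sub>r\<^bsub>D\<^esub> a) t) = inner (a \<odot>\<^bsub>M\<^esub> m) t"
    by (rule CD.tensor_hom_ext[where f = "\<lambda>t. inner m (tensor_map A C D id (\<lambda>d. d \<odot>\<^sub>r\<^bsub>D\<^esub> a) t)"
          and g = "inner (a \<odot>\<^bsub>M\<^esub> m)", OF TT_abelian add_hom_comp[OF Rh inner_hom[OF *(3)]] inner_hom[OF am]])
      (use * am in \<open>simp_all add: Rp inner_pure D.rsmult_closed DM.pure_balanced\<close>)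
  thus "inner m (t \<odot>\<^sub>r\<^bsub>tensor_bimodule A C D\<^esub> a) = inner (a \<odot>\<^bsub>M\<^esub> m) t" by simp
qed

lemma assoc_eq: "tensor_assoc A C D M = tensor_lift TT (\<lambda>t m. inner m t)"
  by (simp add: tensor_assoc_def Let_def)

lemma assoc_add_hom: "tensor_assoc A C D M \<in> add_hom (tensor_group A (tensor_bimodule A C D) M) TT"
  unfolding assoc_eq by (rule CD_M.tensor_lift_hom[OF TT_abelian outer_balanced])

lemma assoc_pure: "\<lbrakk>t \<in> carrier (tensor_group A C D); m \<in> carrier M\<rbrakk> \<Longrightarrow>
    tensor_assoc A C D M (pure_tensor A (tensor_bimodule A C D) M t m) = inner m t"
  unfolding assoc_eq using CD_M.tensor_lift_pure[OF TT_abelian outer_balanced] by simp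

lemma assoc_left_hom:
  "tensor_assoc A C D M \<in> left_hom A (tensor_module A (tensor_bimodule A C D) M) TT"
proof (rule CD_M.tensor_left_homI[OF C_DM.tensor_left_module assoc_add_hom])
  fix a t m assume *: "a \<in> carrier A" "t \<in> carrier (tensor_bimodule A C D)" "m \<in> carrier M"
  have sT: "(\<lambda>x. a \<odot>\<^bsub>TT\<^esub> x) \<in> add_hom TT TT"
    using * by (intro add_homI C_DMm.smult_closed C_DMm.smult_r_distr) simp_all
  have "inner m (tensor_map A C D (\<lambda>c. a \<odot>\<^bsub>C\<^esub> c) id t) = a \<odot>\<^bsub>TT\<^esub> inner m t"
    by (rule CD.tensor_hom_ext[where f = "\<lambda>t. inner m (tensor_map A C D (\<lambda>c. a \<odot>\<^bsub>C\<^esub> c) id t)"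
          and g = "\<lambda>t. a \<odot>\<^bsub>TT\<^esub> inner m t", OF TT_abelian add_hom_comp[OF CD.smult_hom inner_hom]
          add_hom_comp[OF inner_hom sT]])
       (use * in \<open>simp_all add: inner_pure CD.smult_pure C.smult_closed C_DM.smult_pure\<close>)
  moreover have "tensor_map A C D (\<lambda>c. a \<odot>\<^bsub>C\<^esub> c) id t \<in> carrier (tensor_group A C D)"
    using add_homD(1)[OF CD.smult_hom] * by simp
  ultimately show "tensor_assoc A C D M
        (pure_tensor A (tensor_bimodule A C D) M (a \<odot>\<^bsub>tensor_bimodule A C D\<^esub> t) m) =
       a \<odot>\<^bsub>TT\<^esub> tensor_assoc A C D M (pure_tensor A (tensor_bimodule A C D) M t m)"
    using * by (simp add: assoc_pure)
qed

end

lemma tensor_lunit_hom: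
  assumes "left_module A M"
  shows "tensor_lunit M \<in> left_hom A (tensor_module A (regular_bimodule A) M) M"
    and "\<lbrakk>a \<in> carrier A; m \<in> carrier M\<rbrakk> \<Longrightarrow>
      tensor_lunit M (pure_tensor A (regular_bimodule A) M a m) = a \<odot>\<^bsub>M\<^esub> m"
proof -
  interpret M: left_module A M by fact
  interpret R: bimodule A "regular_bimodule A" by (rule regular_bimodule[OF M.R.ring_axioms])
  interpret RM: tensor_pair A "regular_bimodule A" M by unfold_locales
  have b: "balanced A (regular_bimodule A) M M (\<lambda>a m. a \<odot>\<^bsub>M\<^esub> m)"
    by (rule balancedI)
      (simp_all add: regular_bimodule_def M.smult_closed M.smult_l_distr M.smult_r_distr M.smult_assoc)
  have pure: "tensor_lunit M (pure_tensor A (regular_bimodule A) M a m) = a \<odot>\<^bsub>M\<^esub> m"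
    if "a \<in> carrier A" "m \<in> carrier M" for a m
    unfolding tensor_lunit_def
    by (rule RM.tensor_lift_pure[OF M.M.abelian_group_axioms b])
      (use that in \<open>simp_all add: regular_bimodule_def\<close>)
  show "tensor_lunit M \<in> left_hom A (tensor_module A (regular_bimodule A) M) M"
  proof (rule RM.tensor_left_homI[OF assms])
    show "tensor_lunit M \<in> add_hom (tensor_group A (regular_bimodule A) M) M"
      unfolding tensor_lunit_def by (rule RM.tensor_lift_hom[OF M.M.abelian_group_axioms b])
  qed (use pure in \<open>simp add: regular_bimodule_def M.smult_assoc\<close>)
  show "\<lbrakk>a \<in> carrier A; m \<in> carrier M\<rbrakk> \<Longrightarrow>
      tensor_lunit M (pure_tensor A (regular_bimodule A) M a m) = a \<odot>\<^bsub>M\<^esub> m" by (rule pure)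
qed

section \<open>The comonad of a coring\<close>

text \<open>
  A comodule is a coalgebra over the functor \<open>C \<otimes>\<^sub>A -\<close> with the two natural transformations
  \<open>cmult\<close> and \<open>ccounit\<close>. Only their linearity and naturality matter in what follows.
\<close>

definition cmult ::
  "('a, 'r) ring_scheme \<Rightarrow> ('a, 'c, 'x) coring_scheme \<Rightarrow> ('a, 'm, 'y) module_scheme \<Rightarrow>
    ('c, 'm) tensor \<Rightarrow> ('c, ('c, 'm) tensor) tensor" where
  "cmult A C M t = tensor_assoc A C C M (tensor_map A (tensor_bimodule A C C) M (comult C) id t)"

definition ccounit ::
  "('a, 'r) ring_scheme \<Rightarrow> ('a, 'c, 'x) coring_scheme \<Rightarrow> ('a, 'm, 'y) module_scheme \<Rightarrow>
    ('c, 'm) tensor \<Rightarrow> 'm" where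
  "ccounit A C M t = tensor_lunit M (tensor_map A (regular_bimodule A) M (counit C) id t)"

section \<open>Tensoring with a fixed bimodule as a functor\<close>

context bimodule
begin

lemma pairI: "left_module A N \<Longrightarrow> tensor_pair A M N"
  by (simp add: tensor_pair_def bimodule_axioms)

lemma T_left_module: "left_module A N \<Longrightarrow> left_module A (tensor_module A M N)"
  by (rule tensor_pair.tensor_left_module[OF pairI])

lemma T_hom:
  assumes "left_module A N" "left_module A P" "f \<in> left_hom A N P"
  shows "tensor_map A M P id f \<in> left_hom A (tensor_module A M N) (tensor_module A M P)"
  by (rule tensor_map_left_hom[OF pairI pairI right_hom_id left_hom_id(1)]) (rule assms)+

lemma T_add_hom:
  assumes "left_module A N" "left_module A P" "f \<in> left_hom A N P"
  shows "tensor_map A M P id f \<in> add_hom (tensor_group A M N) (tensor_group A M P)"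
  by (rule tensor_map_hom[OF pairI pairI right_hom_id]) (rule assms)+

lemma T_pure:
  assumes "left_module A N" "left_module A P" "f \<in> left_hom A N P" "c \<in> carrier M" "n \<in> carrier N"
  shows "tensor_map A M P id f (pure_tensor A M N c n) = pure_tensor A M P c (f n)"
  using tensor_map_pure[OF pairI pairI right_hom_id] assms by simp

lemma T_comp:
  assumes "left_module A N" "left_module A P" "left_module A Q" "f \<in> left_hom A N P" "g \<in> left_hom A P Q"
    and "t \<in> carrier (tensor_group A M N)"
  shows "tensor_map A M Q id g (tensor_map A M P id f t) = tensor_map A M Q id (\<lambda>x. g (f x)) t"
proof -
  interpret N: tensor_pair A M N by (rule pairI[OF assms(1)])
  interpret Q: tensor_pair A M Q by (rule pairI[OF assms(3)])
  note gf = left_hom_comp[OF assms(4,5)]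
  show ?thesis
    by (rule N.tensor_hom_ext[where f = "\<lambda>t. tensor_map A M Q id g (tensor_map A M P id f t)"
          and g = "tensor_map A M Q id (\<lambda>x. g (f x))", OF Q.tensor_abelian_group
            add_hom_comp[OF T_add_hom T_add_hom] T_add_hom])
      (use assms gf in \<open>simp_all add: T_pure left_homD(1)[OF assms(4)]\<close>)
qed

text \<open>Linear maps that agree on the carrier may differ as HOL functions, so the equality of
  the maps that they induce on tensor products has to be derived from their values on pure
  tensors.\<close>

lemma T_cong:
  assumes "left_module A N" "left_module A P" "f \<in> left_hom A N P" "g \<in> left_hom A N P"
    and "\<And>x. x \<in> carrier N \<Longrightarrow> f x = g x" "t \<in> carrier (tensor_group A M N)"
  shows "tensor_map A M P id f t = tensor_map A M P id g t"
proof -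
  interpret N: tensor_pair A M N by (rule pairI[OF assms(1)])
  interpret P: tensor_pair A M P by (rule pairI[OF assms(2)])
  show ?thesis
    by (rule N.tensor_hom_ext[where f = "tensor_map A M P id f"
          and g = "tensor_map A M P id g", OF P.tensor_abelian_group T_add_hom T_add_hom])
      (use assms in \<open>simp_all add: T_pure\<close>)
qed

lemma T_id:
  assumes "left_module A N" "t \<in> carrier (tensor_group A M N)"
  shows "tensor_map A M N id (\<lambda>x. x) t = t"
proof -
  interpret N: tensor_pair A M N by (rule pairI[OF assms(1)])
  have i: "(\<lambda>x. x) \<in> add_hom (tensor_group A M N) (tensor_group A M N)" by (rule add_homI) simp_all
  show ?thesis
    by (rule N.tensor_hom_ext[where f = "tensor_map A M N id (\<lambda>x. x)"
          and g = "\<lambda>x. x", OF N.tensor_abelian_group T_add_hom i])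
      (use assms in \<open>simp_all add: T_pure left_hom_id(2)\<close>)
qed

end

section \<open>Naturality of comultiplication and counit\<close>

context coring
begin

lemma ring_A: "ring A"
  by (rule R.ring_axioms)

lemma comult_homs: "comult C \<in> left_hom A C (tensor_bimodule A C C)"
    "comult C \<in> right_hom A C (tensor_bimodule A C C)"
  using bimodule_homD[OF comult_hom] by simp_all

lemma counit_homs: "counit C \<in> left_hom A C (regular_bimodule A)"
    "counit C \<in> right_hom A C (regular_bimodule A)"
  using bimodule_homD[OF counit_hom] by simp_all

lemma comult_tensor_hom:
  assumes "left_module A M"
  shows "tensor_map A (tensor_bimodule A C C) M (comult C) id \<in>
      left_hom A (tensor_module A C M) (tensor_module A (tensor_bimodule A C C) M)"
    and "\<lbrakk>c \<in> carrier C; m \<in> carrier M\<rbrakk> \<Longrightarrow>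
      tensor_map A (tensor_bimodule A C C) M (comult C) id (pure_tensor A C M c m) =
      pure_tensor A (tensor_bimodule A C C) M (comult C c) m"
proof -
  interpret M: left_module A M by fact
  interpret t: tensor_triple A C C M by unfold_locales
  show "tensor_map A (tensor_bimodule A C C) M (comult C) id \<in>
      left_hom A (tensor_module A C M) (tensor_module A (tensor_bimodule A C C) M)"
    by (rule tensor_map_left_hom[OF pairI[OF assms]]) (rule t.CD_M.tensor_pair_axioms comult_homs left_hom_id)+
  show "\<lbrakk>c \<in> carrier C; m \<in> carrier M\<rbrakk> \<Longrightarrow>
      tensor_map A (tensor_bimodule A C C) M (comult C) id (pure_tensor A C M c m) =
      pure_tensor A (tensor_bimodule A C C) M (comult C c) m"
    using tensor_map_pure[OF pairI[OF assms] t.CD_M.tensor_pair_axioms comult_homs(2) left_hom_id(1)] by simp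
qed

lemma counit_tensor_hom:
  assumes "left_module A M"
  shows "tensor_map A (regular_bimodule A) M (counit C) id \<in>
      left_hom A (tensor_module A C M) (tensor_module A (regular_bimodule A) M)"
    and "\<lbrakk>c \<in> carrier C; m \<in> carrier M\<rbrakk> \<Longrightarrow>
      tensor_map A (regular_bimodule A) M (counit C) id (pure_tensor A C M c m) =
      pure_tensor A (regular_bimodule A) M (counit C c) m"
proof -
  interpret R: bimodule A "regular_bimodule A" by (rule regular_bimodule[OF ring_A])
  show "tensor_map A (regular_bimodule A) M (counit C) id \<in>
      left_hom A (tensor_module A C M) (tensor_module A (regular_bimodule A) M)"
    by (rule tensor_map_left_hom[OF pairI[OF assms] R.pairI[OF assms] counit_homs(2,1) left_hom_id(1)])
  show "\<lbrakk>c \<in> carrier C; m \<in> carrier M\<rbrakk> \<Longrightarrow>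
      tensor_map A (regular_bimodule A) M (counit C) id (pure_tensor A C M c m) =
      pure_tensor A (regular_bimodule A) M (counit C c) m"
    using tensor_map_pure[OF pairI[OF assms] R.pairI[OF assms] counit_homs(2) left_hom_id(1)] by simp
qed

lemma cmult_hom:
  assumes "left_module A M"
  shows "cmult A C M \<in> left_hom A (tensor_module A C M) (tensor_module A C (tensor_module A C M))"
proof -
  interpret M: left_module A M by fact
  interpret t: tensor_triple A C C M by unfold_locales
  show ?thesis unfolding cmult_def
    by (rule left_hom_comp[OF comult_tensor_hom(1)[OF assms] t.assoc_left_hom])
qed

lemma ccounit_hom:
  assumes "left_module A M"
  shows "ccounit A C M \<in> left_hom A (tensor_module A C M) M"
  unfolding ccounit_def
  by (rule left_hom_comp[OF counit_tensor_hom(1)[OF assms] tensor_lunit_hom(1)[OF assms]])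

text \<open>The reduction to pure tensors happens twice: in the argument, which becomes c tensor m,
  and then in C tensor C, because the comultiplication of c is an arbitrary tensor there. The second
  reduction is the fact \<open>inner\<close>.\<close>

lemma cmult_nat:
  assumes "left_module A M" "left_module A N" "f \<in> left_hom A M N" "t \<in> carrier (tensor_group A C M)"
  shows "cmult A C N (tensor_map A C N id f t) =
    tensor_map A C (tensor_module A C N) id (tensor_map A C N id f) (cmult A C M t)"
proof -
  interpret M: left_module A M by fact
  interpret N: left_module A N by fact
  interpret t: tensor_triple A C C M by unfold_locales
  interpret u: tensor_triple A C C N by unfold_locales
  let ?Tf = "tensor_map A C N id f" and ?TTf = "tensor_map A C (tensor_module A C N) id (tensor_map A C N id f)"
  note Tf = T_hom[OF assms(1-3)]
  note TTf = T_hom[OF T_left_module[OF assms(1)] T_left_module[OF assms(2)] Tf]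
  note fD = left_homD(1)[OF assms(3)]
  have inner: "u.inner (f m) s = ?TTf (t.inner m s)"
    if m: "m \<in> carrier M" and s: "s \<in> carrier (tensor_group A C C)" for m s
    by (rule t.CD.tensor_hom_ext[where f = "u.inner (f m)" and g = "\<lambda>s. ?TTf (t.inner m s)",
          OF u.TT_abelian u.inner_hom add_hom_comp[OF t.inner_hom left_homD(4)[OF TTf]]])
      (use m s in \<open>simp_all add: t.inner_pure u.inner_pure fD
          T_pure[OF T_left_module[OF assms(1)] T_left_module[OF assms(2)] Tf] T_pure[OF assms(1-3)]\<close>)
  show ?thesis
  proof (rule t.DM.tensor_hom_ext[where f = "\<lambda>t. cmult A C N (?Tf t)" and g = "\<lambda>t. ?TTf (cmult A C M t)"])
    show "(\<lambda>t. cmult A C N (?Tf t)) \<in> add_hom (tensor_group A C M) u.TT"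
      using left_homD(4)[OF left_hom_comp[OF Tf cmult_hom[OF assms(2)]]] by (simp add: add_hom_def)
    show "(\<lambda>t. ?TTf (cmult A C M t)) \<in> add_hom (tensor_group A C M) u.TT"
      using left_homD(4)[OF left_hom_comp[OF cmult_hom[OF assms(1)] TTf]] by (simp add: add_hom_def)
    fix c m assume cm: "c \<in> carrier C" "m \<in> carrier M"
    have cc: "comult C c \<in> carrier (tensor_group A C C)" using left_homD(1)[OF comult_homs(1)] cm by simp
    show "cmult A C N (?Tf (pure_tensor A C M c m)) = ?TTf (cmult A C M (pure_tensor A C M c m))"
      using cm cc inner[OF cm(2) cc] unfolding cmult_def
      by (simp add: T_pure[OF assms(1-3)] comult_tensor_hom(2)[OF assms(1)] comult_tensor_hom(2)[OF assms(2)] fD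
          t.assoc_pure u.assoc_pure)
  qed (rule u.TT_abelian assms(4))+
qed

text \<open>On c tensor m both sides are the counit of c times the image of m, by linearity of
  \<open>f\<close>.\<close>

lemma ccounit_nat:
  assumes "left_module A M" "left_module A N" "f \<in> left_hom A M N" "t \<in> carrier (tensor_group A C M)"
  shows "ccounit A C N (tensor_map A C N id f t) = f (ccounit A C M t)"
proof -
  interpret M: left_module A M by fact
  interpret N: left_module A N by fact
  interpret tM: tensor_pair A C M by unfold_locales
  note Tf = T_hom[OF assms(1-3)]
  note fD = left_homD[OF assms(3)]
  show ?thesis
  proof (rule tM.tensor_hom_ext[where f = "\<lambda>t. ccounit A C N (tensor_map A C N id f t)" and g = "\<lambda>t. f (ccounit A C M t)"])
    show "(\<lambda>t. ccounit A C N (tensor_map A C N id f t)) \<in> add_hom (tensor_group A C M) N"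
      using left_homD(4)[OF left_hom_comp[OF Tf ccounit_hom[OF assms(2)]]] by (simp add: add_hom_def)
    show "(\<lambda>t. f (ccounit A C M t)) \<in> add_hom (tensor_group A C M) N"
      using left_homD(4)[OF left_hom_comp[OF ccounit_hom[OF assms(1)] assms(3)]] by (simp add: add_hom_def)
    fix c m assume cm: "c \<in> carrier C" "m \<in> carrier M"
    have cc: "counit C c \<in> carrier A" using left_homD(1)[OF counit_homs(1)] cm by (simp add: regular_bimodule_def)
    show "ccounit A C N (tensor_map A C N id f (pure_tensor A C M c m)) = f (ccounit A C M (pure_tensor A C M c m))"
      using cm cc unfolding ccounit_def
      by (simp add: T_pure[OF assms(1-3)] counit_tensor_hom(2)[OF assms(1)] counit_tensor_hom(2)[OF assms(2)] fD
          tensor_lunit_hom(2)[OF assms(1)] tensor_lunit_hom(2)[OF assms(2)])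
  qed (rule N.M.abelian_group_axioms assms(4))+
qed

end

section \<open>Directed colimits of modules\<close>

text \<open>The map of formal sums that acts by \<open>g\<close> on the second entries. On classes
  it becomes \<open>tensor_map\<close> with \<open>id\<close> in the first factor, which is the
  content of \<open>T_tcoset\<close>.\<close>

definition frag_map :: "('m \<Rightarrow> 'n) \<Rightarrow> ('c \<times> 'm \<Rightarrow>\<^sub>0 int) \<Rightarrow> ('c \<times> 'n \<Rightarrow>\<^sub>0 int)" where
  "frag_map g = frag_extend (frag_of \<circ> map_prod id g)"

lemma frag_map_simps [simp]:
  "frag_map g 0 = 0" "frag_map g (frag_of (c, m)) = frag_of (c, g m)"
  "frag_map g (s - t) = frag_map g s - frag_map g t" "frag_map g (- t) = - frag_map g t"
  "frag_map g (s + t) = frag_map g s + frag_map g t"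
  by (simp_all add: frag_map_def frag_extend_diff frag_extend_minus frag_extend_add del: minus_frag_cmul)

lemma frag_map_comp: "frag_map g (frag_map f t) = frag_map (\<lambda>x. g (f x)) t"
  unfolding frag_map_def frag_extend_compose by (rule frag_extend_eq) auto

lemma frag_map_cong:
  assumes "\<And>c m. (c, m) \<in> Poly_Mapping.keys t \<Longrightarrow> f m = g m"
  shows "frag_map f t = frag_map g t"
  unfolding frag_map_def by (rule frag_extend_eq) (use assms in auto)

lemma frag_map_keys:
  assumes "Poly_Mapping.keys t \<subseteq> C \<times> M" "g \<in> M \<rightarrow> N"
  shows "Poly_Mapping.keys (frag_map g t) \<subseteq> C \<times> N"
proof -
  have "Poly_Mapping.keys (frag_map g t) \<subseteq> map_prod id g ` Poly_Mapping.keys t"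
    unfolding frag_map_def using keys_frag_extend[of "frag_of \<circ> map_prod id g" t] by auto
  also have "\<dots> \<subseteq> map_prod id g ` (C \<times> M)" using assms(1) by (rule image_mono)
  also have "\<dots> \<subseteq> C \<times> N" using assms(2) by auto
  finally show ?thesis .
qed

text \<open>The kernel of a map of free abelian groups induced by a map of the generators is explained by
  finitely many coincidences between the generators.\<close>

lemma frag_map_zero_factor:
  assumes "frag_map h t = 0"
    and "\<And>c d m n. \<lbrakk>(c, m) \<in> Poly_Mapping.keys t; (d, n) \<in> Poly_Mapping.keys t; h m = h n\<rbrakk> \<Longrightarrow> g m = g n"
  shows "frag_map g t = 0"
proof -
  \<comment> \<open>\<open>p\<close> is \<open>g\<close> after a section of \<open>h\<close> on the
    entries that occur in \<open>t\<close>. As \<open>g\<close> identifies whatever \<open>h\<close>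
    identifies there, \<open>g\<close> agrees with \<open>p\<close> after \<open>h\<close> on these
    entries, and the image of \<open>t\<close> under \<open>g\<close> factors through its image
    under \<open>h\<close>.\<close>
  define p where "p = (\<lambda>y. g (SOME m. (\<exists>c. (c, m) \<in> Poly_Mapping.keys t) \<and> h m = y))"
  have "p (h m) = g m" if "(c, m) \<in> Poly_Mapping.keys t" for c m
  proof -
    have "(\<exists>c. (c, n) \<in> Poly_Mapping.keys t) \<and> h n = h m"
      if "n = (SOME n. (\<exists>c. (c, n) \<in> Poly_Mapping.keys t) \<and> h n = h m)" for n
      unfolding that by (rule someI_ex) (use \<open>(c, m) \<in> _\<close> in blast)
    thus ?thesis unfolding p_def using assms(2) that by blast
  qed
  hence "frag_map g t = frag_map (\<lambda>x. p (h x)) t" by (intro frag_map_cong) auto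
  also have "\<dots> = frag_map p (frag_map h t)" by (rule frag_map_comp[symmetric])
  finally show ?thesis using assms(1) by simp
qed

lemma (in bimodule) T_tcoset:
  assumes "left_module A N" "left_module A P" "f \<in> left_hom A N P"
    and "Poly_Mapping.keys t \<subseteq> carrier M \<times> carrier N"
  shows "tensor_map A M P id f (tcoset A M N t) = tcoset A M P (frag_map f t)"
proof -
  interpret N: tensor_pair A M N by (rule pairI[OF assms(1)])
  interpret P: tensor_pair A M P by (rule pairI[OF assms(2)])
  note h = T_add_hom[OF assms(1-3)]
  have fN: "f \<in> carrier N \<rightarrow> carrier P" using left_homD(1)[OF assms(3)] by simp
  show ?thesis
  proof (rule free_Abelian_group_induct[OF assms(4)])
    show "tensor_map A M P id f (tcoset A M N 0) = tcoset A M P (frag_map f 0)"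
      using add_hom_zero[OF N.tensor_abelian_group P.tensor_abelian_group h]
      by (simp add: N.tcoset_zero P.tcoset_zero)
    fix x y assume *: "Poly_Mapping.keys x \<subseteq> carrier M \<times> carrier N" "Poly_Mapping.keys y \<subseteq> carrier M \<times> carrier N"
      "tensor_map A M P id f (tcoset A M N x) = tcoset A M P (frag_map f x)"
      "tensor_map A M P id f (tcoset A M N y) = tcoset A M P (frag_map f y)"
    have "tcoset A M N (x - y) = tcoset A M N x \<ominus>\<^bsub>tensor_group A M N\<^esub> tcoset A M N y"
      using * by (simp add: N.tcoset_diff)
    thus "tensor_map A M P id f (tcoset A M N (x - y)) = tcoset A M P (frag_map f (x - y))"
      using * frag_map_keys[OF *(2) fN]
      by (simp add: add_hom_diff[OF N.tensor_abelian_group P.tensor_abelian_group h] N.tcoset_closed P.tcoset_diff)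
  next
    fix a assume "a \<in> carrier M \<times> carrier N"
    then obtain c n where "a = (c, n)" "c \<in> carrier M" "n \<in> carrier N" by auto
    thus "tensor_map A M P id f (tcoset A M N (frag_of a)) = tcoset A M P (frag_map f (frag_of a))"
      using T_pure[OF assms(1-3)] by (simp add: N.pure_tcoset[symmetric] P.pure_tcoset[symmetric])
  qed
qed

text \<open>A directed colimit of modules described by elements: everything in L comes from a stage,
  and whatever dies in L dies at a later stage. In this form the property can be passed on to tensor
  products, and no universal property has to be invoked for that.\<close>

locale directed_colim =
  fixes A :: "('a, 'r) ring_scheme" and I :: "'i set" and r :: "'i rel"
    and M :: "'i \<Rightarrow> ('a, 'm, 'x) module_scheme" and f :: "'i \<Rightarrow> 'i \<Rightarrow> 'm \<Rightarrow> 'm"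
    and L :: "('a, 'l, 'y) module_scheme" and h :: "'i \<Rightarrow> 'm \<Rightarrow> 'l"
  assumes I_refl: "i \<in> I \<Longrightarrow> (i, i) \<in> r"
    and I_trans: "\<lbrakk>i \<in> I; j \<in> I; k \<in> I; (i, j) \<in> r; (j, k) \<in> r\<rbrakk> \<Longrightarrow> (i, k) \<in> r"
    and I_nonempty: "I \<noteq> {}"
    and I_directed: "\<lbrakk>i \<in> I; j \<in> I\<rbrakk> \<Longrightarrow> \<exists>k\<in>I. (i, k) \<in> r \<and> (j, k) \<in> r"
    and L_module: "left_module A L"
    and M_module: "i \<in> I \<Longrightarrow> left_module A (M i)"
    and f_hom: "\<lbrakk>i \<in> I; j \<in> I; (i, j) \<in> r\<rbrakk> \<Longrightarrow> f i j \<in> left_hom A (M i) (M j)"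
    and h_hom: "i \<in> I \<Longrightarrow> h i \<in> left_hom A (M i) L"
    and h_f: "\<lbrakk>i \<in> I; j \<in> I; (i, j) \<in> r; x \<in> carrier (M i)\<rbrakk> \<Longrightarrow> h j (f i j x) = h i x"
    and f_f: "\<lbrakk>i \<in> I; j \<in> I; k \<in> I; (i, j) \<in> r; (j, k) \<in> r; x \<in> carrier (M i)\<rbrakk> \<Longrightarrow>
      f j k (f i j x) = f i k x"
    and h_surj: "y \<in> carrier L \<Longrightarrow> \<exists>i\<in>I. \<exists>x\<in>carrier (M i). h i x = y"
    and h_kernel: "\<lbrakk>i \<in> I; x \<in> carrier (M i); h i x = \<zero>\<^bsub>L\<^esub>\<rbrakk> \<Longrightarrow>
      \<exists>j\<in>I. (i, j) \<in> r \<and> f i j x = \<zero>\<^bsub>M j\<^esub>"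
begin

lemma f_closed: "\<lbrakk>i \<in> I; j \<in> I; (i, j) \<in> r; x \<in> carrier (M i)\<rbrakk> \<Longrightarrow> f i j x \<in> carrier (M j)"
  using left_homD(1)[OF f_hom] by blast

lemma h_closed: "\<lbrakk>i \<in> I; x \<in> carrier (M i)\<rbrakk> \<Longrightarrow> h i x \<in> carrier L"
  using left_homD(1)[OF h_hom] by blast

lemma h_eq:
  assumes "i \<in> I" "x \<in> carrier (M i)" "y \<in> carrier (M i)" "h i x = h i y"
  shows "\<exists>j\<in>I. (i, j) \<in> r \<and> f i j x = f i j y"
proof -
  interpret L: left_module A L by (rule L_module)
  interpret Mi: left_module A "M i" by (rule M_module[OF assms(1)])
  have "h i (x \<ominus>\<^bsub>M i\<^esub> y) = \<zero>\<^bsub>L\<^esub>"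
    using left_hom_diff[OF M_module L_module h_hom] assms h_closed by (simp add: L.M.diff_zero_iff)
  then obtain j where j: "j \<in> I" "(i, j) \<in> r" "f i j (x \<ominus>\<^bsub>M i\<^esub> y) = \<zero>\<^bsub>M j\<^esub>"
    using h_kernel[of i "x \<ominus>\<^bsub>M i\<^esub> y"] assms by auto
  interpret Mj: left_module A "M j" by (rule M_module[OF j(1)])
  have "f i j x \<ominus>\<^bsub>M j\<^esub> f i j y = \<zero>\<^bsub>M j\<^esub>"
    using left_hom_diff[OF M_module M_module f_hom] assms j by simp
  thus ?thesis using j assms f_closed by (auto simp: Mj.M.diff_zero_iff)
qed

lemma h_eq_two:
  assumes "i \<in> I" "j \<in> I" "x \<in> carrier (M i)" "y \<in> carrier (M j)" "h i x = h j y"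
  shows "\<exists>k\<in>I. (i, k) \<in> r \<and> (j, k) \<in> r \<and> f i k x = f j k y"
proof -
  obtain k where k: "k \<in> I" "(i, k) \<in> r" "(j, k) \<in> r" using I_directed[OF assms(1,2)] by blast
  have "h k (f i k x) = h k (f j k y)" using assms k by (simp add: h_f)
  then obtain l where l: "l \<in> I" "(k, l) \<in> r" "f k l (f i k x) = f k l (f j k y)"
    using h_eq[OF k(1)] f_closed assms k by metis
  hence "f i l x = f j l y" using assms k by (simp add: f_f)
  moreover have "(i, l) \<in> r" "(j, l) \<in> r" using I_trans assms(1,2) k l(1,2) by blast+
  ultimately show ?thesis using l by blast
qed

text \<open>The coincidences are realised one after the other, each at a later stage than the
  previous one; those already achieved persist under transition maps.\<close>

lemma h_eq_finite:
  assumes "i \<in> I" "finite S" "\<And>x y. (x, y) \<in> S \<Longrightarrow> x \<in> carrier (M i) \<and> y \<in> carrier (M i) \<and> h i x = h i y"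
  shows "\<exists>j\<in>I. (i, j) \<in> r \<and> (\<forall>(x, y)\<in>S. f i j x = f i j y)"
  using assms(2,3)
proof (induction S rule: finite_induct)
  case empty
  then show ?case using I_refl[OF assms(1)] assms(1) by blast
next
  case (insert p S)
  obtain j where j: "j \<in> I" "(i, j) \<in> r" "\<forall>(x, y)\<in>S. f i j x = f i j y"
    using insert.IH insert.prems by blast
  obtain x y where p: "p = (x, y)" by (cases p)
  have xy: "x \<in> carrier (M i)" "y \<in> carrier (M i)" "h i x = h i y" using insert.prems[of x y] p by simp_all
  have "h j (f i j x) = h j (f i j y)" using xy j assms(1) by (simp add: h_f)
  then obtain k where k: "k \<in> I" "(j, k) \<in> r" "f j k (f i j x) = f j k (f i j y)"
    using h_eq[OF j(1)] f_closed[OF assms(1) j(1,2)] xy by metis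
  have "(i, k) \<in> r" using I_trans[OF assms(1) j(1) k(1) j(2) k(2)] .
  moreover have "\<forall>(x, y)\<in>insert p S. f i k x = f i k y"
  proof clarify
    fix u v assume "(u, v) \<in> insert p S"
    moreover have "u \<in> carrier (M i)" "v \<in> carrier (M i)" using insert.prems[OF calculation] by simp_all
    moreover have "f j k (f i j u) = f j k (f i j v)"
      using \<open>(u, v) \<in> insert p S\<close> k j p by auto
    ultimately show "f i k u = f i k v" using f_f[OF assms(1) j(1) k(1) j(2) k(2)] by simp
  qed
  ultimately show ?case using k(1) by blast
qed

text \<open>A defining relation involves at most two elements of L, and these have preimages at a
  common stage, where the corresponding relation is a relation again. The formal sum itself is
  lifted and not merely its class.\<close>

lemma tensor_rels_lift:
  assumes "bimodule A C" "t \<in> tensor_relations A C L"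
  shows "\<exists>j\<in>I. \<exists>s\<in>tensor_relations A C (M j). frag_map (h j) s = t"
proof -
  interpret C: bimodule A C by fact
  interpret L: tensor_pair A C L by (rule C.pairI[OF L_module])
  note pM = C.pairI[OF M_module]
  \<comment> \<open>Relations are stable under transition maps: the class of \<open>s\<close> is
    zero, and \<open>T_tcoset\<close> turns this into a statement about the class of the transported
    sum.\<close>
  have push: "frag_map (f i j) s \<in> tensor_relations A C (M j)"
      "frag_map (h j) (frag_map (f i j) s) = frag_map (h i) s"
    if "i \<in> I" "j \<in> I" "(i, j) \<in> r" "s \<in> tensor_relations A C (M i)" for i j s
  proof -
    interpret i: tensor_pair A C "M i" by (rule pM[OF that(1)])
    interpret j: tensor_pair A C "M j" by (rule pM[OF that(2)])
    note keys = i.rels_keys[OF that(4)]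
    have "tcoset A C (M i) s = tcoset A C (M i) 0" using that by (simp add: i.tcoset_cong)
    hence "tcoset A C (M j) (frag_map (f i j) s) = tcoset A C (M j) (frag_map (f i j) 0)"
      using C.T_tcoset[OF M_module[OF that(1)] M_module[OF that(2)] f_hom[OF that(1-3)], of s]
       C.T_tcoset[OF M_module[OF that(1)] M_module[OF that(2)] f_hom[OF that(1-3)], of 0] keys by simp
    thus "frag_map (f i j) s \<in> tensor_relations A C (M j)" by (simp add: j.tcoset_cong)
    show "frag_map (h j) (frag_map (f i j) s) = frag_map (h i) s"
      unfolding frag_map_comp by (rule frag_map_cong) (use keys h_f that in auto)
  qed
  have lift2: "\<exists>k\<in>I. \<exists>x\<in>carrier (M k). \<exists>y\<in>carrier (M k). h k x = m \<and> h k y = n"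
    if mn: "m \<in> carrier L" "n \<in> carrier L" for m n
  proof -
    obtain i x where i: "i \<in> I" "x \<in> carrier (M i)" "h i x = m" using h_surj[OF mn(1)] by blast
    obtain j y where j: "j \<in> I" "y \<in> carrier (M j)" "h j y = n" using h_surj[OF mn(2)] by blast
    obtain k where k: "k \<in> I" "(i, k) \<in> r" "(j, k) \<in> r" using I_directed[OF i(1) j(1)] by blast
    have "f i k x \<in> carrier (M k)" "f j k y \<in> carrier (M k)" "h k (f i k x) = m" "h k (f j k y) = n"
      using i j k f_closed h_f by simp_all
    thus ?thesis using k(1) by blast
  qed
  show ?thesis using assms(2)
  proof (induction rule: L.rels_induct)
    case zero
    obtain i where "i \<in> I" using I_nonempty by blast
    then show ?case using tensor_pair.rels_zero[OF pM] frag_map_simps(1) by blast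
  next
    case (minus t)
    then obtain j s where "j \<in> I" "s \<in> tensor_relations A C (M j)" "frag_map (h j) s = t" by blast
    then show ?case using tensor_pair.rels_minus[OF pM] frag_map_simps(4) by blast
  next
    case (add t u)
    then obtain i s j v where *: "i \<in> I" "s \<in> tensor_relations A C (M i)" "frag_map (h i) s = t"
      "j \<in> I" "v \<in> tensor_relations A C (M j)" "frag_map (h j) v = u" by blast
    obtain k where k: "k \<in> I" "(i, k) \<in> r" "(j, k) \<in> r" using I_directed[OF *(1,4)] by blast
    have "frag_map (f i k) s + frag_map (f j k) v \<in> tensor_relations A C (M k)"
      using push(1) * k tensor_pair.rels_add[OF pM] by simp
    moreover have "frag_map (h k) (frag_map (f i k) s + frag_map (f j k) v) = t + u"
      using push(2) * k by simp
    ultimately show ?case using k(1) by blast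
  next
    case (add_left c d m)
    then obtain i x where i: "i \<in> I" "x \<in> carrier (M i)" "h i x = m" using h_surj by blast
    have "frag_of (c \<oplus>\<^bsub>C\<^esub> d, x) - frag_of (c, x) - frag_of (d, x) \<in> tensor_relations A C (M i)"
      by (rule tensor_pair.rels_gen(1)[OF pM]) (use add_left i in auto)
    moreover have "frag_map (h i) (frag_of (c \<oplus>\<^bsub>C\<^esub> d, x) - frag_of (c, x) - frag_of (d, x)) =
      frag_of (c \<oplus>\<^bsub>C\<^esub> d, m) - frag_of (c, m) - frag_of (d, m)" using i by simp
    ultimately show ?case using i(1) by blast
  next
    case (add_right c m n)
    then obtain i x y where i: "i \<in> I" "x \<in> carrier (M i)" "y \<in> carrier (M i)" "h i x = m" "h i y = n"
      using lift2 by blast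
    have "frag_of (c, x \<oplus>\<^bsub>M i\<^esub> y) - frag_of (c, x) - frag_of (c, y) \<in> tensor_relations A C (M i)"
      by (rule tensor_pair.rels_gen(2)[OF pM]) (use add_right i in auto)
    moreover have "frag_map (h i) (frag_of (c, x \<oplus>\<^bsub>M i\<^esub> y) - frag_of (c, x) - frag_of (c, y)) =
      frag_of (c, m \<oplus>\<^bsub>L\<^esub> n) - frag_of (c, m) - frag_of (c, n)"
      using i left_homD(2)[OF h_hom[OF i(1)]] by simp
    ultimately show ?case using i(1) by blast
  next
    case (balanced c a m)
    then obtain i x where i: "i \<in> I" "x \<in> carrier (M i)" "h i x = m" using h_surj by blast
    have "frag_of (c \<odot>\<^sub>r\<^bsub>C\<^esub> a, x) - frag_of (c, a \<odot>\<^bsub>M i\<^esub> x) \<in> tensor_relations A C (M i)"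
      by (rule tensor_pair.rels_gen(3)[OF pM]) (use balanced i in auto)
    moreover have "frag_map (h i) (frag_of (c \<odot>\<^sub>r\<^bsub>C\<^esub> a, x) - frag_of (c, a \<odot>\<^bsub>M i\<^esub> x)) =
      frag_of (c \<odot>\<^sub>r\<^bsub>C\<^esub> a, m) - frag_of (c, a \<odot>\<^bsub>L\<^esub> m)"
      using i balanced left_homD(3)[OF h_hom[OF i(1)]] by simp
    ultimately show ?case using i(1) by blast
  qed
qed

text \<open>Surjectivity holds because a formal sum has finitely many entries, which lift to one
  stage. For the kernel, let \<open>t\<close> represent an element that dies over L. Its image is a
  relation over L, which lifts to a relation \<open>s\<close> at some stage. The transported
  \<open>t\<close> and \<open>s\<close> have equal images as formal sums over L, and the finitely
  many coincidences of entries that cause this are realised at a later stage; there \<open>t\<close>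
  equals a relation.\<close>

lemma tensor_directed_colim:
  assumes "bimodule A C"
  shows "directed_colim A I r (\<lambda>i. tensor_module A C (M i)) (\<lambda>i j. tensor_map A C (M j) id (f i j))
    (tensor_module A C L) (\<lambda>i. tensor_map A C L id (h i))"
proof -
  interpret C: bimodule A C by fact
  interpret L: tensor_pair A C L by (rule C.pairI[OF L_module])
  note pM = C.pairI[OF M_module]
  have ub: "\<exists>k\<in>I. \<exists>\<sigma>. Poly_Mapping.keys \<sigma> \<subseteq> carrier C \<times> carrier (M k) \<and> frag_map (h k) \<sigma> = t"
    if "Poly_Mapping.keys t \<subseteq> carrier C \<times> carrier L" for t
  proof (rule free_Abelian_group_induct[OF that])
    obtain i where "i \<in> I" using I_nonempty by blast
    thus "\<exists>k\<in>I. \<exists>\<sigma>. Poly_Mapping.keys \<sigma> \<subseteq> carrier C \<times> carrier (M k) \<and> frag_map (h k) \<sigma> = 0"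
      by (intro bexI[of _ i] exI[of _ 0]) simp_all
  next
    fix x y assume "\<exists>k\<in>I. \<exists>\<sigma>. Poly_Mapping.keys \<sigma> \<subseteq> carrier C \<times> carrier (M k) \<and> frag_map (h k) \<sigma> = x"
     "\<exists>k\<in>I. \<exists>\<sigma>. Poly_Mapping.keys \<sigma> \<subseteq> carrier C \<times> carrier (M k) \<and> frag_map (h k) \<sigma> = y"
    then obtain i s j t where *: "i \<in> I" "Poly_Mapping.keys s \<subseteq> carrier C \<times> carrier (M i)" "frag_map (h i) s = x"
       "j \<in> I" "Poly_Mapping.keys t \<subseteq> carrier C \<times> carrier (M j)" "frag_map (h j) t = y" by blast
    obtain k where k: "k \<in> I" "(i, k) \<in> r" "(j, k) \<in> r" using I_directed[OF *(1,4)] by blast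
    have "frag_map (h k) (frag_map (f i k) s) = x"
      unfolding frag_map_comp *(3)[symmetric] by (rule frag_map_cong) (use * k h_f in auto)
    moreover have "frag_map (h k) (frag_map (f j k) t) = y"
      unfolding frag_map_comp *(6)[symmetric] by (rule frag_map_cong) (use * k h_f in auto)
    moreover have "Poly_Mapping.keys (frag_map (f i k) s) \<subseteq> carrier C \<times> carrier (M k)"
      by (rule frag_map_keys[OF *(2)]) (use f_closed[OF *(1) k(1,2)] in simp)
    moreover have "Poly_Mapping.keys (frag_map (f j k) t) \<subseteq> carrier C \<times> carrier (M k)"
      by (rule frag_map_keys[OF *(5)]) (use f_closed[OF *(4) k(1,3)] in simp)
    ultimately show "\<exists>k\<in>I. \<exists>\<sigma>. Poly_Mapping.keys \<sigma> \<subseteq> carrier C \<times> carrier (M k) \<and> frag_map (h k) \<sigma> = x - y"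
      using k(1) keys_diff[of "frag_map (f i k) s" "frag_map (f j k) t"]
      by (intro bexI[of _ k] exI[of _ "frag_map (f i k) s - frag_map (f j k) t"]) auto
  next
    fix a assume "a \<in> carrier C \<times> carrier L"
    then obtain c m where a: "a = (c, m)" "c \<in> carrier C" "m \<in> carrier L" by auto
    then obtain i x where "i \<in> I" "x \<in> carrier (M i)" "h i x = m" using h_surj by blast
    thus "\<exists>k\<in>I. \<exists>\<sigma>. Poly_Mapping.keys \<sigma> \<subseteq> carrier C \<times> carrier (M k) \<and> frag_map (h k) \<sigma> = frag_of a"
      using a by (intro bexI[of _ i] exI[of _ "frag_of (c, x)"]) auto
  qed
  show ?thesis
  proof (rule directed_colim.intro)
    fix y assume "y \<in> carrier (tensor_module A C L)"
    then obtain t where t: "Poly_Mapping.keys t \<subseteq> carrier C \<times> carrier L" "y = tcoset A C L t"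
      using L.tensorE by auto
    obtain k s where k: "k \<in> I" "Poly_Mapping.keys s \<subseteq> carrier C \<times> carrier (M k)" "frag_map (h k) s = t"
      using ub[OF t(1)] by blast
    have "tensor_map A C L id (h k) (tcoset A C (M k) s) = y"
      using C.T_tcoset[OF M_module[OF k(1)] L_module h_hom[OF k(1)] k(2)] k t by simp
    moreover have "tcoset A C (M k) s \<in> carrier (tensor_module A C (M k))"
      using tensor_pair.tcoset_closed[OF pM[OF k(1)] k(2)] by simp
    ultimately show "\<exists>i\<in>I. \<exists>x\<in>carrier (tensor_module A C (M i)). tensor_map A C L id (h i) x = y"
      using k(1) by blast
  next
    fix i x assume ix: "i \<in> I" "x \<in> carrier (tensor_module A C (M i))"
      "tensor_map A C L id (h i) x = \<zero>\<^bsub>tensor_module A C L\<^esub>"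
    interpret i: tensor_pair A C "M i" by (rule pM[OF ix(1)])
    obtain t where t: "Poly_Mapping.keys t \<subseteq> carrier C \<times> carrier (M i)" "x = tcoset A C (M i) t"
      using ix(2) i.tensorE by auto
    have "tcoset A C L (frag_map (h i) t) = tcoset A C L 0"
      using ix(3) C.T_tcoset[OF M_module[OF ix(1)] L_module h_hom[OF ix(1)] t(1)] t(2) by (simp add: L.tcoset_zero)
    hence "frag_map (h i) t \<in> tensor_relations A C L" by (simp add: L.tcoset_cong)
    then obtain j s where j: "j \<in> I" "s \<in> tensor_relations A C (M j)" "frag_map (h j) s = frag_map (h i) t"
      using tensor_rels_lift[OF assms] by blast
    interpret j: tensor_pair A C "M j" by (rule pM[OF j(1)])
    obtain k where k: "k \<in> I" "(i, k) \<in> r" "(j, k) \<in> r" using I_directed[OF ix(1) j(1)] by blast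
    note sk = j.rels_keys[OF j(2)]
    \<comment> \<open>This difference vanishes over L already as a formal sum, which is what makes
      \<open>frag_map_zero_factor\<close> applicable.\<close>
    let ?u = "frag_map (f i k) t - frag_map (f j k) s"
    have u0: "frag_map (h k) ?u = 0"
    proof -
      have "frag_map (h k) (frag_map (f i k) t) = frag_map (h i) t"
        unfolding frag_map_comp by (rule frag_map_cong) (use ix t k h_f in auto)
      moreover have "frag_map (h k) (frag_map (f j k) s) = frag_map (h j) s"
        unfolding frag_map_comp by (rule frag_map_cong) (use j sk k h_f in auto)
      ultimately show ?thesis using j(3) by simp
    qed
    have "Poly_Mapping.keys (frag_map (f i k) t) \<subseteq> carrier C \<times> carrier (M k)"
      by (rule frag_map_keys[OF t(1)]) (use f_closed[OF ix(1) k(1,2)] in simp)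
    moreover have "Poly_Mapping.keys (frag_map (f j k) s) \<subseteq> carrier C \<times> carrier (M k)"
      by (rule frag_map_keys[OF sk]) (use f_closed[OF j(1) k(1,3)] in simp)
    ultimately have uk: "Poly_Mapping.keys ?u \<subseteq> carrier C \<times> carrier (M k)"
      using keys_diff[of "frag_map (f i k) t" "frag_map (f j k) s"] by blast
    \<comment> \<open>All pairs of second entries of \<open>?u\<close> that \<open>h k\<close>
      identifies. They are finitely many, so one later stage realises all these
      identifications.\<close>
    define S where "S = {(m, n). m \<in> snd ` Poly_Mapping.keys ?u \<and> n \<in> snd ` Poly_Mapping.keys ?u \<and> h k m = h k n}"
    have "S \<subseteq> snd ` Poly_Mapping.keys ?u \<times> snd ` Poly_Mapping.keys ?u" unfolding S_def by blast
    hence "finite S" by (rule finite_subset) simp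
    moreover have "m \<in> carrier (M k) \<and> n \<in> carrier (M k) \<and> h k m = h k n" if "(m, n) \<in> S" for m n
      using that uk unfolding S_def by auto
    ultimately obtain l where l: "l \<in> I" "(k, l) \<in> r" "\<forall>(x, y)\<in>S. f k l x = f k l y"
      using h_eq_finite[OF k(1), of S] by blast
    have "frag_map (f k l) ?u = 0"
      by (rule frag_map_zero_factor[OF u0]) (use l(3) in \<open>force simp: S_def image_iff\<close>)
    hence e: "frag_map (f k l) (frag_map (f i k) t) = frag_map (f k l) (frag_map (f j k) s)" by simp
    have il: "(i, l) \<in> r" "(j, l) \<in> r" using I_trans ix(1) j(1) k l(1,2) by blast+
    have "frag_map (f k l) (frag_map (f i k) t) = frag_map (f i l) t"
      unfolding frag_map_comp by (rule frag_map_cong) (use ix t k l f_f in auto)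
    moreover have "frag_map (f k l) (frag_map (f j k) s) = frag_map (f j l) s"
      unfolding frag_map_comp by (rule frag_map_cong) (use j sk k l f_f in auto)
    ultimately have e': "frag_map (f i l) t = frag_map (f j l) s" using e by simp
    interpret l: tensor_pair A C "M l" by (rule pM[OF l(1)])
    have "tensor_map A C (M l) id (f i l) x = tcoset A C (M l) (frag_map (f j l) s)"
      using C.T_tcoset[OF M_module[OF ix(1)] M_module[OF l(1)] f_hom[OF ix(1) l(1) il(1)] t(1)] t(2) e' by simp
    also have "\<dots> = tensor_map A C (M l) id (f j l) (tcoset A C (M j) s)"
      using C.T_tcoset[OF M_module[OF j(1)] M_module[OF l(1)] f_hom[OF j(1) l(1) il(2)] sk] by simp
    also have "tcoset A C (M j) s = \<zero>\<^bsub>tensor_module A C (M j)\<^esub>"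
      using j(2) by (simp add: j.tcoset_zero j.tcoset_cong)
    also have "tensor_map A C (M l) id (f j l) \<zero>\<^bsub>tensor_module A C (M j)\<^esub> = \<zero>\<^bsub>tensor_module A C (M l)\<^esub>"
      by (rule left_hom_zero[OF C.T_left_module C.T_left_module C.T_hom])
        (use j l il M_module f_hom in auto)
    finally show "\<exists>j\<in>I. (i, j) \<in> r \<and> tensor_map A C (M j) id (f i j) x = \<zero>\<^bsub>tensor_module A C (M j)\<^esub>"
      using l(1) il(1) by blast
  next
    fix i j x assume *: "i \<in> I" "j \<in> I" "(i, j) \<in> r" "x \<in> carrier (tensor_module A C (M i))"
    have "tensor_map A C L id (\<lambda>x. h j (f i j x)) x = tensor_map A C L id (h i) x"
      by (rule C.T_cong[OF M_module L_module left_hom_comp[OF f_hom h_hom] h_hom]) (use * h_f in auto)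
    thus "tensor_map A C L id (h j) (tensor_map A C (M j) id (f i j) x) = tensor_map A C L id (h i) x"
      using C.T_comp[OF M_module M_module L_module f_hom h_hom] * by simp
  next
    fix i j k x assume *: "i \<in> I" "j \<in> I" "k \<in> I" "(i, j) \<in> r" "(j, k) \<in> r" "x \<in> carrier (tensor_module A C (M i))"
    have ik: "(i, k) \<in> r" using I_trans * by blast
    have "tensor_map A C (M k) id (\<lambda>x. f j k (f i j x)) x = tensor_map A C (M k) id (f i k) x"
      by (rule C.T_cong[OF M_module M_module left_hom_comp[OF f_hom f_hom] f_hom]) (use * ik f_f in auto)
    thus "tensor_map A C (M k) id (f j k) (tensor_map A C (M j) id (f i j) x) = tensor_map A C (M k) id (f i k) x"
      using C.T_comp[OF M_module M_module M_module f_hom f_hom] * by simp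
  next
    show "left_module A (tensor_module A C L)" by (rule C.T_left_module[OF L_module])
    show "left_module A (tensor_module A C (M i))" if "i \<in> I" for i
      by (rule C.T_left_module[OF M_module[OF that]])
    show "tensor_map A C (M j) id (f i j) \<in> left_hom A (tensor_module A C (M i)) (tensor_module A C (M j))"
      if "i \<in> I" "j \<in> I" "(i, j) \<in> r" for i j
      by (rule C.T_hom[OF M_module[OF that(1)] M_module[OF that(2)] f_hom[OF that]])
    show "tensor_map A C L id (h i) \<in> left_hom A (tensor_module A C (M i)) (tensor_module A C L)"
      if "i \<in> I" for i
      by (rule C.T_hom[OF M_module[OF that] L_module h_hom[OF that]])
  qed ((rule I_refl I_nonempty I_directed I_trans; assumption?)+)
qed

end

section \<open>Small sets\<close>

locale universe =
  fixes \<kappa> :: "'u rel"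
  assumes universe: "universe_cardinal \<kappa>"
begin

lemma Cinf: "Cinfinite \<kappa>" and reg: "regularCard \<kappa>"
  using universe by (simp_all add: universe_cardinal_def)

lemma small_leq: "\<lbrakk>|X| \<le>o |Y|; small \<kappa> Y\<rbrakk> \<Longrightarrow> small \<kappa> X"
  by (rule ordLeq_ordLess_trans)

lemma small_subset: "\<lbrakk>X \<subseteq> Y; small \<kappa> Y\<rbrakk> \<Longrightarrow> small \<kappa> X"
  by (rule small_leq[OF card_of_mono1])

lemma small_image: "small \<kappa> X \<Longrightarrow> small \<kappa> (f ` X)"
  by (rule small_leq[OF card_of_image])

lemma small_inj: "\<lbrakk>inj_on f X; f ` X \<subseteq> Y; small \<kappa> Y\<rbrakk> \<Longrightarrow> small \<kappa> X"
  by (rule small_leq[OF card_of_ordLeqI]) auto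

lemma small_UN: "\<lbrakk>small \<kappa> I; \<And>i. i \<in> I \<Longrightarrow> small \<kappa> (F i)\<rbrakk> \<Longrightarrow> small \<kappa> (\<Union>i\<in>I. F i)"
  using card_of_UNION_ordLess_infinite_Field_regularCard[OF reg Cinf] by blast

lemma small_Sigma:
  assumes "small \<kappa> I" "\<And>i. i \<in> I \<Longrightarrow> small \<kappa> (F i)"
  shows "small \<kappa> (SIGMA i:I. F i)"
proof -
  have "(SIGMA i:I. F i) = (\<Union>i\<in>I. Pair i ` F i)" by auto
  moreover have "small \<kappa> (\<Union>i\<in>I. Pair i ` F i)"
    by (rule small_UN[OF assms(1)], rule small_image, rule assms(2))
  ultimately show ?thesis by simp
qed

lemma small_inject:
  assumes "small \<kappa> (X :: 'x set)"
  obtains \<phi> :: "'x \<Rightarrow> 'u" where "inj_on \<phi> X"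
proof -
  have "\<kappa> =o |Field \<kappa>|" using Cinf card_of_Field_ordIso ordIso_symmetric by blast
  hence "|X| \<le>o |Field \<kappa>|" using assms ordLess_imp_ordLeq ordLeq_ordIso_trans by blast
  thus thesis using that card_of_ordLeq[of X "Field \<kappa>"] by blast
qed

lemma infinite_u: "infinite (UNIV :: 'u set)"
  using Cinf finite_subset[OF subset_UNIV] unfolding cinfinite_def by blast

lemma small_finite: "finite X \<Longrightarrow> small \<kappa> X"
proof -
  assume "finite X"
  hence "|X| <o |Field \<kappa>|"
    using Cinf unfolding cinfinite_def by (intro finite_ordLess_infinite2) auto
  thus ?thesis using Cinf card_of_Field_ordIso ordLess_ordIso_trans by blast
qed

text \<open>The exponentiation property of \<open>\<kappa>\<close>, applied to a two-element set,
  puts the cardinality of the continuum below \<open>\<kappa>\<close>, and with it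
  \<open>natLeq\<close>.\<close>

lemma small_countable:
  assumes "countable X"
  shows "small \<kappa> X"
proof -
  obtain a :: 'u and b :: 'u where ab: "a \<noteq> b"
    using infinite_u by (metis (full_types) UNIV_I ex_new_if_finite finite.emptyI finite.insertI insertI1)
  have "ctwo \<le>o |{a, b}|" unfolding ctwo_def
    by (rule card_of_ordLeqI[of "\<lambda>x. if x then a else b"]) (use ab in \<open>auto simp: inj_on_def split: if_splits\<close>)
  hence "ctwo ^c natLeq \<le>o |{a, b}| ^c natLeq" by (rule cexp_mono1[OF _ natLeq_Card_order])
  moreover have "|{a, b}| ^c natLeq <o \<kappa>"
    using universe small_finite[of "{a, b}"] unfolding universe_cardinal_def by simp
  ultimately have "ctwo ^c natLeq <o \<kappa>" by (rule ordLeq_ordLess_trans)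
  hence "natLeq <o \<kappa>" by (rule ordLess_transitive[OF ordLess_ctwo_cexp[OF natLeq_Card_order]])
  moreover have "|X| \<le>o natLeq" using assms by (simp add: countable_card_le_natLeq)
  ultimately show ?thesis by (rule ordLeq_ordLess_trans[rotated])
qed

lemma small_Un:
  assumes "small \<kappa> X" "small \<kappa> Y"
  shows "small \<kappa> (X \<union> Y)"
proof -
  have "small \<kappa> (\<Union>i\<in>{False, True}. if i then X else Y)"
    by (rule small_UN[OF small_finite]) (use assms in \<open>auto split: if_splits\<close>)
  thus ?thesis by (simp add: Un_commute)
qed

text \<open>A nonempty countable set is the range of a sequence, and
  \<open>universe_cardinal\<close> bounds the number of sequences. That property speaks of subsets
  of \<open>'u\<close>, so \<open>X\<close> is first moved there along an injection.\<close>

lemma small_countable_subsets: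
  assumes "small \<kappa> (X :: 'x set)"
  shows "small \<kappa> {B. B \<subseteq> X \<and> countable B}"
proof -
  obtain \<phi> :: "'x \<Rightarrow> 'u" where \<phi>: "inj_on \<phi> X" by (rule small_inject[OF assms])
  let ?Y = "\<phi> ` X"
  have "|?Y| ^c natLeq <o \<kappa>"
    using universe small_image[OF assms, of \<phi>] unfolding universe_cardinal_def by blast
  hence F: "small \<kappa> (Func (UNIV :: nat set) ?Y)" by (simp add: cexp_def Field_natLeq Field_card_of)
  have "{B. B \<subseteq> ?Y \<and> countable B} \<subseteq> {{}} \<union> range ` Func (UNIV :: nat set) ?Y"
  proof
    fix B assume B: "B \<in> {B. B \<subseteq> ?Y \<and> countable B}"
    show "B \<in> {{}} \<union> range ` Func (UNIV :: nat set) ?Y"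
    proof (cases "B = {}")
      case False
      have "range (from_nat_into B) = B" using B False by (intro range_from_nat_into) auto
      moreover have "from_nat_into B \<in> Func UNIV ?Y"
        using B from_nat_into[OF False] by (auto simp: Func_def)
      ultimately show ?thesis by blast
    qed simp
  qed
  moreover have "small \<kappa> ({{}} \<union> range ` Func (UNIV :: nat set) ?Y)"
    by (rule small_Un[OF small_finite small_image[OF F]]) simp
  ultimately have Y: "small \<kappa> {B. B \<subseteq> ?Y \<and> countable B}" by (rule small_subset)
  show ?thesis
    by (rule small_inj[OF _ _ Y, of "image \<phi>"])
      (use \<phi> in \<open>auto simp: inj_on_def inj_on_image_eq_iff[OF \<phi>]\<close>)
qed

text \<open>A function with countable support is determined by its graph over the support, a
  countable subset of \<open>X\<close> times \<open>Y\<close>; \<open>d\<close> is the value off the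
  support. Vectors of free modules and formal sums of pairs are the two instances.\<close>

lemma small_partial_functions:
  assumes "small \<kappa> X" "small \<kappa> Y"
    and "\<And>v. v \<in> V \<Longrightarrow> countable {x. v x \<noteq> d} \<and> {x. v x \<noteq> d} \<subseteq> X \<and> v ` {x. v x \<noteq> d} \<subseteq> Y"
  shows "small \<kappa> V"
proof (rule small_inj)
  show "small \<kappa> {B. B \<subseteq> X \<times> Y \<and> countable B}"
    by (intro small_countable_subsets small_Sigma assms)
  let ?g = "\<lambda>v. (\<lambda>x. (x, v x)) ` {x. v x \<noteq> d}"
  show "?g ` V \<subseteq> {B. B \<subseteq> X \<times> Y \<and> countable B}" using assms(3) by fastforce
  show "inj_on ?g V"
  proof (rule inj_onI, rule ext)
    fix v w x assume eq: "?g v = ?g w"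
    have "v x = y \<and> y \<noteq> d \<longleftrightarrow> (x, y) \<in> ?g v" "w x = y \<and> y \<noteq> d \<longleftrightarrow> (x, y) \<in> ?g w" for y by auto
    thus "v x = w x" using eq by metis
  qed
qed

lemma small_free:
  assumes "ring A" "small \<kappa> (carrier A)" "small \<kappa> X"
  shows "small \<kappa> (carrier (free_left_module A X))"
  by (rule small_partial_functions[OF assms(3,2), of _ "\<zero>\<^bsub>A\<^esub>"])
    (use free_val[OF assms(1)] in \<open>auto simp: countable_finite free_carrier\<close>)

lemma small_sequences:
  assumes "small \<kappa> X"
  shows "small \<kappa> {t :: nat \<Rightarrow> 'x. range t \<subseteq> X}"
proof (rule small_inj)
  show "small \<kappa> {B. B \<subseteq> (UNIV :: nat set) \<times> X \<and> countable B}"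
    by (intro small_countable_subsets small_Sigma small_countable assms) simp
  show "(\<lambda>t. range (\<lambda>n. (n, t n))) ` {t :: nat \<Rightarrow> 'x. range t \<subseteq> X} \<subseteq>
      {B. B \<subseteq> (UNIV :: nat set) \<times> X \<and> countable B}" by auto
  show "inj_on (\<lambda>t. range (\<lambda>n. (n, t n))) {t :: nat \<Rightarrow> 'x. range t \<subseteq> X}"
  proof (rule inj_onI, rule ext)
    fix t u :: "nat \<Rightarrow> 'x" and n assume "range (\<lambda>n. (n, t n)) = range (\<lambda>n. (n, u n))"
    hence "(n, t n) \<in> range (\<lambda>n. (n, u n))" by blast
    thus "t n = u n" by auto
  qed
qed

lemma small_tensor:
  fixes C :: "('a, 'c, 'x) bimodule_scheme" and M :: "('a, 'm, 'y) module_scheme"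
  assumes "bimodule A C" "left_module A M" "small \<kappa> (carrier C)" "small \<kappa> (carrier M)"
  shows "small \<kappa> (carrier (tensor_group A C M))"
proof -
  interpret tensor_pair A C M by (rule bimodule.pairI[OF assms(1,2)])
  have "small \<kappa> (Poly_Mapping.lookup ` {t :: 'c \<times> 'm \<Rightarrow>\<^sub>0 int. Poly_Mapping.keys t \<subseteq> gens})"
  proof (rule small_partial_functions[where X = gens and Y = "UNIV :: int set" and d = 0])
    show "small \<kappa> gens" by (intro small_Sigma assms)
    show "small \<kappa> (UNIV :: int set)" by (rule small_countable) simp
    fix v assume "v \<in> Poly_Mapping.lookup ` {t :: 'c \<times> 'm \<Rightarrow>\<^sub>0 int. Poly_Mapping.keys t \<subseteq> gens}"
    then obtain t :: "'c \<times> 'm \<Rightarrow>\<^sub>0 int" where t: "Poly_Mapping.keys t \<subseteq> gens" "v = Poly_Mapping.lookup t" by blast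
    have "{x. v x \<noteq> 0} = Poly_Mapping.keys t" using t by (simp add: Poly_Mapping.keys.rep_eq)
    thus "countable {x. v x \<noteq> 0} \<and> {x. v x \<noteq> 0} \<subseteq> gens \<and> v ` {x. v x \<noteq> 0} \<subseteq> UNIV"
      using t by (simp add: countable_finite)
  qed
  hence "small \<kappa> {t :: 'c \<times> 'm \<Rightarrow>\<^sub>0 int. Poly_Mapping.keys t \<subseteq> gens}"
    by (rule small_inj[rotated 2, where f = Poly_Mapping.lookup]) (auto intro!: inj_onI simp: poly_mapping.lookup_inject)
  thus ?thesis unfolding tensor_carrier by (rule small_image)
qed

end

section \<open>Maps into directed colimits\<close>

context directed_colim
begin

text \<open>The value at an element of L is read off from an arbitrary preimage at an arbitrary
  stage. Any two preimages coincide at a common later stage, so the choice does not matter, and sums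
  may be computed at a common stage.\<close>

lemma colim_lift:
  assumes "left_module A N" "\<And>i. i \<in> I \<Longrightarrow> \<eta> i \<in> left_hom A (M i) N"
    and "\<And>i j x. \<lbrakk>i \<in> I; j \<in> I; (i, j) \<in> r; x \<in> carrier (M i)\<rbrakk> \<Longrightarrow> \<eta> j (f i j x) = \<eta> i x"
  shows "\<exists>k\<in>left_hom A L N. \<forall>i\<in>I. \<forall>x\<in>carrier (M i). k (h i x) = \<eta> i x"
proof -
  define p where "p = (\<lambda>y. SOME p. fst p \<in> I \<and> snd p \<in> carrier (M (fst p)) \<and> h (fst p) (snd p) = y)"
  have p: "fst (p y) \<in> I" "snd (p y) \<in> carrier (M (fst (p y)))" "h (fst (p y)) (snd (p y)) = y"
    if "y \<in> carrier L" for y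
  proof -
    have "\<exists>p. fst p \<in> I \<and> snd p \<in> carrier (M (fst p)) \<and> h (fst p) (snd p) = y"
      using h_surj[OF that] by force
    from someI_ex[OF this] show "fst (p y) \<in> I" "snd (p y) \<in> carrier (M (fst (p y)))"
      "h (fst (p y)) (snd (p y)) = y" unfolding p_def by auto
  qed
  define k where "k = (\<lambda>y. \<eta> (fst (p y)) (snd (p y)))"
  have k: "k (h i x) = \<eta> i x" if ix: "i \<in> I" "x \<in> carrier (M i)" for i x
  proof -
    note q = p[OF h_closed[OF ix]]
    obtain l where l: "l \<in> I" "(fst (p (h i x)), l) \<in> r" "(i, l) \<in> r"
       "f (fst (p (h i x))) l (snd (p (h i x))) = f i l x"
      using h_eq_two[OF q(1) ix(1) q(2) ix(2) q(3)] by blast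
    thus ?thesis unfolding k_def using assms(3)[OF q(1) l(1,2) q(2)] assms(3)[OF ix(1) l(1,3) ix(2)] by simp
  qed
  have "k \<in> left_hom A L N"
  proof (rule left_homI)
    fix y assume y: "y \<in> carrier L"
    show "k y \<in> carrier N" unfolding k_def using left_homD(1)[OF assms(2)] p[OF y] by simp
    fix a assume a: "a \<in> carrier A"
    obtain i x where ix: "i \<in> I" "x \<in> carrier (M i)" "h i x = y" using h_surj[OF y] by blast
    interpret Mi: left_module A "M i" by (rule M_module[OF ix(1)])
    have "a \<odot>\<^bsub>L\<^esub> y = h i (a \<odot>\<^bsub>M i\<^esub> x)" using left_homD(3)[OF h_hom[OF ix(1)] a ix(2)] ix by simp
    thus "k (a \<odot>\<^bsub>L\<^esub> y) = a \<odot>\<^bsub>N\<^esub> k y"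
      using k[OF ix(1,2)] k[OF ix(1) Mi.smult_closed[OF a ix(2)]] left_homD(3)[OF assms(2)[OF ix(1)] a ix(2)] ix(3)
      by simp
  next
    fix y z assume y: "y \<in> carrier L" and z: "z \<in> carrier L"
    obtain i x where ix: "i \<in> I" "x \<in> carrier (M i)" "h i x = y" using h_surj[OF y] by blast
    obtain j w where jw: "j \<in> I" "w \<in> carrier (M j)" "h j w = z" using h_surj[OF z] by blast
    obtain l where l: "l \<in> I" "(i, l) \<in> r" "(j, l) \<in> r" using I_directed[OF ix(1) jw(1)] by blast
    define x' where "x' = f i l x" define w' where "w' = f j l w"
    have x': "x' \<in> carrier (M l)" "h l x' = y" unfolding x'_def
      using f_closed[OF ix(1) l(1,2) ix(2)] h_f[OF ix(1) l(1,2) ix(2)] ix(3) by simp_all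
    have w': "w' \<in> carrier (M l)" "h l w' = z" unfolding w'_def
      using f_closed[OF jw(1) l(1,3) jw(2)] h_f[OF jw(1) l(1,3) jw(2)] jw(3) by simp_all
    interpret Ml: left_module A "M l" by (rule M_module[OF l(1)])
    have "y \<oplus>\<^bsub>L\<^esub> z = h l (x' \<oplus>\<^bsub>M l\<^esub> w')" using left_homD(2)[OF h_hom[OF l(1)] x'(1) w'(1)] x' w' by simp
    thus "k (y \<oplus>\<^bsub>L\<^esub> z) = k y \<oplus>\<^bsub>N\<^esub> k z"
      using k[OF l(1) x'(1)] k[OF l(1) w'(1)] k[OF l(1) Ml.M.add.m_closed[OF x'(1) w'(1)]]
        left_homD(2)[OF assms(2)[OF l(1)] x'(1) w'(1)] x'(2) w'(2) by simp
  qed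
  thus ?thesis using k by blast
qed

text \<open>Maps out of S are determined by their values on the generators. For each of the
  countably many generators the two values coincide at some stage, and an upper bound of these
  stages serves all of them.\<close>

lemma coincide:
  assumes aleph1: "\<And>X. \<lbrakk>X \<subseteq> I; countable X\<rbrakk> \<Longrightarrow> \<exists>u\<in>I. \<forall>x\<in>X. (x, u) \<in> r"
    and "presents A S X g Y" "countable X" "i \<in> I"
    and "\<psi> \<in> left_hom A S (M i)" "\<psi>' \<in> left_hom A S (M i)"
    and "\<And>s. s \<in> carrier S \<Longrightarrow> h i (\<psi> s) = h i (\<psi>' s)"
  shows "\<exists>j\<in>I. (i, j) \<in> r \<and> (\<forall>s\<in>carrier S. f i j (\<psi> s) = f i j (\<psi>' s))"
proof -
  note g = presentsD(2)[OF assms(2)]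
  have "\<exists>j\<in>I. (i, j) \<in> r \<and> f i j (\<psi> (g x)) = f i j (\<psi>' (g x))" if "x \<in> X" for x
    by (rule h_eq[OF assms(4)]) (use that g left_homD(1)[OF assms(5)] left_homD(1)[OF assms(6)] assms(7) in auto)
  then obtain J where J: "\<And>x. x \<in> X \<Longrightarrow> J x \<in> I" "\<And>x. x \<in> X \<Longrightarrow> (i, J x) \<in> r"
    "\<And>x. x \<in> X \<Longrightarrow> f i (J x) (\<psi> (g x)) = f i (J x) (\<psi>' (g x))" by metis
  \<comment> \<open>Including \<open>i\<close> itself places \<open>u\<close> above \<open>i\<close>
    even if there are no generators.\<close>
  obtain u where u: "u \<in> I" "\<forall>x\<in>insert i (J ` X). (x, u) \<in> r"
    using aleph1[of "insert i (J ` X)"] assms(3,4) J(1) by auto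
  have iu: "(i, u) \<in> r" using u by simp
  have "f i u (\<psi> (g x)) = f i u (\<psi>' (g x))" if "x \<in> X" for x
  proof -
    have "(J x, u) \<in> r" using u that by simp
    moreover have "\<psi> (g x) \<in> carrier (M i)" "\<psi>' (g x) \<in> carrier (M i)"
      using g that left_homD(1)[OF assms(5)] left_homD(1)[OF assms(6)] by auto
    ultimately show ?thesis
      using f_f[OF assms(4) J(1)[OF that] u(1) J(2)[OF that]] J(3)[OF that] by metis
  qed
  hence "f i u (\<psi> s) = f i u (\<psi>' s)" if "s \<in> carrier S" for s
    by (rule presents_ext[OF assms(2) M_module[OF u(1)] left_hom_comp[OF assms(5) f_hom[OF assms(4) u(1) iu]]
        left_hom_comp[OF assms(6) f_hom[OF assms(4) u(1) iu]]]) (use that in auto)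
  thus ?thesis using u(1) iu by blast
qed

text \<open>The generators of S are lifted to a common stage \<open>u\<close>. There the relations
  may fail, but each of them holds over L and hence from some stage \<open>K y\<close> on. An upper
  bound \<open>v\<close> of these countably many stages satisfies all relations, and the
  presentation then yields a linear map.\<close>

lemma factor:
  assumes aleph1: "\<And>X. \<lbrakk>X \<subseteq> I; countable X\<rbrakk> \<Longrightarrow> \<exists>u\<in>I. \<forall>x\<in>X. (x, u) \<in> r"
    and "presents A S X g Y" "countable X" "countable Y" "\<phi> \<in> left_hom A S L"
  shows "\<exists>i\<in>I. \<exists>\<psi>\<in>left_hom A S (M i). \<forall>s\<in>carrier S. h i (\<psi> s) = \<phi> s"
proof -
  note g = presentsD(2)[OF assms(2)]
  have "\<exists>i\<in>I. \<exists>m\<in>carrier (M i). h i m = \<phi> (g x)" if "x \<in> X" for x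
    using h_surj left_homD(1)[OF assms(5) g[OF that]] by blast
  then obtain J m where J: "\<And>x. x \<in> X \<Longrightarrow> J x \<in> I" "\<And>x. x \<in> X \<Longrightarrow> m x \<in> carrier (M (J x))"
     "\<And>x. x \<in> X \<Longrightarrow> h (J x) (m x) = \<phi> (g x)" by metis
  obtain u where u: "u \<in> I" "\<forall>x\<in>J ` X. (x, u) \<in> r"
    using aleph1[of "J ` X"] assms(3) J(1) by auto
  define n where "n = (\<lambda>x. f (J x) u (m x))"
  have n: "n x \<in> carrier (M u)" "h u (n x) = \<phi> (g x)" if "x \<in> X" for x
    using J that u f_closed h_f unfolding n_def by auto
  have nX: "n \<in> X \<rightarrow> carrier (M u)" using n by simp
  have Y: "y \<in> carrier (free_left_module A X)" if "y \<in> Y" for y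
    using presentsD(4)[OF assms(2)] that by blast
  have "\<exists>j\<in>I. (u, j) \<in> r \<and> f u j (lincomb A (M u) n y) = \<zero>\<^bsub>M j\<^esub>" if "y \<in> Y" for y
  proof (rule h_kernel[OF u(1) lincomb_closed[OF M_module[OF u(1)] nX Y[OF that]]])
    have "h u (lincomb A (M u) n y) = lincomb A L (\<lambda>x. h u (n x)) y"
      by (rule hom_lincomb[OF M_module[OF u(1)] L_module nX h_hom[OF u(1)] Y[OF that]])
    also have "\<dots> = lincomb A L (\<lambda>x. \<phi> (g x)) y"
      by (rule lincomb_cong[OF L_module _ Y[OF that]]) (use n h_closed[OF u(1)] in auto)
    also have "\<dots> = \<phi> (lincomb A S g y)"
      by (rule hom_lincomb[OF presentsD(1)[OF assms(2)] L_module presentsD(3)[OF assms(2)] assms(5) Y[OF that], symmetric])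
    also have "\<dots> = \<zero>\<^bsub>L\<^esub>"
      using presentsD(5)[OF assms(2) that] left_hom_zero[OF presentsD(1)[OF assms(2)] L_module assms(5)] by simp
    finally show "h u (lincomb A (M u) n y) = \<zero>\<^bsub>L\<^esub>" .
  qed
  then obtain K where K: "\<And>y. y \<in> Y \<Longrightarrow> K y \<in> I" "\<And>y. y \<in> Y \<Longrightarrow> (u, K y) \<in> r"
     "\<And>y. y \<in> Y \<Longrightarrow> f u (K y) (lincomb A (M u) n y) = \<zero>\<^bsub>M (K y)\<^esub>" by metis
  \<comment> \<open>Including \<open>u\<close> itself places \<open>v\<close> above \<open>u\<close>
    even if there are no relations.\<close>
  obtain v where v: "v \<in> I" "\<forall>x\<in>insert u (K ` Y). (x, v) \<in> r"
    using aleph1[of "insert u (K ` Y)"] assms(4) u(1) K(1) by auto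
  have uv: "(u, v) \<in> r" using v by simp
  define p where "p = (\<lambda>x. f u v (n x))"
  have p: "p x \<in> carrier (M v)" "h v (p x) = \<phi> (g x)" if "x \<in> X" for x
    using f_closed[OF u(1) v(1) uv] h_f[OF u(1) v(1) uv] n[OF that] unfolding p_def by auto
  have pY: "lincomb A (M v) p y = \<zero>\<^bsub>M v\<^esub>" if "y \<in> Y" for y
  proof -
    have Kv: "(K y, v) \<in> r" using v that by simp
    have "lincomb A (M v) p y = f u v (lincomb A (M u) n y)" unfolding p_def
      by (rule hom_lincomb[OF M_module[OF u(1)] M_module[OF v(1)] nX f_hom[OF u(1) v(1) uv] Y[OF that], symmetric])
    also have "\<dots> = f (K y) v (f u (K y) (lincomb A (M u) n y))"
      by (rule f_f[OF u(1) K(1)[OF that] v(1) K(2)[OF that] Kv lincomb_closed[OF M_module[OF u(1)] nX Y[OF that]], symmetric])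
    also have "\<dots> = \<zero>\<^bsub>M v\<^esub>"
      unfolding K(3)[OF that]
      by (rule left_hom_zero[OF M_module[OF K(1)[OF that]] M_module[OF v(1)] f_hom[OF K(1)[OF that] v(1) Kv]])
    finally show ?thesis .
  qed
  have pX: "p \<in> X \<rightarrow> carrier (M v)" using p by simp
  obtain \<psi> where \<psi>: "\<psi> \<in> left_hom A S (M v)" "\<And>x. x \<in> X \<Longrightarrow> \<psi> (g x) = p x"
    by (rule presents_lift[OF assms(2) M_module[OF v(1)] pX pY]) blast+
  have "h v (\<psi> s) = \<phi> s" if "s \<in> carrier S" for s
    by (rule presents_ext[OF assms(2) L_module left_hom_comp[OF \<psi>(1) h_hom[OF v(1)]] assms(5) _ that])
      (use \<psi>(2) p in simp)
  thus ?thesis using v(1) \<psi>(1) by blast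
qed

end

section \<open>Comodules and their colimits\<close>

definition mk_comodule ::
  "('a, 'm, 'y) module_scheme \<Rightarrow> ('m \<Rightarrow> ('c, 'm) tensor) \<Rightarrow> ('a, 'c, 'm) comodule" where
  "mk_comodule L \<nu> =
    \<lparr>carrier = carrier L, mult = undefined, one = undefined, zero = zero L, add = add L,
     smult = smult L, coact = \<nu>\<rparr>"

lemma mk_comodule_simps [simp]:
  "carrier (mk_comodule L \<nu>) = carrier L" "zero (mk_comodule L \<nu>) = zero L"
  "add (mk_comodule L \<nu>) = add L" "smult (mk_comodule L \<nu>) = smult L" "coact (mk_comodule L \<nu>) = \<nu>"
  by (simp_all add: mk_comodule_def)

text \<open>A module and the comodule built on it are records of different types, so the tensor
  constructions over them are different terms. These rules let the coaction disappear from all of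
  them.\<close>

lemma mk_comodule_tensor [simp]:
  "tensor_group A C (mk_comodule L \<nu>) = tensor_group A C L"
  "pure_tensor A C (mk_comodule L \<nu>) = pure_tensor A C L"
  "tensor_map A C (mk_comodule L \<nu>) = tensor_map A C L"
  "tensor_module A C (mk_comodule L \<nu>) = tensor_module A C L"
proof -
  have 1: "tensor_relations A C (mk_comodule L \<nu>) = tensor_relations A C L"
    by (simp add: tensor_relations_def)
  show 2: "tensor_group A C (mk_comodule L \<nu>) = tensor_group A C L"
    by (simp add: tensor_group_def 1)
  show 3: "pure_tensor A C (mk_comodule L \<nu>) = pure_tensor A C L"
    by (intro ext) (simp add: pure_tensor_def 1)
  show 4: "tensor_map A C (mk_comodule L \<nu>) = tensor_map A C L"
    by (intro ext) (simp add: tensor_map_def 2 3)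
  show "tensor_module A C (mk_comodule L \<nu>) = tensor_module A C L"
    by (simp add: tensor_module_def 2 4)
qed

lemma mk_comodule_left_hom [simp]:
  "left_hom A (mk_comodule L \<nu>) N = left_hom A L N" "left_hom A N (mk_comodule L \<nu>) = left_hom A N L"
  by (simp_all add: left_hom_def)

lemma mk_comodule_left_module [simp]: "left_module A (mk_comodule L \<nu>) \<longleftrightarrow> left_module A L"
  using left_module_cong[of A L "mk_comodule L \<nu>"] left_module_cong[of A "mk_comodule L \<nu>" L] by auto

lemma mk_comodule_cmult [simp]: "cmult A C (mk_comodule L \<nu>) = cmult A C L"
  by (intro ext) (simp add: cmult_def tensor_assoc_def Let_def)

lemma comoduleD:
  assumes "comodule A C M"
  shows "left_module A M" "coring A C" "coact M \<in> left_hom A M (tensor_module A C M)"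
    "m \<in> carrier M \<Longrightarrow> coact M m \<in> carrier (tensor_group A C M)"
    "m \<in> carrier M \<Longrightarrow> cmult A C M (coact M m) =
      tensor_map A C (tensor_module A C M) id (coact M) (coact M m)"
    "m \<in> carrier M \<Longrightarrow> ccounit A C M (coact M m) = m"
proof -
  interpret comodule A C M by fact
  show "left_module A M" "coring A C" "coact M \<in> left_hom A M (tensor_module A C M)"
    using M.left_module_axioms C.coring_axioms coact_hom by auto
  show "m \<in> carrier M \<Longrightarrow> coact M m \<in> carrier (tensor_group A C M)"
    using left_homD(1)[OF coact_hom] by simp
  show "m \<in> carrier M \<Longrightarrow> cmult A C M (coact M m) =
      tensor_map A C (tensor_module A C M) id (coact M) (coact M m)"
    using coact_coassoc by (simp add: cmult_def)
  show "m \<in> carrier M \<Longrightarrow> ccounit A C M (coact M m) = m"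
    using coact_counit by (simp add: ccounit_def)
qed

lemma comodule_homD:
  assumes "f \<in> comodule_hom A C M N"
  shows "f \<in> left_hom A M N" "f \<in> extensional (carrier M)" "m \<in> carrier M \<Longrightarrow> f m \<in> carrier N"
    "m \<in> carrier M \<Longrightarrow> coact N (f m) = tensor_map A C N id f (coact M m)"
  using assms by (auto simp: comodule_hom_def left_homD)

section \<open>Comodules and their morphisms as a category\<close>

context coring
begin

text \<open>Unlike \<open>cmult\<close>, \<open>ccounit\<close> takes its values in the record
  itself, through finite sums formed there, and simplification does not see through these.
  Naturality along the identity function, which is linear between the two records, identifies the
  two maps.\<close>

lemma mk_comodule_ccounit:
  fixes L :: "('a, 'm, 'y) module_scheme" and \<nu> :: "'m \<Rightarrow> ('c, 'm) tensor"
  assumes "left_module A L" "t \<in> carrier (tensor_group A C L)"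
  shows "ccounit A C (mk_comodule L \<nu>) t = ccounit A C L t"
  using ccounit_nat[of "mk_comodule L \<nu>" L "\<lambda>x. x" t] assms T_id[OF assms]
  by (simp add: left_hom_id(2))

lemma mk_comoduleI:
  fixes L :: "('a, 'm, 'y) module_scheme"
  assumes "left_module A L" "\<nu> \<in> left_hom A L (tensor_module A C L)"
    and "\<And>m. m \<in> carrier L \<Longrightarrow> cmult A C L (\<nu> m) = tensor_map A C (tensor_module A C L) id \<nu> (\<nu> m)"
    and "\<And>m. m \<in> carrier L \<Longrightarrow> ccounit A C L (\<nu> m) = m"
  shows "comodule A C (mk_comodule L \<nu>)"
proof -
  let ?M = "mk_comodule L \<nu> :: ('a, 'c, 'm) comodule"
  have "comodule_axioms A C ?M"
  proof
    show "coact ?M \<in> left_hom A ?M (tensor_module A C ?M)" using assms(2) by simp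
    fix m assume m: "m \<in> carrier ?M"
    have "cmult A C ?M (coact ?M m) = tensor_map A C (tensor_module A C ?M) id (coact ?M) (coact ?M m)"
      using assms(3) m by simp
    thus "tensor_assoc A C C ?M (tensor_map A (tensor_bimodule A C C) ?M (comult C) id (coact ?M m)) =
      tensor_map A C (tensor_module A C ?M) id (coact ?M) (coact ?M m)"
      unfolding cmult_def .
    have "ccounit A C ?M (coact ?M m) = m"
      using assms(4) m mk_comodule_ccounit[OF assms(1), of "\<nu> m" \<nu>] left_homD(1)[OF assms(2), of m]
      by simp
    thus "tensor_lunit ?M (tensor_map A (regular_bimodule A) ?M (counit C) id (coact ?M m)) = m"
      unfolding ccounit_def .
  qed
  thus ?thesis using assms(1) coring_axioms by (simp add: comodule_def)
qed

lemma comodule_homI: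
  assumes "comodule A C M" "comodule A C N" "f \<in> left_hom A M N"
    and "\<And>m. m \<in> carrier M \<Longrightarrow> coact N (f m) = tensor_map A C N id f (coact M m)"
  shows "restrict f (carrier M) \<in> comodule_hom A C M N"
proof -
  note M = comoduleD[OF assms(1)] and N = comoduleD[OF assms(2)]
  have r: "restrict f (carrier M) \<in> left_hom A M N"
    by (rule left_hom_cong[OF M(1) assms(3)]) simp
  have "tensor_map A C N id (restrict f (carrier M)) (coact M m) = tensor_map A C N id f (coact M m)"
    if "m \<in> carrier M" for m
    by (rule T_cong[OF M(1) N(1) r assms(3) _ M(4)[OF that]]) simp
  thus ?thesis using r assms(4) by (simp add: comodule_hom_def)
qed

lemma comodule_hom_id:
  assumes "comodule A C M"
  shows "(\<lambda>x\<in>carrier M. x) \<in> comodule_hom A C M M"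
  by (rule comodule_homI[OF assms assms left_hom_id(2)])
    (simp add: T_id[OF comoduleD(1)[OF assms] comoduleD(4)[OF assms]])

lemma comodule_hom_comp:
  assumes "comodule A C L" "comodule A C M" "comodule A C N"
    and "f \<in> comodule_hom A C L M" "g \<in> comodule_hom A C M N"
  shows "compose (carrier L) g f \<in> comodule_hom A C L N"
  unfolding compose_def
proof (rule comodule_homI[OF assms(1,3)])
  note L = comoduleD[OF assms(1)] and M = comoduleD[OF assms(2)] and N = comoduleD[OF assms(3)]
  note f = comodule_homD[OF assms(4)] and g = comodule_homD[OF assms(5)]
  show "(\<lambda>x. g (f x)) \<in> left_hom A L N" by (rule left_hom_comp[OF f(1) g(1)])
  fix m assume m: "m \<in> carrier L"
  show "coact N (g (f m)) = tensor_map A C N id (\<lambda>x. g (f x)) (coact L m)"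
    using f(4)[OF m] g(4)[OF f(3)[OF m]] T_comp[OF L(1) M(1) N(1) f(1) g(1) L(4)[OF m]] by simp
qed

lemma category_Comod:
  fixes \<kappa> :: "'u rel"
  shows "category (Comod \<kappa> A C)"
proof
  fix W X Y Z :: "('a, 'c, 'u) comodule" and f g h
  assume "W \<in> Obj (Comod \<kappa> A C)" "X \<in> Obj (Comod \<kappa> A C)" "Y \<in> Obj (Comod \<kappa> A C)"
    and f: "f \<in> Hom (Comod \<kappa> A C) W X" and g: "g \<in> Hom (Comod \<kappa> A C) X Y"
  thus "Cmp (Comod \<kappa> A C) W Y Z h (Cmp (Comod \<kappa> A C) W X Y g f) =
      Cmp (Comod \<kappa> A C) W X Z (Cmp (Comod \<kappa> A C) X Y Z h g) f"
    by (auto simp: Comod_def compose_def fun_eq_iff comodule_homD(3))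
next
  fix X Y :: "('a, 'c, 'u) comodule" and f
  assume "X \<in> Obj (Comod \<kappa> A C)" "Y \<in> Obj (Comod \<kappa> A C)" and f: "f \<in> Hom (Comod \<kappa> A C) X Y"
  hence f: "f \<in> comodule_hom A C X Y" by (simp add: Comod_def)
  have "f \<in> extensional (carrier X)" by (rule comodule_homD(2)[OF f])
  thus "Cmp (Comod \<kappa> A C) X X Y f (Idt (Comod \<kappa> A C) X) = f"
      "Cmp (Comod \<kappa> A C) X Y Y (Idt (Comod \<kappa> A C) Y) f = f"
    by (auto simp: Comod_def compose_def fun_eq_iff comodule_homD(3)[OF f] extensional_def)
next
  fix X Y Z :: "('a, 'c, 'u) comodule" and f g
  assume "X \<in> Obj (Comod \<kappa> A C)" "Y \<in> Obj (Comod \<kappa> A C)" "Z \<in> Obj (Comod \<kappa> A C)"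
    "f \<in> Hom (Comod \<kappa> A C) X Y" "g \<in> Hom (Comod \<kappa> A C) Y Z"
  thus "Cmp (Comod \<kappa> A C) X Y Z g f \<in> Hom (Comod \<kappa> A C) X Z"
    using comodule_hom_comp[of X Y Z f g] by (simp add: Comod_def)
qed (simp add: Comod_def comodule_hom_id)

end

lemma mspan_ext:
  assumes "left_module A M" "left_module A N" "Y \<subseteq> carrier M" "f \<in> left_hom A M N" "g \<in> left_hom A M N"
    and "\<And>y. y \<in> Y \<Longrightarrow> f y = g y" "v \<in> mspan A M Y"
  shows "f v = g v"
proof -
  interpret M: left_module A M by fact
  show ?thesis using assms(7)
  proof (induction rule: mspan.induct)
    case zero
    then show ?case using left_hom_zero[OF assms(1,2,4)] left_hom_zero[OF assms(1,2,5)] by simp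
  next
    case (step y a v)
    have "y \<in> carrier M" "v \<in> carrier M" using step assms(3) M.mspan_closed by auto
    then show ?case using step assms(6)
      by (simp add: left_homD[OF assms(4)] left_homD[OF assms(5)] M.smult_closed)
  qed
qed

lemma Comod_simps [simp]:
  "X \<in> Obj (Comod \<kappa> A C) \<longleftrightarrow> comodule A C X \<and> small \<kappa> (carrier X)"
  "Hom (Comod \<kappa> A C) = comodule_hom A C"
  "Cmp (Comod \<kappa> A C) X Y Z g f = compose (carrier X) g f"
  "Idt (Comod \<kappa> A C) X = (\<lambda>x\<in>carrier X. x)"
  by (simp_all add: Comod_def)

lemma Comod_functorD:
  assumes "is_functor J (Comod \<kappa> A C) D"
  shows "i \<in> Obj J \<Longrightarrow> comodule A C (fobj D i)" "i \<in> Obj J \<Longrightarrow> small \<kappa> (carrier (fobj D i))"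
    "i \<in> Obj J \<Longrightarrow> left_module A (fobj D i)"
    "\<lbrakk>i \<in> Obj J; j \<in> Obj J; u \<in> Hom J i j\<rbrakk> \<Longrightarrow> fmap D i j u \<in> comodule_hom A C (fobj D i) (fobj D j)"
    "\<lbrakk>i \<in> Obj J; x \<in> carrier (fobj D i)\<rbrakk> \<Longrightarrow> fmap D i i (Idt J i) x = x"
    "\<lbrakk>i \<in> Obj J; j \<in> Obj J; k \<in> Obj J; u \<in> Hom J i j; v \<in> Hom J j k; x \<in> carrier (fobj D i)\<rbrakk> \<Longrightarrow>
      fmap D j k v (fmap D i j u x) = fmap D i k (Cmp J i j k v u) x"
  using assms comoduleD(1) by (auto simp: is_functor_def compose_eq)

text \<open>Colimits of comodules are recognised on the level of modules. The linear map supplied by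
  \<open>lift\<close> respects the coactions automatically: the two linear maps from X to
  \<open>tensor_module A C N\<close> that have to agree do so on the images of the cocone, and by
  \<open>gen\<close> these span X. The same argument gives uniqueness.\<close>

lemma (in coring) comod_colimitI:
  fixes \<kappa> :: "'u rel"
    and D :: "('i, 'n, ('a, 'c, 'u) comodule, 'u \<Rightarrow> 'u) functor_data"
    and X :: "('a, 'c, 'u) comodule"
  assumes D: "is_functor J (Comod \<kappa> A C) D" and X: "X \<in> Obj (Comod \<kappa> A C)"
    and \<xi>: "\<And>i. i \<in> Obj J \<Longrightarrow> \<xi> i \<in> comodule_hom A C (fobj D i) X"
    and compat: "\<And>i j u x. \<lbrakk>i \<in> Obj J; j \<in> Obj J; u \<in> Hom J i j; x \<in> carrier (fobj D i)\<rbrakk> \<Longrightarrow>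
      \<xi> j (fmap D i j u x) = \<xi> i x"
    and gen: "\<And>x. x \<in> carrier X \<Longrightarrow> x \<in> mspan A X (\<Union>i\<in>Obj J. \<xi> i ` carrier (fobj D i))"
    and lift: "\<And>(N :: ('a, 'c, 'u) comodule) \<eta>. \<lbrakk>left_module A N;
      \<And>i. i \<in> Obj J \<Longrightarrow> \<eta> i \<in> left_hom A (fobj D i) N;
      \<And>i j u x. \<lbrakk>i \<in> Obj J; j \<in> Obj J; u \<in> Hom J i j; x \<in> carrier (fobj D i)\<rbrakk> \<Longrightarrow>
        \<eta> j (fmap D i j u x) = \<eta> i x\<rbrakk> \<Longrightarrow>
      \<exists>k\<in>left_hom A X N. \<forall>i\<in>Obj J. \<forall>x\<in>carrier (fobj D i). k (\<xi> i x) = \<eta> i x"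
  shows "is_colimit J (Comod \<kappa> A C) D X \<xi>"
proof -
  note DD = Comod_functorD[OF D]
  have Xc: "comodule A C X" using X by simp
  note Xm = comoduleD[OF Xc]
  let ?Y = "\<Union>i\<in>Obj J. \<xi> i ` carrier (fobj D i)"
  have Y: "?Y \<subseteq> carrier X" using comodule_homD(3)[OF \<xi>] by blast
  \<comment> \<open>One extensionality principle stated at two types of targets: \<open>ext1\<close>
    for maps into comodules, \<open>ext2\<close> for maps into tensor products.\<close>
  have ext1: "f v = g v" if "left_module A N" "f \<in> left_hom A X N" "g \<in> left_hom A X N"
    "\<And>i x. \<lbrakk>i \<in> Obj J; x \<in> carrier (fobj D i)\<rbrakk> \<Longrightarrow> f (\<xi> i x) = g (\<xi> i x)" "v \<in> carrier X"
    for f g v and N :: "('a, 'c, 'u) comodule"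
    by (rule mspan_ext[OF Xm(1) that(1) Y that(2,3) _ gen[OF that(5)]]) (use that(4) in auto)
  have ext2: "f v = g v" if "left_module A N" "f \<in> left_hom A X N" "g \<in> left_hom A X N"
    "\<And>i x. \<lbrakk>i \<in> Obj J; x \<in> carrier (fobj D i)\<rbrakk> \<Longrightarrow> f (\<xi> i x) = g (\<xi> i x)" "v \<in> carrier X"
    for f g v and N :: "('a, ('c, 'u) tensor) module"
    by (rule mspan_ext[OF Xm(1) that(1) Y that(2,3) _ gen[OF that(5)]]) (use that(4) in auto)
  have "compose (carrier (fobj D i)) (\<xi> j) (fmap D i j u) = \<xi> i"
    if "i \<in> Obj J" "j \<in> Obj J" "u \<in> Hom J i j" for i j u
    using compat[OF that] comodule_homD(2)[OF \<xi>[OF that(1)]]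
    by (auto simp: compose_def fun_eq_iff extensional_def)
  hence cocone: "is_cocone J (Comod \<kappa> A C) D X \<xi>" using X \<xi> by (simp add: is_cocone_def)
  moreover have "\<exists>!h. h \<in> comodule_hom A C X N \<and> (\<forall>i\<in>Obj J. compose (carrier (fobj D i)) h (\<xi> i) = \<eta> i)"
    if "is_cocone J (Comod \<kappa> A C) D N \<eta>" for N \<eta>
  proof -
    have N: "comodule A C N" and \<eta>: "\<And>i. i \<in> Obj J \<Longrightarrow> \<eta> i \<in> comodule_hom A C (fobj D i) N"
      and c: "\<And>i j u. \<lbrakk>i \<in> Obj J; j \<in> Obj J; u \<in> Hom J i j\<rbrakk> \<Longrightarrow>
        compose (carrier (fobj D i)) (\<eta> j) (fmap D i j u) = \<eta> i"
      using that by (auto simp: is_cocone_def)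
    note Nm = comoduleD[OF N]
    have c': "\<eta> j (fmap D i j u x) = \<eta> i x" if "i \<in> Obj J" "j \<in> Obj J" "u \<in> Hom J i j" "x \<in> carrier (fobj D i)" for i j u x
      using fun_cong[OF c[OF that(1-3)], of x] that(4) by (simp add: compose_eq)
    have \<eta>1: "\<And>i. i \<in> Obj J \<Longrightarrow> \<eta> i \<in> left_hom A (fobj D i) N" using comodule_homD(1)[OF \<eta>] by simp
    obtain k where k: "k \<in> left_hom A X N" "\<And>i x. \<lbrakk>i \<in> Obj J; x \<in> carrier (fobj D i)\<rbrakk> \<Longrightarrow> k (\<xi> i x) = \<eta> i x"
      using lift[OF Nm(1) \<eta>1 c'] by blast
    have co: "coact N (k x) = tensor_map A C N id k (coact X x)" if "x \<in> carrier X" for x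
    proof (rule ext2[OF T_left_module[OF Nm(1)] left_hom_comp[OF k(1) Nm(3)]
          left_hom_comp[OF Xm(3) T_hom[OF Xm(1) Nm(1) k(1)]] _ that])
      fix i x assume ix: "i \<in> Obj J" "x \<in> carrier (fobj D i)"
      note Di = comoduleD[OF DD(1)[OF ix(1)]]
      have "coact N (k (\<xi> i x)) = tensor_map A C N id (\<eta> i) (coact (fobj D i) x)"
        using k(2)[OF ix] comodule_homD(4)[OF \<eta>[OF ix(1)] ix(2)] by simp
      also have "\<dots> = tensor_map A C N id (\<lambda>x. k (\<xi> i x)) (coact (fobj D i) x)"
        by (rule T_cong[OF Di(1) Nm(1) \<eta>1[OF ix(1)] left_hom_comp[OF comodule_homD(1)[OF \<xi>[OF ix(1)]] k(1)] _ Di(4)[OF ix(2)]])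
          (use k(2) ix(1) in simp)
      also have "\<dots> = tensor_map A C N id k (tensor_map A C X id (\<xi> i) (coact (fobj D i) x))"
        by (rule T_comp[OF Di(1) Xm(1) Nm(1) comodule_homD(1)[OF \<xi>[OF ix(1)]] k(1) Di(4)[OF ix(2)], symmetric])
      also have "\<dots> = tensor_map A C N id k (coact X (\<xi> i x))"
        using comodule_homD(4)[OF \<xi>[OF ix(1)] ix(2)] by simp
      finally show "coact N (k (\<xi> i x)) = tensor_map A C N id k (coact X (\<xi> i x))" .
    qed
    show ?thesis
    proof (rule ex1I[of _ "restrict k (carrier X)"], intro conjI ballI)
      show "restrict k (carrier X) \<in> comodule_hom A C X N" by (rule comodule_homI[OF Xc N k(1) co])
      fix i assume i: "i \<in> Obj J"
      show "compose (carrier (fobj D i)) (restrict k (carrier X)) (\<xi> i) = \<eta> i"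
        using k(2)[OF i] comodule_homD(2)[OF \<eta>[OF i]] comodule_homD(3)[OF \<xi>[OF i]]
        by (auto simp: compose_def fun_eq_iff extensional_def)
    next
      fix h assume h: "h \<in> comodule_hom A C X N \<and> (\<forall>i\<in>Obj J. compose (carrier (fobj D i)) h (\<xi> i) = \<eta> i)"
      have "h v = k v" if "v \<in> carrier X" for v
      proof (rule ext1[OF Nm(1) comodule_homD(1)[OF conjunct1[OF h]] k(1) _ that])
        fix i x assume ix: "i \<in> Obj J" "x \<in> carrier (fobj D i)"
        show "h (\<xi> i x) = k (\<xi> i x)"
          using fun_cong[OF bspec[OF conjunct2[OF h] ix(1)], of x] ix k(2) by (simp add: compose_eq)
      qed
      thus "h = restrict k (carrier X)"
        using comodule_homD(2)[OF conjunct1[OF h]] by (auto simp: fun_eq_iff extensional_def)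
    qed
  qed
  ultimately show ?thesis by (simp add: is_colimit_def)
qed

section \<open>Construction of colimits by generators and relations\<close>

definition colim_gens :: "('i, 'n) category \<Rightarrow> ('i \<Rightarrow> ('a, 'm, 'y) module_scheme) \<Rightarrow> ('i \<times> 'm) set" where
  "colim_gens J D = (SIGMA i:Obj J. carrier (D i))"

text \<open>The first two families force the inclusion of each \<open>D i\<close> to be additive and
  homogeneous, the third identifies an element with its images under the maps of the diagram. The
  module presented by them is the colimit of the underlying modules.\<close>

definition colim_rels ::
  "('a, 'r) ring_scheme \<Rightarrow> ('i, 'n) category \<Rightarrow> ('i \<Rightarrow> ('a, 'm, 'y) module_scheme) \<Rightarrow>
    ('i \<Rightarrow> 'i \<Rightarrow> 'n \<Rightarrow> 'm \<Rightarrow> 'm) \<Rightarrow> ('i \<times> 'm \<Rightarrow> 'a) set" where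
  "colim_rels A J D d =
    (let F = free_left_module A (colim_gens J D) in
      {unit_vec A (i, x \<oplus>\<^bsub>D i\<^esub> y) \<ominus>\<^bsub>F\<^esub> (unit_vec A (i, x) \<oplus>\<^bsub>F\<^esub> unit_vec A (i, y)) | i x y.
        i \<in> Obj J \<and> x \<in> carrier (D i) \<and> y \<in> carrier (D i)} \<union>
      {unit_vec A (i, a \<odot>\<^bsub>D i\<^esub> x) \<ominus>\<^bsub>F\<^esub> a \<odot>\<^bsub>F\<^esub> unit_vec A (i, x) | i x a.
        i \<in> Obj J \<and> x \<in> carrier (D i) \<and> a \<in> carrier A} \<union>
      {unit_vec A (j, d i j u x) \<ominus>\<^bsub>F\<^esub> unit_vec A (i, x) | i j u x.
        i \<in> Obj J \<and> j \<in> Obj J \<and> u \<in> Hom J i j \<and> x \<in> carrier (D i)})"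

locale module_diagram =
  fixes A :: "('a, 'r) ring_scheme" and J :: "('i, 'n) category"
    and D :: "'i \<Rightarrow> ('a, 'm, 'y) module_scheme" and d :: "'i \<Rightarrow> 'i \<Rightarrow> 'n \<Rightarrow> 'm \<Rightarrow> 'm"
  assumes A_ring: "ring A" and D_module: "i \<in> Obj J \<Longrightarrow> left_module A (D i)"
    and d_closed: "\<lbrakk>i \<in> Obj J; j \<in> Obj J; u \<in> Hom J i j; x \<in> carrier (D i)\<rbrakk> \<Longrightarrow> d i j u x \<in> carrier (D j)"
begin

abbreviation "G \<equiv> colim_gens J D"
abbreviation "FG \<equiv> free_left_module A G"

sublocale FG: left_module A FG by (rule free_left_module[OF A_ring])

lemma unit_closed: "\<lbrakk>i \<in> Obj J; x \<in> carrier (D i)\<rbrakk> \<Longrightarrow> unit_vec A (i, x) \<in> carrier FG"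
  by (rule unit_vec_closed[OF A_ring]) (simp add: colim_gens_def)

lemma D_add: "\<lbrakk>i \<in> Obj J; x \<in> carrier (D i); y \<in> carrier (D i)\<rbrakk> \<Longrightarrow> x \<oplus>\<^bsub>D i\<^esub> y \<in> carrier (D i)"
proof -
  assume *: "i \<in> Obj J" "x \<in> carrier (D i)" "y \<in> carrier (D i)"
  interpret left_module A "D i" by (rule D_module[OF *(1)])
  show ?thesis using * by simp
qed

lemma D_smult: "\<lbrakk>i \<in> Obj J; x \<in> carrier (D i); a \<in> carrier A\<rbrakk> \<Longrightarrow> a \<odot>\<^bsub>D i\<^esub> x \<in> carrier (D i)"
  using left_module.smult_closed[OF D_module] by blast

lemma rels_sub: "colim_rels A J D d \<subseteq> carrier FG"
  unfolding colim_rels_def Let_def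
  by (auto intro!: FG.M.minus_closed FG.M.add.m_closed FG.smult_closed unit_closed d_closed D_add D_smult)

text \<open>A dictionary between relations and cocones. Read from left to right it makes the
  generators of the presented module a cocone (\<open>colimit_cocone\<close>); read from right to
  left it turns a cocone into a map out of that module (\<open>colimit_lift\<close>).\<close>

lemma rels_vanish_iff:
  assumes "left_module A N" "h \<in> G \<rightarrow> carrier N"
  shows "(\<forall>y\<in>colim_rels A J D d. lincomb A N h y = \<zero>\<^bsub>N\<^esub>) \<longleftrightarrow>
    (\<forall>i\<in>Obj J. (\<lambda>x. h (i, x)) \<in> left_hom A (D i) N) \<and>
    (\<forall>i\<in>Obj J. \<forall>j\<in>Obj J. \<forall>u\<in>Hom J i j. \<forall>x\<in>carrier (D i). h (j, d i j u x) = h (i, x))"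
proof -
  interpret N: left_module A N by fact
  note hm = lincomb_hom[OF assms]
  have hc: "h (i, x) \<in> carrier N" if "i \<in> Obj J" "x \<in> carrier (D i)" for i x
    using assms(2) that by (auto simp: colim_gens_def)
  have u: "lincomb A N h (unit_vec A (i, x)) = h (i, x)" if "i \<in> Obj J" "x \<in> carrier (D i)" for i x
    using lincomb_unit_vec[where A = A and M = N and g = h and x = "(i, x)"] assms(1) hc[OF that] by blast
  note diff = left_hom_diff[OF FG.left_module_axioms assms(1) hm]
  have 1: "lincomb A N h (unit_vec A (i, x \<oplus>\<^bsub>D i\<^esub> y) \<ominus>\<^bsub>FG\<^esub> (unit_vec A (i, x) \<oplus>\<^bsub>FG\<^esub> unit_vec A (i, y))) = \<zero>\<^bsub>N\<^esub>
     \<longleftrightarrow> h (i, x \<oplus>\<^bsub>D i\<^esub> y) = h (i, x) \<oplus>\<^bsub>N\<^esub> h (i, y)" if "i \<in> Obj J" "x \<in> carrier (D i)" "y \<in> carrier (D i)" for i x y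
    using that D_add[OF that]
    by (simp add: diff unit_closed u left_homD(2)[OF hm] hc N.M.diff_zero_iff)
  have 2: "lincomb A N h (unit_vec A (i, a \<odot>\<^bsub>D i\<^esub> x) \<ominus>\<^bsub>FG\<^esub> a \<odot>\<^bsub>FG\<^esub> unit_vec A (i, x)) = \<zero>\<^bsub>N\<^esub>
     \<longleftrightarrow> h (i, a \<odot>\<^bsub>D i\<^esub> x) = a \<odot>\<^bsub>N\<^esub> h (i, x)" if "i \<in> Obj J" "x \<in> carrier (D i)" "a \<in> carrier A" for i x a
    using that D_smult[OF that]
    by (simp add: diff unit_closed u left_homD(3)[OF hm] hc N.M.diff_zero_iff FG.smult_closed N.smult_closed)
  have 3: "lincomb A N h (unit_vec A (j, d i j u x) \<ominus>\<^bsub>FG\<^esub> unit_vec A (i, x)) = \<zero>\<^bsub>N\<^esub>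
     \<longleftrightarrow> h (j, d i j u x) = h (i, x)" if "i \<in> Obj J" "j \<in> Obj J" "u \<in> Hom J i j" "x \<in> carrier (D i)" for i j u x
    using that d_closed[OF that] by (simp add: diff unit_closed u hc N.M.diff_zero_iff)
  have "(\<forall>y\<in>colim_rels A J D d. lincomb A N h y = \<zero>\<^bsub>N\<^esub>) \<longleftrightarrow>
    (\<forall>i\<in>Obj J. \<forall>x\<in>carrier (D i). \<forall>y\<in>carrier (D i). h (i, x \<oplus>\<^bsub>D i\<^esub> y) = h (i, x) \<oplus>\<^bsub>N\<^esub> h (i, y)) \<and>
    (\<forall>i\<in>Obj J. \<forall>x\<in>carrier (D i). \<forall>a\<in>carrier A. h (i, a \<odot>\<^bsub>D i\<^esub> x) = a \<odot>\<^bsub>N\<^esub> h (i, x)) \<and>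
    (\<forall>i\<in>Obj J. \<forall>j\<in>Obj J. \<forall>u\<in>Hom J i j. \<forall>x\<in>carrier (D i). h (j, d i j u x) = h (i, x))" (is "?L \<longleftrightarrow> ?R1 \<and> ?R2 \<and> ?R3")
  proof
    assume L: ?L
    have "?R1" using L 1 unfolding colim_rels_def Let_def by blast
    moreover have "?R2" using L 2 unfolding colim_rels_def Let_def by blast
    moreover have "?R3" using L 3 unfolding colim_rels_def Let_def by blast
    ultimately show "?R1 \<and> ?R2 \<and> ?R3" by blast
  next
    assume "?R1 \<and> ?R2 \<and> ?R3"
    thus ?L using 1 2 3 unfolding colim_rels_def Let_def by auto
  qed
  thus ?thesis using hc by (auto simp: left_hom_def Pi_iff)
qed

lemma colimit_cocone:
  assumes "presents A L G \<gamma> (colim_rels A J D d)"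
  shows "i \<in> Obj J \<Longrightarrow> (\<lambda>x. \<gamma> (i, x)) \<in> left_hom A (D i) L"
    "\<lbrakk>i \<in> Obj J; j \<in> Obj J; u \<in> Hom J i j; x \<in> carrier (D i)\<rbrakk> \<Longrightarrow> \<gamma> (j, d i j u x) = \<gamma> (i, x)"
  using rels_vanish_iff[OF presentsD(1,3)[OF assms]] presentsD(5)[OF assms] by blast+

lemma colimit_lift:
  assumes "presents A L G \<gamma> (colim_rels A J D d)" "left_module A N"
    and "\<And>i. i \<in> Obj J \<Longrightarrow> \<eta> i \<in> left_hom A (D i) N"
    and "\<And>i j u x. \<lbrakk>i \<in> Obj J; j \<in> Obj J; u \<in> Hom J i j; x \<in> carrier (D i)\<rbrakk> \<Longrightarrow> \<eta> j (d i j u x) = \<eta> i x"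
  obtains k where "k \<in> left_hom A L N" "\<And>i x. \<lbrakk>i \<in> Obj J; x \<in> carrier (D i)\<rbrakk> \<Longrightarrow> k (\<gamma> (i, x)) = \<eta> i x"
proof -
  let ?h = "\<lambda>p. \<eta> (fst p) (snd p)"
  have h: "?h \<in> G \<rightarrow> carrier N" using left_homD(1)[OF assms(3)] by (auto simp: colim_gens_def)
  have "(\<lambda>x. \<eta> i x) \<in> left_hom A (D i) N" if "i \<in> Obj J" for i using assms(3)[OF that] by simp
  hence "\<forall>y\<in>colim_rels A J D d. lincomb A N ?h y = \<zero>\<^bsub>N\<^esub>"
    unfolding rels_vanish_iff[OF assms(2) h] using assms(4) by simp
  hence van: "lincomb A N ?h y = \<zero>\<^bsub>N\<^esub>" if "y \<in> colim_rels A J D d" for y using that by simp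
  obtain k where k: "k \<in> left_hom A L N" "\<And>p. p \<in> G \<Longrightarrow> k (\<gamma> p) = ?h p"
    by (rule presents_lift[OF assms(1,2) h van]) blast+
  show thesis
  proof (rule that[OF k(1)])
    show "k (\<gamma> (i, x)) = \<eta> i x" if "i \<in> Obj J" "x \<in> carrier (D i)" for i x
      using k(2)[of "(i, x)"] that by (simp add: colim_gens_def)
  qed
qed

lemma colimit_ext:
  assumes "presents A L G \<gamma> (colim_rels A J D d)" "left_module A N" "k \<in> left_hom A L N" "k' \<in> left_hom A L N"
    and "\<And>i x. \<lbrakk>i \<in> Obj J; x \<in> carrier (D i)\<rbrakk> \<Longrightarrow> k (\<gamma> (i, x)) = k' (\<gamma> (i, x))" "y \<in> carrier L"
  shows "k y = k' y"
  by (rule presents_ext[OF assms(1-4) _ assms(6)]) (use assms(5) in \<open>auto simp: colim_gens_def\<close>)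

end

lemma presents_mspan:
  assumes "presents A L X g Y" "g ` X \<subseteq> Z" "Z \<subseteq> carrier L" "y \<in> carrier L"
  shows "y \<in> mspan A L Z"
proof -
  interpret L: left_module A L by (rule presentsD(1)[OF assms(1)])
  interpret F: left_module A "free_left_module A X" by (rule free_left_module[OF L.R.ring_axioms])
  note h = lincomb_hom[OF presentsD(1,3)[OF assms(1)]]
  obtain v where v: "v \<in> carrier (free_left_module A X)" "y = lincomb A L g v" using presentsD(7)[OF assms(1,4)] by blast
  from L.R.ring_axioms v(1) have "lincomb A L g v \<in> mspan A L Z"
  proof (induction rule: free_induct)
    case zero
    then show ?case using left_hom_zero[OF F.left_module_axioms L.left_module_axioms h] mspan.zero by metis
  next
    case (step a x v)
    have u: "unit_vec A x \<in> carrier (free_left_module A X)" by (rule unit_vec_closed[OF L.R.ring_axioms step(2)])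
    have gx: "g x \<in> carrier L" using presentsD(2)[OF assms(1) step(2)] .
    have "lincomb A L g (a \<odot>\<^bsub>free_left_module A X\<^esub> unit_vec A x \<oplus>\<^bsub>free_left_module A X\<^esub> v) =
        a \<odot>\<^bsub>L\<^esub> g x \<oplus>\<^bsub>L\<^esub> lincomb A L g v"
      using step u gx by (simp add: left_homD[OF h] F.smult_closed lincomb_unit_vec[OF L.left_module_axioms])
    then show ?case using mspan.step[of "g x" Z a A "lincomb A L g v" L] step assms(2) by auto
  qed
  thus ?thesis using v(2) by simp
qed

lemma Comod_module_diagram:
  assumes "coring A C" "is_functor J (Comod \<kappa> A C) D"
  shows "module_diagram A J (fobj D) (fmap D)"
proof (rule module_diagram.intro)
  show "ring A" by (rule coring.ring_A[OF assms(1)])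
  show "left_module A (fobj D i)" if "i \<in> Obj J" for i using Comod_functorD(3)[OF assms(2) that] .
  show "fmap D i j u x \<in> carrier (fobj D j)" if "i \<in> Obj J" "j \<in> Obj J" "u \<in> Hom J i j" "x \<in> carrier (fobj D i)" for i j u x
    using comodule_homD(3)[OF Comod_functorD(4)[OF assms(2) that(1-3)] that(4)] .
qed

text \<open>The coactions of the \<open>D i\<close>, followed by the maps that the cocone induces on
  tensor products, form a cocone and thus induce a coaction on the colimit module. Its axioms are
  equalities of linear maps out of the colimit; on the image of \<open>D i\<close> they follow from
  those of \<open>D i\<close> by naturality of \<open>cmult\<close> and \<open>ccounit\<close>. The
  presentation belongs to the conclusion because \<open>presented_directed\<close> reads off from it
  when an element vanishes.\<close>

lemma (in coring) Comod_colimit_exists: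
  fixes \<kappa> :: "'u rel" and D :: "('i, 'n, ('a, 'c, 'u) comodule, 'u \<Rightarrow> 'u) functor_data"
  assumes "universe \<kappa>" "small \<kappa> (carrier A)" "is_functor J (Comod \<kappa> A C) D" "small \<kappa> (Obj J)"
  obtains X \<xi> \<gamma> where "is_colimit J (Comod \<kappa> A C) D X \<xi>"
    "presents A X (colim_gens J (fobj D)) \<gamma> (colim_rels A J (fobj D) (fmap D))"
    "\<And>i x. \<lbrakk>i \<in> Obj J; x \<in> carrier (fobj D i)\<rbrakk> \<Longrightarrow> \<xi> i x = \<gamma> (i, x)"
proof -
  interpret U: universe \<kappa> by fact
  interpret MD: module_diagram A J "fobj D" "fmap D" by (rule Comod_module_diagram[OF coring_axioms assms(3)])
  note DD = Comod_functorD[OF assms(3)]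
  have "small \<kappa> (colim_gens J (fobj D))" unfolding colim_gens_def by (rule U.small_Sigma[OF assms(4) DD(2)])
  hence sF: "small \<kappa> (carrier MD.FG)" by (rule U.small_free[OF ring_A assms(2)])
  \<comment> \<open>Smallness of the free module is what allows its quotient to be carried by
    \<open>'u\<close>.\<close>
  obtain \<phi> :: "('i \<times> 'u \<Rightarrow> 'a) \<Rightarrow> 'u" where \<phi>: "inj_on \<phi> (carrier MD.FG)" by (rule U.small_inject[OF sF])
  obtain L :: "('a, 'u) module" and \<gamma> where L: "presents A L MD.G \<gamma> (colim_rels A J (fobj D) (fmap D))"
      "carrier L \<subseteq> \<phi> ` carrier MD.FG"
    by (rule presents_exists[OF ring_A \<phi> MD.rels_sub]) blast
  have sL: "small \<kappa> (carrier L)" by (rule U.small_subset[OF L(2) U.small_image[OF sF]])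
  note Lm = presentsD(1)[OF L(1)]
  note TL = T_left_module[OF Lm] note TTL = T_left_module[OF TL]
  note \<gamma> = MD.colimit_cocone(1)[OF L(1)] note \<gamma>d = MD.colimit_cocone(2)[OF L(1)]
  let ?\<gamma> = "\<lambda>i x. \<gamma> (i, x)"
  let ?c = "\<lambda>i. coact (fobj D i)"
  let ?\<eta> = "\<lambda>i x. tensor_map A C L id (?\<gamma> i) (?c i x)"
  have c: "?c i \<in> left_hom A (fobj D i) (tensor_module A C (fobj D i))" "left_module A (fobj D i)"
     "\<And>x. x \<in> carrier (fobj D i) \<Longrightarrow> ?c i x \<in> carrier (tensor_group A C (fobj D i))" if "i \<in> Obj J" for i
    using comoduleD[OF DD(1)[OF that]] by auto
  have \<eta>: "?\<eta> i \<in> left_hom A (fobj D i) (tensor_module A C L)" if "i \<in> Obj J" for i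
    by (rule left_hom_comp[OF c(1)[OF that] T_hom[OF c(2)[OF that] Lm \<gamma>[OF that]]])
  have \<eta>d: "?\<eta> j (fmap D i j u x) = ?\<eta> i x" if *: "i \<in> Obj J" "j \<in> Obj J" "u \<in> Hom J i j" "x \<in> carrier (fobj D i)" for i j u x
  proof -
    note u = comodule_homD[OF DD(4)[OF *(1-3)]]
    have "?\<eta> j (fmap D i j u x) = tensor_map A C L id (?\<gamma> j) (tensor_map A C (fobj D j) id (fmap D i j u) (?c i x))"
      using u(4)[OF *(4)] by simp
    also have "\<dots> = tensor_map A C L id (\<lambda>x. ?\<gamma> j (fmap D i j u x)) (?c i x)"
      by (rule T_comp[OF c(2)[OF *(1)] c(2)[OF *(2)] Lm u(1) \<gamma>[OF *(2)] c(3)[OF *(1,4)]])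
    also have "\<dots> = ?\<eta> i x"
      by (rule T_cong[OF c(2)[OF *(1)] Lm left_hom_comp[OF u(1) \<gamma>[OF *(2)]] \<gamma>[OF *(1)] _ c(3)[OF *(1,4)]])
        (use \<gamma>d * in auto)
    finally show ?thesis .
  qed
  obtain \<nu> where \<nu>: "\<nu> \<in> left_hom A L (tensor_module A C L)"
    "\<And>i x. \<lbrakk>i \<in> Obj J; x \<in> carrier (fobj D i)\<rbrakk> \<Longrightarrow> \<nu> (\<gamma> (i, x)) = ?\<eta> i x"
    by (rule MD.colimit_lift[OF L(1) TL \<eta> \<eta>d]) blast+
  have coassoc: "cmult A C L (\<nu> m) = tensor_map A C (tensor_module A C L) id \<nu> (\<nu> m)" if "m \<in> carrier L" for m
  proof (rule MD.colimit_ext[OF L(1) TTL left_hom_comp[OF \<nu>(1) cmult_hom[OF Lm]] left_hom_comp[OF \<nu>(1) T_hom[OF Lm TL \<nu>(1)]] _ that])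
    fix i x assume ix: "i \<in> Obj J" "x \<in> carrier (fobj D i)"
    note Di = comoduleD[OF DD(1)[OF ix(1)]]
    note \<gamma>i = \<gamma>[OF ix(1)] note T\<gamma>i = T_hom[OF Di(1) Lm \<gamma>i] note cx = Di(4)[OF ix(2)]
    have "cmult A C L (\<nu> (\<gamma> (i, x))) =
        tensor_map A C (tensor_module A C L) id (tensor_map A C L id (?\<gamma> i)) (cmult A C (fobj D i) (?c i x))"
      using \<nu>(2)[OF ix] cmult_nat[OF Di(1) Lm \<gamma>i cx] by simp
    also have "\<dots> = tensor_map A C (tensor_module A C L) id (tensor_map A C L id (?\<gamma> i))
        (tensor_map A C (tensor_module A C (fobj D i)) id (?c i) (?c i x))"
      using Di(5)[OF ix(2)] by simp
    also have "\<dots> = tensor_map A C (tensor_module A C L) id (?\<eta> i) (?c i x)"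
      by (rule T_comp[OF Di(1) T_left_module[OF Di(1)] TL Di(3) T\<gamma>i cx])
    also have "\<dots> = tensor_map A C (tensor_module A C L) id (\<lambda>x. \<nu> (?\<gamma> i x)) (?c i x)"
      by (rule T_cong[OF Di(1) TL \<eta>[OF ix(1)] left_hom_comp[OF \<gamma>i \<nu>(1)] _ cx]) (use \<nu>(2) ix(1) in simp)
    also have "\<dots> = tensor_map A C (tensor_module A C L) id \<nu> (?\<eta> i x)"
      by (rule T_comp[OF Di(1) Lm TL \<gamma>i \<nu>(1) cx, symmetric])
    finally show "cmult A C L (\<nu> (\<gamma> (i, x))) = tensor_map A C (tensor_module A C L) id \<nu> (\<nu> (\<gamma> (i, x)))"
      using \<nu>(2)[OF ix] by simp
  qed
  have counit: "ccounit A C L (\<nu> m) = m" if "m \<in> carrier L" for m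
  proof (rule MD.colimit_ext[OF L(1) Lm left_hom_comp[OF \<nu>(1) ccounit_hom[OF Lm]] left_hom_id(2) _ that])
    fix i x assume ix: "i \<in> Obj J" "x \<in> carrier (fobj D i)"
    note Di = comoduleD[OF DD(1)[OF ix(1)]]
    show "ccounit A C L (\<nu> (\<gamma> (i, x))) = \<gamma> (i, x)"
      using \<nu>(2)[OF ix] ccounit_nat[OF Di(1) Lm \<gamma>[OF ix(1)] Di(4)[OF ix(2)]] Di(6)[OF ix(2)] by simp
  qed
  define X where "X = mk_comodule L \<nu>"
  have X: "comodule A C X" unfolding X_def by (rule mk_comoduleI[OF Lm \<nu>(1) coassoc counit])
  define \<xi> where "\<xi> = (\<lambda>i. restrict (?\<gamma> i) (carrier (fobj D i)))"
  have \<xi>: "\<xi> i \<in> comodule_hom A C (fobj D i) X" if "i \<in> Obj J" for i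
    unfolding \<xi>_def by (rule comodule_homI[OF DD(1)[OF that] X]) (use \<gamma>[OF that] \<nu>(2) that in \<open>simp_all add: X_def\<close>)
  \<comment> \<open>X and \<open>L\<close> have the same module operations but are different
    records; the identity function, linear between them, transfers the presentation.\<close>
  have pX: "presents A X MD.G \<gamma> (colim_rels A J (fobj D) (fmap D))"
  proof -
    have e: "lincomb A X \<gamma> v = lincomb A L \<gamma> v" if "v \<in> carrier MD.FG" for v
      using hom_lincomb[OF _ Lm, of X \<gamma> MD.G "\<lambda>x. x" v] Lm presentsD(3)[OF L(1)] that
      by (simp add: X_def left_hom_id(2))
    show ?thesis using L(1) e unfolding presents_def by (auto simp: X_def image_iff)
  qed
  have "is_colimit J (Comod \<kappa> A C) D X \<xi>"
  proof (rule comod_colimitI[OF assms(3) _ \<xi>])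
    show "X \<in> Obj (Comod \<kappa> A C)" using X sL by (simp add: X_def)
    show "\<xi> j (fmap D i j u x) = \<xi> i x"
      if "i \<in> Obj J" "j \<in> Obj J" "u \<in> Hom J i j" "x \<in> carrier (fobj D i)" for i j u x
      using \<gamma>d[OF that] MD.d_closed[OF that] that by (simp add: \<xi>_def)
    show "x \<in> mspan A X (\<Union>i\<in>Obj J. \<xi> i ` carrier (fobj D i))" if "x \<in> carrier X" for x
      by (rule presents_mspan[OF pX _ _ that])
        (use comodule_homD(3)[OF \<xi>] in \<open>force simp: \<xi>_def colim_gens_def\<close>)+
    fix N :: "('a, 'c, 'u) comodule" and \<eta> :: "'i \<Rightarrow> 'u \<Rightarrow> 'u"
    assume N: "left_module A N" "\<And>i. i \<in> Obj J \<Longrightarrow> \<eta> i \<in> left_hom A (fobj D i) N"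
      "\<And>i j u x. \<lbrakk>i \<in> Obj J; j \<in> Obj J; u \<in> Hom J i j; x \<in> carrier (fobj D i)\<rbrakk> \<Longrightarrow> \<eta> j (fmap D i j u x) = \<eta> i x"
    obtain k where k: "k \<in> left_hom A L N" "\<And>i x. \<lbrakk>i \<in> Obj J; x \<in> carrier (fobj D i)\<rbrakk> \<Longrightarrow> k (\<gamma> (i, x)) = \<eta> i x"
      by (rule MD.colimit_lift[OF L(1) N]) blast+
    show "\<exists>k\<in>left_hom A X N. \<forall>i\<in>Obj J. \<forall>x\<in>carrier (fobj D i). k (\<xi> i x) = \<eta> i x"
      by (rule bexI[of _ k]) (use k in \<open>auto simp: \<xi>_def X_def\<close>)
  qed
  thus thesis using pX by (rule that) (simp add: \<xi>_def)
qed

section \<open>Countably presentable modules\<close>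

lemma free_hom_ext:
  assumes "ring A" "left_module A N" "f \<in> left_hom A (free_left_module A X) N" "g \<in> left_hom A (free_left_module A X) N"
    and "\<And>x. x \<in> X \<Longrightarrow> f (unit_vec A x) = g (unit_vec A x)" "v \<in> carrier (free_left_module A X)"
  shows "f v = g v"
proof -
  interpret F: left_module A "free_left_module A X" by (rule free_left_module[OF assms(1)])
  from assms(1,6) show ?thesis
  proof (induction rule: free_induct)
    case zero
    then show ?case using left_hom_zero[OF F.left_module_axioms assms(2,3)] left_hom_zero[OF F.left_module_axioms assms(2,4)] by simp
  next
    case (step a x v)
    have "unit_vec A x \<in> carrier (free_left_module A X)" by (rule unit_vec_closed[OF assms(1) step(2)])
    then show ?case using step assms(5)[OF step(2)]
      by (simp add: left_homD[OF assms(3)] left_homD[OF assms(4)] F.smult_closed)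
  qed
qed

lemma mspan_image:
  assumes "left_module A M" "left_module A N" "f \<in> left_hom A M N" "Y \<subseteq> carrier M" "v \<in> mspan A M Y"
  shows "f v \<in> mspan A N (f ` Y)"
proof -
  interpret M: left_module A M by fact
  show ?thesis using assms(5)
  proof (induction rule: mspan.induct)
    case zero
    then show ?case using left_hom_zero[OF assms(1-3)] mspan.zero by metis
  next
    case (step y a v)
    have "y \<in> carrier M" "v \<in> carrier M" using step assms(4) M.mspan_closed by auto
    then show ?case using step mspan.step[of "f y" "f ` Y" a A "f v" N]
      by (simp add: left_homD[OF assms(3)] M.smult_closed)
  qed
qed

lemma presents_of_surj:
  assumes "left_module A M" "p \<in> left_hom A (free_left_module A X) M" "p ` carrier (free_left_module A X) = carrier M"
    and "Y \<subseteq> carrier (free_left_module A X)"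
    and "\<And>v. v \<in> carrier (free_left_module A X) \<Longrightarrow> p v = \<zero>\<^bsub>M\<^esub> \<longleftrightarrow> v \<in> mspan A (free_left_module A X) Y"
  shows "presents A M X (\<lambda>x. p (unit_vec A x)) Y"
proof -
  interpret M: left_module A M by fact
  note u = unit_vec_closed[OF M.R.ring_axioms]
  have e: "lincomb A M (\<lambda>x. p (unit_vec A x)) v = p v" if "v \<in> carrier (free_left_module A X)" for v
    using hom_lincomb[OF free_left_module[OF M.R.ring_axioms] assms(1) _ assms(2) that, of "unit_vec A"]
      lincomb_free_self[OF M.R.ring_axioms that] by (simp add: u)
  show ?thesis unfolding presents_def
    using assms e left_homD(1)[OF assms(2)] by (auto simp: image_iff u)
qed

lemma presents_hom:
  assumes "presents A M X g Y"
  shows "lincomb A M g \<in> left_hom A (free_left_module A X) M"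
    "lincomb A M g ` carrier (free_left_module A X) = carrier M"
  using lincomb_hom[OF presentsD(1,3)[OF assms]] assms by (auto simp: presents_def)

text \<open>The maps \<open>t\<close> and \<open>s\<close> are the mutually inverse isomorphisms of
  free modules induced by the bijection. The lemma is needed because
  \<open>countably_presentable\<close> admits only sets of naturals as generating sets.\<close>

lemma presents_reindex:
  assumes "presents A M X g Y" "bij_betw b X' X"
  shows "\<exists>t. presents A M X' (\<lambda>x. g (b x)) (t ` Y)"
proof -
  let ?F = "free_left_module A X" and ?F' = "free_left_module A X'"
  interpret M: left_module A M by (rule presentsD(1)[OF assms(1)])
  interpret F: left_module A ?F by (rule free_left_module[OF M.R.ring_axioms])
  interpret F': left_module A ?F' by (rule free_left_module[OF M.R.ring_axioms])
  note u = unit_vec_closed[OF M.R.ring_axioms]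
  let ?e = "inv_into X' b"
  have bX: "b x \<in> X" if "x \<in> X'" for x using assms(2) that by (auto simp: bij_betw_def)
  have eX: "?e x \<in> X'" "b (?e x) = x" if "x \<in> X" for x
    using assms(2) that by (auto simp: bij_betw_def inv_into_into f_inv_into_f)
  have eb: "?e (b x) = x" if "x \<in> X'" for x using assms(2) that by (simp add: bij_betw_def)
  define t where "t = lincomb A ?F' (\<lambda>x. unit_vec A (?e x))"
  define s where "s = lincomb A ?F (\<lambda>x. unit_vec A (b x))"
  have t: "t \<in> left_hom A ?F ?F'" unfolding t_def by (rule lincomb_hom[OF F'.left_module_axioms]) (simp add: u eX)
  have s: "s \<in> left_hom A ?F' ?F" unfolding s_def by (rule lincomb_hom[OF F.left_module_axioms]) (simp add: u bX)
  have tu: "t (unit_vec A x) = unit_vec A (?e x)" if "x \<in> X" for x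
    unfolding t_def using u[OF eX(1)[OF that]]
    by (intro lincomb_unit_vec[where g = "\<lambda>x. unit_vec A (?e x)"] F'.left_module_axioms)
  have su: "s (unit_vec A x) = unit_vec A (b x)" if "x \<in> X'" for x
    unfolding s_def using u[OF bX[OF that]]
    by (intro lincomb_unit_vec[where g = "\<lambda>x. unit_vec A (b x)"] F.left_module_axioms)
  have ts: "t (s v) = v" if "v \<in> carrier ?F'" for v
    by (rule free_hom_ext[where f = "\<lambda>v. t (s v)" and g = "\<lambda>v. v", OF M.R.ring_axioms F'.left_module_axioms left_hom_comp[OF s t] left_hom_id(2) _ that])
      (simp add: su tu bX eb)
  have st: "s (t v) = v" if "v \<in> carrier ?F" for v
    by (rule free_hom_ext[where f = "\<lambda>v. s (t v)" and g = "\<lambda>v. v", OF M.R.ring_axioms F.left_module_axioms left_hom_comp[OF t s] left_hom_id(2) _ that])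
      (simp add: su tu eX)
  note p = presents_hom[OF assms(1)]
  let ?p = "\<lambda>v. lincomb A M g (s v)"
  have tY: "t ` Y \<subseteq> carrier ?F'" using presentsD(4)[OF assms(1)] left_homD(1)[OF t] by blast
  have "presents A M X' (\<lambda>x. ?p (unit_vec A x)) (t ` Y)"
  proof (rule presents_of_surj[OF M.left_module_axioms left_hom_comp[OF s p(1)] _ tY])
    have "s ` carrier ?F' = carrier ?F"
      using left_homD(1)[OF s] left_homD(1)[OF t] st by (metis image_eqI image_subsetI subsetI subset_antisym)
    thus "?p ` carrier ?F' = carrier M" using p(2) by (metis image_image)
    fix v assume v: "v \<in> carrier ?F'"
    have sv: "s v \<in> carrier ?F" using left_homD(1)[OF s v] .
    have "lincomb A M g (s v) = \<zero>\<^bsub>M\<^esub> \<longleftrightarrow> s v \<in> mspan A ?F Y" by (rule presentsD(6)[OF assms(1) sv])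
    also have "\<dots> \<longleftrightarrow> v \<in> mspan A ?F' (t ` Y)"
    proof
      assume "s v \<in> mspan A ?F Y"
      from mspan_image[OF F.left_module_axioms F'.left_module_axioms t presentsD(4)[OF assms(1)] this]
      show "v \<in> mspan A ?F' (t ` Y)" using ts[OF v] by simp
    next
      assume "v \<in> mspan A ?F' (t ` Y)"
      from mspan_image[OF F'.left_module_axioms F.left_module_axioms s tY this]
      have "s v \<in> mspan A ?F (s ` t ` Y)" .
      moreover have "s ` t ` Y = Y" using st presentsD(4)[OF assms(1)] by (force simp: image_iff)
      ultimately show "s v \<in> mspan A ?F Y" by simp
    qed
    finally show "lincomb A M g (s v) = \<zero>\<^bsub>M\<^esub> \<longleftrightarrow> v \<in> mspan A ?F' (t ` Y)" .
  qed
  hence P: "presents A M X' (\<lambda>x. lincomb A M g (s (unit_vec A x))) (t ` Y)" .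
  have eq: "lincomb A M g (s (unit_vec A x)) = g (b x)" if "x \<in> X'" for x
    using lincomb_unit_vec[OF M.left_module_axioms, of g "b x"] presentsD(2)[OF assms(1) bX[OF that]] su[OF that] by simp
  have "lincomb A M (\<lambda>x. lincomb A M g (s (unit_vec A x))) v = lincomb A M (\<lambda>x. g (b x)) v" if "v \<in> carrier ?F'" for v
    by (rule lincomb_cong[OF M.left_module_axioms presentsD(3)[OF P] that eq])
  hence "presents A M X' (\<lambda>x. g (b x)) (t ` Y)"
    using P presentsD(2)[OF assms(1)] bX unfolding presents_def by (auto simp: image_iff)
  thus ?thesis by blast
qed

text \<open>This is the quotient by cosets that occurs in \<open>cokernel_module\<close>, as opposed
  to \<open>quotient_on_type\<close>. Scalar multiplication is defined there as a union over all
  representatives; the union is a single coset because the span is closed under scalars.\<close>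

lemma quotient_module_hom:
  assumes "left_module A M" "Y \<subseteq> carrier M"
  defines "N \<equiv> mspan A M Y"
  shows "(\<lambda>v. N +>\<^bsub>M\<^esub> v) \<in> left_hom A M (quotient_module M N)"
    "(\<lambda>v. N +>\<^bsub>M\<^esub> v) ` carrier M = carrier (quotient_module M N)"
    "left_module A (quotient_module M N)"
    "\<lbrakk>v \<in> carrier M; w \<in> carrier M\<rbrakk> \<Longrightarrow> N +>\<^bsub>M\<^esub> v = N +>\<^bsub>M\<^esub> w \<longleftrightarrow> v \<ominus>\<^bsub>M\<^esub> w \<in> N"
proof -
  interpret M: left_module A M by fact
  have N: "N \<subseteq> carrier M" unfolding N_def using M.mspan_closed[OF _ assms(2)] by blast
  have as: "additive_subgroup N M"
  proof (rule additive_subgroup.intro, rule subgroup.intro)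
    show "N \<subseteq> carrier (add_monoid M)" using N by simp
    show "x \<otimes>\<^bsub>add_monoid M\<^esub> y \<in> N" if "x \<in> N" "y \<in> N" for x y
      using M.mspan_add that assms(2) by (simp add: N_def)
    show "\<one>\<^bsub>add_monoid M\<^esub> \<in> N" by (simp add: N_def mspan.zero)
    show "inv\<^bsub>add_monoid M\<^esub> x \<in> N" if "x \<in> N" for x
      using M.mspan_minus[of x Y] that assms(2) by (simp add: N_def a_inv_def)
  qed
  interpret N: abelian_subgroup N M
    by (rule abelian_subgroupI3[OF as M.M.abelian_group_axioms])
  let ?q = "\<lambda>v. N +>\<^bsub>M\<^esub> v"
  let ?Q = "quotient_module M N"
  have eq: "N +>\<^bsub>M\<^esub> v = N +>\<^bsub>M\<^esub> w \<longleftrightarrow> v \<ominus>\<^bsub>M\<^esub> w \<in> N" if "v \<in> carrier M" "w \<in> carrier M" for v w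
  proof
    assume "N +>\<^bsub>M\<^esub> v = N +>\<^bsub>M\<^esub> w"
    hence "v \<in> N +>\<^bsub>M\<^esub> w" using N.a_rcos_self[OF that(1)] by simp
    thus "v \<ominus>\<^bsub>M\<^esub> w \<in> N" using N.a_rcos_module_imp[OF that(2)]
      by (simp add: a_minus_def)
  next
    assume "v \<ominus>\<^bsub>M\<^esub> w \<in> N"
    hence "v \<in> N +>\<^bsub>M\<^esub> w" using N.a_rcos_module_rev[OF that(2,1)] by (simp add: a_minus_def)
    thus "N +>\<^bsub>M\<^esub> v = N +>\<^bsub>M\<^esub> w" using M.M.a_repr_independence[of v N w] that N.a_subgroup by simp
  qed
  have add: "?q (v \<oplus>\<^bsub>M\<^esub> w) = ?q v \<oplus>\<^bsub>?Q\<^esub> ?q w" if "v \<in> carrier M" "w \<in> carrier M" for v w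
    using N.a_rcos_sum[OF that] by (simp add: quotient_module_def)
  have im: "?q ` carrier M = carrier ?Q" by (auto simp: quotient_module_def A_RCOSETS_def')
  have zero: "\<zero>\<^bsub>?Q\<^esub> = ?q \<zero>\<^bsub>M\<^esub>" using N by (simp add: quotient_module_def M.M.a_coset_add_zero)
  have smult: "?q (a \<odot>\<^bsub>M\<^esub> v) = a \<odot>\<^bsub>?Q\<^esub> ?q v" if "a \<in> carrier A" "v \<in> carrier M" for a v
  proof -
    have const: "N +>\<^bsub>M\<^esub> (a \<odot>\<^bsub>M\<^esub> x) = N +>\<^bsub>M\<^esub> (a \<odot>\<^bsub>M\<^esub> v)" if "x \<in> ?q v" for x
    proof -
      have x: "x \<in> carrier M" using that N.a_elemrcos_carrier \<open>v \<in> carrier M\<close> by blast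
      have xv: "x \<ominus>\<^bsub>M\<^esub> v \<in> N" using N.a_rcos_module_imp[OF \<open>v \<in> carrier M\<close> that] by (simp add: a_minus_def)
      have h: "(\<lambda>x. a \<odot>\<^bsub>M\<^esub> x) \<in> add_hom M M"
        using \<open>a \<in> carrier A\<close> M.smult_closed M.smult_r_distr by (intro add_homI) auto
      have "a \<odot>\<^bsub>M\<^esub> x \<ominus>\<^bsub>M\<^esub> a \<odot>\<^bsub>M\<^esub> v = a \<odot>\<^bsub>M\<^esub> (x \<ominus>\<^bsub>M\<^esub> v)"
        using add_hom_diff[OF M.M.abelian_group_axioms M.M.abelian_group_axioms h x \<open>v \<in> carrier M\<close>] by simp
      also have "\<dots> \<in> N" using M.mspan_smult[of "x \<ominus>\<^bsub>M\<^esub> v" Y a] xv assms(2) \<open>a \<in> carrier A\<close> by (simp add: N_def)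
      finally show ?thesis using eq M.smult_closed x \<open>a \<in> carrier A\<close> \<open>v \<in> carrier M\<close> by simp
    qed
    have ne: "?q v \<noteq> {}" using N.a_rcos_self[OF that(2)] by (metis empty_iff)
    have "(\<Union>x\<in>?q v. N +>\<^bsub>M\<^esub> (a \<odot>\<^bsub>M\<^esub> x)) = N +>\<^bsub>M\<^esub> (a \<odot>\<^bsub>M\<^esub> v)"
      by (rule SUP_eq_const[OF ne const])
    thus ?thesis by (simp add: quotient_module_def)
  qed
  show "?q \<in> left_hom A M ?Q" "left_module A ?Q" using left_module_surj[OF assms(1) im zero add smult] by auto
  show "?q ` carrier M = carrier ?Q" by (rule im)
  show "\<lbrakk>v \<in> carrier M; w \<in> carrier M\<rbrakk> \<Longrightarrow> N +>\<^bsub>M\<^esub> v = N +>\<^bsub>M\<^esub> w \<longleftrightarrow> v \<ominus>\<^bsub>M\<^esub> w \<in> N" by (rule eq)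
qed

text \<open>Composing \<open>p\<close> with a section of \<open>q\<close> gives the isomorphism; it
  is well defined and injective because \<open>q\<close> and \<open>p\<close> identify the same
  pairs of elements.\<close>

lemma iso_of_surjections:
  assumes "left_module A F" "left_module A Q" "left_module A M" "q \<in> left_hom A F Q" "p \<in> left_hom A F M"
    "q ` carrier F = carrier Q" "p ` carrier F = carrier M"
    "\<And>v w. \<lbrakk>v \<in> carrier F; w \<in> carrier F\<rbrakk> \<Longrightarrow> q v = q w \<longleftrightarrow> p v = p w"
  shows "left_module_isomorphic A Q M"
proof -
  interpret F: left_module A F by fact
  let ?h = "\<lambda>x. p (inv_into (carrier F) q x)"
  have r: "inv_into (carrier F) q x \<in> carrier F" "q (inv_into (carrier F) q x) = x" if "x \<in> carrier Q" for x
    using that assms(6) by (auto intro: inv_into_into f_inv_into_f)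
  have qv: "q v \<in> carrier Q" if "v \<in> carrier F" for v using left_homD(1)[OF assms(4) that] .
  have h: "?h (q v) = p v" if "v \<in> carrier F" for v
    using r[OF qv[OF that]] assms(8) that by blast
  have ex: "\<exists>v. v \<in> carrier F \<and> x = q v" if "x \<in> carrier Q" for x using r[OF that] by metis
  have "?h \<in> left_hom A Q M"
  proof (rule left_homI)
    fix x assume x: "x \<in> carrier Q"
    obtain v where v: "v \<in> carrier F" "x = q v" using ex[OF x] by blast
    show "?h x \<in> carrier M" using h[OF v(1)] v left_homD(1)[OF assms(5)] by simp
    fix a assume a: "a \<in> carrier A"
    have "a \<odot>\<^bsub>Q\<^esub> x = q (a \<odot>\<^bsub>F\<^esub> v)" using v a left_homD(3)[OF assms(4)] by simp
    thus "?h (a \<odot>\<^bsub>Q\<^esub> x) = a \<odot>\<^bsub>M\<^esub> ?h x"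
      using h[OF v(1)] h[OF F.smult_closed[OF a v(1)]] v a left_homD(3)[OF assms(5)] by simp
  next
    fix x y assume x: "x \<in> carrier Q" and y: "y \<in> carrier Q"
    obtain v where v: "v \<in> carrier F" "x = q v" using ex[OF x] by blast
    obtain w where w: "w \<in> carrier F" "y = q w" using ex[OF y] by blast
    have "x \<oplus>\<^bsub>Q\<^esub> y = q (v \<oplus>\<^bsub>F\<^esub> w)" using v w left_homD(2)[OF assms(4)] by simp
    thus "?h (x \<oplus>\<^bsub>Q\<^esub> y) = ?h x \<oplus>\<^bsub>M\<^esub> ?h y"
      using h[OF v(1)] h[OF w(1)] h[OF F.M.add.m_closed[OF v(1) w(1)]] v w left_homD(2)[OF assms(5)] by simp
  qed
  moreover have "bij_betw ?h (carrier Q) (carrier M)"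
  proof (rule bij_betw_imageI)
    show "inj_on ?h (carrier Q)"
    proof (rule inj_onI)
      fix x y assume x: "x \<in> carrier Q" and y: "y \<in> carrier Q" and e: "?h x = ?h y"
      obtain v where v: "v \<in> carrier F" "x = q v" using ex[OF x] by blast
      obtain w where w: "w \<in> carrier F" "y = q w" using ex[OF y] by blast
      have "p v = p w" using e h[OF v(1)] h[OF w(1)] v w by simp
      thus "x = y" using assms(8)[OF v(1) w(1)] v w by simp
    qed
    have "?h ` carrier Q = ?h ` q ` carrier F" by (simp add: assms(6))
    also have "\<dots> = p ` carrier F" unfolding image_image by (rule image_cong[OF refl h])
    finally show "?h ` carrier Q = carrier M" using assms(7) by simp
  qed
  ultimately show ?thesis unfolding left_module_isomorphic_def by blast
qed

text \<open>A family of relations and a map of free modules are two forms of the same datum: the map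
  sends the basis vectors to the relations, and its image is their span.\<close>

lemma lincomb_image_mspan:
  assumes "left_module A M" "y \<in> X \<rightarrow> carrier M"
  shows "lincomb A M y ` carrier (free_left_module A X) = mspan A M (y ` X)"
proof -
  let ?F = "free_left_module A X"
  interpret M: left_module A M by fact
  interpret F: left_module A ?F by (rule free_left_module[OF M.R.ring_axioms])
  note h = lincomb_hom[OF assms]
  have uy: "lincomb A M y (unit_vec A x) = y x" "unit_vec A x \<in> carrier ?F" if "x \<in> X" for x
    using lincomb_unit_vec[where g = y and x = x and M = M] assms that unit_vec_closed[OF M.R.ring_axioms that] by auto
  show ?thesis
  proof (intro equalityI subsetI)
    fix m assume "m \<in> lincomb A M y ` carrier ?F"
    then obtain v where v: "v \<in> carrier ?F" "m = lincomb A M y v" by blast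
    from M.R.ring_axioms v(1) have "lincomb A M y v \<in> mspan A M (y ` X)"
    proof (induction rule: free_induct)
      case zero
      then show ?case using left_hom_zero[OF F.left_module_axioms M.left_module_axioms h] mspan.zero by metis
    next
      case (step a x v)
      then show ?case using mspan.step[of "y x" "y ` X" a A "lincomb A M y v" M] uy[OF step(2)]
        by (simp add: left_homD[OF h] F.smult_closed)
    qed
    thus "m \<in> mspan A M (y ` X)" using v by simp
  next
    fix m assume "m \<in> mspan A M (y ` X)"
    thus "m \<in> lincomb A M y ` carrier ?F"
    proof (induction rule: mspan.induct)
      case zero
      have "lincomb A M y \<zero>\<^bsub>?F\<^esub> = \<zero>\<^bsub>M\<^esub>" by (rule left_hom_zero[OF F.left_module_axioms M.left_module_axioms h])
      then show ?case using F.M.add.one_closed by (metis imageI monoid.simps(2) partial_object.simps(1))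
    next
      case (step z a v)
      then obtain x w where x: "x \<in> X" "z = y x" "w \<in> carrier ?F" "v = lincomb A M y w" by blast
      have "a \<odot>\<^bsub>M\<^esub> z \<oplus>\<^bsub>M\<^esub> v = lincomb A M y (a \<odot>\<^bsub>?F\<^esub> unit_vec A x \<oplus>\<^bsub>?F\<^esub> w)"
        using x uy[OF x(1)] step(2) by (simp add: left_homD[OF h] F.smult_closed)
      moreover have "a \<odot>\<^bsub>?F\<^esub> unit_vec A x \<oplus>\<^bsub>?F\<^esub> w \<in> carrier ?F"
        using x uy[OF x(1)] step(2) by (simp add: F.smult_closed)
      ultimately show ?case by blast
    qed
  qed
qed

text \<open>Generators and relations are both numbered by naturals. The map of free modules that
  sends the basis vectors to the relations then has the span of the relations as its image, so its
  cokernel is M.\<close>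

lemma countably_presentable_if_presents:
  assumes "presents A M X g Y" "countable X" "countable Y"
  shows "countably_presentable A M"
proof -
  let ?X = "to_nat_on X ` X"
  have "bij_betw (from_nat_into X) ?X X"
    using bij_betw_inv_into[OF inj_on_imp_bij_betw[OF inj_on_to_nat_on[OF assms(2)]]] assms(2)
    by (intro bij_betwI[of _ _ _ "to_nat_on X"]) auto
  from presents_reindex[OF assms(1) this] obtain g' Y' where P: "presents A M ?X g' Y'" and Y': "countable Y'"
    using assms(3) by blast
  let ?F = "free_left_module A ?X" and ?I = "to_nat_on Y' ` Y'"
  note p = presents_hom[OF P] and Mm = presentsD(1)[OF P]
  have R: "ring A" by (rule left_moduleD(1)[OF Mm])
  note Fm = free_left_module[OF R, of ?X]
  interpret F: left_module A ?F by (rule Fm)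
  interpret M: left_module A M by (rule Mm)
  have y: "from_nat_into Y' \<in> ?I \<rightarrow> carrier ?F" "from_nat_into Y' ` ?I = Y'"
    using Y' presentsD(4)[OF P] by (auto simp: image_iff)
  let ?f = "lincomb A ?F (from_nat_into Y')"
  have f: "?f \<in> left_hom A (free_left_module A ?I) ?F" by (rule lincomb_hom[OF Fm y(1)])
  have im: "?f ` carrier (free_left_module A ?I) = mspan A ?F Y'"
    using lincomb_image_mspan[OF Fm y(1)] y(2) by simp
  note q = quotient_module_hom[OF Fm presentsD(4)[OF P]]
  have "left_module_isomorphic A (quotient_module ?F (mspan A ?F Y')) M"
  proof (rule iso_of_surjections[OF Fm q(3) Mm q(1) p(1) q(2) p(2)])
    fix v w assume vw: "v \<in> carrier ?F" "w \<in> carrier ?F"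
    have "v \<ominus>\<^bsub>?F\<^esub> w \<in> mspan A ?F Y' \<longleftrightarrow> lincomb A M g' (v \<ominus>\<^bsub>?F\<^esub> w) = \<zero>\<^bsub>M\<^esub>"
      using presentsD(6)[OF P, of "v \<ominus>\<^bsub>?F\<^esub> w"] vw by simp
    also have "\<dots> \<longleftrightarrow> lincomb A M g' v = lincomb A M g' w"
      using left_hom_diff[OF Fm Mm p(1) vw] left_homD(1)[OF p(1)] vw by (simp add: M.M.diff_zero_iff)
    finally show "mspan A ?F Y' +>\<^bsub>?F\<^esub> v = mspan A ?F Y' +>\<^bsub>?F\<^esub> w \<longleftrightarrow> lincomb A M g' v = lincomb A M g' w"
      using q(4)[OF vw] by simp
  qed
  thus ?thesis unfolding countably_presentable_def cokernel_module_def using f im by metis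
qed

text \<open>The images of the basis vectors under the map of free modules serve as the countable set
  of relations.\<close>

lemma presents_if_countably_presentable:
  assumes "left_module A M" "countably_presentable A M"
  obtains X :: "nat set" and g Y where "presents A M X g Y" "countable Y"
proof -
  interpret M: left_module A M by fact
  obtain Z X :: "nat set" and f where f: "f \<in> left_hom A (free_left_module A Z) (free_left_module A X)"
    and iso: "left_module_isomorphic A (quotient_module (free_left_module A X) (f ` carrier (free_left_module A Z))) M"
    using assms(2) unfolding countably_presentable_def cokernel_module_def by blast
  let ?F = "free_left_module A X"
  have R: "ring A" by (rule M.R.ring_axioms)
  note Fm = free_left_module[OF R, of X]
  interpret F: left_module A ?F by (rule Fm)
  note u = unit_vec_closed[OF R]
  let ?Y = "(\<lambda>z. f (unit_vec A z)) ` Z"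
  have fu: "(\<lambda>z. f (unit_vec A z)) \<in> Z \<rightarrow> carrier ?F" by (auto intro!: left_homD(1)[OF f] u)
  have "f v = lincomb A ?F (\<lambda>z. f (unit_vec A z)) v" if "v \<in> carrier (free_left_module A Z)" for v
    using hom_lincomb[OF free_left_module[OF R] Fm _ f that, of "unit_vec A"] lincomb_free_self[OF R that]
    by (simp add: u)
  hence "f ` carrier (free_left_module A Z) = lincomb A ?F (\<lambda>z. f (unit_vec A z)) ` carrier (free_left_module A Z)"
    by (rule image_cong[OF refl])
  hence im: "f ` carrier (free_left_module A Z) = mspan A ?F ?Y" using lincomb_image_mspan[OF Fm fu] by simp
  have Y: "?Y \<subseteq> carrier ?F" using fu by auto
  let ?N = "mspan A ?F ?Y" let ?Q = "quotient_module ?F ?N"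
  note q = quotient_module_hom[OF Fm Y]
  interpret Q: left_module A ?Q by (rule q(3))
  obtain h where h: "h \<in> left_hom A ?Q M" "bij_betw h (carrier ?Q) (carrier M)"
    using iso unfolding im left_module_isomorphic_def by blast
  let ?p = "\<lambda>v. h (?N +>\<^bsub>?F\<^esub> v)"
  have "presents A M X (\<lambda>x. ?p (unit_vec A x)) ?Y"
  proof (rule presents_of_surj[OF assms(1) left_hom_comp[OF q(1) h(1)] _ Y])
    have "?p ` carrier ?F = h ` carrier ?Q" using q(2) by (metis image_image)
    thus "?p ` carrier ?F = carrier M" using h(2) by (simp add: bij_betw_def)
    fix v assume v: "v \<in> carrier ?F"
    have qz: "?N +>\<^bsub>?F\<^esub> \<zero>\<^bsub>?F\<^esub> = \<zero>\<^bsub>?Q\<^esub>" by (rule left_hom_zero[OF Fm q(3) q(1)])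
    have "?p v = \<zero>\<^bsub>M\<^esub> \<longleftrightarrow> h (?N +>\<^bsub>?F\<^esub> v) = h \<zero>\<^bsub>?Q\<^esub>"
      using left_hom_zero[OF q(3) assms(1) h(1)] by simp
    also have "\<dots> \<longleftrightarrow> ?N +>\<^bsub>?F\<^esub> v = ?N +>\<^bsub>?F\<^esub> \<zero>\<^bsub>?F\<^esub>"
      using h(2) left_homD(1)[OF q(1) v] qz Q.M.add.one_closed
      by (auto simp: bij_betw_def inj_on_eq_iff)
    also have "\<dots> \<longleftrightarrow> v \<ominus>\<^bsub>?F\<^esub> \<zero>\<^bsub>?F\<^esub> \<in> ?N" using q(4)[OF v] by simp
    also have "v \<ominus>\<^bsub>?F\<^esub> \<zero>\<^bsub>?F\<^esub> = v"
      using v F.M.minus_equality[of "\<zero>\<^bsub>?F\<^esub>" "\<zero>\<^bsub>?F\<^esub>"] by (simp add: a_minus_def)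
    finally show "?p v = \<zero>\<^bsub>M\<^esub> \<longleftrightarrow> v \<in> ?N" .
  qed
  thus thesis by (rule that) simp
qed

section \<open>Colimits of sets\<close>

lemma poset_category_simps [simp]:
  "Obj (poset_category I r) = I"
  "u \<in> Hom (poset_category I r) i j \<longleftrightarrow> (i, j) \<in> r"
  "Idt (poset_category I r) i = ()" "Cmp (poset_category I r) i j k v u = ()"
  by (simp_all add: poset_category_def)

lemma aleph1_directedD:
  assumes "aleph1_directed I r"
  shows "i \<in> I \<Longrightarrow> (i, i) \<in> r" "\<lbrakk>(i, j) \<in> r; (j, k) \<in> r\<rbrakk> \<Longrightarrow> (i, k) \<in> r" "I \<noteq> {}"
    "\<lbrakk>i \<in> I; j \<in> I\<rbrakk> \<Longrightarrow> \<exists>k\<in>I. (i, k) \<in> r \<and> (j, k) \<in> r"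
    "\<lbrakk>X \<subseteq> I; countable X\<rbrakk> \<Longrightarrow> \<exists>u\<in>I. \<forall>x\<in>X. (x, u) \<in> r" "(i, j) \<in> r \<Longrightarrow> i \<in> I \<and> j \<in> I"
proof -
  note p = partial_order_onD[of I r]
  have po: "partial_order_on I r" and c: "\<And>X. \<lbrakk>X \<subseteq> I; countable X\<rbrakk> \<Longrightarrow> \<exists>u\<in>I. \<forall>x\<in>X. (x, u) \<in> r"
    using assms by (auto simp: aleph1_directed_def)
  show "i \<in> I \<Longrightarrow> (i, i) \<in> r" using p(1)[OF po] by (rule refl_onD)
  show "\<lbrakk>(i, j) \<in> r; (j, k) \<in> r\<rbrakk> \<Longrightarrow> (i, k) \<in> r" using p(2)[OF po] by (rule transD)
  show "\<lbrakk>X \<subseteq> I; countable X\<rbrakk> \<Longrightarrow> \<exists>u\<in>I. \<forall>x\<in>X. (x, u) \<in> r" by (rule c)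
  show "I \<noteq> {}" using c[of "{}"] by auto
  show "\<lbrakk>i \<in> I; j \<in> I\<rbrakk> \<Longrightarrow> \<exists>k\<in>I. (i, k) \<in> r \<and> (j, k) \<in> r" using c[of "{i, j}"] by auto
  show "(i, j) \<in> r \<Longrightarrow> i \<in> I \<and> j \<in> I" using p(4)[OF po] by blast
qed

lemma set_category_simps [simp]:
  "Hom set_category X Y = X \<rightarrow>\<^sub>E Y" "Cmp set_category X Y Z g f = compose X g f" "Obj set_category = UNIV"
  by (simp_all add: set_category_def)

text \<open>The counterpart of \<open>directed_colim\<close> for sets. By \<open>surj\<close> a
  cocone forces the values of the mediating map. They are consistent because two preimages of one
  element, moved to a common stage, are identified by \<open>inj\<close> at a later one.\<close>

lemma set_colimitI:
  fixes F :: "('i, unit, 'x set, 'x \<Rightarrow> 'x) functor_data"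
  assumes "aleph1_directed I r"
    and f: "\<And>i j. (i, j) \<in> r \<Longrightarrow> fmap F i j () \<in> fobj F i \<rightarrow> fobj F j"
    and \<xi>: "\<And>i. i \<in> I \<Longrightarrow> \<xi> i \<in> fobj F i \<rightarrow>\<^sub>E X"
    and compat: "\<And>i j y. \<lbrakk>(i, j) \<in> r; y \<in> fobj F i\<rbrakk> \<Longrightarrow> \<xi> j (fmap F i j () y) = \<xi> i y"
    and surj: "\<And>x. x \<in> X \<Longrightarrow> \<exists>i\<in>I. \<exists>y\<in>fobj F i. \<xi> i y = x"
    and inj: "\<And>i y y'. \<lbrakk>i \<in> I; y \<in> fobj F i; y' \<in> fobj F i; \<xi> i y = \<xi> i y'\<rbrakk> \<Longrightarrow>
      \<exists>j. (i, j) \<in> r \<and> fmap F i j () y = fmap F i j () y'"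
  shows "is_colimit (poset_category I r) set_category F X \<xi>"
proof -
  note I = aleph1_directedD[OF assms(1)]
  have "compose (fobj F i) (\<xi> j) (fmap F i j ()) = \<xi> i" if "(i, j) \<in> r" for i j
    using compat[OF that] \<xi>[of i] I(6)[OF that] by (auto simp: compose_def fun_eq_iff PiE_def extensional_def)
  hence "is_cocone (poset_category I r) set_category F X \<xi>" using \<xi> by (simp add: is_cocone_def)
  moreover have "\<exists>!h. h \<in> X \<rightarrow>\<^sub>E Y \<and> (\<forall>i\<in>I. compose (fobj F i) h (\<xi> i) = \<eta> i)"
    if "is_cocone (poset_category I r) set_category F Y \<eta>" for Y \<eta>
  proof -
    note coc = that
    have \<eta>: "\<eta> i \<in> fobj F i \<rightarrow>\<^sub>E Y" if "i \<in> I" for i using coc that by (simp add: is_cocone_def)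
    have c: "\<eta> j (fmap F i j () y) = \<eta> i y" if "(i, j) \<in> r" "y \<in> fobj F i" for i j y
    proof -
      have "compose (fobj F i) (\<eta> j) (fmap F i j ()) = \<eta> i"
        using coc that I(6)[OF that(1)] by (simp add: is_cocone_def)
      from fun_cong[OF this, of y] show ?thesis using that by (simp add: compose_eq)
    qed
    have wd: "\<eta> i y = \<eta> j z" if ij: "i \<in> I" "j \<in> I" "y \<in> fobj F i" "z \<in> fobj F j" "\<xi> i y = \<xi> j z" for i j y z
    proof -
      obtain k where k: "k \<in> I" "(i, k) \<in> r" "(j, k) \<in> r" using I(4)[OF ij(1,2)] by blast
      have m: "fmap F i k () y \<in> fobj F k" "fmap F j k () z \<in> fobj F k" using f k ij by auto
      have "\<xi> k (fmap F i k () y) = \<xi> k (fmap F j k () z)" using compat k ij by simp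
      then obtain l where l: "(k, l) \<in> r" "fmap F k l () (fmap F i k () y) = fmap F k l () (fmap F j k () z)"
        using inj[OF k(1) m] by blast
      have "\<eta> i y = \<eta> l (fmap F k l () (fmap F i k () y))" using c[OF l(1) m(1)] c[OF k(2) ij(3)] by simp
      also have "\<dots> = \<eta> j z" unfolding l(2) using c[OF l(1) m(2)] c[OF k(3) ij(4)] by simp
      finally show ?thesis .
    qed
    define h where "h = (\<lambda>x\<in>X. THE z. \<exists>i\<in>I. \<exists>y\<in>fobj F i. \<xi> i y = x \<and> z = \<eta> i y)"
    have h: "h (\<xi> i y) = \<eta> i y" if "i \<in> I" "y \<in> fobj F i" for i y
    proof -
      have "\<xi> i y \<in> X" using \<xi>[OF that(1)] that(2) by auto
      moreover have "(THE z. \<exists>j\<in>I. \<exists>y'\<in>fobj F j. \<xi> j y' = \<xi> i y \<and> z = \<eta> j y') = \<eta> i y"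
        using that wd by (intro the_equality) blast+
      ultimately show ?thesis by (simp add: h_def)
    qed
    show ?thesis
    proof (rule ex1I[of _ h], intro conjI ballI)
      have "h x \<in> Y" if "x \<in> X" for x using surj[OF that] h \<eta> by (metis PiE_mem)
      thus "h \<in> X \<rightarrow>\<^sub>E Y" by (auto simp: h_def)
      show "compose (fobj F i) h (\<xi> i) = \<eta> i" if "i \<in> I" for i
        using h[OF that] \<eta>[OF that] by (auto simp: compose_def fun_eq_iff PiE_def extensional_def)
    next
      fix k assume k: "k \<in> X \<rightarrow>\<^sub>E Y \<and> (\<forall>i\<in>I. compose (fobj F i) k (\<xi> i) = \<eta> i)"
      show "k = h"
      proof
        fix x
        show "k x = h x"
        proof (cases "x \<in> X")
          case True
          then obtain i y where iy: "i \<in> I" "y \<in> fobj F i" "\<xi> i y = x" using surj by blast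
          have "compose (fobj F i) k (\<xi> i) y = \<eta> i y" using k iy(1) by simp
          thus ?thesis using h[OF iy(1,2)] iy by (simp add: compose_eq)
        next
          case False
          thus ?thesis using k by (auto simp: h_def PiE_def extensional_def)
        qed
      qed
    qed
  qed
  ultimately show ?thesis by (simp add: is_colimit_def)
qed

text \<open>A colimit cocone of sets is jointly surjective, as two maps to a two-element set show.\<close>

lemma set_colimit_surj:
  fixes F :: "('i, 'n, 'x set, 'x \<Rightarrow> 'x) functor_data" and a b :: 'x
  assumes "is_colimit J set_category F X \<xi>" "a \<noteq> b" "x \<in> X"
    and f: "\<And>i j u. \<lbrakk>i \<in> Obj J; j \<in> Obj J; u \<in> Hom J i j\<rbrakk> \<Longrightarrow> fmap F i j u \<in> fobj F i \<rightarrow> fobj F j"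
  shows "\<exists>i\<in>Obj J. \<exists>y\<in>fobj F i. \<xi> i y = x"
proof (rule ccontr)
  assume n: "\<not> ?thesis"
  have \<xi>: "\<xi> i \<in> fobj F i \<rightarrow>\<^sub>E X" if "i \<in> Obj J" for i
    using assms(1) that by (simp add: is_colimit_def is_cocone_def)
  define \<eta> where "\<eta> = (\<lambda>i. \<lambda>y\<in>fobj F i. a)"
  have "compose (fobj F i) (\<eta> j) (fmap F i j u) = \<eta> i" if "i \<in> Obj J" "j \<in> Obj J" "u \<in> Hom J i j" for i j u
    using f[OF that] by (auto simp: \<eta>_def compose_def fun_eq_iff)
  hence co: "is_cocone J set_category F {a, b} \<eta>" by (simp add: is_cocone_def \<eta>_def)
  have "\<exists>!h. h \<in> Hom set_category X {a, b} \<and>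
      (\<forall>i\<in>Obj J. Cmp set_category (fobj F i) X {a, b} h (\<xi> i) = \<eta> i)"
    using conjunct2[OF assms(1)[unfolded is_colimit_def]] co by blast
  hence uniq: "\<exists>!h. h \<in> X \<rightarrow>\<^sub>E {a, b} \<and> (\<forall>i\<in>Obj J. compose (fobj F i) h (\<xi> i) = \<eta> i)" by simp
  define g where "g = (\<lambda>y\<in>X. a)"
  \<comment> \<open>\<open>k\<close> differs from the constant map \<open>g\<close> only at the
    element \<open>x\<close> that is assumed to be missed, so the two have the same composites with
    the cocone.\<close>
  define k where "k = (\<lambda>y\<in>X. if y = x then b else a)"
  have g: "g \<in> X \<rightarrow>\<^sub>E {a, b} \<and> (\<forall>i\<in>Obj J. compose (fobj F i) g (\<xi> i) = \<eta> i)"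
    using \<xi> by (auto simp: g_def \<eta>_def compose_def fun_eq_iff)
  have "compose (fobj F i) k (\<xi> i) = \<eta> i" if "i \<in> Obj J" for i
    using \<xi>[OF that] n that by (auto simp: k_def \<eta>_def compose_def fun_eq_iff)
  hence k: "k \<in> X \<rightarrow>\<^sub>E {a, b} \<and> (\<forall>i\<in>Obj J. compose (fobj F i) k (\<xi> i) = \<eta> i)" by (auto simp: k_def)
  have "g = k" using uniq g k by blast
  hence "g x = k x" by simp
  thus False using assms(2,3) by (simp add: g_def k_def)
qed

text \<open>S is the quotient of P by the relations that identify each generator \<open>g x\<close>
  with its image under the idempotent given by \<open>p\<close> followed by \<open>i\<close>. There
  are only as many new relations as generators. Here \<open>w x\<close> is a vector that represents
  this image, and \<open>?\<theta>\<close> lifts the idempotent to the free module. If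
  \<open>v\<close> dies in S, then \<open>?\<theta> v\<close> dies in P and so lies in the span of
  the old relations.\<close>

lemma countably_presentable_retract:
  assumes "left_module A S" "left_module A P" "i \<in> left_hom A S P" "p \<in> left_hom A P S"
    and "\<And>s. s \<in> carrier S \<Longrightarrow> p (i s) = s" "countably_presentable A P"
  shows "countably_presentable A S"
proof -
  obtain X :: "nat set" and g Y where P: "presents A P X g Y" and cY: "countable Y"
    by (rule presents_if_countably_presentable[OF assms(2,6)])
  let ?F = "free_left_module A X"
  interpret S: left_module A S by fact
  interpret P: left_module A P by fact
  have R: "ring A" by (rule S.R.ring_axioms)
  note Fm = free_left_module[OF R, of X]
  interpret F: left_module A ?F by (rule Fm)
  note u = unit_vec_closed[OF R]
  note pi = presents_hom[OF P]
  let ?\<pi> = "lincomb A P g"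
  have \<pi>u: "?\<pi> (unit_vec A x) = g x" if "x \<in> X" for x
    using lincomb_unit_vec[where g = g and x = x and M = P] assms(2) presentsD(2)[OF P that] by blast
  have "\<exists>w\<in>carrier ?F. i (p (g x)) = ?\<pi> w" if "x \<in> X" for x
    using presentsD(7)[OF P left_homD(1)[OF assms(3) left_homD(1)[OF assms(4) presentsD(2)[OF P that]]]] .
  then obtain w where w: "\<And>x. x \<in> X \<Longrightarrow> w x \<in> carrier ?F" "\<And>x. x \<in> X \<Longrightarrow> i (p (g x)) = ?\<pi> (w x)" by metis
  let ?\<theta> = "lincomb A ?F w"
  have \<theta>: "?\<theta> \<in> left_hom A ?F ?F" by (rule lincomb_hom[OF Fm]) (simp add: w)
  have \<theta>u: "?\<theta> (unit_vec A x) = w x" if "x \<in> X" for x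
    using lincomb_unit_vec[where g = w and x = x and M = ?F] Fm w(1)[OF that] by blast
  have \<pi>\<theta>: "?\<pi> (?\<theta> v) = i (p (?\<pi> v))" if "v \<in> carrier ?F" for v
    by (rule free_hom_ext[where f = "\<lambda>v. ?\<pi> (?\<theta> v)" and g = "\<lambda>v. i (p (?\<pi> v))", OF R assms(2)
          left_hom_comp[OF \<theta> pi(1)] left_hom_comp[OF left_hom_comp[OF pi(1) assms(4)] assms(3)] _ that])
      (simp add: \<theta>u \<pi>u w(2))
  let ?Y' = "(\<lambda>x. unit_vec A x \<ominus>\<^bsub>?F\<^esub> w x) ` X"
  have Y: "Y \<union> ?Y' \<subseteq> carrier ?F" using presentsD(4)[OF P] by (auto simp: u w)
  \<comment> \<open>Modulo the new relations every vector is equivalent to its image under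
    \<open>?\<theta>\<close>. The difference is linear in \<open>v\<close>, and for a unit vector it
    is one of the new relations.\<close>
  have diff: "v \<ominus>\<^bsub>?F\<^esub> ?\<theta> v \<in> mspan A ?F (Y \<union> ?Y')" if "v \<in> carrier ?F" for v
    using R that
  proof (induction rule: free_induct)
    case zero
    have "?\<theta> \<zero>\<^bsub>?F\<^esub> = \<zero>\<^bsub>?F\<^esub>" by (rule left_hom_zero[OF Fm Fm \<theta>])
    then show ?case by (simp add: a_minus_def F.M.r_neg mspan.zero)
  next
    case (step a x v)
    have d: "(\<lambda>v. v \<ominus>\<^bsub>?F\<^esub> ?\<theta> v) \<in> left_hom A ?F ?F"
    proof (rule left_homI)
      fix v z assume vz: "v \<in> carrier ?F" "z \<in> carrier ?F"
      note tv = left_homD(1)[OF \<theta> vz(1)] left_homD(1)[OF \<theta> vz(2)]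
      show "v \<ominus>\<^bsub>?F\<^esub> ?\<theta> v \<in> carrier ?F" using vz tv by simp
      show "v \<oplus>\<^bsub>?F\<^esub> z \<ominus>\<^bsub>?F\<^esub> ?\<theta> (v \<oplus>\<^bsub>?F\<^esub> z) = (v \<ominus>\<^bsub>?F\<^esub> ?\<theta> v) \<oplus>\<^bsub>?F\<^esub> (z \<ominus>\<^bsub>?F\<^esub> ?\<theta> z)"
        using vz tv by (simp add: left_homD(2)[OF \<theta>] a_minus_def F.M.minus_add F.M.a_ac)
    next
      fix b v assume bv: "b \<in> carrier A" "v \<in> carrier ?F"
      note tv = left_homD(1)[OF \<theta> bv(2)]
      have h: "(\<lambda>x. b \<odot>\<^bsub>?F\<^esub> x) \<in> add_hom ?F ?F"
        using bv F.smult_closed F.smult_r_distr by (intro add_homI) auto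
      show "b \<odot>\<^bsub>?F\<^esub> v \<ominus>\<^bsub>?F\<^esub> ?\<theta> (b \<odot>\<^bsub>?F\<^esub> v) = b \<odot>\<^bsub>?F\<^esub> (v \<ominus>\<^bsub>?F\<^esub> ?\<theta> v)"
        using add_hom_diff[OF F.M.abelian_group_axioms F.M.abelian_group_axioms h bv(2) tv] bv
        by (simp add: left_homD(3)[OF \<theta>])
    qed
    have ux: "unit_vec A x \<in> carrier ?F" by (rule u[OF step(2)])
    have "unit_vec A x \<ominus>\<^bsub>?F\<^esub> ?\<theta> (unit_vec A x) \<in> Y \<union> ?Y'" using step(2) by (auto simp: \<theta>u)
    from mspan.step[OF this step(1,4)] show ?case
      using left_homD(2)[OF d F.smult_closed[OF step(1) ux] step(3)] left_homD(3)[OF d step(1) ux] by simp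
  qed
  have "presents A S X (\<lambda>x. p (?\<pi> (unit_vec A x))) (Y \<union> ?Y')"
  proof (rule presents_of_surj[OF assms(1) left_hom_comp[OF pi(1) assms(4)] _ Y])
    have "p ` carrier P = carrier S"
      using left_homD(1)[OF assms(4)] left_homD(1)[OF assms(3)] assms(5) by (metis image_eqI image_subsetI subsetI subset_antisym)
    thus "(\<lambda>v. p (?\<pi> v)) ` carrier ?F = carrier S" using pi(2) by (metis image_image)
    fix v assume v: "v \<in> carrier ?F"
    show "p (?\<pi> v) = \<zero>\<^bsub>S\<^esub> \<longleftrightarrow> v \<in> mspan A ?F (Y \<union> ?Y')"
    proof
      assume "p (?\<pi> v) = \<zero>\<^bsub>S\<^esub>"
      hence "?\<pi> (?\<theta> v) = \<zero>\<^bsub>P\<^esub>" using \<pi>\<theta>[OF v] left_hom_zero[OF assms(1-3)] by simp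
      hence "?\<theta> v \<in> mspan A ?F Y" using presentsD(6)[OF P left_homD(1)[OF \<theta> v]] by simp
      hence "?\<theta> v \<in> mspan A ?F (Y \<union> ?Y')"
        by (rule mspan_mono[OF _ _ Fm Y]) (use F.mspan_base[OF _ Y] in blast)
      from F.mspan_add[OF diff[OF v] this Y] show "v \<in> mspan A ?F (Y \<union> ?Y')"
        using v left_homD(1)[OF \<theta> v] by (simp add: a_minus_def F.M.a_assoc F.M.l_neg)
    next
      assume "v \<in> mspan A ?F (Y \<union> ?Y')"
      thus "p (?\<pi> v) = \<zero>\<^bsub>S\<^esub>"
      proof (rule mspan_kernel[where f = "\<lambda>v. p (?\<pi> v)", OF Fm assms(1) left_hom_comp[OF pi(1) assms(4)] Y, rotated])
        fix y assume "y \<in> Y \<union> ?Y'"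
        thus "p (?\<pi> y) = \<zero>\<^bsub>S\<^esub>"
        proof
          assume "y \<in> Y"
          thus ?thesis using presentsD(5)[OF P] left_hom_zero[OF assms(2,1,4)] by simp
        next
          assume "y \<in> ?Y'"
          then obtain x where x: "x \<in> X" "y = unit_vec A x \<ominus>\<^bsub>?F\<^esub> w x" by blast
          have gx: "g x \<in> carrier P" by (rule presentsD(2)[OF P x(1)])
          have igx: "i (p (g x)) \<in> carrier P" using left_homD(1)[OF assms(3)] left_homD(1)[OF assms(4) gx] by simp
          have "?\<pi> y = g x \<ominus>\<^bsub>P\<^esub> i (p (g x))"
            using left_hom_diff[OF Fm assms(2) pi(1) u[OF x(1)] w(1)[OF x(1)]] x \<pi>u w(2) by simp
          hence "p (?\<pi> y) = p (g x) \<ominus>\<^bsub>S\<^esub> p (i (p (g x)))" using left_hom_diff[OF assms(2,1,4) gx igx] by simp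
          thus ?thesis using assms(5)[OF left_homD(1)[OF assms(4) gx]] left_homD(1)[OF assms(4) gx]
            by (simp add: S.M.diff_zero_iff)
        qed
      qed
    qed
  qed
  thus ?thesis by (rule countably_presentable_if_presents) (use cY in auto)
qed

section \<open>Directed colimits of comodules\<close>

text \<open>Conjugates the transition maps by isomorphisms of the stages. This is how approximations
  of a comodule are exchanged for members of a small set of representatives.\<close>

lemma (in directed_colim) directed_colim_iso:
  assumes "\<And>i. i \<in> I \<Longrightarrow> left_module A (N i)" "\<And>i. i \<in> I \<Longrightarrow> \<alpha> i \<in> left_hom A (M i) (N i)"
    "\<And>i. i \<in> I \<Longrightarrow> \<beta> i \<in> left_hom A (N i) (M i)"
    "\<And>i x. \<lbrakk>i \<in> I; x \<in> carrier (M i)\<rbrakk> \<Longrightarrow> \<beta> i (\<alpha> i x) = x"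
    "\<And>i y. \<lbrakk>i \<in> I; y \<in> carrier (N i)\<rbrakk> \<Longrightarrow> \<alpha> i (\<beta> i y) = y"
  shows "directed_colim A I r N (\<lambda>i j x. \<alpha> j (f i j (\<beta> i x))) L (\<lambda>i x. h i (\<beta> i x))"
proof (rule directed_colim.intro)
  note \<alpha>c = left_homD(1)[OF assms(2)] and \<beta>c = left_homD(1)[OF assms(3)]
  fix i assume i: "i \<in> I"
  show "(i, i) \<in> r" by (rule I_refl[OF i])
  show "left_module A (N i)" by (rule assms(1)[OF i])
  show "(\<lambda>x. h i (\<beta> i x)) \<in> left_hom A (N i) L" by (rule left_hom_comp[OF assms(3)[OF i] h_hom[OF i]])
  fix x assume x: "x \<in> carrier (N i)"
  show "\<exists>j\<in>I. (i, j) \<in> r \<and> \<alpha> j (f i j (\<beta> i x)) = \<zero>\<^bsub>N j\<^esub>" if z: "h i (\<beta> i x) = \<zero>\<^bsub>L\<^esub>"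
  proof -
    obtain j where j: "j \<in> I" "(i, j) \<in> r" "f i j (\<beta> i x) = \<zero>\<^bsub>M j\<^esub>" using h_kernel[OF i \<beta>c[OF i x] z] by blast
    thus ?thesis using left_hom_zero[OF M_module[OF j(1)] assms(1)[OF j(1)] assms(2)[OF j(1)]] by auto
  qed
next
  fix y assume "y \<in> carrier L"
  then obtain i x where "i \<in> I" "x \<in> carrier (M i)" "h i x = y" using h_surj by blast
  thus "\<exists>i\<in>I. \<exists>x\<in>carrier (N i). h i (\<beta> i x) = y"
    using assms(4) left_homD(1)[OF assms(2)] by (intro bexI[of _ i] bexI[of _ "\<alpha> i x"]) auto
next
  fix i j k assume ijk: "i \<in> I" "j \<in> I" "k \<in> I" "(i, j) \<in> r" "(j, k) \<in> r"
  show "(i, k) \<in> r" using I_trans ijk by blast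
  fix x assume x: "x \<in> carrier (N i)"
  have b: "\<beta> i x \<in> carrier (M i)" by (rule left_homD(1)[OF assms(3)[OF ijk(1)] x])
  show "\<alpha> k (f j k (\<beta> j (\<alpha> j (f i j (\<beta> i x))))) = \<alpha> k (f i k (\<beta> i x))"
    using f_f[OF ijk b] assms(4)[OF ijk(2) f_closed[OF ijk(1,2,4) b]] by simp
next
  fix i j assume ij: "i \<in> I" "j \<in> I" "(i, j) \<in> r"
  show "(\<lambda>x. \<alpha> j (f i j (\<beta> i x))) \<in> left_hom A (N i) (N j)"
    by (rule left_hom_comp[OF left_hom_comp[OF assms(3)[OF ij(1)] f_hom[OF ij]] assms(2)[OF ij(2)]])
  fix x assume x: "x \<in> carrier (N i)"
  have b: "\<beta> i x \<in> carrier (M i)" by (rule left_homD(1)[OF assms(3)[OF ij(1)] x])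
  show "h j (\<beta> j (\<alpha> j (f i j (\<beta> i x)))) = h i (\<beta> i x)"
    using h_f[OF ij b] assms(4)[OF ij(2) f_closed[OF ij b]] by simp
next
  fix i j assume "i \<in> I" "j \<in> I"
  thus "\<exists>k\<in>I. (i, k) \<in> r \<and> (j, k) \<in> r" by (rule I_directed)
qed (rule I_nonempty L_module)+

text \<open>The criteria of \<open>comod_colimitI\<close> are met because the images of the stages
  make up all of X and \<open>colim_lift\<close> provides the linear maps out of it.\<close>

lemma (in coring) directed_colim_is_colimit:
  fixes \<kappa> :: "'u rel" and D :: "('i, unit, ('a, 'c, 'u) comodule, 'u \<Rightarrow> 'u) functor_data"
  assumes "directed_colim A I r (fobj D) (\<lambda>i j. fmap D i j ()) X \<xi>"
    and D: "is_functor (poset_category I r) (Comod \<kappa> A C) D" and X: "X \<in> Obj (Comod \<kappa> A C)"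
    and \<xi>: "\<And>i. i \<in> I \<Longrightarrow> \<xi> i \<in> comodule_hom A C (fobj D i) X"
  shows "is_colimit (poset_category I r) (Comod \<kappa> A C) D X \<xi>"
proof -
  interpret directed_colim A I r "fobj D" "\<lambda>i j. fmap D i j ()" X \<xi> by fact
  interpret X: left_module A X by (rule L_module)
  show ?thesis
  proof (rule comod_colimitI[OF D X])
    show "\<xi> i \<in> comodule_hom A C (fobj D i) X" if "i \<in> Obj (poset_category I r)" for i
      using \<xi> that by simp
    show "\<xi> j (fmap D i j u x) = \<xi> i x"
      if "i \<in> Obj (poset_category I r)" "j \<in> Obj (poset_category I r)" "u \<in> Hom (poset_category I r) i j"
        "x \<in> carrier (fobj D i)" for i j u x
      using h_f[of i j x] that by simp
    show "x \<in> mspan A X (\<Union>i\<in>Obj (poset_category I r). \<xi> i ` carrier (fobj D i))" if "x \<in> carrier X" for x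
    proof (rule X.mspan_base)
      show "x \<in> (\<Union>i\<in>Obj (poset_category I r). \<xi> i ` carrier (fobj D i))" using h_surj[OF that] by auto
      show "(\<Union>i\<in>Obj (poset_category I r). \<xi> i ` carrier (fobj D i)) \<subseteq> carrier X" using h_closed by auto
    qed
    fix N :: "('a, 'c, 'u) comodule" and \<eta> :: "'i \<Rightarrow> 'u \<Rightarrow> 'u"
    assume N: "left_module A N" "\<And>i. i \<in> Obj (poset_category I r) \<Longrightarrow> \<eta> i \<in> left_hom A (fobj D i) N"
      "\<And>i j u x. \<lbrakk>i \<in> Obj (poset_category I r); j \<in> Obj (poset_category I r); u \<in> Hom (poset_category I r) i j;
        x \<in> carrier (fobj D i)\<rbrakk> \<Longrightarrow> \<eta> j (fmap D i j u x) = \<eta> i x"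
    have "\<exists>k\<in>left_hom A X N. \<forall>i\<in>I. \<forall>x\<in>carrier (fobj D i). k (\<xi> i x) = \<eta> i x"
      by (rule colim_lift[OF N(1)]) (use N(2,3) in auto)
    thus "\<exists>k\<in>left_hom A X N. \<forall>i\<in>Obj (poset_category I r). \<forall>x\<in>carrier (fobj D i). k (\<xi> i x) = \<eta> i x" by simp
  qed
qed

section \<open>Colimits of directed diagrams of comodules, described by elements\<close>

locale small_coring = coring A C + universe \<kappa>
  for A :: "('a, 'r) ring_scheme" and C :: "('a, 'c, 'x) coring_scheme" and \<kappa> :: "'u rel" +
  assumes small_A: "small \<kappa> (carrier A)" and small_C: "small \<kappa> (carrier C)"
begin

abbreviation "Cat \<equiv> Comod \<kappa> A C"

text \<open>The kernel condition is the delicate point: an element of \<open>D i\<close> that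
  vanishes in L is only known to be a combination of relations. The map \<open>?E j\<close>
  evaluates formal combinations at the stage \<open>j\<close>. Every relation is killed by
  \<open>?E j\<close> for all sufficiently late \<open>j\<close>, hence so is every combination of
  relations, whereas \<open>?E j\<close> sends the unit vector of an element of an earlier stage to
  its image in \<open>D j\<close>.\<close>

lemma presented_directed:
  fixes D :: "('i, unit, ('a, 'c, 'u) comodule, 'u \<Rightarrow> 'u) functor_data" and L :: "('a, 'l, 'y) module_scheme"
  assumes I: "aleph1_directed I r" and D: "is_functor (poset_category I r) Cat D"
    and P: "presents A L (colim_gens (poset_category I r) (fobj D)) \<gamma> (colim_rels A (poset_category I r) (fobj D) (fmap D))"
  shows "directed_colim A I r (fobj D) (\<lambda>i j. fmap D i j ()) L (\<lambda>i x. \<gamma> (i, x))"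
proof -
  note ID = aleph1_directedD[OF I] and DD = Comod_functorD[OF D, simplified]
  interpret MD: module_diagram A "poset_category I r" "fobj D" "fmap D"
    by (rule Comod_module_diagram[OF coring_axioms D])
  let ?f = "\<lambda>i j. fmap D i j ()"
  note Lm = presentsD(1)[OF P] and \<gamma> = MD.colimit_cocone[OF P, simplified]
  have f: "?f i j \<in> left_hom A (fobj D i) (fobj D j)" if "(i, j) \<in> r" for i j
    using comodule_homD(1)[OF DD(4)] ID(6)[OF that] that by blast
  have ff: "?f j k (?f i j x) = ?f i k x" if "(i, j) \<in> r" "(j, k) \<in> r" "x \<in> carrier (fobj D i)" for i j k x
    using DD(6)[of i j k x] ID(6)[OF that(1)] ID(6)[OF that(2)] that by auto
  have fc: "?f i j x \<in> carrier (fobj D j)" if "(i, j) \<in> r" "x \<in> carrier (fobj D i)" for i j x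
    using left_homD(1)[OF f[OF that(1)] that(2)] .
  \<comment> \<open>Generators from stages that are not below \<open>j\<close> get the default value
    zero; only such \<open>j\<close> matter later as lie above the stages involved.\<close>
  define g where "g = (\<lambda>j p. if (fst p, j) \<in> r then ?f (fst p) j (snd p) else \<zero>\<^bsub>fobj D j\<^esub>)"
  have g: "g j \<in> MD.G \<rightarrow> carrier (fobj D j)" if "j \<in> I" for j
  proof -
    interpret Dj: left_module A "fobj D j" by (rule DD(3)[OF that])
    show ?thesis using fc by (auto simp: g_def colim_gens_def)
  qed
  let ?E = "\<lambda>j. lincomb A (fobj D j) (g j)"
  have E: "?E j \<in> left_hom A MD.FG (fobj D j)" if "j \<in> I" for j
    by (rule lincomb_hom[OF DD(3)[OF that] g[OF that]])
  have Eu: "?E j (unit_vec A (i, x)) = ?f i j x" if "(i, j) \<in> r" "x \<in> carrier (fobj D i)" for i j x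
    using lincomb_unit_vec[where g = "g j" and x = "(i, x)" and M = "fobj D j" and A = A] DD(3) ID(6)[OF that(1)]
      fc[OF that] that by (simp add: g_def)
  have uc: "unit_vec A (i, x) \<in> carrier MD.FG" if "i \<in> I" "x \<in> carrier (fobj D i)" for i x
    using MD.unit_closed that by simp
  \<comment> \<open>The vanishing is claimed for all \<open>j\<close> beyond a threshold and not for
    one \<open>j\<close>, so that the thresholds of several relations can be replaced by a common
    upper bound.\<close>
  have gen: "\<exists>k\<in>I. \<forall>j\<in>I. (k, j) \<in> r \<longrightarrow> ?E j y = \<zero>\<^bsub>fobj D j\<^esub>"
    if "y \<in> colim_rels A (poset_category I r) (fobj D) (fmap D)" for y
  proof -
    have dz: "?E j (v \<ominus>\<^bsub>MD.FG\<^esub> w) = \<zero>\<^bsub>fobj D j\<^esub>"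
      if "j \<in> I" "v \<in> carrier MD.FG" "w \<in> carrier MD.FG" "?E j v = ?E j w" for j v w
    proof -
      interpret Dj: left_module A "fobj D j" by (rule DD(3)[OF that(1)])
      show ?thesis using left_hom_diff[OF MD.FG.left_module_axioms Dj.left_module_axioms E[OF that(1)] that(2,3)]
          left_homD(1)[OF E[OF that(1)]] that by (simp add: Dj.M.diff_zero_iff)
    qed
    from that consider
      (a) i x y' where "i \<in> I" "x \<in> carrier (fobj D i)" "y' \<in> carrier (fobj D i)"
        "y = unit_vec A (i, x \<oplus>\<^bsub>fobj D i\<^esub> y') \<ominus>\<^bsub>MD.FG\<^esub> (unit_vec A (i, x) \<oplus>\<^bsub>MD.FG\<^esub> unit_vec A (i, y'))"
    | (b) i x a where "i \<in> I" "x \<in> carrier (fobj D i)" "a \<in> carrier A"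
        "y = unit_vec A (i, a \<odot>\<^bsub>fobj D i\<^esub> x) \<ominus>\<^bsub>MD.FG\<^esub> a \<odot>\<^bsub>MD.FG\<^esub> unit_vec A (i, x)"
    | (c) i j x where "i \<in> I" "j \<in> I" "(i, j) \<in> r" "x \<in> carrier (fobj D i)"
        "y = unit_vec A (j, ?f i j x) \<ominus>\<^bsub>MD.FG\<^esub> unit_vec A (i, x)"
      unfolding colim_rels_def Let_def by auto
    thus ?thesis
    proof cases
      case a
      note ac = MD.D_add[simplified, OF a(1-3)]
      have "?E j y = \<zero>\<^bsub>fobj D j\<^esub>" if j: "j \<in> I" "(i, j) \<in> r" for j
        unfolding a(4)
        by (rule dz[OF j(1)]) (use a uc ac j in \<open>simp_all add: Eu left_homD(2)[OF E[OF j(1)]] left_homD(2)[OF f[OF j(2)]]\<close>)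
      thus ?thesis using a(1) by blast
    next
      case b
      note bc = MD.D_smult[simplified, OF b(1-3)]
      have "?E j y = \<zero>\<^bsub>fobj D j\<^esub>" if j: "j \<in> I" "(i, j) \<in> r" for j
        unfolding b(4)
        by (rule dz[OF j(1)])
          (use b uc bc j in \<open>simp_all add: Eu left_homD(3)[OF E[OF j(1)]] left_homD(3)[OF f[OF j(2)]] MD.FG.smult_closed\<close>)
      thus ?thesis using b(1) by blast
    next
      case (c i l x)
      \<comment> \<open>The threshold is the target \<open>l\<close> of the transition map: above
        it, \<open>i\<close> also lies below \<open>j\<close>, so both generators in the relation
        are evaluated properly and not by default.\<close>
      have "?E j y = \<zero>\<^bsub>fobj D j\<^esub>" if j: "j \<in> I" "(l, j) \<in> r" for j
        unfolding c(5)
        by (rule dz[OF j(1)]) (use c uc fc j ID(2)[OF c(3) j(2)] in \<open>simp_all add: Eu ff\<close>)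
      thus ?thesis using c(2) by blast
    qed
  qed
  have ker: "\<exists>k\<in>I. \<forall>j\<in>I. (k, j) \<in> r \<longrightarrow> ?E j v = \<zero>\<^bsub>fobj D j\<^esub>"
    if "v \<in> mspan A MD.FG (colim_rels A (poset_category I r) (fobj D) (fmap D))" for v
    using that
  proof (induction rule: mspan.induct)
    case zero
    have "?E j \<zero>\<^bsub>MD.FG\<^esub> = \<zero>\<^bsub>fobj D j\<^esub>" if "j \<in> I" for j
      by (rule left_hom_zero[OF MD.FG.left_module_axioms DD(3)[OF that] E[OF that]])
    thus ?case using ID(3) by blast
  next
    case (step y a v)
    obtain k where k: "k \<in> I" "\<And>j. \<lbrakk>j \<in> I; (k, j) \<in> r\<rbrakk> \<Longrightarrow> ?E j y = \<zero>\<^bsub>fobj D j\<^esub>" using gen[OF step(1)] by blast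
    obtain l where l: "l \<in> I" "\<And>j. \<lbrakk>j \<in> I; (l, j) \<in> r\<rbrakk> \<Longrightarrow> ?E j v = \<zero>\<^bsub>fobj D j\<^esub>" using step(4) by blast
    obtain m where m: "m \<in> I" "(k, m) \<in> r" "(l, m) \<in> r" using ID(4)[OF k(1) l(1)] by blast
    have yc: "y \<in> carrier MD.FG" "v \<in> carrier MD.FG"
      using MD.rels_sub step(1) MD.FG.mspan_closed[OF step(3) MD.rels_sub] by auto
    have "?E j (a \<odot>\<^bsub>MD.FG\<^esub> y \<oplus>\<^bsub>MD.FG\<^esub> v) = \<zero>\<^bsub>fobj D j\<^esub>" if j: "j \<in> I" "(m, j) \<in> r" for j
    proof -
      interpret Dj: left_module A "fobj D j" by (rule DD(3)[OF j(1)])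
      have "?E j y = \<zero>\<^bsub>fobj D j\<^esub>" by (rule k(2)[OF j(1) ID(2)[OF m(2) j(2)]])
      moreover have "?E j v = \<zero>\<^bsub>fobj D j\<^esub>" by (rule l(2)[OF j(1) ID(2)[OF m(3) j(2)]])
      ultimately show ?thesis using yc step(2)
        by (simp add: left_homD[OF E[OF j(1)]] MD.FG.smult_closed)
    qed
    thus ?case using m(1) by blast
  qed
  show ?thesis
  proof (rule directed_colim.intro)
    fix i x assume ix: "i \<in> I" "x \<in> carrier (fobj D i)" "\<gamma> (i, x) = \<zero>\<^bsub>L\<^esub>"
    have "lincomb A L \<gamma> (unit_vec A (i, x)) = \<zero>\<^bsub>L\<^esub>"
      using lincomb_unit_vec[where g = \<gamma> and x = "(i, x)" and M = L and A = A] Lm left_homD(1)[OF \<gamma>(1)[OF ix(1)] ix(2)] ix(3) by simp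
    hence "unit_vec A (i, x) \<in> mspan A MD.FG (colim_rels A (poset_category I r) (fobj D) (fmap D))"
      using presentsD(6)[OF P uc[OF ix(1,2)]] by simp
    then obtain k where k: "k \<in> I" "\<And>j. \<lbrakk>j \<in> I; (k, j) \<in> r\<rbrakk> \<Longrightarrow> ?E j (unit_vec A (i, x)) = \<zero>\<^bsub>fobj D j\<^esub>"
      using ker by blast
    obtain m where m: "m \<in> I" "(i, m) \<in> r" "(k, m) \<in> r" using ID(4)[OF ix(1) k(1)] by blast
    show "\<exists>j\<in>I. (i, j) \<in> r \<and> ?f i j x = \<zero>\<^bsub>fobj D j\<^esub>"
      using m k(2)[OF m(1,3)] Eu[OF m(2) ix(2)] by (intro bexI[of _ m]) auto
  next
    fix y assume "y \<in> carrier L"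
    then obtain v where v: "v \<in> carrier MD.FG" "y = lincomb A L \<gamma> v" using presentsD(7)[OF P] by blast
    note h = presents_hom(1)[OF P]
    from ring_A v(1) have "\<exists>i\<in>I. \<exists>x\<in>carrier (fobj D i). \<gamma> (i, x) = lincomb A L \<gamma> v"
    proof (induction rule: free_induct)
      case zero
      obtain i where i: "i \<in> I" using ID(3) by blast
      interpret Di: left_module A "fobj D i" by (rule DD(3)[OF i])
      have "\<gamma> (i, \<zero>\<^bsub>fobj D i\<^esub>) = \<zero>\<^bsub>L\<^esub>" using left_hom_zero[OF Di.left_module_axioms Lm \<gamma>(1)[OF i]] .
      moreover have "lincomb A L \<gamma> \<zero>\<^bsub>MD.FG\<^esub> = \<zero>\<^bsub>L\<^esub>" by (rule left_hom_zero[OF MD.FG.left_module_axioms Lm h])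
      ultimately show ?case using i by (intro bexI[of _ i] bexI[of _ "\<zero>\<^bsub>fobj D i\<^esub>"]) auto
    next
      case (step a p v)
      then obtain i x where ix: "i \<in> I" "x \<in> carrier (fobj D i)" "\<gamma> (i, x) = lincomb A L \<gamma> v" by blast
      obtain k z where p: "p = (k, z)" "k \<in> I" "z \<in> carrier (fobj D k)" using step(2) by (auto simp: colim_gens_def)
      obtain m where m: "m \<in> I" "(i, m) \<in> r" "(k, m) \<in> r" using ID(4)[OF ix(1) p(2)] by blast
      interpret Dm: left_module A "fobj D m" by (rule DD(3)[OF m(1)])
      define x' z' where "x' = ?f i m x" and "z' = ?f k m z"
      have x': "x' \<in> carrier (fobj D m)" "\<gamma> (m, x') = lincomb A L \<gamma> v"
        using fc[OF m(2) ix(2)] \<gamma>(2)[OF ix(1) m(1) m(2) ix(2)] ix(3) by (auto simp: x'_def)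
      have z': "z' \<in> carrier (fobj D m)" "\<gamma> (m, z') = \<gamma> p"
        using fc[OF m(3) p(3)] \<gamma>(2)[OF p(2) m(1) m(3) p(3)] p(1) by (auto simp: z'_def)
      have up: "lincomb A L \<gamma> (unit_vec A p) = \<gamma> p" "unit_vec A p \<in> carrier MD.FG"
        using lincomb_unit_vec[where g = \<gamma> and x = p and M = L and A = A] Lm presentsD(2)[OF P step(2)]
          unit_vec_closed[OF ring_A step(2)] by auto
      have "\<gamma> (m, a \<odot>\<^bsub>fobj D m\<^esub> z' \<oplus>\<^bsub>fobj D m\<^esub> x') = lincomb A L \<gamma> (a \<odot>\<^bsub>MD.FG\<^esub> unit_vec A p \<oplus>\<^bsub>MD.FG\<^esub> v)"
        using left_homD(2)[OF \<gamma>(1)[OF m(1)] Dm.smult_closed[OF step(1) z'(1)] x'(1)]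
          left_homD(3)[OF \<gamma>(1)[OF m(1)] step(1) z'(1)] step x' z' up
        by (simp add: left_homD[OF h] MD.FG.smult_closed)
      moreover have "a \<odot>\<^bsub>fobj D m\<^esub> z' \<oplus>\<^bsub>fobj D m\<^esub> x' \<in> carrier (fobj D m)"
        using x' z' step(1) by (simp add: Dm.smult_closed)
      ultimately show ?case using m(1) by blast
    qed
    thus "\<exists>i\<in>I. \<exists>x\<in>carrier (fobj D i). \<gamma> (i, x) = y" using v(2) by simp
  next
    fix i j assume "i \<in> I" "j \<in> I" thus "\<exists>k\<in>I. (i, k) \<in> r \<and> (j, k) \<in> r" by (rule ID(4))
  next
    fix i j k assume "(i, j) \<in> r" "(j, k) \<in> r" thus "(i, k) \<in> r" by (rule ID(2))
  next
    fix i j assume ij: "i \<in> I" "j \<in> I" "(i, j) \<in> r"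
    show "?f i j \<in> left_hom A (fobj D i) (fobj D j)" by (rule f[OF ij(3)])
    fix x assume "x \<in> carrier (fobj D i)"
    thus "\<gamma> (j, ?f i j x) = \<gamma> (i, x)" using \<gamma>(2)[OF ij] by simp
  next
    fix i j k x assume "(i, j) \<in> r" "(j, k) \<in> r" "x \<in> carrier (fobj D i)"
    thus "?f j k (?f i j x) = ?f i k x" by (rule ff)
  next
    fix i assume i: "i \<in> I"
    show "(i, i) \<in> r" by (rule ID(1)[OF i])
    show "left_module A (fobj D i)" by (rule DD(3)[OF i])
    show "(\<lambda>x. \<gamma> (i, x)) \<in> left_hom A (fobj D i) L" by (rule \<gamma>(1)[OF i])
  qed (rule ID(3) Lm)+
qed

end

section \<open>Comparison of the two notions of presentability\<close>

context small_coring
begin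

text \<open>An arbitrary colimit X is compared with the presented one through the mediating maps
  \<open>h\<close> and \<open>k\<close>. The equation \<open>kh\<close> carries surjectivity over
  from L to X, and \<open>h\<close> carries over the kernel condition.\<close>

lemma colimit_directed:
  fixes D :: "('i, unit, ('a, 'c, 'u) comodule, 'u \<Rightarrow> 'u) functor_data"
  assumes I: "aleph1_directed I r" and D: "is_functor (poset_category I r) Cat D" and "small \<kappa> I"
    and X: "is_colimit (poset_category I r) Cat D X \<xi>"
  shows "directed_colim A I r (fobj D) (\<lambda>i j. fmap D i j ()) X \<xi>"
proof -
  note ID = aleph1_directedD[OF I] and DD = Comod_functorD[OF D, simplified]
  have sI: "small \<kappa> (Obj (poset_category I r))" using assms(3) by simp
  obtain L \<theta> \<gamma> where L: "is_colimit (poset_category I r) Cat D L \<theta>"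
    and P: "presents A L (colim_gens (poset_category I r) (fobj D)) \<gamma> (colim_rels A (poset_category I r) (fobj D) (fmap D))"
    and lamg: "\<And>i x. \<lbrakk>i \<in> Obj (poset_category I r); x \<in> carrier (fobj D i)\<rbrakk> \<Longrightarrow> \<theta> i x = \<gamma> (i, x)"
    by (rule Comod_colimit_exists[OF universe_axioms small_A D sI]) blast
  interpret L: directed_colim A I r "fobj D" "\<lambda>i j. fmap D i j ()" L "\<lambda>i x. \<gamma> (i, x)"
    by (rule presented_directed[OF I D P])
  note lg = lamg[simplified]
  have cX: "is_cocone (poset_category I r) Cat D X \<xi>" and cL: "is_cocone (poset_category I r) Cat D L \<theta>"
    using X L by (simp_all add: is_colimit_def)
  have Xc: "comodule A C X" and \<xi>: "\<And>i. i \<in> I \<Longrightarrow> \<xi> i \<in> comodule_hom A C (fobj D i) X"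
    and \<xi>f: "\<And>i j. \<lbrakk>i \<in> I; j \<in> I; (i, j) \<in> r\<rbrakk> \<Longrightarrow> compose (carrier (fobj D i)) (\<xi> j) (fmap D i j ()) = \<xi> i"
    using cX by (simp_all add: is_cocone_def)
  obtain h where h: "h \<in> comodule_hom A C X L" "\<And>i. i \<in> I \<Longrightarrow> compose (carrier (fobj D i)) h (\<xi> i) = \<theta> i"
    using X cL unfolding is_colimit_def by (metis Comod_simps(2,3) poset_category_simps(1))
  obtain k where k: "k \<in> comodule_hom A C L X" "\<And>i. i \<in> I \<Longrightarrow> compose (carrier (fobj D i)) k (\<theta> i) = \<xi> i"
    using L cX unfolding is_colimit_def by (metis Comod_simps(2,3) poset_category_simps(1))
  have Lc: "comodule A C L" using cL by (simp add: is_cocone_def)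
  have hx: "h (\<xi> i x) = \<gamma> (i, x)" and kx: "k (\<gamma> (i, x)) = \<xi> i x" if "i \<in> I" "x \<in> carrier (fobj D i)" for i x
    using fun_cong[OF h(2)[OF that(1)], of x] fun_cong[OF k(2)[OF that(1)], of x] lg[OF that] that
    by (simp_all add: compose_eq)
  \<comment> \<open>The composite and the identity are both endomorphisms of the colimit cocone on
    X, so uniqueness in the universal property makes them equal.\<close>
  have kh: "k (h y) = y" if "y \<in> carrier X" for y
  proof -
    have "\<exists>!e. e \<in> Hom Cat X X \<and> (\<forall>i\<in>Obj (poset_category I r). Cmp Cat (fobj D i) X X e (\<xi> i) = \<xi> i)"
      using conjunct2[OF X[unfolded is_colimit_def]] cX by blast
    hence u: "\<exists>!e. e \<in> comodule_hom A C X X \<and> (\<forall>i\<in>I. compose (carrier (fobj D i)) e (\<xi> i) = \<xi> i)" by simp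
    have "compose (carrier X) k h \<in> comodule_hom A C X X \<and>
        (\<forall>i\<in>I. compose (carrier (fobj D i)) (compose (carrier X) k h) (\<xi> i) = \<xi> i)"
    proof (intro conjI ballI comodule_hom_comp[OF Xc Lc Xc h(1) k(1)] ext)
      fix i x assume i: "i \<in> I"
      show "compose (carrier (fobj D i)) (compose (carrier X) k h) (\<xi> i) x = \<xi> i x"
      proof (cases "x \<in> carrier (fobj D i)")
        case True
        thus ?thesis using hx[OF i True] kx[OF i True] comodule_homD(3)[OF \<xi>[OF i] True] by (simp add: compose_eq)
      next
        case False
        thus ?thesis using comodule_homD(2)[OF \<xi>[OF i]] by (simp add: compose_def extensional_def)
      qed
    qed
    moreover have "(\<lambda>x\<in>carrier X. x) \<in> comodule_hom A C X X \<and>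
        (\<forall>i\<in>I. compose (carrier (fobj D i)) (\<lambda>x\<in>carrier X. x) (\<xi> i) = \<xi> i)"
    proof (intro conjI ballI comodule_hom_id[OF Xc] ext)
      fix i x assume i: "i \<in> I"
      show "compose (carrier (fobj D i)) (\<lambda>x\<in>carrier X. x) (\<xi> i) x = \<xi> i x"
        using comodule_homD(2)[OF \<xi>[OF i]] comodule_homD(3)[OF \<xi>[OF i]]
        by (cases "x \<in> carrier (fobj D i)") (auto simp: compose_def extensional_def)
    qed
    ultimately have "compose (carrier X) k h = (\<lambda>x\<in>carrier X. x)" using u by blast
    from fun_cong[OF this, of y] show ?thesis using that by (simp add: compose_eq)
  qed
  show ?thesis
  proof (rule directed_colim.intro)
    fix y assume y: "y \<in> carrier X"
    obtain i x where ix: "i \<in> I" "x \<in> carrier (fobj D i)" "\<gamma> (i, x) = h y"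
      using L.h_surj[OF comodule_homD(3)[OF h(1) y]] by blast
    have "\<xi> i x = y" using kx[OF ix(1,2)] ix(3) kh[OF y] by simp
    thus "\<exists>i\<in>I. \<exists>x\<in>carrier (fobj D i). \<xi> i x = y" using ix by blast
  next
    fix i x assume ix: "i \<in> I" "x \<in> carrier (fobj D i)" "\<xi> i x = \<zero>\<^bsub>X\<^esub>"
    have "\<gamma> (i, x) = h \<zero>\<^bsub>X\<^esub>" using hx[OF ix(1,2)] ix(3) by simp
    also have "\<dots> = \<zero>\<^bsub>L\<^esub>"
      by (rule left_hom_zero[OF comoduleD(1)[OF Xc] comoduleD(1)[OF Lc] comodule_homD(1)[OF h(1)]])
    finally show "\<exists>j\<in>I. (i, j) \<in> r \<and> fmap D i j () x = \<zero>\<^bsub>fobj D j\<^esub>" by (rule L.h_kernel[OF ix(1,2)])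
  next
    fix i j x assume ij: "i \<in> I" "j \<in> I" "(i, j) \<in> r" "x \<in> carrier (fobj D i)"
    show "\<xi> j (fmap D i j () x) = \<xi> i x" using fun_cong[OF \<xi>f[OF ij(1-3)], of x] ij(4) by (simp add: compose_eq)
  next
    show "left_module A X" by (rule comoduleD(1)[OF Xc])
    show "\<xi> i \<in> left_hom A (fobj D i) X" if "i \<in> I" for i by (rule comodule_homD(1)[OF \<xi>[OF that]])
    show "left_module A (fobj D i)" if "i \<in> I" for i by (rule L.M_module[OF that])
    show "fmap D i j () \<in> left_hom A (fobj D i) (fobj D j)" if "i \<in> I" "j \<in> I" "(i, j) \<in> r" for i j
      by (rule L.f_hom[OF that])
    show "fmap D j k () (fmap D i j () x) = fmap D i k () x"
      if "i \<in> I" "j \<in> I" "k \<in> I" "(i, j) \<in> r" "(j, k) \<in> r" "x \<in> carrier (fobj D i)" for i j k x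
      by (rule L.f_f[OF that])
  qed (rule ID; assumption)+
qed

lemma hom_functor_simps:
  "fobj (comp_functor (hom_functor Cat S) D) i = comodule_hom A C S (fobj D i)"
  "fmap (comp_functor (hom_functor Cat S) D) i j u =
    (\<lambda>g\<in>comodule_hom A C S (fobj D i). compose (carrier S) (fmap D i j u) g)"
  "fobj (hom_functor Cat S) X = comodule_hom A C S X"
  "fmap (hom_functor Cat S) X Y f = (\<lambda>g\<in>comodule_hom A C S X. compose (carrier S) f g)"
  by (simp_all add: comp_functor_def hom_functor_def)

text \<open>A morphism into the colimit factors through a stage as a linear map by
  \<open>factor\<close>, but this map need not respect the coactions. The failure is a pair of
  linear maps into the tensor product with that stage which agree over X. As the tensor products
  form a directed colimit too, \<open>coincide\<close> makes them agree at a later stage.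
  Injectivity on hom-sets is \<open>coincide\<close> for the modules themselves.\<close>

lemma countably_presentable_imp_aleph1_presentable:
  assumes S: "S \<in> Obj Cat" and CP: "countably_presentable A S"
  shows "aleph1_presentable \<kappa> Cat S"
  unfolding aleph1_presentable_def
proof (intro conjI allI impI S)
  fix I :: "'u set" and r and D :: "('u, unit, ('a, 'c, 'u) comodule, 'u \<Rightarrow> 'u) functor_data" and X \<xi>
  assume "aleph1_directed_diagram \<kappa> I r Cat D \<and> is_colimit (poset_category I r) Cat D X \<xi>"
  hence I: "aleph1_directed I r" and D: "is_functor (poset_category I r) Cat D" and sI: "small \<kappa> I"
    and X: "is_colimit (poset_category I r) Cat D X \<xi>"
    by (auto simp: aleph1_directed_diagram_def)
  note ID = aleph1_directedD[OF I] and DD = Comod_functorD[OF D, simplified]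
  interpret X: directed_colim A I r "fobj D" "\<lambda>i j. fmap D i j ()" X \<xi>
    by (rule colimit_directed[OF I D sI X])
  interpret TX: directed_colim A I r "\<lambda>i. tensor_module A C (fobj D i)"
    "\<lambda>i j. tensor_map A C (fobj D j) id (fmap D i j ())" "tensor_module A C X" "\<lambda>i. tensor_map A C X id (\<xi> i)"
    by (rule X.tensor_directed_colim[OF bimodule_axioms])
  have Xc: "comodule A C X" and \<xi>: "\<And>i. i \<in> I \<Longrightarrow> \<xi> i \<in> comodule_hom A C (fobj D i) X"
    using X by (simp_all add: is_colimit_def is_cocone_def)
  have Sc: "comodule A C S" using S by simp
  note Sm = comoduleD[OF Sc] and Xm = comoduleD[OF Xc]
  obtain Z :: "nat set" and g Y where P: "presents A S Z g Y" and cY: "countable Y"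
    by (rule presents_if_countably_presentable[OF Sm(1) CP])
  have fh: "fmap D i j () \<in> comodule_hom A C (fobj D i) (fobj D j)" if "(i, j) \<in> r" for i j
    using DD(4) ID(6)[OF that] that by blast
  have \<xi>f: "\<xi> j (fmap D i j () x) = \<xi> i x" if "(i, j) \<in> r" "x \<in> carrier (fobj D i)" for i j x
    using X.h_f that ID(6)[OF that(1)] by blast
  show "is_colimit (poset_category I r) set_category (comp_functor (hom_functor Cat S) D)
     (fobj (hom_functor Cat S) X) (\<lambda>i. fmap (hom_functor Cat S) (fobj D i) X (\<xi> i))"
    unfolding hom_functor_simps
  proof (rule set_colimitI[OF I], unfold hom_functor_simps)
    show "(\<lambda>g\<in>comodule_hom A C S (fobj D i). compose (carrier S) (fmap D i j ()) g)
        \<in> comodule_hom A C S (fobj D i) \<rightarrow> comodule_hom A C S (fobj D j)" if "(i, j) \<in> r" for i j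
      using comodule_hom_comp[OF Sc DD(1) DD(1) _ fh[OF that]] ID(6)[OF that] by auto
    show "(\<lambda>g\<in>comodule_hom A C S (fobj D i). compose (carrier S) (\<xi> i) g)
        \<in> comodule_hom A C S (fobj D i) \<rightarrow>\<^sub>E comodule_hom A C S X" if "i \<in> I" for i
      using comodule_hom_comp[OF Sc DD(1)[OF that] Xc _ \<xi>[OF that]] by auto
    show "(\<lambda>g\<in>comodule_hom A C S (fobj D j). compose (carrier S) (\<xi> j) g)
          ((\<lambda>g\<in>comodule_hom A C S (fobj D i). compose (carrier S) (fmap D i j ()) g) \<psi>) =
        (\<lambda>g\<in>comodule_hom A C S (fobj D i). compose (carrier S) (\<xi> i) g) \<psi>"
      if ij: "(i, j) \<in> r" and \<psi>: "\<psi> \<in> comodule_hom A C S (fobj D i)" for i j \<psi>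
    proof -
      have "compose (carrier S) (fmap D i j ()) \<psi> \<in> comodule_hom A C S (fobj D j)"
        using comodule_hom_comp[OF Sc DD(1) DD(1) \<psi> fh[OF ij]] ID(6)[OF ij] by auto
      thus ?thesis using \<psi> \<xi>f[OF ij] comodule_homD(3)[OF \<psi>]
        by (auto simp: compose_def fun_eq_iff)
    qed
    show "\<exists>i\<in>I. \<exists>\<psi>\<in>comodule_hom A C S (fobj D i).
        (\<lambda>g\<in>comodule_hom A C S (fobj D i). compose (carrier S) (\<xi> i) g) \<psi> = \<phi>"
      if \<phi>: "\<phi> \<in> comodule_hom A C S X" for \<phi>
    proof -
      note \<phi>D = comodule_homD[OF \<phi>]
      obtain i \<psi> where i: "i \<in> I" and \<psi>: "\<psi> \<in> left_hom A S (fobj D i)" "\<And>s. s \<in> carrier S \<Longrightarrow> \<xi> i (\<psi> s) = \<phi> s"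
        using X.factor[OF ID(5) P _ cY \<phi>D(1)] by (auto simp: countable_subset[OF subset_UNIV])
      note Di = comoduleD[OF DD(1)[OF i]] and \<psi>c = left_homD(1)[OF \<psi>(1)]
      \<comment> \<open>The two sides of the equation that would make \<open>\<psi>\<close> a
        morphism of comodules.\<close>
      let ?a = "\<lambda>s. coact (fobj D i) (\<psi> s)" and ?b = "\<lambda>s. tensor_map A C (fobj D i) id \<psi> (coact S s)"
      have a: "?a \<in> left_hom A S (tensor_module A C (fobj D i))" by (rule left_hom_comp[OF \<psi>(1) Di(3)])
      have b: "?b \<in> left_hom A S (tensor_module A C (fobj D i))"
        by (rule left_hom_comp[OF Sm(3) T_hom[OF Sm(1) Di(1) \<psi>(1)]])
      have ab: "tensor_map A C X id (\<xi> i) (?a s) = tensor_map A C X id (\<xi> i) (?b s)" if s: "s \<in> carrier S" for s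
      proof -
        have "tensor_map A C X id (\<xi> i) (?a s) = coact X (\<phi> s)"
          using comodule_homD(4)[OF \<xi>[OF i] \<psi>c[OF s]] \<psi>(2)[OF s] by simp
        also have "\<dots> = tensor_map A C X id \<phi> (coact S s)" by (rule \<phi>D(4)[OF s])
        also have "\<dots> = tensor_map A C X id (\<lambda>s. \<xi> i (\<psi> s)) (coact S s)"
          by (rule T_cong[OF Sm(1) Xm(1) \<phi>D(1) left_hom_comp[OF \<psi>(1) comodule_homD(1)[OF \<xi>[OF i]]] _ Sm(4)[OF s]])
            (simp add: \<psi>(2))
        also have "\<dots> = tensor_map A C X id (\<xi> i) (?b s)"
          by (rule T_comp[OF Sm(1) Di(1) Xm(1) \<psi>(1) comodule_homD(1)[OF \<xi>[OF i]] Sm(4)[OF s], symmetric])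
        finally show ?thesis .
      qed
      obtain j where j: "j \<in> I" "(i, j) \<in> r" "\<And>s. s \<in> carrier S \<Longrightarrow>
          tensor_map A C (fobj D j) id (fmap D i j ()) (?a s) = tensor_map A C (fobj D j) id (fmap D i j ()) (?b s)"
        using TX.coincide[OF ID(5) P _ i a b ab] by (auto simp: countable_subset[OF subset_UNIV])
      note Dj = comoduleD[OF DD(1)[OF j(1)]] and fij = comodule_homD[OF fh[OF j(2)]]
      let ?\<chi> = "\<lambda>s. fmap D i j () (\<psi> s)"
      have \<chi>: "restrict ?\<chi> (carrier S) \<in> comodule_hom A C S (fobj D j)"
      proof (rule comodule_homI[OF Sc DD(1)[OF j(1)] left_hom_comp[OF \<psi>(1) fij(1)]])
        fix s assume s: "s \<in> carrier S"
        have "coact (fobj D j) (?\<chi> s) = tensor_map A C (fobj D j) id (fmap D i j ()) (?a s)"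
          by (rule fij(4)[OF \<psi>c[OF s]])
        also have "\<dots> = tensor_map A C (fobj D j) id (fmap D i j ()) (?b s)" by (rule j(3)[OF s])
        also have "\<dots> = tensor_map A C (fobj D j) id ?\<chi> (coact S s)"
          by (rule T_comp[OF Sm(1) Di(1) Dj(1) \<psi>(1) fij(1) Sm(4)[OF s]])
        finally show "coact (fobj D j) (?\<chi> s) = tensor_map A C (fobj D j) id ?\<chi> (coact S s)" .
      qed
      have "compose (carrier S) (\<xi> j) (restrict ?\<chi> (carrier S)) = \<phi>"
        using \<xi>f[OF j(2) \<psi>c] \<psi>(2) \<phi>D(2) by (auto simp: compose_def fun_eq_iff extensional_def)
      thus ?thesis using \<chi> j(1) by (intro bexI[of _ j] bexI[of _ "restrict ?\<chi> (carrier S)"]) simp_all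
    qed
    show "\<exists>j. (i, j) \<in> r \<and>
        (\<lambda>g\<in>comodule_hom A C S (fobj D i). compose (carrier S) (fmap D i j ()) g) \<psi> =
        (\<lambda>g\<in>comodule_hom A C S (fobj D i). compose (carrier S) (fmap D i j ()) g) \<psi>'"
      if i: "i \<in> I" and \<psi>: "\<psi> \<in> comodule_hom A C S (fobj D i)" "\<psi>' \<in> comodule_hom A C S (fobj D i)"
        and eq: "(\<lambda>g\<in>comodule_hom A C S (fobj D i). compose (carrier S) (\<xi> i) g) \<psi> =
          (\<lambda>g\<in>comodule_hom A C S (fobj D i). compose (carrier S) (\<xi> i) g) \<psi>'" for i \<psi> \<psi>'
    proof -
      have "compose (carrier S) (\<xi> i) \<psi> = compose (carrier S) (\<xi> i) \<psi>'" using eq \<psi> by simp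
      hence e: "\<xi> i (\<psi> s) = \<xi> i (\<psi>' s)" if "s \<in> carrier S" for s
        using that by (metis compose_eq)
      obtain j where j: "j \<in> I" "(i, j) \<in> r" "\<And>s. s \<in> carrier S \<Longrightarrow> fmap D i j () (\<psi> s) = fmap D i j () (\<psi>' s)"
        using X.coincide[OF ID(5) P _ i comodule_homD(1)[OF \<psi>(1)] comodule_homD(1)[OF \<psi>(2)] e]
        by (auto simp: countable_subset[OF subset_UNIV])
      thus ?thesis using \<psi> by (intro exI[of _ j]) (auto simp: compose_def fun_eq_iff)
    qed
  qed
qed

text \<open>The section of the retraction comes from the identity of S: it is an element of the
  colimit of the hom-sets, and \<open>set_colimit_surj\<close> lifts it to a stage.\<close>

lemma aleph1_presentable_imp_countably_presentable:
  assumes "aleph1_presentable \<kappa> Cat S"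
    and "aleph1_directed_colimit_of \<kappa> Cat {S \<in> Obj Cat. countably_presentable A S} S"
  shows "countably_presentable A S"
proof -
  obtain I :: "'u set" and r and D :: "('u, unit, ('a, 'c, 'u) comodule, 'u \<Rightarrow> 'u) functor_data" and \<xi>
    where ID: "aleph1_directed_diagram \<kappa> I r Cat D" and G: "\<forall>i\<in>I. fobj D i \<in> {S \<in> Obj Cat. countably_presentable A S}"
    and X: "is_colimit (poset_category I r) Cat D S \<xi>"
    using assms(2) unfolding aleph1_directed_colimit_of_def by blast
  have I: "aleph1_directed I r" and D: "is_functor (poset_category I r) Cat D"
    using ID by (auto simp: aleph1_directed_diagram_def)
  note DD = Comod_functorD[OF D, simplified]
  have Sc: "comodule A C S" and \<xi>: "\<And>i. i \<in> I \<Longrightarrow> \<xi> i \<in> comodule_hom A C (fobj D i) S"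
    using X by (simp_all add: is_colimit_def is_cocone_def)
  have "is_colimit (poset_category I r) set_category (comp_functor (hom_functor Cat S) D)
        (fobj (hom_functor Cat S) S) (\<lambda>i. fmap (hom_functor Cat S) (fobj D i) S (\<xi> i))"
    using assms(1) ID X unfolding aleph1_presentable_def by blast
  note co = this[unfolded hom_functor_simps]
  \<comment> \<open>The corresponding constant functions are the two distinct elements that
    \<open>set_colimit_surj\<close> takes in the type of morphisms.\<close>
  obtain a b :: 'u where ab: "a \<noteq> b"
    using infinite_u by (metis (full_types) UNIV_I ex_new_if_finite finite.emptyI finite.insertI insertI1)
  have "\<exists>i\<in>Obj (poset_category I r). \<exists>y\<in>fobj (comp_functor (hom_functor Cat S) D) i.
      (\<lambda>g\<in>comodule_hom A C S (fobj D i). compose (carrier S) (\<xi> i) g) y = (\<lambda>x\<in>carrier S. x)"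
  proof (rule set_colimit_surj[OF co])
    show "(\<lambda>_. a) \<noteq> (\<lambda>_ :: 'u. b)" using ab by (simp add: fun_eq_iff)
    show "(\<lambda>x\<in>carrier S. x) \<in> comodule_hom A C S S" by (rule comodule_hom_id[OF Sc])
    fix i j u assume ij: "i \<in> Obj (poset_category I r)" "j \<in> Obj (poset_category I r)" "u \<in> Hom (poset_category I r) i j"
    show "fmap (comp_functor (hom_functor Cat S) D) i j u
       \<in> fobj (comp_functor (hom_functor Cat S) D) i \<rightarrow> fobj (comp_functor (hom_functor Cat S) D) j"
      unfolding hom_functor_simps
      using comodule_hom_comp[OF Sc DD(1) DD(1) _ DD(4)] ij by auto
  qed
  then obtain i g where i: "i \<in> I" and g: "g \<in> comodule_hom A C S (fobj D i)"
    and e: "compose (carrier S) (\<xi> i) g = (\<lambda>x\<in>carrier S. x)"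
    by (auto simp: hom_functor_simps)
  have "\<xi> i (g s) = s" if "s \<in> carrier S" for s
    using fun_cong[OF e, of s] that by (simp add: compose_eq)
  thus ?thesis
    by (rule countably_presentable_retract[OF comoduleD(1)[OF Sc] DD(3)[OF i] comodule_homD(1)[OF g]
          comodule_homD(1)[OF \<xi>[OF i]]]) (use G i in auto)
qed

text \<open>
  Up to isomorphism, a countably presentable comodule is determined by generators indexed by natural
  numbers, countably many relations between them, and lifts of the coactions of the generators.
\<close>

definition parameters :: "(nat set \<times> (nat \<Rightarrow> 'a) set \<times> (nat \<Rightarrow> ('c, nat \<Rightarrow> 'a) tensor)) set" where
  "parameters = (SIGMA X:UNIV. {Y. Y \<subseteq> carrier (free_left_module A X) \<and> countable Y} \<times>
    {t. range t \<subseteq> carrier (tensor_group A C (free_left_module A X))})"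

definition has_parameters ::
  "('a, 'c, 'm) comodule \<Rightarrow> nat set \<times> (nat \<Rightarrow> 'a) set \<times> (nat \<Rightarrow> ('c, nat \<Rightarrow> 'a) tensor) \<Rightarrow> bool" where
  "has_parameters S p \<longleftrightarrow> p \<in> parameters \<and> (case p of (X, Y, t) \<Rightarrow> \<exists>g. presents A S X g Y \<and>
    (\<forall>n\<in>X. tensor_map A C S id (lincomb A S g) (t n) = coact S (g n)))"

text \<open>The three components are countable data over small sets: a set of naturals, a countable
  set of vectors in a small free module, and a sequence in a small tensor product.\<close>

lemma small_parameters: "small \<kappa> parameters"
  unfolding parameters_def
proof (rule small_Sigma)
  have "small \<kappa> {B. B \<subseteq> (UNIV :: nat set) \<and> countable B}"
    by (intro small_countable_subsets small_countable) simp
  thus "small \<kappa> (UNIV :: nat set set)"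
    by (rule small_subset[rotated]) (auto intro: countable_subset[OF subset_UNIV])
  fix X :: "nat set"
  have F: "small \<kappa> (carrier (free_left_module A X))"
    by (rule small_free[OF ring_A small_A small_countable]) (rule countable_subset[OF subset_UNIV], simp)
  show "small \<kappa> ({Y. Y \<subseteq> carrier (free_left_module A X) \<and> countable Y} \<times>
    {t :: nat \<Rightarrow> ('c, nat \<Rightarrow> 'a) tensor. range t \<subseteq> carrier (tensor_group A C (free_left_module A X))})"
    by (intro small_Sigma small_countable_subsets small_sequences F
        small_tensor[OF bimodule_axioms free_left_module[OF ring_A] small_C])
qed

text \<open>A pure tensor lifts by lifting its second entry, and differences of lifts are lifts. For
  the evaluation map of a presentation this yields the tensors over the free module that form the
  third component of the parameters.\<close>

lemma T_surj:
  assumes "left_module A N" "left_module A P" "f \<in> left_hom A N P" "f ` carrier N = carrier P"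
    and "t \<in> carrier (tensor_group A C P)"
  shows "\<exists>s\<in>carrier (tensor_group A C N). tensor_map A C P id f s = t"
proof -
  interpret N: tensor_pair A C N by (rule pairI[OF assms(1)])
  interpret P: tensor_pair A C P by (rule pairI[OF assms(2)])
  note h = T_add_hom[OF assms(1-3)]
  show ?thesis using assms(5)
  proof (induction rule: P.tensor_induct)
    case zero
    then show ?case using add_hom_zero[OF N.tensor_abelian_group P.tensor_abelian_group h] N.T.zero_closed by blast
  next
    case (pure c m)
    then have "m \<in> f ` carrier N" using assms(4) by simp
    then obtain n where n: "m = f n" "n \<in> carrier N" by (rule imageE)
    show ?case unfolding n(1)
      by (rule bexI, rule T_pure[OF assms(1-3) pure(1) n(2)], rule N.pure_closed[OF pure(1) n(2)])
  next
    case (diff x y)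
    then obtain s u where su: "s \<in> carrier (tensor_group A C N)" "tensor_map A C P id f s = x"
      "u \<in> carrier (tensor_group A C N)" "tensor_map A C P id f u = y" by blast
    have "tensor_map A C P id f (s \<ominus>\<^bsub>tensor_group A C N\<^esub> u) = x \<ominus>\<^bsub>tensor_group A C P\<^esub> y"
      using add_hom_diff[OF N.tensor_abelian_group P.tensor_abelian_group h su(1,3)] su(2,4) by simp
    thus ?case using N.T.minus_closed[OF su(1,3)] by (rule bexI)
  qed
qed

lemma has_parameters_exists:
  assumes "comodule A C S" "countably_presentable A S"
  shows "\<exists>p. has_parameters S p"
proof -
  note Sm = comoduleD[OF assms(1)]
  obtain X :: "nat set" and g Y where P: "presents A S X g Y" and cY: "countable Y"
    by (rule presents_if_countably_presentable[OF Sm(1) assms(2)])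
  let ?F = "free_left_module A X"
  interpret TF: tensor_pair A C ?F by (rule pairI[OF free_left_module[OF ring_A]])
  note p = presents_hom[OF P]
  \<comment> \<open>Outside \<open>X\<close> an arbitrary element is taken, so that \<open>t\<close>
    becomes a total sequence, as \<open>parameters\<close> demands.\<close>
  have "\<exists>s\<in>carrier (tensor_group A C ?F). n \<in> X \<longrightarrow> tensor_map A C S id (lincomb A S g) s = coact S (g n)" for n
  proof (cases "n \<in> X")
    case True
    from T_surj[OF free_left_module[OF ring_A] Sm(1) p Sm(4)[OF presentsD(2)[OF P True]]] show ?thesis by blast
  qed (use TF.T.zero_closed in blast)
  then obtain t where t: "\<And>n. t n \<in> carrier (tensor_group A C ?F)"
    "\<And>n. n \<in> X \<Longrightarrow> tensor_map A C S id (lincomb A S g) (t n) = coact S (g n)" by metis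
  have "(X, Y, t) \<in> parameters" using presentsD(4)[OF P] cY t(1) by (auto simp: parameters_def)
  hence "has_parameters S (X, Y, t)" using P t(2) by (auto simp: has_parameters_def)
  thus ?thesis by blast
qed

text \<open>Equal relations give a linear map that matches the generators. It respects the coactions
  because the coactions of corresponding generators are images of the same tensor \<open>t n\<close>
  over the common free module.\<close>

lemma has_parameters_hom:
  assumes "comodule A C S" "comodule A C S'" "presents A S X g Y" "presents A S' X g' Y"
    and "\<And>n. n \<in> X \<Longrightarrow> t n \<in> carrier (tensor_group A C (free_left_module A X))"
    and "\<And>n. n \<in> X \<Longrightarrow> tensor_map A C S id (lincomb A S g) (t n) = coact S (g n)"
    and "\<And>n. n \<in> X \<Longrightarrow> tensor_map A C S' id (lincomb A S' g') (t n) = coact S' (g' n)"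
  obtains \<alpha> where "\<alpha> \<in> comodule_hom A C S S'" "\<And>n. n \<in> X \<Longrightarrow> \<alpha> (g n) = g' n"
proof -
  note Sm = comoduleD[OF assms(1)] and Sm' = comoduleD[OF assms(2)]
  note P = assms(3) and P' = assms(4)
  obtain \<alpha> where \<alpha>: "\<alpha> \<in> left_hom A S S'" "\<And>n. n \<in> X \<Longrightarrow> \<alpha> (g n) = g' n"
    by (rule presents_lift[OF P Sm'(1) presentsD(3)[OF P'] presentsD(5)[OF P']]) blast+
  have \<alpha>q: "\<alpha> (lincomb A S g v) = lincomb A S' g' v" if "v \<in> carrier (free_left_module A X)" for v
    using hom_lincomb[OF Sm(1) Sm'(1) presentsD(3)[OF P] \<alpha>(1) that]
      lincomb_cong[OF Sm'(1) presentsD(3)[OF P'] that, of "\<lambda>x. \<alpha> (g x)"] \<alpha>(2) by simp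
  have "coact S' (\<alpha> s) = tensor_map A C S' id \<alpha> (coact S s)" if "s \<in> carrier S" for s
  proof (rule presents_ext[OF P T_left_module[OF Sm'(1)] left_hom_comp[OF \<alpha>(1) Sm'(3)]
        left_hom_comp[OF Sm(3) T_hom[OF Sm(1) Sm'(1) \<alpha>(1)]] _ that])
    fix n assume n: "n \<in> X"
    note Fm = free_left_module[OF ring_A, of X] and q = presents_hom(1)[OF P] and q' = presents_hom(1)[OF P']
    have "coact S' (\<alpha> (g n)) = tensor_map A C S' id (lincomb A S' g') (t n)" using \<alpha>(2)[OF n] assms(7)[OF n] by simp
    also have "\<dots> = tensor_map A C S' id (\<lambda>v. \<alpha> (lincomb A S g v)) (t n)"
      by (rule T_cong[OF Fm Sm'(1) q' left_hom_comp[OF q \<alpha>(1)] _ assms(5)[OF n]]) (simp add: \<alpha>q)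
    also have "\<dots> = tensor_map A C S' id \<alpha> (tensor_map A C S id (lincomb A S g) (t n))"
      by (rule T_comp[OF Fm Sm(1) Sm'(1) q \<alpha>(1) assms(5)[OF n], symmetric])
    finally show "coact S' (\<alpha> (g n)) = tensor_map A C S' id \<alpha> (coact S (g n))" using assms(6)[OF n] by simp
  qed
  hence "restrict \<alpha> (carrier S) \<in> comodule_hom A C S S'" by (rule comodule_homI[OF assms(1,2) \<alpha>(1)])
  thus thesis by (rule that) (simp add: \<alpha>(2) presentsD(2)[OF P])
qed

lemma has_parameters_iso:
  assumes "comodule A C S" "comodule A C S'" "has_parameters S p" "has_parameters S' p"
  shows "\<exists>\<alpha>\<in>comodule_hom A C S S'. \<exists>\<beta>\<in>comodule_hom A C S' S.
    (\<forall>s\<in>carrier S. \<beta> (\<alpha> s) = s) \<and> (\<forall>s\<in>carrier S'. \<alpha> (\<beta> s) = s)"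
proof -
  note Sm = comoduleD[OF assms(1)] and Sm' = comoduleD[OF assms(2)]
  obtain X Y t where p: "p = (X, Y, t)" by (cases p)
  obtain g where P: "presents A S X g Y" and g: "\<And>n. n \<in> X \<Longrightarrow> tensor_map A C S id (lincomb A S g) (t n) = coact S (g n)"
    using assms(3) unfolding has_parameters_def p by auto
  obtain g' where P': "presents A S' X g' Y" and g': "\<And>n. n \<in> X \<Longrightarrow> tensor_map A C S' id (lincomb A S' g') (t n) = coact S' (g' n)"
    using assms(4) unfolding has_parameters_def p by auto
  have t: "t n \<in> carrier (tensor_group A C (free_left_module A X))" for n
    using assms(3) unfolding has_parameters_def p parameters_def by auto
  obtain \<alpha> where \<alpha>: "\<alpha> \<in> comodule_hom A C S S'" "\<And>n. n \<in> X \<Longrightarrow> \<alpha> (g n) = g' n"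
    by (rule has_parameters_hom[OF assms(1,2) P P' t g g']) blast+
  obtain \<beta> where \<beta>: "\<beta> \<in> comodule_hom A C S' S" "\<And>n. n \<in> X \<Longrightarrow> \<beta> (g' n) = g n"
    by (rule has_parameters_hom[OF assms(2,1) P' P t g' g]) blast+
  note a = comodule_homD(1)[OF \<alpha>(1)] and b = comodule_homD(1)[OF \<beta>(1)]
  have "\<beta> (\<alpha> s) = s" if "s \<in> carrier S" for s
    by (rule presents_ext[OF P Sm(1) left_hom_comp[OF a b] left_hom_id(2) _ that]) (simp add: \<alpha> \<beta>)
  moreover have "\<alpha> (\<beta> s) = s" if "s \<in> carrier S'" for s
    by (rule presents_ext[OF P' Sm'(1) left_hom_comp[OF b a] left_hom_id(2) _ that]) (simp add: \<alpha> \<beta>)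
  ultimately show ?thesis using \<alpha>(1) \<beta>(1) by blast
qed

text \<open>One comodule for every parameter that occurs. Such a choice is needed for smallness:
  isomorphic copies of a single comodule on different subsets of \<open>'u\<close> are already too
  many.\<close>

definition representatives :: "('a, 'c, 'u) comodule set" where
  "representatives = (\<lambda>p. SOME S. S \<in> Obj Cat \<and> has_parameters S p) `
    {p \<in> parameters. \<exists>S. S \<in> Obj Cat \<and> has_parameters S p}"

lemma small_representatives: "small \<kappa> representatives"
  unfolding representatives_def by (rule small_image, rule small_subset[OF _ small_parameters]) blast

lemma representatives_props:
  assumes "S \<in> representatives"
  shows "S \<in> Obj Cat" "countably_presentable A S"
proof -
  obtain p where p: "\<exists>S. S \<in> Obj Cat \<and> has_parameters S p" and S: "S = (SOME S. S \<in> Obj Cat \<and> has_parameters S p)"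
    using assms unfolding representatives_def by blast
  have Sp: "S \<in> Obj Cat \<and> has_parameters S p" unfolding S by (rule someI_ex[OF p])
  thus "S \<in> Obj Cat" by blast
  obtain X Y t where p': "p = (X, Y, t)" by (cases p)
  obtain g where P: "presents A S X g Y" using Sp unfolding has_parameters_def p' by auto
  have "countable Y" using Sp unfolding has_parameters_def parameters_def p' by simp
  thus "countably_presentable A S"
    by (rule countably_presentable_if_presents[OF P countable_subset[OF subset_UNIV], rotated]) simp
qed

lemma representative_exists:
  assumes "S \<in> Obj Cat" "countably_presentable A S"
  shows "\<exists>S'\<in>representatives. \<exists>\<alpha>\<in>comodule_hom A C S S'. \<exists>\<beta>\<in>comodule_hom A C S' S.
    (\<forall>s\<in>carrier S. \<beta> (\<alpha> s) = s) \<and> (\<forall>s\<in>carrier S'. \<alpha> (\<beta> s) = s)"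
proof -
  have Sc: "comodule A C S" using assms(1) by simp
  obtain p where p: "has_parameters S p" using has_parameters_exists[OF Sc assms(2)] by blast
  have ex: "\<exists>S. S \<in> Obj Cat \<and> has_parameters S p" using assms(1) p by blast
  define S' where "S' = (SOME S. S \<in> Obj Cat \<and> has_parameters S p)"
  have S': "S' \<in> Obj Cat \<and> has_parameters S' p" unfolding S'_def by (rule someI_ex[OF ex])
  have "p \<in> parameters" using p by (simp add: has_parameters_def)
  hence rep: "S' \<in> representatives" unfolding representatives_def S'_def using ex by blast
  have S'c: "comodule A C S'" using S' by simp
  show ?thesis
    by (rule bexI, rule has_parameters_iso[OF Sc S'c p conjunct2[OF S']], rule rep)
qed

end

section \<open>Approximating a comodule by countably presentable ones\<close>

text \<open>The step that adds all \<open>c u\<close> is iterated over the natural numbers. An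
  element of the union appears after finitely many iterations, and its \<open>c u\<close> is
  contained in the next one.\<close>

lemma countable_closure:
  assumes "\<And>u. u \<in> U \<Longrightarrow> countable (c u) \<and> c u \<subseteq> U" "Z \<subseteq> U" "countable Z"
  obtains W where "Z \<subseteq> W" "W \<subseteq> U" "countable W" "\<And>u. u \<in> W \<Longrightarrow> c u \<subseteq> W"
proof -
  define step where "step = (\<lambda>V. V \<union> (\<Union>u\<in>V. c u))"
  define V where "V = (\<lambda>n. (step ^^ n) Z)"
  have VS: "V (Suc n) = V n \<union> (\<Union>u\<in>V n. c u)" for n by (simp add: V_def step_def)
  have V: "V n \<subseteq> U \<and> countable (V n)" for n
  proof (induction n)
    case 0
    then show ?case using assms(2,3) by (simp add: V_def)
  next
    case (Suc n)
    have "countable (\<Union>u\<in>V n. c u)" by (rule countable_UN) (use Suc assms(1) in auto)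
    moreover have "(\<Union>u\<in>V n. c u) \<subseteq> U" using Suc assms(1) by blast
    ultimately show ?case using Suc by (simp add: VS)
  qed
  show thesis
  proof (rule that[of "\<Union>n. V n"])
    show "Z \<subseteq> (\<Union>n. V n)" using UN_upper[of 0 UNIV V] by (simp add: V_def)
    show "(\<Union>n. V n) \<subseteq> U" using V by blast
    show "countable (\<Union>n. V n)" by (rule countable_UN) (use V in auto)
    fix u assume "u \<in> (\<Union>n. V n)"
    then obtain n where "u \<in> V n" by blast
    hence "c u \<subseteq> V (Suc n)" by (auto simp: VS)
    thus "c u \<subseteq> (\<Union>n. V n)" by blast
  qed
qed

lemma free_restrict_supp:
  assumes "ring A" "v \<in> carrier (free_left_module A X)"
  shows "v \<in> carrier (free_left_module A {x. v x \<noteq> \<zero>\<^bsub>A\<^esub>})"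
  using assms(2) free_val[OF assms] by (auto simp: free_carrier)

text \<open>
  Let \<open>M\<close> be presented by all its elements and all the relations between them. A set \<open>Z\<close> of elements
  and relations defines the module generated by the elements in \<open>Z\<close> subject to those relations in \<open>Z\<close>
  that only involve elements in \<open>Z\<close>.
\<close>

locale comodule_approx = small_coring A C \<kappa>
  for A :: "('a, 'r) ring_scheme" and C :: "('a, 'c, 'x) coring_scheme" and \<kappa> :: "'u rel" +
  fixes M :: "('a, 'c, 'u) comodule"
  assumes M_Obj: "M \<in> Obj (Comod \<kappa> A C)"
begin

lemma M_comodule: "comodule A C M" and M_small: "small \<kappa> (carrier M)"
  using M_Obj by simp_all

lemmas M_props = comoduleD[OF M_comodule]

definition all_rels :: "('u \<Rightarrow> 'a) set" where
  "all_rels = {v \<in> carrier (free_left_module A (carrier M)). lincomb A M (\<lambda>x. x) v = \<zero>\<^bsub>M\<^esub>}"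

definition all_data :: "('u + ('u \<Rightarrow> 'a)) set" where
  "all_data = Inl ` carrier M \<union> Inr ` all_rels"

definition gens_of :: "('u + ('u \<Rightarrow> 'a)) set \<Rightarrow> 'u set" where
  "gens_of Z = {m. Inl m \<in> Z}"

definition rels_of :: "('u + ('u \<Rightarrow> 'a)) set \<Rightarrow> ('u \<Rightarrow> 'a) set" where
  "rels_of Z = {v. Inr v \<in> Z \<and> v \<in> carrier (free_left_module A (gens_of Z))}"

lemma gens_of_sub: "Z \<subseteq> all_data \<Longrightarrow> gens_of Z \<subseteq> carrier M"
  by (auto simp: gens_of_def all_data_def)

lemma gens_of_mono: "Z \<subseteq> W \<Longrightarrow> gens_of Z \<subseteq> gens_of W"
  by (auto simp: gens_of_def)

lemma rels_of_mono: "Z \<subseteq> W \<Longrightarrow> rels_of Z \<subseteq> rels_of W"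
  using free_mono[OF gens_of_mono ring_A, of Z W] by (auto simp: rels_of_def)

lemma rels_of_sub: "Z \<subseteq> all_data \<Longrightarrow> rels_of Z \<subseteq> all_rels"
  by (auto simp: rels_of_def all_data_def)

lemma countable_gens_of: "countable Z \<Longrightarrow> countable (gens_of Z)"
  using countable_image_inj_on[of Inl "gens_of Z"] countable_subset[of "Inl ` gens_of Z" Z]
  by (auto simp: gens_of_def)

lemma countable_rels_of: "countable Z \<Longrightarrow> countable (rels_of Z)"
  using countable_image_inj_on[of Inr "rels_of Z"] countable_subset[of "Inr ` rels_of Z" Z]
  by (auto simp: rels_of_def)

lemma small_all_data: "small \<kappa> all_data"
proof -
  have "small \<kappa> all_rels" unfolding all_rels_def
    by (rule small_subset[OF _ small_free[OF ring_A small_A M_small]]) blast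
  thus ?thesis unfolding all_data_def by (intro small_Un small_image M_small)
qed

text \<open>One small presented module with its generators is fixed for every \<open>Z\<close>, so
  that all transition maps refer to the same modules.\<close>

definition presentation :: "('u + ('u \<Rightarrow> 'a)) set \<Rightarrow> ('a, 'u) module \<times> ('u \<Rightarrow> 'u)" where
  "presentation Z = (SOME q. presents A (fst q) (gens_of Z) (snd q) (rels_of Z) \<and> small \<kappa> (carrier (fst q)))"

definition approx :: "('u + ('u \<Rightarrow> 'a)) set \<Rightarrow> ('a, 'u) module" where
  "approx Z = fst (presentation Z)"

definition agen :: "('u + ('u \<Rightarrow> 'a)) set \<Rightarrow> 'u \<Rightarrow> 'u" where
  "agen Z = snd (presentation Z)"

lemma approx_presents:
  assumes "Z \<subseteq> all_data"
  shows "presents A (approx Z) (gens_of Z) (agen Z) (rels_of Z)" "small \<kappa> (carrier (approx Z))"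
proof -
  let ?F = "free_left_module A (gens_of Z)"
  have s: "small \<kappa> (carrier ?F)"
    by (rule small_free[OF ring_A small_A small_subset[OF gens_of_sub[OF assms] M_small]])
  obtain \<phi> :: "('u \<Rightarrow> 'a) \<Rightarrow> 'u" where \<phi>: "inj_on \<phi> (carrier ?F)" by (rule small_inject[OF s])
  have Y: "rels_of Z \<subseteq> carrier ?F" by (auto simp: rels_of_def)
  obtain L :: "('a, 'u) module" and g where L: "presents A L (gens_of Z) g (rels_of Z)" "carrier L \<subseteq> \<phi> ` carrier ?F"
    by (rule presents_exists[OF ring_A \<phi> Y]) blast
  have "small \<kappa> (carrier L)" by (rule small_subset[OF L(2) small_image[OF s]])
  hence "\<exists>q :: ('a, 'u) module \<times> ('u \<Rightarrow> 'u). presents A (fst q) (gens_of Z) (snd q) (rels_of Z) \<and> small \<kappa> (carrier (fst q))"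
    using L(1) by (intro exI[of _ "(L, g)"]) simp
  from someI_ex[OF this]
  show "presents A (approx Z) (gens_of Z) (agen Z) (rels_of Z)" "small \<kappa> (carrier (approx Z))"
    by (simp_all add: approx_def agen_def presentation_def)
qed

lemma approx_module: "Z \<subseteq> all_data \<Longrightarrow> left_module A (approx Z)"
  by (rule presentsD(1)[OF approx_presents(1)])

definition atrans :: "('u + ('u \<Rightarrow> 'a)) set \<Rightarrow> ('u + ('u \<Rightarrow> 'a)) set \<Rightarrow> 'u \<Rightarrow> 'u" where
  "atrans Z W = (SOME f. f \<in> left_hom A (approx Z) (approx W) \<and> (\<forall>x\<in>gens_of Z. f (agen Z x) = agen W x))"

definition aproj :: "('u + ('u \<Rightarrow> 'a)) set \<Rightarrow> 'u \<Rightarrow> 'u" where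
  "aproj Z = (SOME f. f \<in> left_hom A (approx Z) M \<and> (\<forall>x\<in>gens_of Z. f (agen Z x) = x))"

lemma atrans:
  assumes "Z \<subseteq> W" "W \<subseteq> all_data"
  shows "atrans Z W \<in> left_hom A (approx Z) (approx W)" "x \<in> gens_of Z \<Longrightarrow> atrans Z W (agen Z x) = agen W x"
proof -
  note P = approx_presents(1)[OF order_trans[OF assms]] and Q = approx_presents(1)[OF assms(2)]
  have g: "agen W \<in> gens_of Z \<rightarrow> carrier (approx W)"
    using presentsD(2)[OF Q] gens_of_mono[OF assms(1)] by auto
  have y: "lincomb A (approx W) (agen W) y = \<zero>\<^bsub>approx W\<^esub>" if "y \<in> rels_of Z" for y
    using presentsD(5)[OF Q] rels_of_mono[OF assms(1)] that by blast
  obtain f where "f \<in> left_hom A (approx Z) (approx W)" "\<And>x. x \<in> gens_of Z \<Longrightarrow> f (agen Z x) = agen W x"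
    by (rule presents_lift[OF P approx_module[OF assms(2)] g y]) blast+
  hence "\<exists>f. f \<in> left_hom A (approx Z) (approx W) \<and> (\<forall>x\<in>gens_of Z. f (agen Z x) = agen W x)" by blast
  from someI_ex[OF this] show "atrans Z W \<in> left_hom A (approx Z) (approx W)"
    "x \<in> gens_of Z \<Longrightarrow> atrans Z W (agen Z x) = agen W x" by (simp_all add: atrans_def)
qed

lemma aproj:
  assumes "Z \<subseteq> all_data"
  shows "aproj Z \<in> left_hom A (approx Z) M" "x \<in> gens_of Z \<Longrightarrow> aproj Z (agen Z x) = x"
proof -
  have g: "(\<lambda>x. x) \<in> gens_of Z \<rightarrow> carrier M" using gens_of_sub[OF assms] by auto
  have y: "lincomb A M (\<lambda>x. x) y = \<zero>\<^bsub>M\<^esub>" if "y \<in> rels_of Z" for y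
    using rels_of_sub[OF assms] that by (auto simp: all_rels_def)
  obtain f where "f \<in> left_hom A (approx Z) M" "\<And>x. x \<in> gens_of Z \<Longrightarrow> f (agen Z x) = x"
    by (rule presents_lift[OF approx_presents(1)[OF assms] M_props(1) g y]) blast+
  hence "\<exists>f. f \<in> left_hom A (approx Z) M \<and> (\<forall>x\<in>gens_of Z. f (agen Z x) = x)" by blast
  from someI_ex[OF this] show "aproj Z \<in> left_hom A (approx Z) M"
    "x \<in> gens_of Z \<Longrightarrow> aproj Z (agen Z x) = x" by (simp_all add: aproj_def)
qed

lemma approx_ext:
  assumes "Z \<subseteq> all_data" "left_module A N" "f \<in> left_hom A (approx Z) N" "f' \<in> left_hom A (approx Z) N"
    and "\<And>x. x \<in> gens_of Z \<Longrightarrow> f (agen Z x) = f' (agen Z x)" "v \<in> carrier (approx Z)"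
  shows "f v = f' v"
  by (rule presents_ext[OF approx_presents(1)[OF assms(1)] assms(2-6)])

lemma agen_closed: "\<lbrakk>Z \<subseteq> all_data; x \<in> gens_of Z\<rbrakk> \<Longrightarrow> agen Z x \<in> carrier (approx Z)"
  by (rule presentsD(2)[OF approx_presents(1)])

lemma atrans_trans:
  assumes "Z \<subseteq> W" "W \<subseteq> V" "V \<subseteq> all_data" "v \<in> carrier (approx Z)"
  shows "atrans W V (atrans Z W v) = atrans Z V v"
proof -
  have W: "W \<subseteq> all_data" and ZV: "Z \<subseteq> V" and Z: "Z \<subseteq> all_data" using assms by auto
  show ?thesis
    by (rule approx_ext[where f = "\<lambda>v. atrans W V (atrans Z W v)", OF Z approx_module[OF assms(3)]
          left_hom_comp[OF atrans(1)[OF assms(1) W] atrans(1)[OF assms(2,3)]] atrans(1)[OF ZV assms(3)] _ assms(4)])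
      (use gens_of_mono[OF assms(1)] in \<open>simp add: atrans(2)[OF assms(1) W] atrans(2)[OF ZV assms(3)] atrans(2)[OF assms(2,3)] subset_iff\<close>)
qed

lemma atrans_refl: "\<lbrakk>Z \<subseteq> all_data; v \<in> carrier (approx Z)\<rbrakk> \<Longrightarrow> atrans Z Z v = v"
  by (rule approx_ext[where f = "atrans Z Z" and f' = "\<lambda>v. v", OF _ approx_module atrans(1)[OF order_refl] left_hom_id(2)])
    (simp_all add: atrans(2))

lemma aproj_atrans:
  assumes "Z \<subseteq> W" "W \<subseteq> all_data" "v \<in> carrier (approx Z)"
  shows "aproj W (atrans Z W v) = aproj Z v"
proof -
  have Z: "Z \<subseteq> all_data" using assms by auto
  show ?thesis
    by (rule approx_ext[where f = "\<lambda>v. aproj W (atrans Z W v)", OF Z M_props(1)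
          left_hom_comp[OF atrans(1)[OF assms(1,2)] aproj(1)[OF assms(2)]] aproj(1)[OF Z] _ assms(3)])
      (use gens_of_mono[OF assms(1)] in \<open>simp add: atrans(2)[OF assms(1,2)] aproj(2)[OF assms(2)] aproj(2)[OF Z] subset_iff\<close>)
qed

text \<open>An element \<open>y\<close> of M is hit as soon as \<open>Inl y\<close> is present. An
  element of an approximation that dies in M is represented by a vector \<open>w\<close> that is a
  relation of M, and it dies as soon as \<open>Inr w\<close> is present. By \<open>cof\<close> such
  indices exist. The indexing by \<open>\<psi>\<close> covers both uses: all countable sets, and
  only the closed ones with indices in \<open>'u\<close>.\<close>

lemma approx_directed:
  assumes sub: "\<And>i. i \<in> I \<Longrightarrow> \<psi> i \<subseteq> all_data \<and> countable (\<psi> i)"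
    and cof: "\<And>Z. \<lbrakk>Z \<subseteq> all_data; countable Z\<rbrakk> \<Longrightarrow> \<exists>i\<in>I. Z \<subseteq> \<psi> i"
  shows "directed_colim A I {(i, j). i \<in> I \<and> j \<in> I \<and> \<psi> i \<subseteq> \<psi> j} (\<lambda>i. approx (\<psi> i))
    (\<lambda>i j. atrans (\<psi> i) (\<psi> j)) M (\<lambda>i. aproj (\<psi> i))"
proof (rule directed_colim.intro)
  show "I \<noteq> {}" using cof[of "{}"] by auto
  show "left_module A M" by (rule M_props(1))
  fix i assume i: "i \<in> I"
  note Zi = conjunct1[OF sub[OF i]]
  show "(i, i) \<in> {(i, j). i \<in> I \<and> j \<in> I \<and> \<psi> i \<subseteq> \<psi> j}" using i by simp
  show "left_module A (approx (\<psi> i))" by (rule approx_module[OF Zi])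
  show "aproj (\<psi> i) \<in> left_hom A (approx (\<psi> i)) M" by (rule aproj(1)[OF Zi])
  fix v assume v: "v \<in> carrier (approx (\<psi> i))" and z: "aproj (\<psi> i) v = \<zero>\<^bsub>M\<^esub>"
  note P = approx_presents(1)[OF Zi]
  obtain w where w: "w \<in> carrier (free_left_module A (gens_of (\<psi> i)))" "v = lincomb A (approx (\<psi> i)) (agen (\<psi> i)) w"
    using presentsD(7)[OF P v] by blast
  have "lincomb A M (\<lambda>x. x) w = lincomb A M (\<lambda>x. aproj (\<psi> i) (agen (\<psi> i) x)) w"
    by (rule lincomb_cong[OF M_props(1) _ w(1)]) (use gens_of_sub[OF Zi] aproj(2)[OF Zi] in auto)
  also have "\<dots> = aproj (\<psi> i) v"
    unfolding w(2) by (rule hom_lincomb[OF approx_module[OF Zi] M_props(1) presentsD(3)[OF P] aproj(1)[OF Zi] w(1), symmetric])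
  finally have "w \<in> all_rels"
    using z w(1) free_mono[OF gens_of_sub[OF Zi] ring_A] by (auto simp: all_rels_def)
  hence "\<psi> i \<union> {Inr w} \<subseteq> all_data" "countable (\<psi> i \<union> {Inr w})" using sub[OF i] by (auto simp: all_data_def)
  then obtain j where j: "j \<in> I" "\<psi> i \<union> {Inr w} \<subseteq> \<psi> j" using cof by blast
  hence ij: "\<psi> i \<subseteq> \<psi> j" by simp
  note Zj = conjunct1[OF sub[OF j(1)]]
  note Q = approx_presents(1)[OF Zj]
  have "w \<in> rels_of (\<psi> j)" using j(2) w(1) free_mono[OF gens_of_mono[OF ij] ring_A] by (auto simp: rels_of_def)
  hence "lincomb A (approx (\<psi> j)) (agen (\<psi> j)) w = \<zero>\<^bsub>approx (\<psi> j)\<^esub>" by (rule presentsD(5)[OF Q])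
  moreover have "atrans (\<psi> i) (\<psi> j) v = lincomb A (approx (\<psi> j)) (\<lambda>x. atrans (\<psi> i) (\<psi> j) (agen (\<psi> i) x)) w"
    unfolding w(2) by (rule hom_lincomb[OF approx_module[OF Zi] approx_module[OF Zj] presentsD(3)[OF P] atrans(1)[OF ij Zj] w(1)])
  moreover have "lincomb A (approx (\<psi> j)) (\<lambda>x. atrans (\<psi> i) (\<psi> j) (agen (\<psi> i) x)) w = lincomb A (approx (\<psi> j)) (agen (\<psi> j)) w"
  proof (rule lincomb_cong[OF approx_module[OF Zj] _ w(1)])
    show "(\<lambda>x. atrans (\<psi> i) (\<psi> j) (agen (\<psi> i) x)) \<in> gens_of (\<psi> i) \<rightarrow> carrier (approx (\<psi> j))"
      using left_homD(1)[OF atrans(1)[OF ij Zj]] agen_closed[OF Zi] by auto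
  qed (rule atrans(2)[OF ij Zj])
  ultimately show "\<exists>j\<in>I. (i, j) \<in> {(i, j). i \<in> I \<and> j \<in> I \<and> \<psi> i \<subseteq> \<psi> j} \<and> atrans (\<psi> i) (\<psi> j) v = \<zero>\<^bsub>approx (\<psi> j)\<^esub>"
    using i j(1) ij by (intro bexI[of _ j]) auto
next
  fix y assume y: "y \<in> carrier M"
  obtain i where i: "i \<in> I" "{Inl y} \<subseteq> \<psi> i" using cof[of "{Inl y}"] y by (auto simp: all_data_def)
  note Zi = conjunct1[OF sub[OF i(1)]]
  have "y \<in> gens_of (\<psi> i)" using i(2) by (simp add: gens_of_def)
  thus "\<exists>i\<in>I. \<exists>x\<in>carrier (approx (\<psi> i)). aproj (\<psi> i) x = y"
    using i(1) agen_closed[OF Zi] aproj(2)[OF Zi] by (intro bexI[of _ i] bexI[of _ "agen (\<psi> i) y"]) auto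
next
  fix i j assume ij: "i \<in> I" "j \<in> I"
  have "\<psi> i \<union> \<psi> j \<subseteq> all_data" "countable (\<psi> i \<union> \<psi> j)" using sub[OF ij(1)] sub[OF ij(2)] by auto
  then obtain k where "k \<in> I" "\<psi> i \<union> \<psi> j \<subseteq> \<psi> k" using cof by blast
  thus "\<exists>k\<in>I. (i, k) \<in> {(i, j). i \<in> I \<and> j \<in> I \<and> \<psi> i \<subseteq> \<psi> j} \<and> (j, k) \<in> {(i, j). i \<in> I \<and> j \<in> I \<and> \<psi> i \<subseteq> \<psi> j}"
    using ij by (intro bexI[of _ k]) auto
next
  fix i j k assume "(i, j) \<in> {(i, j). i \<in> I \<and> j \<in> I \<and> \<psi> i \<subseteq> \<psi> j}" "(j, k) \<in> {(i, j). i \<in> I \<and> j \<in> I \<and> \<psi> i \<subseteq> \<psi> j}"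
  thus "(i, k) \<in> {(i, j). i \<in> I \<and> j \<in> I \<and> \<psi> i \<subseteq> \<psi> j}" by auto
next
  fix i j assume "i \<in> I" "j \<in> I" "(i, j) \<in> {(i, j). i \<in> I \<and> j \<in> I \<and> \<psi> i \<subseteq> \<psi> j}"
  hence ij: "\<psi> i \<subseteq> \<psi> j" "\<psi> j \<subseteq> all_data" using sub by auto
  show "atrans (\<psi> i) (\<psi> j) \<in> left_hom A (approx (\<psi> i)) (approx (\<psi> j))" by (rule atrans(1)[OF ij])
  fix x assume "x \<in> carrier (approx (\<psi> i))"
  thus "aproj (\<psi> j) (atrans (\<psi> i) (\<psi> j) x) = aproj (\<psi> i) x" by (rule aproj_atrans[OF ij])
next
  fix i j k x assume "k \<in> I" "(i, j) \<in> {(i, j). i \<in> I \<and> j \<in> I \<and> \<psi> i \<subseteq> \<psi> j}"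
    "(j, k) \<in> {(i, j). i \<in> I \<and> j \<in> I \<and> \<psi> i \<subseteq> \<psi> j}" "x \<in> carrier (approx (\<psi> i))"
  thus "atrans (\<psi> j) (\<psi> k) (atrans (\<psi> i) (\<psi> j) x) = atrans (\<psi> i) (\<psi> k) x"
    using sub by (intro atrans_trans) auto
qed

section \<open>Tensor products of the approximations\<close>

abbreviation "TA Z \<equiv> tensor_module A C (approx Z)"
abbreviation "ta Z W \<equiv> tensor_map A C (approx W) id (atrans Z W)"
abbreviation "tp Z \<equiv> tensor_map A C M id (aproj Z)"
abbreviation "tta Z W \<equiv> tensor_map A C (TA W) id (ta Z W)"
abbreviation "ttp Z \<equiv> tensor_map A C (tensor_module A C M) id (tp Z)"

lemma TA_module: "Z \<subseteq> all_data \<Longrightarrow> left_module A (TA Z)"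
  by (rule T_left_module[OF approx_module])

lemma ta_hom: "\<lbrakk>Z \<subseteq> W; W \<subseteq> all_data\<rbrakk> \<Longrightarrow> ta Z W \<in> left_hom A (TA Z) (TA W)"
  by (rule T_hom[OF approx_module approx_module atrans(1)]) auto

lemma tp_hom: "Z \<subseteq> all_data \<Longrightarrow> tp Z \<in> left_hom A (TA Z) (tensor_module A C M)"
  by (rule T_hom[OF approx_module M_props(1) aproj(1)])

lemma ta_trans:
  assumes "Z \<subseteq> W" "W \<subseteq> V" "V \<subseteq> all_data" "t \<in> carrier (TA Z)"
  shows "ta W V (ta Z W t) = ta Z V t"
proof -
  have W: "W \<subseteq> all_data" and ZV: "Z \<subseteq> V" and Z: "Z \<subseteq> all_data" using assms by auto
  have t: "t \<in> carrier (tensor_group A C (approx Z))" using assms(4) by simp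
  note aZW = atrans(1)[OF assms(1) W] and aWV = atrans(1)[OF assms(2,3)] and aZV = atrans(1)[OF ZV assms(3)]
  have "ta W V (ta Z W t) = tensor_map A C (approx V) id (\<lambda>x. atrans W V (atrans Z W x)) t"
    by (rule T_comp[OF approx_module[OF Z] approx_module[OF W] approx_module[OF assms(3)] aZW aWV t])
  also have "\<dots> = ta Z V t"
    by (rule T_cong[OF approx_module[OF Z] approx_module[OF assms(3)] left_hom_comp[OF aZW aWV] aZV
          atrans_trans[OF assms(1-3)] t])
  finally show ?thesis .
qed

lemma tp_ta:
  assumes "Z \<subseteq> W" "W \<subseteq> all_data" "t \<in> carrier (TA Z)"
  shows "tp W (ta Z W t) = tp Z t"
proof -
  have Z: "Z \<subseteq> all_data" using assms by auto
  have t: "t \<in> carrier (tensor_group A C (approx Z))" using assms(3) by simp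
  note aZW = atrans(1)[OF assms(1,2)] and pW = aproj(1)[OF assms(2)] and pZ = aproj(1)[OF Z]
  have "tp W (ta Z W t) = tensor_map A C M id (\<lambda>x. aproj W (atrans Z W x)) t"
    by (rule T_comp[OF approx_module[OF Z] approx_module[OF assms(2)] M_props(1) aZW pW t])
  also have "\<dots> = tp Z t"
    by (rule T_cong[OF approx_module[OF Z] M_props(1) left_hom_comp[OF aZW pW] pZ aproj_atrans[OF assms(1,2)] t])
  finally show ?thesis .
qed

abbreviation "countables \<equiv> {Z. Z \<subseteq> all_data \<and> countable Z}"

lemma countables_directed:
  "directed_colim A countables {(Z, W). Z \<in> countables \<and> W \<in> countables \<and> Z \<subseteq> W} approx atrans M aproj"
  using approx_directed[of countables "\<lambda>Z. Z"] by blast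

text \<open>
  For a generator \<open>u\<close> of \<open>M\<close>, \<open>c u\<close> contains the data needed to lift its coaction, and for a relation
  \<open>u\<close> it contains the data that make the lifted relation hold in the tensor product. Hence the coaction
  lifts to every \<open>Z\<close> that is closed under \<open>c\<close>.
\<close>

lemma lifted_coactions:
  obtains c \<nu> where "\<And>u. u \<in> all_data \<Longrightarrow> countable (c u) \<and> c u \<subseteq> all_data"
    "\<And>Z. \<lbrakk>Z \<subseteq> all_data; \<And>u. u \<in> Z \<Longrightarrow> c u \<subseteq> Z\<rbrakk> \<Longrightarrow> \<nu> Z \<in> left_hom A (approx Z) (TA Z)"
    "\<And>Z v. \<lbrakk>Z \<subseteq> all_data; \<And>u. u \<in> Z \<Longrightarrow> c u \<subseteq> Z; v \<in> carrier (approx Z)\<rbrakk> \<Longrightarrow> tp Z (\<nu> Z v) = coact M (aproj Z v)"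
    "\<And>Z W v. \<lbrakk>Z \<subseteq> W; W \<subseteq> all_data; \<And>u. u \<in> Z \<Longrightarrow> c u \<subseteq> Z; \<And>u. u \<in> W \<Longrightarrow> c u \<subseteq> W; v \<in> carrier (approx Z)\<rbrakk> \<Longrightarrow>
      ta Z W (\<nu> Z v) = \<nu> W (atrans Z W v)"
proof -
  let ?r = "{(Z, W). Z \<in> countables \<and> W \<in> countables \<and> Z \<subseteq> W}"
  interpret D: directed_colim A countables ?r approx atrans M aproj by (rule countables_directed)
  interpret TD: directed_colim A countables ?r TA ta "tensor_module A C M" tp
    by (rule D.tensor_directed_colim[OF bimodule_axioms])
  have "\<exists>q. fst q \<in> countables \<and> snd q \<in> carrier (TA (fst q)) \<and> tp (fst q) (snd q) = coact M x"
    if "x \<in> carrier M" for x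
  proof -
    have "coact M x \<in> carrier (tensor_module A C M)" using M_props(4)[OF that] by simp
    from TD.h_surj[OF this] obtain Z where Z: "Z \<in> countables" "\<exists>t\<in>carrier (TA Z). tp Z t = coact M x"
      by (rule bexE)
    from Z(2) obtain t where "t \<in> carrier (TA Z)" "tp Z t = coact M x" by (rule bexE)
    with Z(1) have "fst (Z, t) \<in> countables \<and> snd (Z, t) \<in> carrier (TA (fst (Z, t))) \<and> tp (fst (Z, t)) (snd (Z, t)) = coact M x"
      by (simp only: fst_conv snd_conv)
    thus ?thesis by (rule exI)
  qed
  then obtain q where q: "\<And>x. x \<in> carrier M \<Longrightarrow> fst (q x) \<in> countables \<and>
      snd (q x) \<in> carrier (TA (fst (q x))) \<and> tp (fst (q x)) (snd (q x)) = coact M x"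
    by (metis (no_types))
  define n \<tau> where "n = (\<lambda>x. fst (q x))" and "\<tau> = (\<lambda>x. snd (q x))"
  have n: "n x \<in> countables" and \<tau>: "\<tau> x \<in> carrier (TA (n x))" "tp (n x) (\<tau> x) = coact M x" if "x \<in> carrier M" for x
    using q[OF that] unfolding n_def \<tau>_def by blast+
  \<comment> \<open>A lift \<open>\<tau> x\<close> of the coaction of \<open>x\<close> is chosen
    once, at the stage \<open>n x\<close>, and transported to every \<open>W\<close> above; hence
    the lifts at different stages are compatible by construction.\<close>
  define \<sigma> where "\<sigma> = (\<lambda>W x. ta (n x) W (\<tau> x))"
  have \<sigma>: "\<sigma> W x \<in> carrier (TA W)" "tp W (\<sigma> W x) = coact M x"
    if "x \<in> carrier M" "n x \<subseteq> W" "W \<subseteq> all_data" for W x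
    using left_homD(1)[OF ta_hom[OF that(2,3)] \<tau>(1)[OF that(1)]] tp_ta[OF that(2,3) \<tau>(1)[OF that(1)]] \<tau>(2)[OF that(1)]
    by (simp_all add: \<sigma>_def)
  have \<sigma>_ta: "ta W V (\<sigma> W x) = \<sigma> V x" if "x \<in> carrier M" "n x \<subseteq> W" "W \<subseteq> V" "V \<subseteq> all_data" for W V x
    unfolding \<sigma>_def by (rule ta_trans[OF that(2-4) \<tau>(1)[OF that(1)]])
  define supp :: "('u \<Rightarrow> 'a) \<Rightarrow> 'u set" where "supp = (\<lambda>y. {x. y x \<noteq> \<zero>\<^bsub>A\<^esub>})"
  \<comment> \<open>A countable stage at which the lifts for all generators in the finite support of
    the relation \<open>y\<close> are available.\<close>
  define B where "B = (\<lambda>y. \<Union>x\<in>supp y. n x)"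
  have yF: "y \<in> carrier (free_left_module A (carrier M))" if "y \<in> all_rels" for y
    using that by (simp add: all_rels_def)
  have supp: "supp y \<subseteq> carrier M" "finite (supp y)" "y \<in> carrier (free_left_module A (supp y))" if "y \<in> all_rels" for y
    using yF[OF that] free_restrict_supp[OF ring_A yF[OF that]] by (auto simp: supp_def free_carrier)
  have B: "B y \<in> countables" if "y \<in> all_rels" for y
  proof -
    have "countable (B y)" unfolding B_def
      by (rule countable_UN) (use n supp(1,2)[OF that] in \<open>auto simp: countable_finite\<close>)
    moreover have "B y \<subseteq> all_data" unfolding B_def using n supp(1)[OF that] by blast
    ultimately show ?thesis by simp
  qed
  have nB: "n x \<subseteq> B y" if "x \<in> supp y" for x y unfolding B_def using that by blast
  \<comment> \<open>The relation \<open>y\<close> evaluated on lifted coactions in place of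
    generators. Over M it becomes the coaction of the zero element that \<open>y\<close> represents,
    so \<open>t y\<close> dies at some later countable stage \<open>w y\<close>.\<close>
  define t where "t = (\<lambda>y. lincomb A (TA (B y)) (\<sigma> (B y)) y)"
  have \<sigma>B: "\<sigma> (B y) \<in> supp y \<rightarrow> carrier (TA (B y))" if y: "y \<in> all_rels" for y
  proof
    fix x assume x: "x \<in> supp y"
    have "x \<in> carrier M" "B y \<subseteq> all_data" using x supp(1)[OF y] B[OF y] by auto
    thus "\<sigma> (B y) x \<in> carrier (TA (B y))" by (intro \<sigma>(1) nB x)
  qed
  have tc: "t y \<in> carrier (TA (B y))" if y: "y \<in> all_rels" for y
    unfolding t_def by (rule lincomb_closed[OF TA_module \<sigma>B[OF y] supp(3)[OF y]]) (use B[OF y] in simp)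
  have t0: "tp (B y) (t y) = \<zero>\<^bsub>tensor_module A C M\<^esub>" if y: "y \<in> all_rels" for y
  proof -
    have By: "B y \<subseteq> all_data" using B[OF y] by simp
    note TM = T_left_module[OF M_props(1)]
    have idc: "(\<lambda>x. x) \<in> supp y \<rightarrow> carrier M" using supp(1)[OF y] by auto
    have "tp (B y) (t y) = lincomb A (tensor_module A C M) (\<lambda>x. tp (B y) (\<sigma> (B y) x)) y"
      unfolding t_def by (rule hom_lincomb[OF TA_module[OF By] TM \<sigma>B[OF y] tp_hom[OF By] supp(3)[OF y]])
    also have "\<dots> = lincomb A (tensor_module A C M) (\<lambda>x. coact M x) y"
    proof (rule lincomb_cong[OF TM _ supp(3)[OF y]])
      show "(\<lambda>x. tp (B y) (\<sigma> (B y) x)) \<in> supp y \<rightarrow> carrier (tensor_module A C M)"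
      proof
        fix x assume "x \<in> supp y"
        hence "\<sigma> (B y) x \<in> carrier (TA (B y))" using \<sigma>B[OF y] by (rule funcset_mem[rotated])
        thus "tp (B y) (\<sigma> (B y) x) \<in> carrier (tensor_module A C M)" by (rule left_homD(1)[OF tp_hom[OF By]])
      qed
      fix x assume x: "x \<in> supp y"
      have "x \<in> carrier M" using x supp(1)[OF y] by blast
      thus "tp (B y) (\<sigma> (B y) x) = coact M x" by (rule \<sigma>(2)[OF _ nB[OF x] By])
    qed
    also have "\<dots> = coact M (lincomb A M (\<lambda>x. x) y)"
      by (rule hom_lincomb[OF M_props(1) TM idc M_props(3) supp(3)[OF y], symmetric])
    also have "\<dots> = \<zero>\<^bsub>tensor_module A C M\<^esub>"
      using y left_hom_zero[OF M_props(1) TM M_props(3)] by (simp add: all_rels_def)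
    finally show ?thesis .
  qed
  have ex: "\<exists>W. W \<in> countables \<and> (B y, W) \<in> ?r \<and> ta (B y) W (t y) = \<zero>\<^bsub>TA W\<^esub>" if "y \<in> all_rels" for y
    using TD.h_kernel[OF B[OF that] tc[OF that] t0[OF that]] unfolding Bex_def .
  from bchoice[OF ballI[OF ex]] obtain w where
    "\<forall>y\<in>all_rels. w y \<in> countables \<and> (B y, w y) \<in> ?r \<and> ta (B y) (w y) (t y) = \<zero>\<^bsub>TA (w y)\<^esub>"
    by (rule exE)
  hence w: "w y \<in> countables" "(B y, w y) \<in> ?r" "ta (B y) (w y) (t y) = \<zero>\<^bsub>TA (w y)\<^esub>" if "y \<in> all_rels" for y
    using that by blast+
  define c :: "'u + ('u \<Rightarrow> 'a) \<Rightarrow> ('u + ('u \<Rightarrow> 'a)) set" where "c = case_sum n w"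
  have c: "countable (c u) \<and> c u \<subseteq> all_data" if "u \<in> all_data" for u
  proof -
    from that consider x where "u = Inl x" "x \<in> carrier M" | y where "u = Inr y" "y \<in> all_rels"
      unfolding all_data_def by blast
    thus ?thesis by cases (use n w(1) in \<open>simp_all add: c_def\<close>)
  qed
  have ex\<nu>: "\<exists>f. f \<in> left_hom A (approx Z) (TA Z) \<and> (\<forall>x\<in>gens_of Z. f (agen Z x) = \<sigma> Z x)"
    if Z: "Z \<subseteq> all_data" and cl: "\<And>u. u \<in> Z \<Longrightarrow> c u \<subseteq> Z" for Z
  proof -
    have nZ: "x \<in> carrier M" "n x \<subseteq> Z" if "x \<in> gens_of Z" for x
      using that gens_of_sub[OF Z] cl[of "Inl x"] by (auto simp: gens_of_def c_def)
    have g: "\<sigma> Z \<in> gens_of Z \<rightarrow> carrier (TA Z)" using \<sigma>(1)[OF nZ Z] by blast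
    \<comment> \<open>As \<open>Z\<close> is closed and contains the relation \<open>y\<close>, it
      contains \<open>w y\<close>. Evaluating \<open>y\<close> at \<open>Z\<close> therefore factors
      through the stage \<open>w y\<close>, where the value is zero.\<close>
    have y0: "lincomb A (TA Z) (\<sigma> Z) y = \<zero>\<^bsub>TA Z\<^esub>" if "y \<in> rels_of Z" for y
    proof -
      have y: "y \<in> all_rels" using that rels_of_sub[OF Z] by blast
      have wZ: "w y \<subseteq> Z" using that cl[of "Inr y"] by (simp add: rels_of_def c_def)
      have Bw: "B y \<subseteq> w y" using w(2)[OF y] by simp
      have wU: "w y \<subseteq> all_data" using w(1)[OF y] by simp
      have BZ: "B y \<subseteq> Z" and By: "B y \<subseteq> all_data" using Bw wZ wU by auto
      have "lincomb A (TA Z) (\<sigma> Z) y = lincomb A (TA Z) (\<lambda>x. ta (B y) Z (\<sigma> (B y) x)) y"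
      proof (rule lincomb_cong[OF TA_module[OF Z] _ supp(3)[OF y]])
        fix x assume x: "x \<in> supp y"
        have xM: "x \<in> carrier M" using x supp(1)[OF y] by blast
        show "\<sigma> Z x = ta (B y) Z (\<sigma> (B y) x)" by (rule \<sigma>_ta[OF xM nB[OF x] BZ Z, symmetric])
      next
        show "\<sigma> Z \<in> supp y \<rightarrow> carrier (TA Z)"
        proof
          fix x assume x: "x \<in> supp y"
          have xM: "x \<in> carrier M" using x supp(1)[OF y] by blast
          show "\<sigma> Z x \<in> carrier (TA Z)" by (rule \<sigma>(1)[OF xM order_trans[OF nB[OF x] BZ] Z])
        qed
      qed
      also have "\<dots> = ta (B y) Z (t y)"
        unfolding t_def by (rule hom_lincomb[OF TA_module[OF By] TA_module[OF Z] \<sigma>B[OF y] ta_hom[OF BZ Z] supp(3)[OF y], symmetric])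
      also have "\<dots> = ta (w y) Z (ta (B y) (w y) (t y))" by (rule ta_trans[OF Bw wZ Z tc[OF y], symmetric])
      also have "\<dots> = \<zero>\<^bsub>TA Z\<^esub>"
        unfolding w(3)[OF y] by (rule left_hom_zero[OF TA_module[OF wU] TA_module[OF Z] ta_hom[OF wZ Z]])
      finally show ?thesis .
    qed
    obtain f where "f \<in> left_hom A (approx Z) (TA Z)" "\<And>x. x \<in> gens_of Z \<Longrightarrow> f (agen Z x) = \<sigma> Z x"
      by (rule presents_lift[OF approx_presents(1)[OF Z] TA_module[OF Z] g y0]) blast+
    thus ?thesis by blast
  qed
  define \<nu> where "\<nu> = (\<lambda>Z. SOME f. f \<in> left_hom A (approx Z) (TA Z) \<and> (\<forall>x\<in>gens_of Z. f (agen Z x) = \<sigma> Z x))"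
  have \<nu>: "\<nu> Z \<in> left_hom A (approx Z) (TA Z)" "x \<in> gens_of Z \<Longrightarrow> \<nu> Z (agen Z x) = \<sigma> Z x"
    if "Z \<subseteq> all_data" "\<And>u. u \<in> Z \<Longrightarrow> c u \<subseteq> Z" for Z x
    using someI_ex[OF ex\<nu>[OF that]] unfolding \<nu>_def by blast+
  have nZ: "x \<in> carrier M \<and> n x \<subseteq> Z" if "Z \<subseteq> all_data" "\<And>u. u \<in> Z \<Longrightarrow> c u \<subseteq> Z" "x \<in> gens_of Z" for x Z
    using that(3) gens_of_sub[OF that(1)] that(2)[of "Inl x"] by (auto simp: gens_of_def c_def)
  have \<nu>p: "tp Z (\<nu> Z v) = coact M (aproj Z v)"
    if Z: "Z \<subseteq> all_data" and cl: "\<And>u. u \<in> Z \<Longrightarrow> c u \<subseteq> Z" and v: "v \<in> carrier (approx Z)" for Z v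
    by (rule approx_ext[OF Z T_left_module[OF M_props(1)] left_hom_comp[OF \<nu>(1)[OF Z cl] tp_hom[OF Z]]
          left_hom_comp[OF aproj(1)[OF Z] M_props(3)] _ v])
      (use nZ[OF Z cl] \<sigma>(2)[OF _ _ Z] in \<open>simp_all add: \<nu>(2)[OF Z cl] aproj(2)[OF Z]\<close>)
  have \<nu>t: "ta Z W (\<nu> Z v) = \<nu> W (atrans Z W v)"
    if ZW: "Z \<subseteq> W" and W: "W \<subseteq> all_data" and cZ: "\<And>u. u \<in> Z \<Longrightarrow> c u \<subseteq> Z" and cW: "\<And>u. u \<in> W \<Longrightarrow> c u \<subseteq> W"
      and v: "v \<in> carrier (approx Z)" for Z W v
  proof -
    have Z: "Z \<subseteq> all_data" using ZW W by blast
    show ?thesis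
    proof (rule approx_ext[where f = "\<lambda>v. ta Z W (\<nu> Z v)" and f' = "\<lambda>v. \<nu> W (atrans Z W v)",
          OF Z TA_module[OF W] left_hom_comp[OF \<nu>(1)[OF Z cZ] ta_hom[OF ZW W]]
          left_hom_comp[OF atrans(1)[OF ZW W] \<nu>(1)[OF W cW]] _ v])
      fix x assume x: "x \<in> gens_of Z"
      have xW: "x \<in> gens_of W" using x gens_of_mono[OF ZW] by blast
      note nx = nZ[OF Z cZ x]
      show "ta Z W (\<nu> Z (agen Z x)) = \<nu> W (atrans Z W (agen Z x))"
        using \<sigma>_ta[OF conjunct1[OF nx] conjunct2[OF nx] ZW W] by (simp add: \<nu>(2)[OF Z cZ x] atrans(2)[OF ZW W x] \<nu>(2)[OF W cW xW])
    qed
  qed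
  show thesis by (rule that[OF c \<nu>(1) \<nu>p \<nu>t])
qed

end

text \<open>Values on the carriers are all that matters. This allows transition maps and cocone maps
  to be replaced by the extensional functions that serve as morphisms in
  \<open>Comod\<close>.\<close>

lemma (in directed_colim) directed_colim_cong:
  assumes "\<And>i j x. \<lbrakk>i \<in> I; j \<in> I; (i, j) \<in> r; x \<in> carrier (M i)\<rbrakk> \<Longrightarrow> f' i j x = f i j x"
    and "\<And>i x. \<lbrakk>i \<in> I; x \<in> carrier (M i)\<rbrakk> \<Longrightarrow> h' i x = h i x"
  shows "directed_colim A I r M f' L h'"
proof (rule directed_colim.intro)
  fix i assume i: "i \<in> I"
  show "h' i \<in> left_hom A (M i) L" by (rule left_hom_cong[OF M_module[OF i] h_hom[OF i]]) (simp add: assms(2) i)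
  fix x assume x: "x \<in> carrier (M i)" and z: "h' i x = \<zero>\<^bsub>L\<^esub>"
  have "h i x = \<zero>\<^bsub>L\<^esub>" using z assms(2)[OF i x] by simp
  then obtain j where j: "j \<in> I" "(i, j) \<in> r" "f i j x = \<zero>\<^bsub>M j\<^esub>" using h_kernel[OF i x] by blast
  thus "\<exists>j\<in>I. (i, j) \<in> r \<and> f' i j x = \<zero>\<^bsub>M j\<^esub>" using assms(1)[OF i j(1,2) x] by auto
next
  fix y assume "y \<in> carrier L"
  then obtain i x where "i \<in> I" "x \<in> carrier (M i)" "h i x = y" using h_surj by blast
  thus "\<exists>i\<in>I. \<exists>x\<in>carrier (M i). h' i x = y" using assms(2) by auto
next
  fix i j assume ij: "i \<in> I" "j \<in> I" "(i, j) \<in> r"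
  show "f' i j \<in> left_hom A (M i) (M j)"
    by (rule left_hom_cong[OF M_module[OF ij(1)] f_hom[OF ij]]) (simp add: assms(1) ij)
  fix x assume x: "x \<in> carrier (M i)"
  show "h' j (f' i j x) = h' i x"
    using assms(1)[OF ij x] assms(2)[OF ij(1) x] assms(2)[OF ij(2) f_closed[OF ij x]] h_f[OF ij x] by simp
next
  fix i j k x assume *: "i \<in> I" "j \<in> I" "k \<in> I" "(i, j) \<in> r" "(j, k) \<in> r" "x \<in> carrier (M i)"
  have ik: "(i, k) \<in> r" by (rule I_trans[OF *(1-5)])
  show "f' j k (f' i j x) = f' i k x"
    using f_f[OF *] assms(1)[OF *(1,2,4,6)] assms(1)[OF *(1,3) ik *(6)] assms(1)[OF *(2,3,5) f_closed[OF *(1,2,4,6)]] by simp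
next
  fix i j assume "i \<in> I" "j \<in> I"
  thus "\<exists>k\<in>I. (i, k) \<in> r \<and> (j, k) \<in> r" by (rule I_directed)
next
  fix i j k assume "i \<in> I" "j \<in> I" "k \<in> I" "(i, j) \<in> r" "(j, k) \<in> r"
  thus "(i, k) \<in> r" by (rule I_trans)
next
  fix i assume i: "i \<in> I"
  show "(i, i) \<in> r" by (rule I_refl[OF i])
  show "left_module A (M i)" by (rule M_module[OF i])
qed (rule I_nonempty L_module)+

context comodule_approx
begin

lemma tta_trans:
  assumes "Z \<subseteq> W" "W \<subseteq> V" "V \<subseteq> all_data" "t \<in> carrier (tensor_module A C (TA Z))"
  shows "tta W V (tta Z W t) = tta Z V t"
proof -
  have W: "W \<subseteq> all_data" and ZV: "Z \<subseteq> V" and Z: "Z \<subseteq> all_data" using assms by auto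
  have t: "t \<in> carrier (tensor_group A C (TA Z))" using assms(4) by simp
  note aZW = ta_hom[OF assms(1) W] and aWV = ta_hom[OF assms(2,3)] and aZV = ta_hom[OF ZV assms(3)]
  have "tta W V (tta Z W t) = tensor_map A C (TA V) id (\<lambda>x. ta W V (ta Z W x)) t"
    by (rule T_comp[OF TA_module[OF Z] TA_module[OF W] TA_module[OF assms(3)] aZW aWV t])
  also have "\<dots> = tta Z V t"
    by (rule T_cong[OF TA_module[OF Z] TA_module[OF assms(3)] left_hom_comp[OF aZW aWV] aZV
          ta_trans[OF assms(1-3)] t])
  finally show ?thesis .
qed

text \<open>
  The lifted coactions need not be coassociative and counital, but each of these equations for a single
  generator holds at some countable stage, which is added to \<open>c u\<close>.
\<close>

lemma comodule_structures:
  obtains c \<nu> where "\<And>u. u \<in> all_data \<Longrightarrow> countable (c u) \<and> c u \<subseteq> all_data"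
    "\<And>Z. \<lbrakk>Z \<subseteq> all_data; \<And>u. u \<in> Z \<Longrightarrow> c u \<subseteq> Z\<rbrakk> \<Longrightarrow> comodule A C (mk_comodule (approx Z) (\<nu> Z))"
    "\<And>Z v. \<lbrakk>Z \<subseteq> all_data; \<And>u. u \<in> Z \<Longrightarrow> c u \<subseteq> Z; v \<in> carrier (approx Z)\<rbrakk> \<Longrightarrow> coact M (aproj Z v) = tp Z (\<nu> Z v)"
    "\<And>Z W v. \<lbrakk>Z \<subseteq> W; W \<subseteq> all_data; \<And>u. u \<in> Z \<Longrightarrow> c u \<subseteq> Z; \<And>u. u \<in> W \<Longrightarrow> c u \<subseteq> W; v \<in> carrier (approx Z)\<rbrakk> \<Longrightarrow>
      \<nu> W (atrans Z W v) = ta Z W (\<nu> Z v)"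
proof (rule lifted_coactions)
  fix c \<nu>
  assume c: "\<And>u. u \<in> all_data \<Longrightarrow> countable (c u) \<and> c u \<subseteq> all_data"
    and \<nu>: "\<And>Z. \<lbrakk>Z \<subseteq> all_data; \<And>u. u \<in> Z \<Longrightarrow> c u \<subseteq> Z\<rbrakk> \<Longrightarrow> \<nu> Z \<in> left_hom A (approx Z) (TA Z)"
    and \<nu>p: "\<And>Z v. \<lbrakk>Z \<subseteq> all_data; \<And>u. u \<in> Z \<Longrightarrow> c u \<subseteq> Z; v \<in> carrier (approx Z)\<rbrakk> \<Longrightarrow> tp Z (\<nu> Z v) = coact M (aproj Z v)"
    and \<nu>t: "\<And>Z W v. \<lbrakk>Z \<subseteq> W; W \<subseteq> all_data; \<And>u. u \<in> Z \<Longrightarrow> c u \<subseteq> Z; \<And>u. u \<in> W \<Longrightarrow> c u \<subseteq> W; v \<in> carrier (approx Z)\<rbrakk> \<Longrightarrow>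
      ta Z W (\<nu> Z v) = \<nu> W (atrans Z W v)"
  let ?r = "{(Z, W). Z \<in> countables \<and> W \<in> countables \<and> Z \<subseteq> W}"
  interpret D: directed_colim A countables ?r approx atrans M aproj by (rule countables_directed)
  interpret TD: directed_colim A countables ?r TA ta "tensor_module A C M" tp
    by (rule D.tensor_directed_colim[OF bimodule_axioms])
  interpret TTD: directed_colim A countables ?r "\<lambda>Z. tensor_module A C (TA Z)" tta "tensor_module A C (tensor_module A C M)" ttp
    by (rule TD.tensor_directed_colim[OF bimodule_axioms])
  note Mm = M_props(1) and TM = T_left_module[OF M_props(1)]
  \<comment> \<open>Each \<open>x\<close> gets a countable closed set \<open>E x\<close> that
    contains it as a generator, because a lifted coaction is available on closed sets only.\<close>
  have ex0: "\<exists>W. Inl x \<in> W \<and> W \<subseteq> all_data \<and> countable W \<and> (\<forall>u\<in>W. c u \<subseteq> W)" if "x \<in> carrier M" for x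
  proof (rule countable_closure[of all_data c "{Inl x}"])
    show "{Inl x} \<subseteq> all_data" using that by (simp add: all_data_def)
  qed (use c in auto)
  from bchoice[OF ballI[OF ex0]] obtain E where
    "\<forall>x\<in>carrier M. Inl x \<in> E x \<and> E x \<subseteq> all_data \<and> countable (E x) \<and> (\<forall>u\<in>E x. c u \<subseteq> E x)" by (rule exE)
  hence E: "Inl x \<in> E x" "E x \<subseteq> all_data" "countable (E x)" "\<And>u. u \<in> E x \<Longrightarrow> c u \<subseteq> E x" if "x \<in> carrier M" for x
    using that by blast+
  define e where "e = (\<lambda>x. agen (E x) x)"
  define s where "s = (\<lambda>x. \<nu> (E x) (e x))"
  have xE: "x \<in> gens_of (E x)" if "x \<in> carrier M" for x using E(1)[OF that] by (simp add: gens_of_def)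
  have e: "e x \<in> carrier (approx (E x))" "aproj (E x) (e x) = x" if "x \<in> carrier M" for x
    unfolding e_def by (rule agen_closed[OF E(2)[OF that] xE[OF that]], rule aproj(2)[OF E(2)[OF that] xE[OF that]])
  have \<nu>E: "\<nu> (E x) \<in> left_hom A (approx (E x)) (TA (E x))" if "x \<in> carrier M" for x
    by (rule \<nu>[OF E(2)[OF that] E(4)[OF that]])
  have s: "s x \<in> carrier (TA (E x))" "s x \<in> carrier (tensor_group A C (approx (E x)))" "tp (E x) (s x) = coact M x" if "x \<in> carrier M" for x
  proof -
    show "s x \<in> carrier (TA (E x))" unfolding s_def by (rule left_homD(1)[OF \<nu>E[OF that] e(1)[OF that]])
    thus "s x \<in> carrier (tensor_group A C (approx (E x)))" by simp
    show "tp (E x) (s x) = coact M x"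
      unfolding s_def using \<nu>p[OF E(2)[OF that] E(4)[OF that] e(1)[OF that]] e(2)[OF that] by simp
  qed
  \<comment> \<open>\<open>d1 x\<close> and \<open>d2 x\<close> are the two sides of coassociativity
    for the generator \<open>x\<close> at the stage \<open>E x\<close>. They agree after projection
    to M, where coassociativity holds.\<close>
  define d1 where "d1 = (\<lambda>x. cmult A C (approx (E x)) (s x))"
  define d2 where "d2 = (\<lambda>x. tensor_map A C (TA (E x)) id (\<nu> (E x)) (s x))"
  have d: "d1 x \<in> carrier (tensor_module A C (TA (E x)))" "d2 x \<in> carrier (tensor_module A C (TA (E x)))"
    "ttp (E x) (d1 x) = ttp (E x) (d2 x)" if x: "x \<in> carrier M" for x
  proof -
    note Em = approx_module[OF E(2)[OF x]] and TEm = TA_module[OF E(2)[OF x]]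
    note p = aproj(1)[OF E(2)[OF x]] and tpE = tp_hom[OF E(2)[OF x]] and nE = \<nu>E[OF x] and sx = s(2)[OF x]
    show "d1 x \<in> carrier (tensor_module A C (TA (E x)))"
      unfolding d1_def by (rule left_homD(1)[OF cmult_hom[OF Em] s(1)[OF x]])
    show "d2 x \<in> carrier (tensor_module A C (TA (E x)))"
      unfolding d2_def by (rule left_homD(1)[OF T_hom[OF Em TEm nE] s(1)[OF x]])
    have "ttp (E x) (d1 x) = cmult A C M (tp (E x) (s x))"
      unfolding d1_def by (rule cmult_nat[OF Em Mm p sx, symmetric])
    also have "\<dots> = tensor_map A C (tensor_module A C M) id (coact M) (tp (E x) (s x))"
      unfolding s(3)[OF x] by (rule M_props(5)[OF x])
    also have "\<dots> = tensor_map A C (tensor_module A C M) id (\<lambda>v. coact M (aproj (E x) v)) (s x)"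
      by (rule T_comp[OF Em Mm TM p M_props(3) sx])
    also have "\<dots> = tensor_map A C (tensor_module A C M) id (\<lambda>v. tp (E x) (\<nu> (E x) v)) (s x)"
      by (rule T_cong[OF Em TM left_hom_comp[OF p M_props(3)] left_hom_comp[OF nE tpE] _ sx])
        (rule \<nu>p[OF E(2)[OF x] E(4)[OF x], symmetric])
    also have "\<dots> = ttp (E x) (d2 x)"
      unfolding d2_def by (rule T_comp[OF Em TEm TM nE tpE sx, symmetric])
    finally show "ttp (E x) (d1 x) = ttp (E x) (d2 x)" .
  qed
  have Ec: "E x \<in> countables" if "x \<in> carrier M" for x using E(2,3)[OF that] by simp
  \<comment> \<open>The stage \<open>F1 x\<close> is countable but not necessarily closed; only
    transition maps are applied at it, never a coaction.\<close>
  have ex1: "\<exists>W. W \<in> countables \<and> (E x, W) \<in> ?r \<and> tta (E x) W (d1 x) = tta (E x) W (d2 x)" if x: "x \<in> carrier M" for x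
    using TTD.h_eq[OF Ec[OF x] d[OF x]] unfolding Bex_def .
  from bchoice[OF ballI[OF ex1]] obtain F1 where
    "\<forall>x\<in>carrier M. F1 x \<in> countables \<and> (E x, F1 x) \<in> ?r \<and> tta (E x) (F1 x) (d1 x) = tta (E x) (F1 x) (d2 x)" by (rule exE)
  hence F1: "F1 x \<in> countables" "(E x, F1 x) \<in> ?r" "tta (E x) (F1 x) (d1 x) = tta (E x) (F1 x) (d2 x)" if "x \<in> carrier M" for x
    using that by blast+
  have e2: "ccounit A C (approx (E x)) (s x) \<in> carrier (approx (E x))"
    "aproj (E x) (ccounit A C (approx (E x)) (s x)) = aproj (E x) (e x)" if x: "x \<in> carrier M" for x
  proof -
    note Em = approx_module[OF E(2)[OF x]]
    show "ccounit A C (approx (E x)) (s x) \<in> carrier (approx (E x))"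
      by (rule left_homD(1)[OF ccounit_hom[OF Em] s(1)[OF x]])
    have "aproj (E x) (ccounit A C (approx (E x)) (s x)) = ccounit A C M (tp (E x) (s x))"
      by (rule ccounit_nat[OF Em Mm aproj(1)[OF E(2)[OF x]] s(2)[OF x], symmetric])
    thus "aproj (E x) (ccounit A C (approx (E x)) (s x)) = aproj (E x) (e x)"
      unfolding s(3)[OF x] e(2)[OF x] using M_props(6)[OF x] by simp
  qed
  have ex2: "\<exists>W. W \<in> countables \<and> (E x, W) \<in> ?r \<and> atrans (E x) W (ccounit A C (approx (E x)) (s x)) = atrans (E x) W (e x)"
    if x: "x \<in> carrier M" for x
    using D.h_eq[OF Ec[OF x] e2(1)[OF x] e(1)[OF x] e2(2)[OF x]] unfolding Bex_def .
  from bchoice[OF ballI[OF ex2]] obtain F2 where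
    "\<forall>x\<in>carrier M. F2 x \<in> countables \<and> (E x, F2 x) \<in> ?r \<and>
      atrans (E x) (F2 x) (ccounit A C (approx (E x)) (s x)) = atrans (E x) (F2 x) (e x)" by (rule exE)
  hence F2: "F2 x \<in> countables" "(E x, F2 x) \<in> ?r"
    "atrans (E x) (F2 x) (ccounit A C (approx (E x)) (s x)) = atrans (E x) (F2 x) (e x)" if "x \<in> carrier M" for x
    using that by blast+
  \<comment> \<open>Only generators receive new data, because an equality of linear maps out of
    \<open>approx Z\<close> is decided on the generators.\<close>
  define c' where "c' = (\<lambda>u. c u \<union> (case u of Inl x \<Rightarrow> F1 x \<union> F2 x | Inr y \<Rightarrow> {}))"
  have c': "countable (c' u) \<and> c' u \<subseteq> all_data" if u: "u \<in> all_data" for u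
  proof -
    from u consider x where "u = Inl x" "x \<in> carrier M" | y where "u = Inr y"
      unfolding all_data_def by blast
    thus ?thesis by cases (use c[OF u] F1(1) F2(1) in \<open>simp_all add: c'_def\<close>)
  qed
  have comod: "comodule A C (mk_comodule (approx Z) (\<nu> Z))"
    if Z: "Z \<subseteq> all_data" and cl': "\<And>u. u \<in> Z \<Longrightarrow> c' u \<subseteq> Z" for Z
  proof -
    have cl: "c u \<subseteq> Z" if "u \<in> Z" for u using cl'[OF that] by (auto simp: c'_def)
    note Zm = approx_module[OF Z] and TZm = TA_module[OF Z]
    have nZ: "\<nu> Z \<in> left_hom A (approx Z) (TA Z)" by (rule \<nu>[OF Z cl])
    have gZ: "x \<in> carrier M" "F1 x \<subseteq> Z" "F2 x \<subseteq> Z" if "x \<in> gens_of Z" for x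
      using that gens_of_sub[OF Z] cl'[of "Inl x"] by (auto simp: gens_of_def c'_def)
    have EZ: "E x \<subseteq> F1 x" "E x \<subseteq> F2 x" "F1 x \<subseteq> all_data" "F2 x \<subseteq> all_data" if "x \<in> carrier M" for x
      using F1(1,2)[OF that] F2(1,2)[OF that] by auto
    \<comment> \<open>A generator of \<open>Z\<close> and its lifted coaction both come from the
      stage \<open>E x\<close>. The transition from there to \<open>Z\<close> can be split at
      \<open>F1 x\<close> or at \<open>F2 x\<close>, where the equations are known.\<close>
    have eZ: "agen Z x = atrans (E x) Z (e x)" "\<nu> Z (agen Z x) = ta (E x) Z (s x)" if "x \<in> gens_of Z" for x
    proof -
      note x = gZ[OF that]
      have ExZ: "E x \<subseteq> Z" using EZ(1)[OF x(1)] x(2) by blast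
      show a: "agen Z x = atrans (E x) Z (e x)"
        unfolding e_def by (rule atrans(2)[OF ExZ Z xE[OF x(1)], symmetric])
      show "\<nu> Z (agen Z x) = ta (E x) Z (s x)"
        unfolding a s_def by (rule \<nu>t[OF ExZ Z E(4)[OF x(1)] cl e(1)[OF x(1)], symmetric])
    qed
    show ?thesis
    proof (rule mk_comoduleI[OF Zm nZ])
      fix m assume m: "m \<in> carrier (approx Z)"
      show "cmult A C (approx Z) (\<nu> Z m) = tensor_map A C (TA Z) id (\<nu> Z) (\<nu> Z m)"
      proof (rule approx_ext[where f = "\<lambda>m. cmult A C (approx Z) (\<nu> Z m)"
          and f' = "\<lambda>m. tensor_map A C (TA Z) id (\<nu> Z) (\<nu> Z m)", OF Z T_left_module[OF TZm]
            left_hom_comp[OF nZ cmult_hom[OF Zm]] left_hom_comp[OF nZ T_hom[OF Zm TZm nZ]] _ m])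
        fix x assume xg: "x \<in> gens_of Z"
        note x = gZ[OF xg]
        have ExZ: "E x \<subseteq> Z" using EZ(1)[OF x(1)] x(2) by blast
        note Em = approx_module[OF E(2)[OF x(1)]] and TEm = TA_module[OF E(2)[OF x(1)]] and sx = s(2)[OF x(1)]
        note tr = atrans(1)[OF ExZ Z] and nE = \<nu>E[OF x(1)]
        have "cmult A C (approx Z) (\<nu> Z (agen Z x)) = tta (E x) Z (d1 x)"
          unfolding eZ(2)[OF xg] d1_def by (rule cmult_nat[OF Em Zm tr sx])
        also have "\<dots> = tta (F1 x) Z (tta (E x) (F1 x) (d1 x))"
          by (rule tta_trans[OF EZ(1)[OF x(1)] x(2) Z d(1)[OF x(1)], symmetric])
        also have "\<dots> = tta (F1 x) Z (tta (E x) (F1 x) (d2 x))" unfolding F1(3)[OF x(1)] ..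
        also have "\<dots> = tta (E x) Z (d2 x)"
          by (rule tta_trans[OF EZ(1)[OF x(1)] x(2) Z d(2)[OF x(1)]])
        also have "\<dots> = tensor_map A C (TA Z) id (\<lambda>v. ta (E x) Z (\<nu> (E x) v)) (s x)"
          unfolding d2_def by (rule T_comp[OF Em TEm TZm nE ta_hom[OF ExZ Z] sx])
        also have "\<dots> = tensor_map A C (TA Z) id (\<lambda>v. \<nu> Z (atrans (E x) Z v)) (s x)"
          by (rule T_cong[OF Em TZm left_hom_comp[OF nE ta_hom[OF ExZ Z]] left_hom_comp[OF tr nZ] _ sx])
            (rule \<nu>t[OF ExZ Z E(4)[OF x(1)] cl])
        also have "\<dots> = tensor_map A C (TA Z) id (\<nu> Z) (ta (E x) Z (s x))"
          by (rule T_comp[OF Em Zm TZm tr nZ sx, symmetric])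
        finally show "cmult A C (approx Z) (\<nu> Z (agen Z x)) = tensor_map A C (TA Z) id (\<nu> Z) (\<nu> Z (agen Z x))"
          unfolding eZ(2)[OF xg] .
      qed
      show "ccounit A C (approx Z) (\<nu> Z m) = m"
      proof (rule approx_ext[where f = "\<lambda>m. ccounit A C (approx Z) (\<nu> Z m)" and f' = "\<lambda>m. m", OF Z Zm
            left_hom_comp[OF nZ ccounit_hom[OF Zm]] left_hom_id(2) _ m])
        fix x assume xg: "x \<in> gens_of Z"
        note x = gZ[OF xg]
        have ExZ: "E x \<subseteq> Z" using EZ(1)[OF x(1)] x(2) by blast
        note Em = approx_module[OF E(2)[OF x(1)]]
        have "ccounit A C (approx Z) (\<nu> Z (agen Z x)) = atrans (E x) Z (ccounit A C (approx (E x)) (s x))"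
          unfolding eZ(2)[OF xg] by (rule ccounit_nat[OF Em Zm atrans(1)[OF ExZ Z] s(2)[OF x(1)]])
        also have "\<dots> = atrans (F2 x) Z (atrans (E x) (F2 x) (ccounit A C (approx (E x)) (s x)))"
          by (rule atrans_trans[OF EZ(2)[OF x(1)] x(3) Z e2(1)[OF x(1)], symmetric])
        also have "\<dots> = atrans (E x) Z (e x)"
          unfolding F2(3)[OF x(1)] by (rule atrans_trans[OF EZ(2)[OF x(1)] x(3) Z e(1)[OF x(1)]])
        finally show "ccounit A C (approx Z) (\<nu> Z (agen Z x)) = agen Z x" unfolding eZ(1)[OF xg] .
      qed
    qed
  qed
  have sub: "c u \<subseteq> Z" if "c' u \<subseteq> Z" for u Z using that by (auto simp: c'_def)
  show thesis
  proof (rule that[of c' \<nu>, OF c' comod])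
    show "coact M (aproj Z v) = tp Z (\<nu> Z v)"
      if "Z \<subseteq> all_data" "\<And>u. u \<in> Z \<Longrightarrow> c' u \<subseteq> Z" "v \<in> carrier (approx Z)" for Z v
      by (rule \<nu>p[OF that(1) sub[OF that(2)] that(3), symmetric])
    show "\<nu> W (atrans Z W v) = ta Z W (\<nu> Z v)"
      if "Z \<subseteq> W" "W \<subseteq> all_data" "\<And>u. u \<in> Z \<Longrightarrow> c' u \<subseteq> Z" "\<And>u. u \<in> W \<Longrightarrow> c' u \<subseteq> W" "v \<in> carrier (approx Z)" for Z W v
      by (rule \<nu>t[OF that(1,2) sub[OF that(3)] sub[OF that(4)] that(5), symmetric])
  qed
qed

end

context comodule_approx
begin

text \<open>The closed countable sets of data index the colimit. Three adjustments bring it into the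
  required form: the index set is copied into \<open>'u\<close> along an injection
  \<open>\<phi>\<close>, each stage is replaced by a representative through chosen isomorphisms
  \<open>\<alpha>\<close> and \<open>\<beta>\<close>, and all maps are made extensional.\<close>

lemma colimit_of_representatives: "aleph1_directed_colimit_of \<kappa> Cat representatives M"
proof (rule comodule_structures)
  fix c \<nu>
  assume c: "\<And>u. u \<in> all_data \<Longrightarrow> countable (c u) \<and> c u \<subseteq> all_data"
    and comod: "\<And>Z. \<lbrakk>Z \<subseteq> all_data; \<And>u. u \<in> Z \<Longrightarrow> c u \<subseteq> Z\<rbrakk> \<Longrightarrow> comodule A C (mk_comodule (approx Z) (\<nu> Z))"
    and \<nu>p: "\<And>Z v. \<lbrakk>Z \<subseteq> all_data; \<And>u. u \<in> Z \<Longrightarrow> c u \<subseteq> Z; v \<in> carrier (approx Z)\<rbrakk> \<Longrightarrow> coact M (aproj Z v) = tp Z (\<nu> Z v)"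
    and \<nu>t: "\<And>Z W v. \<lbrakk>Z \<subseteq> W; W \<subseteq> all_data; \<And>u. u \<in> Z \<Longrightarrow> c u \<subseteq> Z; \<And>u. u \<in> W \<Longrightarrow> c u \<subseteq> W; v \<in> carrier (approx Z)\<rbrakk> \<Longrightarrow>
      \<nu> W (atrans Z W v) = ta Z W (\<nu> Z v)"
  define F where "F = {Z. Z \<subseteq> all_data \<and> countable Z \<and> (\<forall>u\<in>Z. c u \<subseteq> Z)}"
  define Q where "Q = (\<lambda>Z. mk_comodule (approx Z) (\<nu> Z) :: ('a, 'c, 'u) comodule)"
  have F: "Z \<subseteq> all_data" "countable Z" "\<And>u. u \<in> Z \<Longrightarrow> c u \<subseteq> Z" if "Z \<in> F" for Z
    using that by (auto simp: F_def)
  have Qc: "comodule A C (Q Z)" if "Z \<in> F" for Z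
    unfolding Q_def by (rule comod[OF F(1)[OF that] F(3)[OF that]])
  have Q_Obj: "Q Z \<in> Obj Cat" if "Z \<in> F" for Z
    using Qc[OF that] approx_presents(2)[OF F(1)[OF that]] by (simp add: Q_def)
  have Q_cp: "countably_presentable A (Q Z)" if "Z \<in> F" for Z
  proof -
    note P = approx_presents(1)[OF F(1)[OF that]] and Qm = comoduleD(1)[OF Qc[OF that]]
    \<comment> \<open>The identity function is linear between the two records in both directions, so
      the comodule \<open>Q Z\<close> is a retract of \<open>approx Z\<close> as a module and
      inherits countable presentability from it.\<close>
    have i: "(\<lambda>x. x) \<in> left_hom A (Q Z) (approx Z)" "(\<lambda>x. x) \<in> left_hom A (approx Z) (Q Z)"
      by (simp_all add: Q_def left_hom_id(2))
    have cp: "countably_presentable A (approx Z)"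
      by (rule countably_presentable_if_presents[OF P countable_gens_of countable_rels_of]) (rule F(2)[OF that])+
    show ?thesis
      by (rule countably_presentable_retract[OF Qm approx_module[OF F(1)[OF that]] i _ cp]) simp
  qed
  have "\<forall>Z\<in>F. \<exists>q. fst q \<in> representatives \<and> fst (snd q) \<in> comodule_hom A C (Q Z) (fst q) \<and>
      snd (snd q) \<in> comodule_hom A C (fst q) (Q Z) \<and>
      (\<forall>s\<in>carrier (Q Z). snd (snd q) (fst (snd q) s) = s) \<and> (\<forall>s\<in>carrier (fst q). fst (snd q) (snd (snd q) s) = s)"
  proof
    fix Z assume Z: "Z \<in> F"
    from representative_exists[OF Q_Obj[OF Z] Q_cp[OF Z]] obtain S \<alpha> \<beta> where "S \<in> representatives"
      "\<alpha> \<in> comodule_hom A C (Q Z) S" "\<beta> \<in> comodule_hom A C S (Q Z)"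
      "\<forall>s\<in>carrier (Q Z). \<beta> (\<alpha> s) = s" "\<forall>s\<in>carrier S. \<alpha> (\<beta> s) = s" by (elim bexE conjE)
    thus "\<exists>q. fst q \<in> representatives \<and> fst (snd q) \<in> comodule_hom A C (Q Z) (fst q) \<and>
      snd (snd q) \<in> comodule_hom A C (fst q) (Q Z) \<and>
      (\<forall>s\<in>carrier (Q Z). snd (snd q) (fst (snd q) s) = s) \<and> (\<forall>s\<in>carrier (fst q). fst (snd q) (snd (snd q) s) = s)"
      by (intro exI[of _ "(S, \<alpha>, \<beta>)"], unfold fst_conv snd_conv) (intro conjI; assumption)
  qed
  from bchoice[OF this] obtain q where q: "\<forall>Z\<in>F. fst (q Z) \<in> representatives \<and>
      fst (snd (q Z)) \<in> comodule_hom A C (Q Z) (fst (q Z)) \<and> snd (snd (q Z)) \<in> comodule_hom A C (fst (q Z)) (Q Z) \<and>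
      (\<forall>s\<in>carrier (Q Z). snd (snd (q Z)) (fst (snd (q Z)) s) = s) \<and>
      (\<forall>s\<in>carrier (fst (q Z)). fst (snd (q Z)) (snd (snd (q Z)) s) = s)" by (rule exE)
  define S \<alpha> \<beta> where "S = (\<lambda>Z. fst (q Z))" and "\<alpha> = (\<lambda>Z. fst (snd (q Z)))" and "\<beta> = (\<lambda>Z. snd (snd (q Z)))"
  have S: "S Z \<in> representatives" and \<alpha>: "\<alpha> Z \<in> comodule_hom A C (Q Z) (S Z)" and \<beta>: "\<beta> Z \<in> comodule_hom A C (S Z) (Q Z)"
    and \<beta>\<alpha>: "\<And>s. s \<in> carrier (Q Z) \<Longrightarrow> \<beta> Z (\<alpha> Z s) = s" and \<alpha>\<beta>: "\<And>s. s \<in> carrier (S Z) \<Longrightarrow> \<alpha> Z (\<beta> Z s) = s"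
    if "Z \<in> F" for Z
    using bspec[OF q that] unfolding S_def \<alpha>_def \<beta>_def by blast+
  have SO: "S Z \<in> Obj Cat" if "Z \<in> F" for Z by (rule representatives_props(1)[OF S[OF that]])
  have Sc: "comodule A C (S Z)" if "Z \<in> F" for Z using SO[OF that] by simp
  have \<alpha>h: "\<alpha> Z \<in> left_hom A (approx Z) (S Z)" and \<beta>h: "\<beta> Z \<in> left_hom A (S Z) (approx Z)" if "Z \<in> F" for Z
    using comodule_homD(1)[OF \<alpha>[OF that]] comodule_homD(1)[OF \<beta>[OF that]] by (simp_all add: Q_def)
  have sF: "small \<kappa> F"
    by (rule small_subset[OF _ small_countable_subsets[OF small_all_data]]) (auto simp: F_def)
  obtain \<phi> :: "('u + ('u \<Rightarrow> 'a)) set \<Rightarrow> 'u" where \<phi>: "inj_on \<phi> F" by (rule small_inject[OF sF])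
  define I where "I = \<phi> ` F"
  define \<psi> where "\<psi> = inv_into F \<phi>"
  \<comment> \<open>Inclusion of the encoded sets. It is antisymmetric because \<open>\<psi>\<close>
    is injective on \<open>I\<close>, and bounds of countable subsets exist because every countable
    set of data lies in a closed countable one.\<close>
  define r where "r = {(i, j). i \<in> I \<and> j \<in> I \<and> \<psi> i \<subseteq> \<psi> j}"
  have \<psi>F: "\<psi> i \<in> F" if "i \<in> I" for i using that unfolding \<psi>_def I_def by (rule inv_into_into)
  have \<psi>\<phi>: "\<psi> (\<phi> Z) = Z" if "Z \<in> F" for Z unfolding \<psi>_def by (rule inv_into_f_f[OF \<phi> that])
  have \<psi>_inj: "i = j" if "i \<in> I" "j \<in> I" "\<psi> i = \<psi> j" for i j
    using that unfolding \<psi>_def I_def by (metis f_inv_into_f)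
  have cof: "\<exists>i\<in>I. Z \<subseteq> \<psi> i" if "Z \<subseteq> all_data" "countable Z" for Z
  proof (rule countable_closure[of all_data c Z])
    fix W assume "Z \<subseteq> W" "W \<subseteq> all_data" "countable W" "\<And>u. u \<in> W \<Longrightarrow> c u \<subseteq> W"
    hence "W \<in> F" "Z \<subseteq> W" by (auto simp: F_def)
    thus ?thesis using \<psi>\<phi> by (intro bexI[of _ "\<phi> W"]) (auto simp: I_def)
  qed (use that c in auto)
  have I: "aleph1_directed I r"
    unfolding aleph1_directed_def
  proof (intro conjI allI impI)
    show "partial_order_on I r"
      unfolding partial_order_on_def preorder_on_def
      using \<psi>_inj by (auto simp: r_def refl_on_def trans_def antisym_def)
    fix X assume X: "X \<subseteq> I \<and> countable X"
    have "(\<Union>i\<in>X. \<psi> i) \<subseteq> all_data" using X F(1)[OF \<psi>F] by blast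
    moreover have "countable (\<Union>i\<in>X. \<psi> i)" by (rule countable_UN) (use X F(2)[OF \<psi>F] in auto)
    ultimately obtain u where "u \<in> I" "(\<Union>i\<in>X. \<psi> i) \<subseteq> \<psi> u" using cof by meson
    thus "\<exists>u\<in>I. \<forall>x\<in>X. (x, u) \<in> r" using X by (intro bexI[of _ u]) (auto simp: r_def)
  qed
  have subI: "\<psi> i \<subseteq> all_data \<and> countable (\<psi> i)" if "i \<in> I" for i using F(1,2)[OF \<psi>F[OF that]] by simp
  interpret D0: directed_colim A I r "\<lambda>i. approx (\<psi> i)" "\<lambda>i j. atrans (\<psi> i) (\<psi> j)" M "\<lambda>i. aproj (\<psi> i)"
    unfolding r_def by (rule approx_directed[OF subI cof])
  interpret D1: directed_colim A I r "\<lambda>i. S (\<psi> i)" "\<lambda>i j x. \<alpha> (\<psi> j) (atrans (\<psi> i) (\<psi> j) (\<beta> (\<psi> i) x))" M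
    "\<lambda>i x. aproj (\<psi> i) (\<beta> (\<psi> i) x)"
  proof (rule D0.directed_colim_iso)
    fix i assume i: "i \<in> I"
    show "left_module A (S (\<psi> i))" by (rule comoduleD(1)[OF Sc[OF \<psi>F[OF i]]])
    show "\<alpha> (\<psi> i) \<in> left_hom A (approx (\<psi> i)) (S (\<psi> i))" by (rule \<alpha>h[OF \<psi>F[OF i]])
    show "\<beta> (\<psi> i) \<in> left_hom A (S (\<psi> i)) (approx (\<psi> i))" by (rule \<beta>h[OF \<psi>F[OF i]])
    show "\<beta> (\<psi> i) (\<alpha> (\<psi> i) x) = x" if "x \<in> carrier (approx (\<psi> i))" for x
      by (rule \<beta>\<alpha>[OF \<psi>F[OF i]]) (use that in \<open>simp add: Q_def\<close>)
    show "\<alpha> (\<psi> i) (\<beta> (\<psi> i) x) = x" if "x \<in> carrier (S (\<psi> i))" for x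
      by (rule \<alpha>\<beta>[OF \<psi>F[OF i] that])
  qed
  \<comment> \<open>The compositions are nested exactly as \<open>comodule_hom_comp\<close> produces
    them, so that it applies directly; \<open>d_eq\<close> and \<open>\<xi>_eq\<close> provide the
    pointwise form.\<close>
  define d where "d = (\<lambda>i j. compose (carrier (S (\<psi> i)))
    (compose (carrier (Q (\<psi> i))) (\<alpha> (\<psi> j)) (restrict (atrans (\<psi> i) (\<psi> j)) (carrier (Q (\<psi> i))))) (\<beta> (\<psi> i)))"
  define \<xi> where "\<xi> = (\<lambda>i. compose (carrier (S (\<psi> i))) (restrict (aproj (\<psi> i)) (carrier (Q (\<psi> i)))) (\<beta> (\<psi> i)))"
  define D where "D = \<lparr>fobj = (\<lambda>i. S (\<psi> i)), fmap = (\<lambda>i j (u :: unit). d i j)\<rparr>"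
  have \<beta>c: "\<beta> (\<psi> i) x \<in> carrier (Q (\<psi> i))" if "i \<in> I" "x \<in> carrier (S (\<psi> i))" for i x
    using comodule_homD(3)[OF \<beta>[OF \<psi>F[OF that(1)]] that(2)] .
  have d_eq: "d i j x = \<alpha> (\<psi> j) (atrans (\<psi> i) (\<psi> j) (\<beta> (\<psi> i) x))" if "i \<in> I" "x \<in> carrier (S (\<psi> i))" for i j x
    using that \<beta>c[OF that] by (simp add: d_def compose_eq)
  have \<xi>_eq: "\<xi> i x = aproj (\<psi> i) (\<beta> (\<psi> i) x)" if "i \<in> I" "x \<in> carrier (S (\<psi> i))" for i x
    using that \<beta>c[OF that] by (simp add: \<xi>_def compose_eq)
  have rI: "i \<in> I" "j \<in> I" "\<psi> i \<subseteq> \<psi> j" if "(i, j) \<in> r" for i j using that by (auto simp: r_def)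
  have d: "d i j \<in> comodule_hom A C (S (\<psi> i)) (S (\<psi> j))" if ij: "(i, j) \<in> r" for i j
  proof -
    note Zi = \<psi>F[OF rI(1)[OF ij]] and Zj = \<psi>F[OF rI(2)[OF ij]]
    have "restrict (atrans (\<psi> i) (\<psi> j)) (carrier (Q (\<psi> i))) \<in> comodule_hom A C (Q (\<psi> i)) (Q (\<psi> j))"
    proof (rule comodule_homI[OF Qc[OF Zi] Qc[OF Zj]])
      show "atrans (\<psi> i) (\<psi> j) \<in> left_hom A (Q (\<psi> i)) (Q (\<psi> j))"
        using atrans(1)[OF rI(3)[OF ij] F(1)[OF Zj]] by (simp add: Q_def)
      fix m assume "m \<in> carrier (Q (\<psi> i))"
      hence "\<nu> (\<psi> j) (atrans (\<psi> i) (\<psi> j) m) = ta (\<psi> i) (\<psi> j) (\<nu> (\<psi> i) m)"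
        by (intro \<nu>t[OF rI(3)[OF ij] F(1)[OF Zj] F(3)[OF Zi] F(3)[OF Zj]]) (simp_all add: Q_def)
      thus "coact (Q (\<psi> j)) (atrans (\<psi> i) (\<psi> j) m) =
          tensor_map A C (Q (\<psi> j)) id (atrans (\<psi> i) (\<psi> j)) (coact (Q (\<psi> i)) m)"
        by (simp add: Q_def)
    qed
    from comodule_hom_comp[OF Qc[OF Zi] Qc[OF Zj] Sc[OF Zj] this \<alpha>[OF Zj]]
    show ?thesis unfolding d_def
      by (rule comodule_hom_comp[OF Sc[OF Zi] Qc[OF Zi] Sc[OF Zj] \<beta>[OF Zi]])
  qed
  have \<xi>: "\<xi> i \<in> comodule_hom A C (S (\<psi> i)) M" if i: "i \<in> I" for i
  proof -
    note Zi = \<psi>F[OF i]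
    have "restrict (aproj (\<psi> i)) (carrier (Q (\<psi> i))) \<in> comodule_hom A C (Q (\<psi> i)) M"
    proof (rule comodule_homI[OF Qc[OF Zi] M_comodule])
      show "aproj (\<psi> i) \<in> left_hom A (Q (\<psi> i)) M" using aproj(1)[OF F(1)[OF Zi]] by (simp add: Q_def)
      fix m assume "m \<in> carrier (Q (\<psi> i))"
      hence "coact M (aproj (\<psi> i) m) = tp (\<psi> i) (\<nu> (\<psi> i) m)"
        by (intro \<nu>p[OF F(1)[OF Zi] F(3)[OF Zi]]) (simp_all add: Q_def)
      thus "coact M (aproj (\<psi> i) m) = tensor_map A C M id (aproj (\<psi> i)) (coact (Q (\<psi> i)) m)" by (simp add: Q_def)
    qed
    thus ?thesis unfolding \<xi>_def by (rule comodule_hom_comp[OF Sc[OF Zi] Qc[OF Zi] M_comodule \<beta>[OF Zi]])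
  qed
  have dir: "directed_colim A I r (fobj D) (\<lambda>i j. fmap D i j ()) M \<xi>"
    using D1.directed_colim_cong[of d \<xi>] d_eq \<xi>_eq by (simp add: D_def)
  have func: "is_functor (poset_category I r) Cat D"
    unfolding is_functor_def
  proof (intro conjI ballI)
    fix i assume "i \<in> Obj (poset_category I r)"
    hence i: "i \<in> I" by simp
    show "fobj D i \<in> Obj Cat" using SO[OF \<psi>F[OF i]] by (simp add: D_def del: Comod_simps)
    have "d i i = (\<lambda>x\<in>carrier (S (\<psi> i)). x)"
    proof
      fix x
      show "d i i x = (\<lambda>x\<in>carrier (S (\<psi> i)). x) x"
      proof (cases "x \<in> carrier (S (\<psi> i))")
        case True
        have b: "\<beta> (\<psi> i) x \<in> carrier (approx (\<psi> i))" using \<beta>c[OF i True] by (simp add: Q_def)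
        show ?thesis using True d_eq[OF i True] atrans_refl[OF F(1)[OF \<psi>F[OF i]] b] \<alpha>\<beta>[OF \<psi>F[OF i] True] by simp
      qed (simp add: d_def compose_def)
    qed
    thus "fmap D i i (Idt (poset_category I r) i) = Idt Cat (fobj D i)" by (simp add: D_def)
    fix j assume "j \<in> Obj (poset_category I r)"
    show "fmap D i j u \<in> Hom Cat (fobj D i) (fobj D j)" if "u \<in> Hom (poset_category I r) i j" for u
      using d that by (simp add: D_def)
    fix k u v assume "k \<in> Obj (poset_category I r)" and ij: "u \<in> Hom (poset_category I r) i j"
      and jk: "v \<in> Hom (poset_category I r) j k"
    have ij: "(i, j) \<in> r" and jk: "(j, k) \<in> r" using ij jk by simp_all
    have fD: "d j k (d i j x) = d i k x" if "x \<in> carrier (S (\<psi> i))" for x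
      using directed_colim.f_f[OF dir rI(1,2)[OF ij] rI(2)[OF jk] ij jk] that by (simp add: D_def)
    have "d i k = compose (carrier (S (\<psi> i))) (d j k) (d i j)"
    proof
      fix x
      show "d i k x = compose (carrier (S (\<psi> i))) (d j k) (d i j) x"
      proof (cases "x \<in> carrier (S (\<psi> i))")
        case True
        thus ?thesis using fD by (simp add: compose_eq)
      qed (simp add: d_def compose_def)
    qed
    thus "fmap D i k (Cmp (poset_category I r) i j k v u) =
        Cmp Cat (fobj D i) (fobj D j) (fobj D k) (fmap D j k v) (fmap D i j u)"
      by (simp add: D_def)
  qed
  have "is_colimit (poset_category I r) Cat D M \<xi>"
    by (rule directed_colim_is_colimit[OF dir func M_Obj]) (use \<xi> in \<open>simp add: D_def\<close>)
  moreover have "small \<kappa> I" unfolding I_def by (rule small_image[OF sF])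
  moreover have "\<forall>i\<in>I. fobj D i \<in> representatives" using S \<psi>F by (simp add: D_def)
  ultimately show ?thesis
    unfolding aleph1_directed_colimit_of_def aleph1_directed_diagram_def using I func by blast
qed

end

lemma aleph1_directed_colimit_of_mono:
  "\<lbrakk>aleph1_directed_colimit_of \<kappa> K G X; G \<subseteq> G'\<rbrakk> \<Longrightarrow> aleph1_directed_colimit_of \<kappa> K G' X"
  unfolding aleph1_directed_colimit_of_def by blast

section \<open>The category of comodules is locally \<open>\<aleph>\<^sub>1\<close>-presentable\<close>

theorem mainTheorem2:
  fixes \<kappa> :: "'u rel"
    and A :: "('a, 'r) ring_scheme"
    and C :: "('a, 'c, 'x) coring_scheme"
  assumes "universe_cardinal \<kappa>"
    and "small \<kappa> (carrier A)"
    and "small \<kappa> (carrier C)"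
    and "coring A C"
  shows "locally_aleph1_presentable \<kappa> (Comod \<kappa> A C) \<and>
    {S \<in> Obj (Comod \<kappa> A C). aleph1_presentable \<kappa> (Comod \<kappa> A C) S} =
      {S \<in> Obj (Comod \<kappa> A C). countably_presentable A S} \<and>
    (\<forall>M \<in> Obj (Comod \<kappa> A C).
      aleph1_directed_colimit_of \<kappa> (Comod \<kappa> A C)
        {S \<in> Obj (Comod \<kappa> A C). countably_presentable A S} M)"
proof -
  interpret U: universe \<kappa> by (rule universe.intro[OF assms(1)])
  interpret small_coring A C \<kappa>
    by (intro small_coring.intro small_coring_axioms.intro assms U.universe_axioms)
  have rep: "aleph1_directed_colimit_of \<kappa> Cat representatives M" if "M \<in> Obj Cat" for M
    by (rule comodule_approx.colimit_of_representatives)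
      (intro comodule_approx.intro comodule_approx_axioms.intro small_coring_axioms that)
  have sub: "representatives \<subseteq> {S \<in> Obj Cat. countably_presentable A S}"
    using representatives_props by blast
  have colim: "aleph1_directed_colimit_of \<kappa> Cat {S \<in> Obj Cat. countably_presentable A S} M" if "M \<in> Obj Cat" for M
    by (rule aleph1_directed_colimit_of_mono[OF rep[OF that] sub])
  have "has_aleph1_directed_colimits \<kappa> Cat"
    unfolding has_aleph1_directed_colimits_def
  proof (intro allI impI)
    fix I :: "'u set" and r and D :: "('u, unit, ('a, 'c, 'u) comodule, 'u \<Rightarrow> 'u) functor_data"
    assume "aleph1_directed_diagram \<kappa> I r Cat D"
    hence D: "is_functor (poset_category I r) Cat D" and sI: "small \<kappa> (Obj (poset_category I r))"
      by (simp_all add: aleph1_directed_diagram_def)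
    show "\<exists>X \<xi>. is_colimit (poset_category I r) Cat D X \<xi>"
      by (rule Comod_colimit_exists[OF U.universe_axioms small_A D sI]) blast
  qed
  moreover have "has_small_colimits \<kappa> Cat"
    unfolding has_small_colimits_def
  proof (intro allI impI)
    fix J :: "('u, 'u) category" and D :: "('u, 'u, ('a, 'c, 'u) comodule, 'u \<Rightarrow> 'u) functor_data"
    assume "small_category \<kappa> J \<and> is_functor J Cat D"
    hence D: "is_functor J Cat D" and sJ: "small \<kappa> (Obj J)" by (simp_all add: small_category_def)
    show "\<exists>X \<xi>. is_colimit J Cat D X \<xi>"
      by (rule Comod_colimit_exists[OF U.universe_axioms small_A D sJ]) blast
  qed
  \<comment> \<open>The witness is \<open>representatives\<close>. The set of all countably
    presentable objects generates as well, but it is not small.\<close>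
  moreover have "\<exists>G. small \<kappa> G \<and> (\<forall>S\<in>G. aleph1_presentable \<kappa> Cat S) \<and>
      (\<forall>X\<in>Obj Cat. aleph1_directed_colimit_of \<kappa> Cat G X)"
    using small_representatives rep representatives_props countably_presentable_imp_aleph1_presentable by meson
  ultimately have "locally_aleph1_presentable \<kappa> Cat"
    using category_Comod by (simp only: locally_aleph1_presentable_def aleph1_accessible_def simp_thms)
  moreover have "{S \<in> Obj Cat. aleph1_presentable \<kappa> Cat S} = {S \<in> Obj Cat. countably_presentable A S}"
    using countably_presentable_imp_aleph1_presentable aleph1_presentable_imp_countably_presentable colim by blast
  ultimately show ?thesis using colim by blast
qed

end
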